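(* In the laminate setting below, for every subdomain $\Omega'$ compactly contained in $\Omega$ and $i=1,2$, $$\lim_{n\to\infty}\|\chi^i(nx)\nabla u_n\|_{L^\infty(\Omega')}=\|\mathcal M^i(\nabla u^H)\|_{L^\infty(\Omega')},$$ where $$\mathcal M^1(\nabla u^H)=\sqrt{\Big(\tfrac{\beta}{\theta\beta+(1-\theta)\alpha}\partial_{x_1}u^H\Big)^2+(\partial_{x_2}u^H)^2},\qquad \mathcal M^2(\nabla u^H)=\sqrt{\Big(\tfrac{\alpha}{\theta\beta+(1-\theta)\alpha}\partial_{x_1}u^H\Big)^2+(\partial_{x_2}u^H)^2}.$$
   Context: Laminate setting: $d=2$, $Y=[-\tfrac12,\tfrac12]^2$, $\theta\in(0,1)$, $Y_1=\{y\in Y:-\tfrac12\le y_1\le-\tfrac12+\theta\}$, $Y_2=\{y\in Y:-\tfrac12+\theta\le y_1\le\tfrac12\}$, with $Y$-periodically extended characteristic functions $\chi^1,\chi^2$. For constants $0<\alpha<\beta$ let $a(y)=\alpha\chi^1(y)+\beta\chi^2(y)$ and $A(y)=a(y)I$ ($I$ the $2\times2$ identity). Let $\Omega\subset\mathbb{R}^2$ be a bounded (sufficiently regular) domain, $f\in H^1(\Omega)$, and $u_n\in H^1_0(\Omega)$ the solution of $-\mathrm{div}(A(nx)\nabla u_n)=f$. Let $a_h=\frac{\alpha\beta}{\theta\beta+(1-\theta)\alpha}$, $a_m=\theta\alpha+(1-\theta)\beta$, $A^H=\mathrm{diag}(a_h,a_m)$, and $u^H\in H^1_0(\Omega)$ the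 solution of $-\mathrm{div}(A^H\nabla u^H)=f$ (the weak $H^1$ limit of $u_n$). *)

theory Defs
  imports "HOL-Analysis.Analysis" "HOL-Probability.Essential_Supremum"
begin

text \<open>Periodic characteristic functions of the two layers. With
  t = y1 + 1/2 - floor (y1 + 1/2) in [0,1), the point y lies in (the periodic
  extension of) Y1 iff t <= theta, and in Y2 otherwise (the common interface
  has measure zero).\<close>

definition layer_coord :: "real ^ 2 \<Rightarrow> real" where
  "layer_coord y = (y $ 1 + 1/2) - of_int \<lfloor>y $ 1 + 1/2\<rfloor>"

definition chi :: "real \<Rightarrow> nat \<Rightarrow> real ^ 2 \<Rightarrow> real" where
  "chi \<theta> i y =
     (if i = 1 then (if layer_coord y \<le> \<theta> then 1 else 0)
      else if i = 2 then (if layer_coord y \<le> \<theta> then 0 else 1)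
      else 0)"

definition coef :: "real \<Rightarrow> real \<Rightarrow> real \<Rightarrow> real ^ 2 \<Rightarrow> real" where
  "coef \<theta> \<alpha> \<beta> y = \<alpha> * chi \<theta> 1 y + \<beta> * chi \<theta> 2 y"

definition a_h :: "real \<Rightarrow> real \<Rightarrow> real \<Rightarrow> real" where
  "a_h \<theta> \<alpha> \<beta> = \<alpha> * \<beta> / (\<theta> * \<beta> + (1 - \<theta>) * \<alpha>)"

definition a_m :: "real \<Rightarrow> real \<Rightarrow> real \<Rightarrow> real" where
  "a_m \<theta> \<alpha> \<beta> = \<theta> * \<alpha> + (1 - \<theta>) * \<beta>"

definition AH :: "real \<Rightarrow> real \<Rightarrow> real \<Rightarrow> real ^ 2 \<Rightarrow> real ^ 2" where
  "AH \<theta> \<alpha> \<beta> v = (\<chi> j. if j = 1 then a_h \<theta> \<alpha> \<beta> * v $ 1 else a_m \<theta> \<alpha> \<beta> * v $ 2)"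

definition Mlim :: "real \<Rightarrow> real \<Rightarrow> real \<Rightarrow> nat \<Rightarrow> real ^ 2 \<Rightarrow> real" where
  "Mlim \<theta> \<alpha> \<beta> i \<xi> =
     (if i = 1 then sqrt ((\<beta> / (\<theta> * \<beta> + (1 - \<theta>) * \<alpha>) * \<xi> $ 1)\<^sup>2 + (\<xi> $ 2)\<^sup>2)
      else sqrt ((\<alpha> / (\<theta> * \<beta> + (1 - \<theta>) * \<alpha>) * \<xi> $ 1)\<^sup>2 + (\<xi> $ 2)\<^sup>2))"

definition partial :: "2 \<Rightarrow> (real ^ 2 \<Rightarrow> real) \<Rightarrow> real ^ 2 \<Rightarrow> real" where
  "partial j f x = deriv (\<lambda>t. f (x + t *\<^sub>R axis j 1)) 0"

definition partials :: "2 list \<Rightarrow> (real ^ 2 \<Rightarrow> real) \<Rightarrow> real ^ 2 \<Rightarrow> real" where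
  "partials js f = foldr partial js f"

definition smooth :: "(real ^ 2 \<Rightarrow> real) \<Rightarrow> bool" where
  "smooth f \<longleftrightarrow> (\<forall>js. continuous_on UNIV (partials js f) \<and>
      (\<forall>j x. (\<lambda>t. partials js f (x + t *\<^sub>R axis j 1)) differentiable (at 0)))"

definition grad :: "(real ^ 2 \<Rightarrow> real) \<Rightarrow> real ^ 2 \<Rightarrow> real ^ 2" where
  "grad f x = (\<chi> j. partial j f x)"

definition test_fun :: "(real ^ 2) set \<Rightarrow> (real ^ 2 \<Rightarrow> real) \<Rightarrow> bool" where
  "test_fun \<Omega> \<phi> \<longleftrightarrow> smooth \<phi> \<and> compact (closure {x. \<phi> x \<noteq> 0})
      \<and> closure {x. \<phi> x \<noteq> 0} \<subseteq> \<Omega>"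

definition L2 :: "(real ^ 2) set \<Rightarrow> (real ^ 2 \<Rightarrow> 'b::euclidean_space) \<Rightarrow> bool" where
  "L2 \<Omega> u \<longleftrightarrow> u \<in> borel_measurable (lebesgue_on \<Omega>)
      \<and> integrable (lebesgue_on \<Omega>) (\<lambda>x. (norm (u x))\<^sup>2)"

definition weak_grad :: "(real ^ 2) set \<Rightarrow> (real ^ 2 \<Rightarrow> real) \<Rightarrow> (real ^ 2 \<Rightarrow> real ^ 2) \<Rightarrow> bool" where
  "weak_grad \<Omega> u g \<longleftrightarrow> (\<forall>\<phi> j. test_fun \<Omega> \<phi> \<longrightarrow>
      integral\<^sup>L (lebesgue_on \<Omega>) (\<lambda>x. u x * partial j \<phi> x)
      = - integral\<^sup>L (lebesgue_on \<Omega>) (\<lambda>x. g x $ j * \<phi> x))"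

definition H1 :: "(real ^ 2) set \<Rightarrow> (real ^ 2 \<Rightarrow> real) \<Rightarrow> (real ^ 2 \<Rightarrow> real ^ 2) \<Rightarrow> bool" where
  "H1 \<Omega> u g \<longleftrightarrow> L2 \<Omega> u \<and> L2 \<Omega> g \<and> weak_grad \<Omega> u g"

definition H10 :: "(real ^ 2) set \<Rightarrow> (real ^ 2 \<Rightarrow> real) \<Rightarrow> (real ^ 2 \<Rightarrow> real ^ 2) \<Rightarrow> bool" where
  "H10 \<Omega> u g \<longleftrightarrow> H1 \<Omega> u g \<and>
     (\<exists>\<phi>::nat \<Rightarrow> real ^ 2 \<Rightarrow> real. (\<forall>k. test_fun \<Omega> (\<phi> k)) \<and>
        (\<lambda>k. integral\<^sup>L (lebesgue_on \<Omega>) (\<lambda>x. (\<phi> k x - u x)\<^sup>2)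
            + integral\<^sup>L (lebesgue_on \<Omega>) (\<lambda>x. (norm (grad (\<phi> k) x - g x))\<^sup>2))
          \<longlonglongrightarrow> 0)"

text \<open>(u, g) is the weak solution in H^1_0(\<Omega>) of  - div (B(x) \<nabla>u) = f,
  where B x v is the matrix field applied to a vector.\<close>
definition weak_solution :: "(real ^ 2) set \<Rightarrow> (real ^ 2 \<Rightarrow> real ^ 2 \<Rightarrow> real ^ 2)
    \<Rightarrow> (real ^ 2 \<Rightarrow> real) \<Rightarrow> (real ^ 2 \<Rightarrow> real) \<Rightarrow> (real ^ 2 \<Rightarrow> real ^ 2) \<Rightarrow> bool" where
  "weak_solution \<Omega> B f u g \<longleftrightarrow> H10 \<Omega> u g \<and>
     (\<forall>\<phi>. test_fun \<Omega> \<phi> \<longrightarrow>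
        integral\<^sup>L (lebesgue_on \<Omega>) (\<lambda>x. B x (g x) \<bullet> grad \<phi> x)
        = integral\<^sup>L (lebesgue_on \<Omega>) (\<lambda>x. f x * \<phi> x))"

end

theory Submission
  imports Defs
begin

text \<open>The coefficient depends on \<open>x\<^sub>1\<close> only, so difference quotients of \<open>u\<^sub>n\<close> in the direction
  \<open>x\<^sub>2\<close> solve the same equation. Two applications of the Caccioppoli inequality bound \<open>\<partial>\<^sub>2\<nabla>u\<^sub>n\<close> and
  \<open>\<partial>\<^sub>2\<partial>\<^sub>2\<nabla>u\<^sub>n\<close> in \<open>L\<^sup>2\<close> on compact subsets, uniformly in \<open>n\<close>; this is where
  \<open>f \<in> H\<^sup>1\<close> enters. Writing \<open>\<sigma>\<^sub>n = a(nx) \<partial>\<^sub>1u\<^sub>n\<close> and \<open>v\<^sub>n = \<partial>\<^sub>2u\<^sub>n\<close>, the equation turns this into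
  bounds for \<open>\<partial>\<^sub>1\<close>, \<open>\<partial>\<^sub>2\<close> and \<open>\<partial>\<^sub>1\<partial>\<^sub>2\<close> of \<open>\<sigma>\<^sub>n\<close> and \<open>v\<^sub>n\<close>, and a function with square integrable mixed
  derivative in the plane is Hoelder continuous. Hence \<open>\<sigma>\<^sub>n\<close> and \<open>v\<^sub>n\<close> are locally equicontinuous, their
  products with oscillating layer functions converge to the products with the means, and the energy of
  \<open>u\<^sub>n\<close> minus the corrected gradient of \<open>u\<^sup>H\<close> tends to 0: \<open>\<sigma>\<^sub>n\<close> and \<open>v\<^sub>n\<close> converge in \<open>L\<^sup>2\<close>, and by
  equicontinuity locally uniformly, to \<open>a\<^sub>h \<partial>\<^sub>1u\<^sup>H\<close> and \<open>\<partial>\<^sub>2u\<^sup>H\<close>. In layer \<open>i\<close> the modulus of the gradient is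
  \<open>|(\<sigma>\<^sub>n / a\<^sub>i, v\<^sub>n)|\<close>, and the layers meet every open set for large \<open>n\<close>.\<close>

text \<open>Solutions are given only as L2 limits of test functions, and the equations may be tested
  only with smooth functions, so difference quotients of u_n cannot be inserted. The estimates are
  made for the approximants instead, with an error divided by powers of the step sizes; the
  approximation is sent to its limit before the steps tend to 0, and what survives is a bound on
  integrals against test functions. Two tangential derivatives of the gradient are required because
  d1 d2 v_n = d2 d2 (d1 u_n), and because the equation gives d1 d2 sigma_n = - d2 f - a(nx) d2 d2
  v_n; the term d2 f is where f in H1 is consumed. In the energy argument u^H, whose gradient is a
  priori only square integrable, is replaced by a test function phi close to it. The first component
  of grad phi is multiplied by a_h / a(nx): the flux of the corrected gradient is then a_h d1 phi,
  which does not oscillate. The right-hand side f is eliminated by testing the equations of u_n and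
  u^H with the same functions.\<close>

section \<open>Square integrable functions and their norm\<close>

definition sq_int :: "'a measure \<Rightarrow> ('a \<Rightarrow> 'b::euclidean_space) \<Rightarrow> bool" where
  "sq_int M f \<longleftrightarrow> f \<in> borel_measurable M \<and> integrable M (\<lambda>x. (norm (f x))\<^sup>2)"

definition l2norm :: "'a measure \<Rightarrow> ('a \<Rightarrow> 'b::euclidean_space) \<Rightarrow> real" where
  "l2norm M f = sqrt (\<integral>x. (norm (f x))\<^sup>2 \<partial>M)"

abbreviation L2n :: "(real ^ 2 \<Rightarrow> 'b::euclidean_space) \<Rightarrow> real" where
  "L2n \<equiv> l2norm lebesgue"

lemma l2norm_nonneg [simp]: "0 \<le> l2norm M f"
  by (simp add: l2norm_def)

lemma l2norm_sq: "(l2norm M f)\<^sup>2 = (\<integral>x. (norm (f x))\<^sup>2 \<partial>M)"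
  by (simp add: l2norm_def)

lemma sqiD: "sq_int M f \<Longrightarrow> f \<in> borel_measurable M" "sq_int M f \<Longrightarrow> integrable M (\<lambda>x. (norm (f x))\<^sup>2)"
  by (auto simp: sq_int_def)

lemma sq_int_bound:
  fixes f :: "'a \<Rightarrow> 'b::euclidean_space" and g :: "'a \<Rightarrow> 'c::euclidean_space"
  assumes "sq_int M g" "f \<in> borel_measurable M" "\<And>x. norm (f x) \<le> B * norm (g x)"
  shows "sq_int M f"
proof -
  have "integrable M (\<lambda>x. (norm (f x))\<^sup>2)"
  proof (rule Bochner_Integration.integrable_bound)
    show "integrable M (\<lambda>x. B\<^sup>2 * (norm (g x))\<^sup>2)"
      using assms(1) by (auto simp: sq_int_def)
    show "(\<lambda>x. (norm (f x))\<^sup>2) \<in> borel_measurable M"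
      using assms(2) by measurable
    show "AE x in M. norm ((norm (f x))\<^sup>2) \<le> norm (B\<^sup>2 * (norm (g x))\<^sup>2)"
      using assms(3) by (auto simp flip: power_mult_distrib intro!: AE_I2 power_mono)
  qed
  then show ?thesis using assms by (auto simp: sq_int_def)
qed

lemma l2norm_mono:
  fixes f :: "'a \<Rightarrow> 'b::euclidean_space" and g :: "'a \<Rightarrow> 'c::euclidean_space"
  assumes "sq_int M g" "sq_int M f" "0 \<le> B" "\<And>x. norm (f x) \<le> B * norm (g x)"
  shows "l2norm M f \<le> B * l2norm M g"
proof -
  have "(norm (f x))\<^sup>2 \<le> B\<^sup>2 * (norm (g x))\<^sup>2" for x
    using power_mono[OF assms(4) norm_ge_zero, of x 2] by (simp add: power_mult_distrib)
  then have "(l2norm M f)\<^sup>2 \<le> (\<integral>x. B\<^sup>2 * (norm (g x))\<^sup>2 \<partial>M)"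
    unfolding l2norm_sq
    by (intro integral_mono integrable_mult_right sqiD assms)
  also have "\<dots> = (B * l2norm M g)\<^sup>2"
    by (simp add: power_mult_distrib l2norm_sq)
  finally show ?thesis
    using assms(3) by (auto intro: power2_le_imp_le)
qed

lemma sq_int_inner:
  assumes "sq_int M f" "sq_int M g"
  shows "integrable M (\<lambda>x. f x \<bullet> g x)"
proof (rule Bochner_Integration.integrable_bound)
  show "integrable M (\<lambda>x. (norm (f x))\<^sup>2 + (norm (g x))\<^sup>2)"
    using assms by (auto simp: sq_int_def)
  show "(\<lambda>x. f x \<bullet> g x) \<in> borel_measurable M"
    using assms by (auto simp: sq_int_def)
  show "AE x in M. norm (f x \<bullet> g x) \<le> norm ((norm (f x))\<^sup>2 + (norm (g x))\<^sup>2)"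
  proof (rule AE_I2)
    fix x
    have "norm (f x \<bullet> g x) \<le> norm (f x) * norm (g x)"
      by (simp add: Cauchy_Schwarz_ineq2)
    also have "\<dots> \<le> (norm (f x))\<^sup>2 + (norm (g x))\<^sup>2"
      using sum_squares_bound[of "norm (f x)" "norm (g x)"]
        mult_nonneg_nonneg[OF norm_ge_zero norm_ge_zero, of "f x" "g x"] by linarith
    finally show "norm (f x \<bullet> g x) \<le> norm ((norm (f x))\<^sup>2 + (norm (g x))\<^sup>2)"
      by simp
  qed
qed

lemma sq_int_add:
  assumes "sq_int M f" "sq_int M g"
  shows "sq_int M (\<lambda>x. f x + g x)"
proof -
  have "integrable M (\<lambda>x. (norm (f x))\<^sup>2 + 2 * (f x \<bullet> g x) + (norm (g x))\<^sup>2)"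
    using assms sq_int_inner[OF assms] by (auto simp: sq_int_def)
  moreover have "(norm (f x))\<^sup>2 + 2 * (f x \<bullet> g x) + (norm (g x))\<^sup>2 = (norm (f x + g x))\<^sup>2" for x
    by (simp add: power2_norm_eq_inner algebra_simps inner_commute)
  ultimately show ?thesis
    using assms by (auto simp: sq_int_def)
qed

lemma sq_int_scaleR:
  assumes "sq_int M f" shows "sq_int M (\<lambda>x. c *\<^sub>R f x)"
  by (rule sq_int_bound[OF assms, of _ "\<bar>c\<bar>"]) (use assms in \<open>auto simp: sq_int_def\<close>)

lemma sq_int_diff:
  assumes "sq_int M f" "sq_int M g"
  shows "sq_int M (\<lambda>x. f x - g x)"
  using sq_int_add[OF assms(1) sq_int_scaleR[OF assms(2), of "-1"]] by simp

lemma l2norm_scaleR: "l2norm M (\<lambda>x. c *\<^sub>R f x) = \<bar>c\<bar> * l2norm M f"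
  by (simp add: l2norm_def power_mult_distrib real_sqrt_mult)

lemma Cauchy_Schwarz_l2norm:
  assumes "sq_int M f" "sq_int M g"
  shows "\<bar>\<integral>x. f x \<bullet> g x \<partial>M\<bar> \<le> l2norm M f * l2norm M g"
proof -
  define P where "P = (\<integral>x. (norm (f x))\<^sup>2 \<partial>M)"
  define Q where "Q = (\<integral>x. f x \<bullet> g x \<partial>M)"
  define R where "R = (\<integral>x. (norm (g x))\<^sup>2 \<partial>M)"
  have P0: "P \<ge> 0" "R \<ge> 0" by (auto simp: P_def R_def)
  \<comment> \<open>The nonnegative form keeps two variables: for \<open>R = 0\<close> the choice
    \<open>s = 1\<close>, \<open>t = - (P + 1) / Q\<close> gives it the value
    \<open>- P - 2\<close>, and for \<open>R > 0\<close> the choice \<open>s = R\<close>,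
    \<open>t = - Q\<close> gives \<open>R * (P * R - Q\<^sup>2)\<close>.\<close>
  have q: "0 \<le> s\<^sup>2 * P + 2 * s * t * Q + t\<^sup>2 * R" for s t
  proof -
    have "0 \<le> (\<integral>x. (norm (s *\<^sub>R f x + t *\<^sub>R g x))\<^sup>2 \<partial>M)" by simp
    also have "\<dots> = (\<integral>x. s\<^sup>2 * (norm (f x))\<^sup>2 + 2 * s * t * (f x \<bullet> g x) + t\<^sup>2 * (norm (g x))\<^sup>2 \<partial>M)"
      by (rule Bochner_Integration.integral_cong[OF refl], unfold power2_norm_eq_inner)
         (simp add: inner_commute inner_add_left inner_add_right power2_eq_square ring_distribs)
    also have "\<dots> = s\<^sup>2 * P + 2 * s * t * Q + t\<^sup>2 * R"
      using assms sq_int_inner[OF assms] by (auto simp: sq_int_def P_def Q_def R_def)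
    finally show ?thesis .
  qed
  have "Q\<^sup>2 \<le> P * R"
  proof (cases "R = 0")
    case True
    have "Q = 0"
    proof (rule ccontr)
      assume "Q \<noteq> 0"
      have "0 \<le> P + 2 * (- (P + 1) / Q) * Q"
        using q[of 1 "- (P + 1) / Q"] True by simp
      then show False using \<open>Q \<noteq> 0\<close> P0 by simp
    qed
    then show ?thesis using True by simp
  next
    case False
    then have "R > 0" using P0 by simp
    have "0 \<le> R\<^sup>2 * P + 2 * R * (- Q) * Q + Q\<^sup>2 * R"
      using q[of R "- Q"] by simp
    then have "0 \<le> R * (P * R - Q\<^sup>2)"
      by (simp add: algebra_simps power2_eq_square)
    then show ?thesis using \<open>R > 0\<close> by (simp add: zero_le_mult_iff)
  qed
  then have "\<bar>Q\<bar> \<le> sqrt (P * R)"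
    by (metis real_sqrt_abs real_sqrt_le_iff)
  then show ?thesis
    by (simp add: l2norm_def P_def Q_def R_def real_sqrt_mult)
qed

lemma l2norm_triangle:
  assumes "sq_int M f" "sq_int M g"
  shows "l2norm M (\<lambda>x. f x + g x) \<le> l2norm M f + l2norm M g"
proof -
  have "(l2norm M (\<lambda>x. f x + g x))\<^sup>2 = (\<integral>x. (norm (f x))\<^sup>2 + 2 * (f x \<bullet> g x) + (norm (g x))\<^sup>2 \<partial>M)"
    unfolding l2norm_sq
    by (rule Bochner_Integration.integral_cong)
       (auto simp: power2_norm_eq_inner algebra_simps inner_commute)
  also have "\<dots> = (l2norm M f)\<^sup>2 + 2 * (\<integral>x. f x \<bullet> g x \<partial>M) + (l2norm M g)\<^sup>2"
    using assms sq_int_inner[OF assms] by (auto simp: sq_int_def l2norm_sq)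
  also have "\<dots> \<le> (l2norm M f)\<^sup>2 + 2 * (l2norm M f * l2norm M g) + (l2norm M g)\<^sup>2"
    using Cauchy_Schwarz_l2norm[OF assms] by simp
  also have "\<dots> = (l2norm M f + l2norm M g)\<^sup>2"
    by (simp add: power2_eq_square algebra_simps)
  finally show ?thesis
    by (meson add_nonneg_nonneg l2norm_nonneg power2_le_imp_le)
qed

lemma l2norm_triangle_diff:
  assumes "sq_int M f" "sq_int M g"
  shows "l2norm M (\<lambda>x. f x - g x) \<le> l2norm M f + l2norm M g"
  using l2norm_triangle[OF assms(1) sq_int_scaleR[OF assms(2), of "-1"]] l2norm_scaleR[of M "-1" g] by simp

lemma sq_int_mult:
  fixes b :: "'a \<Rightarrow> real"
  assumes "sq_int M f" "b \<in> borel_measurable M" "\<And>x. \<bar>b x\<bar> \<le> B"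
  shows "sq_int M (\<lambda>x. b x *\<^sub>R f x)" "l2norm M (\<lambda>x. b x *\<^sub>R f x) \<le> B * l2norm M f"
proof -
  have B: "norm (b x *\<^sub>R f x) \<le> B * norm (f x)" for x
    using assms(3)[of x] by (simp add: mult_right_mono)
  have B0: "0 \<le> B" using assms(3) by (meson abs_ge_zero order_trans)
  show s: "sq_int M (\<lambda>x. b x *\<^sub>R f x)"
    by (rule sq_int_bound[OF assms(1) _ B]) (use assms in \<open>auto simp: sq_int_def\<close>)
  show "l2norm M (\<lambda>x. b x *\<^sub>R f x) \<le> B * l2norm M f"
    by (rule l2norm_mono[OF assms(1) s B0 B])
qed

lemma borel_measurable_vec_nth [measurable]: "(\<lambda>v::real ^ 2. v $ j) \<in> borel_measurable borel"
  by (intro borel_measurable_continuous_onI continuous_intros)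

lemma sq_int_nth:
  fixes f :: "'a \<Rightarrow> real ^ 2"
  assumes "sq_int M f"
  shows "sq_int M (\<lambda>x. f x $ j)" "l2norm M (\<lambda>x. f x $ j) \<le> l2norm M f"
proof -
  have m: "(\<lambda>x. f x $ j) \<in> borel_measurable M"
    using measurable_compose[OF sqiD(1)[OF assms] borel_measurable_vec_nth] .
  have B: "norm (f x $ j) \<le> 1 * norm (f x)" for x
    using component_le_norm_cart[of "f x" j] by simp
  show s: "sq_int M (\<lambda>x. f x $ j)"
    by (rule sq_int_bound[OF assms m B])
  show "l2norm M (\<lambda>x. f x $ j) \<le> l2norm M f"
    using l2norm_mono[OF assms s _ B] by simp
qed

subsection \<open>Smooth functions of one variable\<close>

text \<open>Finite orders are kept apart from \<open>smooth1\<close> so that the closure rules go by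
  induction on the order: the derivative of a product or an inverse contains the functions
  themselves, for which \<open>Ck1_Suc_imp\<close> supplies the lower order.\<close>

fun Ck1 :: "nat \<Rightarrow> (real \<Rightarrow> real) \<Rightarrow> bool" where
  "Ck1 0 f = continuous_on UNIV f"
| "Ck1 (Suc k) f = ((\<forall>t. f differentiable (at t)) \<and> Ck1 k (deriv f))"

definition smooth1 :: "(real \<Rightarrow> real) \<Rightarrow> bool" where
  "smooth1 f \<longleftrightarrow> (\<forall>k. Ck1 k f)"

lemma DERIV_deriv_differentiable:
  "f differentiable (at t) \<Longrightarrow> (f has_real_derivative deriv f t) (at t)"
  using DERIV_imp_deriv real_differentiable_def by metis

lemma Ck1_SucI:
  assumes "\<And>t. (f has_real_derivative f' t) (at t)" "Ck1 k f'"
  shows "Ck1 (Suc k) f"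
proof -
  have "deriv f = f'" using assms(1) DERIV_imp_deriv by blast
  then show ?thesis using assms by (auto simp: real_differentiable_def)
qed

lemma Ck1_cont: "Ck1 k f \<Longrightarrow> continuous_on UNIV f"
  by (cases k) (auto simp: continuous_on_eq_continuous_at differentiable_imp_continuous_within)

lemma Ck1_Suc_imp: "Ck1 (Suc k) f \<Longrightarrow> Ck1 k f"
  by (induction k arbitrary: f) (auto dest: Ck1_cont[of "Suc 0", simplified]
      simp: continuous_on_eq_continuous_at differentiable_imp_continuous_within)

lemma smooth1_D:
  assumes "smooth1 f"
  shows "(f has_real_derivative deriv f t) (at t)" "smooth1 (deriv f)" "continuous_on UNIV f"
proof -
  have "Ck1 (Suc k) f" for k using assms by (auto simp: smooth1_def)
  then show "(f has_real_derivative deriv f t) (at t)" "smooth1 (deriv f)"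
    by (auto simp: smooth1_def intro: DERIV_deriv_differentiable)
  show "continuous_on UNIV f" using assms Ck1_cont by (auto simp: smooth1_def)
qed

lemma Ck1_add: "Ck1 k f \<Longrightarrow> Ck1 k g \<Longrightarrow> Ck1 k (\<lambda>t. f t + g t)"
proof (induction k arbitrary: f g)
  case 0 then show ?case by (auto intro: continuous_intros)
next
  case (Suc k)
  show ?case
    by (rule Ck1_SucI[where f' = "\<lambda>t. deriv f t + deriv g t"])
       (use Suc in \<open>auto intro!: derivative_eq_intros DERIV_deriv_differentiable\<close>)
qed

lemma Ck1_mult: "Ck1 k f \<Longrightarrow> Ck1 k g \<Longrightarrow> Ck1 k (\<lambda>t. f t * g t)"
proof (induction k arbitrary: f g)
  case 0 then show ?case by (auto intro: continuous_intros)
next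
  case (Suc k)
  show ?case
    by (rule Ck1_SucI[where f' = "\<lambda>t. deriv f t * g t + deriv g t * f t"])
       (use Suc Ck1_Suc_imp[of k] in \<open>auto intro!: Ck1_add derivative_eq_intros DERIV_deriv_differentiable\<close>)
qed

lemma Ck1_const: "Ck1 k (\<lambda>t. c)"
  by (induction k arbitrary: c) (auto intro!: Ck1_SucI[where f'="\<lambda>t. 0"] derivative_eq_intros)

lemma Ck1_affine: "Ck1 k f \<Longrightarrow> Ck1 k (\<lambda>t. f (c * t + d))"
proof (induction k arbitrary: f)
  case 0 then show ?case
    by (auto intro!: continuous_on_compose2[of UNIV f] continuous_intros)
next
  case (Suc k)
  show ?case
  proof (rule Ck1_SucI[where f' = "\<lambda>t. deriv f (c * t + d) * c"])
    show "((\<lambda>t. f (c * t + d)) has_real_derivative deriv f (c * t + d) * c) (at t)" for t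
      by (rule DERIV_chain2[where g = "\<lambda>t. c * t + d"])
         (use Suc in \<open>auto intro!: derivative_eq_intros DERIV_deriv_differentiable\<close>)
    show "Ck1 k (\<lambda>t. deriv f (c * t + d) * c)"
      using Suc by (auto intro!: Ck1_mult Ck1_const)
  qed
qed

lemma Ck1_inverse: "Ck1 k f \<Longrightarrow> (\<And>t. f t \<noteq> 0) \<Longrightarrow> Ck1 k (\<lambda>t. inverse (f t))"
proof (induction k arbitrary: f)
  case 0 then show ?case by (auto intro: continuous_intros)
next
  case (Suc k)
  show ?case
  proof (rule Ck1_SucI[where f' = "\<lambda>t. - 1 * (inverse (f t) * deriv f t * inverse (f t))"])
    show "((\<lambda>t. inverse (f t)) has_real_derivative - 1 * (inverse (f t) * deriv f t * inverse (f t))) (at t)" for t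
      using DERIV_inverse'[OF DERIV_deriv_differentiable[of f t]] Suc by auto
    show "Ck1 k (\<lambda>t. - 1 * (inverse (f t) * deriv f t * inverse (f t)))"
      using Suc Ck1_Suc_imp[of k f] by (intro Ck1_mult Ck1_const) auto
  qed
qed

lemma smooth1_add: "smooth1 f \<Longrightarrow> smooth1 g \<Longrightarrow> smooth1 (\<lambda>t. f t + g t)"
  by (simp add: smooth1_def Ck1_add)
lemma smooth1_mult: "smooth1 f \<Longrightarrow> smooth1 g \<Longrightarrow> smooth1 (\<lambda>t. f t * g t)"
  by (simp add: smooth1_def Ck1_mult)
lemma smooth1_const: "smooth1 (\<lambda>t. c)"
  by (simp add: smooth1_def Ck1_const)
lemma smooth1_affine: "smooth1 f \<Longrightarrow> smooth1 (\<lambda>t. f (c * t + d))"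
  by (simp add: smooth1_def Ck1_affine)
lemma smooth1_inverse: "smooth1 f \<Longrightarrow> (\<And>t. f t \<noteq> 0) \<Longrightarrow> smooth1 (\<lambda>t. inverse (f t))"
  by (simp add: smooth1_def Ck1_inverse)
lemma smooth1_diff: "smooth1 f \<Longrightarrow> smooth1 g \<Longrightarrow> smooth1 (\<lambda>t. f t - g t)"
  using smooth1_add[OF _ smooth1_mult[OF smooth1_const[of "-1"]], of f g] by simp

text \<open>The derivatives of \<open>exp (- inverse t)\<close>, extended by 0: with a polynomial in
  \<open>inverse t\<close> as parameter the family is closed under differentiation.\<close>

definition flat_exp :: "real poly \<Rightarrow> real \<Rightarrow> real" where
  "flat_exp P t = (if t > 0 then poly P (inverse t) * exp (- inverse t) else 0)"

lemma poly_times_exp_tendsto_0: "((\<lambda>s::real. poly P s * exp (- s)) \<longlongrightarrow> 0) at_top"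
proof (induction P)
  case 0 then show ?case by simp
next
  case (pCons c P)
  have B: "((\<lambda>s::real. s ^ k * exp (- s)) \<longlongrightarrow> 0) at_top" for k
    using tendsto_power_div_exp_0[of k] by (simp add: exp_minus field_simps)
  have "poly (pCons c P) s * exp (- s) = (\<Sum>i\<le>degree (pCons c P). coeff (pCons c P) i * (s ^ i * exp (- s)))" for s :: real
    by (simp only: poly_altdef sum_distrib_right mult.assoc)
  then show ?case
    using tendsto_sum[of "{..degree (pCons c P)}" "\<lambda>i s. coeff (pCons c P) i * (s ^ i * exp (- s))" "\<lambda>i. 0" at_top]
      tendsto_mult_right_zero[OF B] by (simp only: sum.neutral_const)
qed

text \<open>The chain rule through \<open>inverse t\<close> produces the factor
  \<open>[:0, 0, 1:]\<close>. At 0 the quotient from the right is an expression of the same kind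
  with one more power of \<open>inverse h\<close>, and the exponential wins by
  \<open>poly_times_exp_tendsto_0\<close>.\<close>

lemma flat_exp_DERIV:
  "(flat_exp P has_real_derivative flat_exp ([:0, 0, 1:] * (P - pderiv P)) t) (at t)"
proof -
  consider "t > 0" | "t < 0" | "t = 0" by linarith
  then show ?thesis
  proof cases
    case 1
    have "((\<lambda>t. poly P (inverse t) * exp (- inverse t)) has_real_derivative
        flat_exp ([:0, 0, 1:] * (P - pderiv P)) t) (at t)"
      using 1 unfolding flat_exp_def
      by (auto intro!: derivative_eq_intros poly_DERIV[THEN DERIV_chain2] simp: field_simps power2_eq_square)
    then show ?thesis
    proof (rule has_field_derivative_transform_within_open)
      show "open {0::real<..}" by (rule open_greaterThan)
    qed (use 1 in \<open>auto simp: flat_exp_def\<close>)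
  next
    case 2
    have "((\<lambda>t. 0) has_real_derivative flat_exp ([:0, 0, 1:] * (P - pderiv P)) t) (at t)"
      using 2 by (simp add: flat_exp_def)
    then show ?thesis
    proof (rule has_field_derivative_transform_within_open)
      show "open {..<0::real}" by (rule open_lessThan)
    qed (use 2 in \<open>auto simp: flat_exp_def\<close>)
  next
    case 3
    have "((\<lambda>h. (flat_exp P (0 + h) - flat_exp P 0) / h) \<longlongrightarrow> 0) (at_right 0)"
    proof (rule Lim_transform_eventually)
      show "((\<lambda>h::real. poly ([:0,1:] * P) (inverse h) * exp (- inverse h)) \<longlongrightarrow> 0) (at_right 0)"
        by (rule filterlim_compose[OF poly_times_exp_tendsto_0 filterlim_inverse_at_top_right])
      show "\<forall>\<^sub>F h in at_right 0. poly ([:0,1:] * P) (inverse h) * exp (- inverse h)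
          = (flat_exp P (0 + h) - flat_exp P 0) / h"
        using eventually_at_right_less[of "0::real"]
        by eventually_elim (simp add: flat_exp_def divide_inverse mult_ac)
    qed
    moreover have "((\<lambda>h. (flat_exp P (0 + h) - flat_exp P 0) / h) \<longlongrightarrow> 0) (at_left 0)"
    proof (rule Lim_transform_eventually)
      show "((\<lambda>h::real. 0) \<longlongrightarrow> (0::real)) (at_left 0)" by simp
      have "\<forall>\<^sub>F h::real in at_left 0. h < 0"
        by (simp add: eventually_at_filter)
      then show "\<forall>\<^sub>F h in at_left 0. 0 = (flat_exp P (0 + h) - flat_exp P 0) / h"
        by eventually_elim (simp add: flat_exp_def)
    qed
    ultimately have "((\<lambda>h. (flat_exp P (0 + h) - flat_exp P 0) / h) \<longlongrightarrow> 0) (at 0)"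
      by (simp add: filterlim_split_at)
    then show ?thesis using 3 by (simp add: DERIV_def flat_exp_def)
  qed
qed

lemma smooth1_flat_exp: "smooth1 (flat_exp P)"
proof -
  have "Ck1 k (flat_exp P)" for k
  proof (induction k arbitrary: P)
    case 0
    show ?case using DERIV_isCont[OF flat_exp_DERIV]
      by (auto simp: continuous_on_eq_continuous_at)
  next
    case (Suc k)
    show ?case by (rule Ck1_SucI[OF flat_exp_DERIV Suc])
  qed
  then show ?thesis by (simp add: smooth1_def)
qed

text \<open>The usual quotient of \<open>p\<close> and \<open>p + q\<close>: \<open>p\<close> is
  positive for \<open>t > -1\<close> and \<open>q\<close> for \<open>t < 1\<close>, so the
  denominator has no zero.\<close>

lemma smooth_step_exists:
  "\<exists>E. smooth1 E \<and> (\<forall>t\<le>-1. E t = 0) \<and> (\<forall>t\<ge>1. E t = 1) \<and> (\<forall>t. 0 \<le> E t \<and> E t \<le> 1)"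
proof -
  define p where "p t = flat_exp [:1:] (1 * t + 1)" for t
  define q where "q t = flat_exp [:1:] (-1 * t + 1)" for t
  have sm: "smooth1 p" "smooth1 q"
    unfolding p_def[abs_def] q_def[abs_def] by (rule smooth1_affine[OF smooth1_flat_exp])+
  have pq: "p t \<ge> 0" "q t \<ge> 0" "p t + q t > 0" for t
    by (auto simp: p_def q_def flat_exp_def add_pos_nonneg add_nonneg_pos)
  define E where "E t = p t * inverse (p t + q t)" for t
  have "smooth1 E"
    unfolding E_def[abs_def] by (intro smooth1_mult smooth1_inverse smooth1_add sm) (use pq in \<open>simp add: less_imp_neq[symmetric]\<close>)
  moreover have "E t = 0" if "t \<le> -1" for t
    using that by (simp add: E_def p_def flat_exp_def)
  moreover have "E t = 1" if "t \<ge> 1" for t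
    using that pq[of t] by (auto simp: E_def q_def flat_exp_def)
  moreover have "0 \<le> E t \<and> E t \<le> 1" for t
    using pq[of t] by (auto simp: E_def field_simps)
  ultimately show ?thesis by blast
qed

definition step :: "real \<Rightarrow> real" where
  "step = (SOME E. smooth1 E \<and> (\<forall>t\<le>-1. E t = 0) \<and> (\<forall>t\<ge>1. E t = 1) \<and> (\<forall>t. 0 \<le> E t \<and> E t \<le> 1))"

lemma smooth1_step: "smooth1 step" and step_0: "t \<le> -1 \<Longrightarrow> step t = 0" and step_1: "t \<ge> 1 \<Longrightarrow> step t = 1"
    and step_ge0: "0 \<le> step t" and step_le1: "step t \<le> 1"
  using someI_ex[OF smooth_step_exists, folded step_def] by auto

subsection \<open>Smooth functions on the plane\<close>

text \<open>\<open>smooth\<close> quantifies over all lists of directions; counting the order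
  instead makes induction available for sums, products and tensors.\<close>

fun Ck2 :: "nat \<Rightarrow> (real ^ 2 \<Rightarrow> real) \<Rightarrow> bool" where
  "Ck2 0 f = continuous_on UNIV f"
| "Ck2 (Suc k) f = (continuous_on UNIV f \<and> (\<forall>j x. (\<lambda>t. f (x + t *\<^sub>R axis j 1)) differentiable (at 0))
      \<and> (\<forall>j. Ck2 k (partial j f)))"

text \<open>\<open>partials\<close> applies the head of a list last, so the derivative taken first
  is the last entry. A recursion on the function therefore has to peel lists from the right.\<close>

lemma smooth_unfold:
  "smooth f \<longleftrightarrow> continuous_on UNIV f \<and> (\<forall>j x. (\<lambda>t. f (x + t *\<^sub>R axis j 1)) differentiable (at 0))
      \<and> (\<forall>j. smooth (partial j f))" (is "?L = ?R")
proof
  assume L: ?L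
  have snoc: "partials (js @ [j]) f = partials js (partial j f)" for js j
    by (simp add: partials_def)
  show ?R
    using L[unfolded smooth_def, rule_format, of "[]"] L[unfolded smooth_def, rule_format, of "_ @ [_]"]
    by (auto simp: smooth_def snoc) (auto simp: partials_def)
next
  assume R: ?R
  show ?L
    unfolding smooth_def
  proof (intro allI)
    fix js
    show "continuous_on UNIV (partials js f) \<and>
      (\<forall>j x. (\<lambda>t. partials js f (x + t *\<^sub>R axis j 1)) differentiable (at 0))"
    proof (cases js rule: rev_cases)
      case Nil then show ?thesis using R by (auto simp: partials_def)
    next
      case (snoc ks j)
      then have "partials js f = partials ks (partial j f)" by (simp add: partials_def)
      then show ?thesis using R by (auto simp: smooth_def)
    qed
  qed
qed

lemma smooth_imp_Ck2: "smooth f \<Longrightarrow> Ck2 k f"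
proof (induction k arbitrary: f)
  case 0
  then show ?case using smooth_unfold[of f] by auto
next
  case (Suc k)
  then show ?case using smooth_unfold[of f] by auto
qed

lemma Ck2_imp_smooth:
  assumes "\<And>k. Ck2 k f" shows "smooth f"
  unfolding smooth_def
proof (intro allI)
  fix js
  show "continuous_on UNIV (partials js f) \<and>
    (\<forall>j x. (\<lambda>t. partials js f (x + t *\<^sub>R axis j 1)) differentiable (at 0))"
    using assms
  proof (induction js arbitrary: f rule: rev_induct)
    case Nil
    then have "Ck2 (Suc 0) f" by blast
    then show ?case by (auto simp: partials_def)
  next
    case (snoc j js)
    have "Ck2 k (partial j f)" for k
      using snoc.prems[of "Suc k"] by auto
    from snoc.IH[OF this] show ?case by (simp add: partials_def)
  qed
qed

lemma smooth_iff_Ck2: "smooth f \<longleftrightarrow> (\<forall>k. Ck2 k f)"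
  using smooth_imp_Ck2 Ck2_imp_smooth by blast

lemma partial_DERIV_0:
  assumes "(\<lambda>t. f (x + t *\<^sub>R axis j 1)) differentiable (at 0)"
  shows "((\<lambda>t. f (x + t *\<^sub>R axis j 1)) has_real_derivative partial j f x) (at 0)"
  unfolding partial_def using DERIV_deriv_differentiable[OF assms] .

lemma partialI:
  "((\<lambda>t. f (x + t *\<^sub>R axis j 1)) has_real_derivative D) (at 0) \<Longrightarrow> partial j f x = D"
  unfolding partial_def by (rule DERIV_imp_deriv)

lemma smooth_partial: "smooth f \<Longrightarrow> smooth (partial j f)"
  using smooth_unfold[of f] by blast

lemma smooth_cont: "smooth f \<Longrightarrow> continuous_on UNIV f"
  using smooth_unfold[of f] by blast

lemma smooth_DERIV:
  assumes "smooth f"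
  shows "((\<lambda>t. f (x + t *\<^sub>R axis j 1)) has_real_derivative partial j f (x + t *\<^sub>R axis j 1)) (at t)"
proof -
  have "((\<lambda>s. f ((x + t *\<^sub>R axis j 1) + s *\<^sub>R axis j 1)) has_real_derivative
      partial j f (x + t *\<^sub>R axis j 1)) (at 0)"
    using assms smooth_unfold[of f] by (intro partial_DERIV_0) blast
  moreover have "(\<lambda>s. f ((x + t *\<^sub>R axis j 1) + s *\<^sub>R axis j 1)) = (\<lambda>s. f (x + (s + t) *\<^sub>R axis j 1))"
    by (simp add: algebra_simps)
  ultimately show ?thesis
    using DERIV_shift[of "\<lambda>t. f (x + t *\<^sub>R axis j 1)" _ 0 t] by simp
qed

lemma partial_translate: "partial j (\<lambda>x. f (x + c)) = (\<lambda>x. partial j f (x + c))"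
  by (simp add: partial_def fun_eq_iff algebra_simps)

lemma Ck2_translate: "Ck2 k f \<Longrightarrow> Ck2 k (\<lambda>x. f (x + c))"
proof (induction k arbitrary: f)
  case 0 then show ?case
    by (auto intro!: continuous_on_compose2[of UNIV f] continuous_intros)
next
  case (Suc k)
  have "(\<lambda>t. f (x + t *\<^sub>R axis j 1 + c)) differentiable (at 0)" for x j
  proof -
    have "(\<lambda>t. f ((x + c) + t *\<^sub>R axis j 1)) differentiable (at 0)"
      using Suc.prems by auto
    then show ?thesis by (simp add: algebra_simps)
  qed
  then show ?case using Suc
    by (auto intro!: continuous_on_compose2[of UNIV f] continuous_intros simp: partial_translate)
qed

lemma Ck2_Suc_imp: "Ck2 (Suc k) f \<Longrightarrow> Ck2 k f"
  by (induction k arbitrary: f) auto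

lemma Ck2_SucI:
  assumes "continuous_on UNIV f"
    "\<And>j x. ((\<lambda>t. f (x + t *\<^sub>R axis j 1)) has_real_derivative f' j x) (at 0)" "\<And>j. Ck2 k (f' j)"
  shows "Ck2 (Suc k) f"
proof -
  have "partial j f = f' j" for j using partialI[OF assms(2)] by blast
  then show ?thesis using assms by (auto simp: real_differentiable_def)
qed

lemma Ck2_DERIV: "Ck2 (Suc k) f \<Longrightarrow> ((\<lambda>t. f (x + t *\<^sub>R axis j 1)) has_real_derivative partial j f x) (at 0)"
  by (auto intro: partial_DERIV_0)

lemma Ck2_add: "Ck2 k f \<Longrightarrow> Ck2 k g \<Longrightarrow> Ck2 k (\<lambda>x. f x + g x)"
proof (induction k arbitrary: f g)
  case 0 then show ?case by (auto intro: continuous_intros)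
next
  case (Suc k)
  show ?case
  proof (rule Ck2_SucI[where f' = "\<lambda>j x. partial j f x + partial j g x"])
    show "((\<lambda>t. f (x + t *\<^sub>R axis j 1) + g (x + t *\<^sub>R axis j 1)) has_real_derivative
        partial j f x + partial j g x) (at 0)" for j x
      using DERIV_add[OF Ck2_DERIV[OF Suc.prems(1)] Ck2_DERIV[OF Suc.prems(2)]] by simp
    show "Ck2 k (\<lambda>x. partial j f x + partial j g x)" for j
      using Suc by auto
  qed (use Suc in \<open>auto intro: continuous_intros\<close>)
qed

lemma Ck2_mult: "Ck2 k f \<Longrightarrow> Ck2 k g \<Longrightarrow> Ck2 k (\<lambda>x. f x * g x)"
proof (induction k arbitrary: f g)
  case 0 then show ?case by (auto intro: continuous_intros)
next
  case (Suc k)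
  show ?case
  proof (rule Ck2_SucI[where f' = "\<lambda>j x. partial j f x * g x + partial j g x * f x"])
    show "((\<lambda>t. f (x + t *\<^sub>R axis j 1) * g (x + t *\<^sub>R axis j 1)) has_real_derivative
        partial j f x * g x + partial j g x * f x) (at 0)" for j x
      using DERIV_mult[OF Ck2_DERIV[OF Suc.prems(1)] Ck2_DERIV[OF Suc.prems(2)]] by simp
    show "Ck2 k (\<lambda>x. partial j f x * g x + partial j g x * f x)" for j
      using Suc Ck2_Suc_imp[of k] by (intro Ck2_add Suc.IH) auto
  qed (use Suc in \<open>auto intro: continuous_intros\<close>)
qed

lemma Ck2_const: "Ck2 k (\<lambda>x. c)"
proof (induction k arbitrary: c)
  case (Suc k)
  show ?case by (rule Ck2_SucI[where f'="\<lambda>j x. 0"]) (simp_all add: Suc)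
qed simp

text \<open>Cut-offs, averaging kernels and the test functions of \<open>mixed_bound\<close> all
  have this form: a partial derivative acts on one factor, and integrals and supports split.\<close>

definition tensor :: "(real \<Rightarrow> real) \<Rightarrow> (real \<Rightarrow> real) \<Rightarrow> real ^ 2 \<Rightarrow> real" where
  "tensor p q x = p (x $ 1) * q (x $ 2)"

lemma tensor_DERIV:
  assumes "\<And>t. (p has_real_derivative p' t) (at t)" "\<And>t. (q has_real_derivative q' t) (at t)"
  shows "((\<lambda>t. tensor p q (x + t *\<^sub>R axis 1 1)) has_real_derivative tensor p' q x) (at 0)"
    "((\<lambda>t. tensor p q (x + t *\<^sub>R axis 2 1)) has_real_derivative tensor p q' x) (at 0)"
proof -
  have sh: "((\<lambda>t. r (y + t)) has_real_derivative r' y) (at 0)"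
    if "\<And>t. (r has_real_derivative r' t) (at t)" for r r' y
    using DERIV_shift[of r "r' y" 0 y] that by (simp add: add.commute)
  show "((\<lambda>t. tensor p q (x + t *\<^sub>R axis 1 1)) has_real_derivative tensor p' q x) (at 0)"
    "((\<lambda>t. tensor p q (x + t *\<^sub>R axis 2 1)) has_real_derivative tensor p q' x) (at 0)"
    unfolding tensor_def
    using DERIV_cmult_right[OF sh[of p p', OF assms(1), of "x $ 1"]]
      DERIV_cmult[OF sh[of q q', OF assms(2), of "x $ 2"]]
    by (simp_all add: axis_def)
qed

lemma tensor_cont: "continuous_on UNIV p \<Longrightarrow> continuous_on UNIV q \<Longrightarrow> continuous_on UNIV (tensor p q)"
  unfolding tensor_def[abs_def]
  by (rule continuous_on_mult; rule continuous_on_compose2[of UNIV], assumption, intro continuous_intros, simp)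

lemma Ck2_tensor: "Ck1 k p \<Longrightarrow> Ck1 k q \<Longrightarrow> Ck2 k (tensor p q)"
proof (induction k arbitrary: p q)
  case 0 then show ?case by (auto intro: tensor_cont)
next
  case (Suc k)
  have d: "(p has_real_derivative deriv p t) (at t)" "(q has_real_derivative deriv q t) (at t)" for t
    using Suc.prems by (auto intro: DERIV_deriv_differentiable)
  show ?case
  proof (rule Ck2_SucI[where f' = "\<lambda>j. if j = 1 then tensor (deriv p) q else tensor p (deriv q)"])
    show "continuous_on UNIV (tensor p q)"
      using Suc.prems by (blast intro: tensor_cont Ck1_cont)
    show "((\<lambda>t. tensor p q (x + t *\<^sub>R axis j 1)) has_real_derivative
       (if j = 1 then tensor (deriv p) q else tensor p (deriv q)) x) (at 0)" for j x
      using tensor_DERIV[of p "deriv p" q "deriv q", OF d, of x] exhaust_2[of j] by auto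
    show "Ck2 k (if j = 1 then tensor (deriv p) q else tensor p (deriv q))" for j
      using Suc.prems Ck1_Suc_imp[of k] by (auto intro!: Suc.IH)
  qed
qed

lemma partial_tensor:
  assumes "smooth1 p" "smooth1 q"
  shows "partial 1 (tensor p q) = tensor (deriv p) q" "partial 2 (tensor p q) = tensor p (deriv q)"
  using tensor_DERIV[of p "deriv p" q "deriv q", OF smooth1_D(1)[OF assms(1)] smooth1_D(1)[OF assms(2)]]
  by (auto intro!: partialI)

lemma smooth_tensor: "smooth1 p \<Longrightarrow> smooth1 q \<Longrightarrow> smooth (tensor p q)"
  by (simp add: smooth_iff_Ck2 smooth1_def Ck2_tensor)
lemma smooth_add: "smooth f \<Longrightarrow> smooth g \<Longrightarrow> smooth (\<lambda>x. f x + g x)"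
  by (simp add: smooth_iff_Ck2 Ck2_add)
lemma smooth_mult: "smooth f \<Longrightarrow> smooth g \<Longrightarrow> smooth (\<lambda>x. f x * g x)"
  by (simp add: smooth_iff_Ck2 Ck2_mult)
lemma smooth_const: "smooth (\<lambda>x. c)"
  by (simp add: smooth_iff_Ck2 Ck2_const)
lemma smooth_translate: "smooth f \<Longrightarrow> smooth (\<lambda>x. f (x + c))"
  by (simp add: smooth_iff_Ck2 Ck2_translate)

lemma smooth_DERIV_0:
  "smooth f \<Longrightarrow> ((\<lambda>t. f (x + t *\<^sub>R axis j 1)) has_real_derivative partial j f x) (at 0)"
  using smooth_unfold[of f] by (blast intro: partial_DERIV_0)

lemma partial_mult:
  assumes "smooth f" "smooth g"
  shows "partial j (\<lambda>x. f x * g x) x = partial j f x * g x + partial j g x * f x"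
  using DERIV_mult[OF smooth_DERIV_0[OF assms(1), of x j] smooth_DERIV_0[OF assms(2), of x j]]
  by (auto intro!: partialI)

lemma grad_mult:
  assumes "smooth f" "smooth g"
  shows "grad (\<lambda>x. f x * g x) x = g x *\<^sub>R grad f x + f x *\<^sub>R grad g x"
  by (simp add: grad_def vec_eq_iff partial_mult[OF assms])

lemma grad_nth: "grad f x $ j = partial j f x"
  by (simp add: grad_def)

lemma continuous_on_vec2:
  fixes f :: "'a::topological_space \<Rightarrow> real ^ 2"
  assumes "\<And>j. continuous_on S (\<lambda>x. f x $ j)" shows "continuous_on S f"
proof -
  have "continuous_on S (\<lambda>x. \<chi> j. f x $ j)"
    by (rule continuous_on_vec_lambda) (rule assms)
  then show ?thesis by simp
qed

lemma grad_cont: "smooth f \<Longrightarrow> continuous_on UNIV (grad f)"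
  by (rule continuous_on_vec2) (simp add: grad_nth smooth_partial smooth_cont)

text \<open>Only direction 2 occurs, the one in which the coefficient is invariant. Backward
  quotients are obtained from negative \<open>h\<close>.\<close>

definition diffq :: "real \<Rightarrow> (real ^ 2 \<Rightarrow> real) \<Rightarrow> real ^ 2 \<Rightarrow> real" where
  "diffq h f x = (f (x + h *\<^sub>R axis 2 1) - f x) / h"

lemma diffq_alt: "diffq h f = (\<lambda>x. inverse h * f (x + h *\<^sub>R axis 2 1) + (- inverse h) * f x)"
  by (simp add: diffq_def fun_eq_iff divide_inverse algebra_simps)

lemma smooth_diffq: "smooth f \<Longrightarrow> smooth (diffq h f)"
  unfolding diffq_alt by (intro smooth_add smooth_mult smooth_const smooth_translate)

lemma partial_cmult_add:
  assumes "smooth f" "smooth g"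
  shows "partial j (\<lambda>x. a * f x + b * g x) x = a * partial j f x + b * partial j g x"
  using DERIV_add[OF DERIV_cmult[OF smooth_DERIV_0[OF assms(1), of x j], of a]
      DERIV_cmult[OF smooth_DERIV_0[OF assms(2), of x j], of b]]
  by (auto intro!: partialI)

lemma partial_diffq:
  assumes "smooth f" shows "partial j (diffq h f) = diffq h (partial j f)"
proof
  show "partial j (diffq h f) x = diffq h (partial j f) x" for x
    using partial_cmult_add[OF smooth_translate[OF assms] assms, of j "inverse h" "h *\<^sub>R axis 2 1" "- inverse h" x]
    unfolding diffq_alt partial_translate .
qed

lemma grad_diffq: "smooth f \<Longrightarrow> grad (diffq h f) x = (1/h) *\<^sub>R (grad f (x + h *\<^sub>R axis 2 1) - grad f x)"
  by (simp add: vec_eq_iff grad_nth partial_diffq diffq_def)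

lemma partial_outside:
  assumes "closed S" "\<And>x. x \<notin> S \<Longrightarrow> f x = 0" "x \<notin> S"
  shows "partial j f x = 0"
proof -
  have o: "open ((\<lambda>t::real. x + t *\<^sub>R axis j 1) -` (- S))"
    by (intro open_vimage continuous_intros) (use assms in auto)
  have "((\<lambda>t. f (x + t *\<^sub>R axis j 1)) has_real_derivative 0) (at 0)"
    by (rule has_field_derivative_transform_within_open[OF DERIV_const[of 0] o])
       (use assms in auto)
  then show ?thesis by (rule partialI)
qed

lemma grad_outside:
  assumes "closed S" "\<And>x. x \<notin> S \<Longrightarrow> f x = 0" "x \<notin> S"
  shows "grad f x = 0"
  using partial_outside[OF assms] by (simp add: vec_eq_iff grad_nth)

lemma test_funI:
  assumes "smooth f" "compact S" "S \<subseteq> \<Omega>" "\<And>x. x \<notin> S \<Longrightarrow> f x = 0"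
  shows "test_fun \<Omega> f"
proof -
  have "closure {x. f x \<noteq> 0} \<subseteq> S"
    using assms by (intro closure_minimal compact_imp_closed) auto
  moreover have "compact (closure {x. f x \<noteq> 0})"
    using assms(2) calculation closed_closure compact_Int_closed[of S "closure {x. f x \<noteq> 0}"]
    by (simp add: Int_absorb1)
  ultimately show ?thesis unfolding test_fun_def using assms(1,3) by (meson order_trans)
qed

lemma test_funE:
  assumes "test_fun \<Omega> f"
  obtains S where "smooth f" "compact S" "S \<subseteq> \<Omega>" "\<And>x. x \<notin> S \<Longrightarrow> f x = 0"
proof (rule that[of "closure {x. f x \<noteq> 0}"])
  show "f x = 0" if "x \<notin> closure {x. f x \<noteq> 0}" for x
    using that closure_subset[of "{x. f x \<noteq> 0}"] by auto
qed (use assms in \<open>simp_all add: test_fun_def\<close>)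

subsection \<open>Integration on the plane\<close>

lemma lebesgue_integral_translate:
  fixes f :: "real ^ 2 \<Rightarrow> 'b::{banach, second_countable_topology}"
  assumes [measurable]: "f \<in> borel_measurable borel"
  shows "(\<integral>x. f (x + c) \<partial>lebesgue) = (\<integral>x. f x \<partial>lebesgue)"
proof -
  have "(\<integral>x. f x \<partial>lborel) = (\<integral>x. f x \<partial>(distr lborel borel ((+) c)))"
    by (simp add: lborel_distr_plus)
  also have "\<dots> = (\<integral>x. f (c + x) \<partial>lborel)"
    by (rule integral_distr) auto
  finally show ?thesis
    by (subst (1 2) integral_completion) (auto simp: add.commute)
qed

lemma cc_bounded:
  fixes f :: "real ^ 2 \<Rightarrow> 'b::euclidean_space"
  assumes "continuous_on UNIV f" "compact S" "\<And>x. x \<notin> S \<Longrightarrow> f x = 0"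
  obtains B where "0 \<le> B" "\<And>x. norm (f x) \<le> B"
proof -
  have "bounded (f ` S)"
    using assms(1,2) by (meson compact_continuous_image compact_imp_bounded continuous_on_subset subset_UNIV)
  then obtain B where B: "\<And>x. x \<in> S \<Longrightarrow> norm (f x) \<le> B"
    by (auto simp: bounded_iff)
  have "norm (f x) \<le> max B 0" for x
    using B[of x] assms(3)[of x] by (cases "x \<in> S") auto
  then show ?thesis using that[of "max B 0"] by simp
qed

lemma cc_integrable:
  fixes f :: "real ^ 2 \<Rightarrow> 'b::euclidean_space"
  assumes "continuous_on UNIV f" "compact S" "\<And>x. x \<notin> S \<Longrightarrow> f x = 0"
  shows "integrable lborel f" "integrable lebesgue f"
proof -
  have "integrable lborel (\<lambda>x. indicator S x *\<^sub>R f x)"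
    by (rule borel_integrable_compact) (use assms in \<open>auto intro: continuous_on_subset\<close>)
  moreover have "(\<lambda>x. indicator S x *\<^sub>R f x) = f"
    using assms(3) by (auto simp: indicator_def fun_eq_iff)
  ultimately show "integrable lborel f" by simp
  then show "integrable lebesgue f" by (simp add: integrable_completion borel_measurable_integrable)
qed

lemma cont_lebesgue_measurable:
  fixes f :: "real ^ 2 \<Rightarrow> 'b::euclidean_space"
  shows "continuous_on UNIV f \<Longrightarrow> f \<in> borel_measurable lebesgue"
  by (simp add: borel_measurable_continuous_onI measurable_completion)

lemma cc_sq_int:
  fixes f :: "real ^ 2 \<Rightarrow> 'b::euclidean_space"
  assumes "continuous_on UNIV f" "compact S" "\<And>x. x \<notin> S \<Longrightarrow> f x = 0"
  shows "sq_int lebesgue f"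
proof -
  have "continuous_on UNIV (\<lambda>x. (norm (f x))\<^sup>2)"
    by (intro continuous_intros assms)
  then have "integrable lebesgue (\<lambda>x. (norm (f x))\<^sup>2)"
    by (rule cc_integrable(2)[OF _ assms(2)]) (simp add: assms(3))
  then show ?thesis using cont_lebesgue_measurable[OF assms(1)] by (simp add: sq_int_def)
qed

text \<open>Carries Lebesgue measure on pairs to the plane (\<open>lborel_vec2_of\<close>), so that
  Fubini for pairs splits the integral of a tensor.\<close>

definition vec2_of :: "real \<times> real \<Rightarrow> real ^ 2" where
  "vec2_of z = (\<chi> i. if i = 1 then fst z else snd z)"

lemma vec2_of_nth [simp]: "vec2_of z $ 1 = fst z" "vec2_of z $ 2 = snd z"
  by (auto simp: vec2_of_def)

lemma vec2_of_measurable [measurable]: "vec2_of \<in> borel_measurable borel"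
proof -
  have "continuous_on UNIV vec2_of"
  proof (rule continuous_on_vec2)
    show "continuous_on UNIV (\<lambda>x. vec2_of x $ j)" for j
      using exhaust_2[of j] by (elim disjE) (simp_all add: continuous_on_fst continuous_on_snd continuous_on_id)
  qed
  then show ?thesis by (rule borel_measurable_continuous_onI)
qed

lemma Basis_vec2: "(Basis :: (real ^ 2) set) = {axis 1 1, axis 2 1}"
  by (auto simp: Basis_vec_def UNIV_2)

lemma prod_Basis_vec2: "(\<Prod>b\<in>(Basis :: (real ^ 2) set). f b) = f (axis 1 1) * f (axis 2 1)"
proof -
  have "axis 1 1 \<noteq> (axis 2 1 :: real ^ 2)" by (simp add: axis_eq_axis)
  then show ?thesis by (simp add: Basis_vec2)
qed

lemma inner_axis_2: "(x :: real ^ 2) \<bullet> axis j 1 = x $ j"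
  by (simp add: inner_axis)

lemma lborel_vec2_of: "distr lborel borel vec2_of = (lborel :: (real ^ 2) measure)"
proof (rule lborel_eqI[symmetric])
  fix l u :: "real ^ 2"
  assume lu: "\<And>b. b \<in> Basis \<Longrightarrow> l \<bullet> b \<le> u \<bullet> b"
  have "vec2_of -` box l u = box (l $ 1, l $ 2) (u $ 1, u $ 2)"
    by (auto simp: box_def Basis_vec2 Basis_prod_def inner_axis_2)
  then have "emeasure (distr lborel borel vec2_of) (box l u) = emeasure lborel (box (l $ 1, l $ 2) (u $ 1, u $ 2))"
    by (subst emeasure_distr) auto
  also have "\<dots> = ennreal ((u $ 1 - l $ 1) * (u $ 2 - l $ 2))"
    by (subst emeasure_lborel_box)
       (use lu[of "axis 1 1"] lu[of "axis 2 1"] in \<open>auto simp: Basis_prod_def Basis_vec2 inner_axis_2\<close>)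
  finally show "emeasure (distr lborel borel vec2_of) (box l u) = ennreal (\<Prod>b\<in>Basis. (u - l) \<bullet> b)"
    by (simp add: prod_Basis_vec2 inner_axis_2)
qed simp

lemma integral_tensor:
  assumes "integrable lborel (tensor p q)" "p \<in> borel_measurable borel" "q \<in> borel_measurable borel"
  shows "(\<integral>x. tensor p q x \<partial>lebesgue) = (\<integral>t. p t \<partial>lborel) * (\<integral>t. q t \<partial>lborel)"
proof -
  have [measurable]: "tensor p q \<in> borel_measurable borel"
    using assms(1) by auto
  have "(\<integral>x. tensor p q x \<partial>lebesgue) = (\<integral>x. tensor p q x \<partial>(distr lborel borel vec2_of))"
    by (simp add: integral_completion lborel_vec2_of)
  also have "\<dots> = (\<integral>z. tensor p q (vec2_of z) \<partial>lborel)"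
    by (rule integral_distr) auto
  also have "\<dots> = (\<integral>z. (case z of (a, b) \<Rightarrow> p a * q b) \<partial>(lborel \<Otimes>\<^sub>M lborel))"
    by (simp add: lborel_prod tensor_def case_prod_beta)
  also have "\<dots> = (\<integral>a. (\<integral>b. (case (a, b) of (a, b) \<Rightarrow> p a * q b) \<partial>lborel) \<partial>lborel)"
  proof (rule lborel_pair.integral_fst'[symmetric])
    have "integrable (distr lborel borel vec2_of) (tensor p q)"
      using assms(1) by (simp add: lborel_vec2_of)
    then have "integrable lborel (\<lambda>z. tensor p q (vec2_of z))"
      by (subst (asm) integrable_distr_eq) auto
    then show "integrable (lborel \<Otimes>\<^sub>M lborel) (\<lambda>(a, b). p a * q b)"
      unfolding lborel_prod tensor_def case_prod_beta vec2_of_nth .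
  qed
  finally show ?thesis by simp
qed

lemma measure_cbox2:
  fixes l u :: "real ^ 2"
  assumes "l $ 1 \<le> u $ 1" "l $ 2 \<le> u $ 2"
  shows "measure lebesgue (cbox l u) = (u $ 1 - l $ 1) * (u $ 2 - l $ 2)"
  using assms by (subst measure_completion)
    (auto simp: measure_lborel_cbox_eq prod_Basis_vec2 inner_axis_2, auto simp: Basis_vec2 inner_axis_2)

subsection \<open>Difference quotients\<close>

lemma cont_translate:
  fixes f :: "real ^ 2 \<Rightarrow> 'b::topological_space"
  assumes "continuous_on UNIV f" shows "continuous_on UNIV (\<lambda>x. f (x + v))"
proof (rule continuous_on_compose2[OF assms])
  show "continuous_on UNIV (\<lambda>x. x + v)" by (intro continuous_intros)
qed simp

lemma smooth_diff_bound:
  assumes "smooth Y" "\<And>x. \<bar>partial j Y x\<bar> \<le> B"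
  shows "\<bar>Y (x + s *\<^sub>R axis j 1) - Y (x + t *\<^sub>R axis j 1)\<bar> \<le> B * \<bar>s - t\<bar>"
proof -
  have "norm (Y (x + s *\<^sub>R axis j 1) - Y (x + t *\<^sub>R axis j 1)) \<le> B * norm (s - t)"
    by (rule field_differentiable_bound[where S = UNIV and f = "\<lambda>t. Y (x + t *\<^sub>R axis j 1)"
          and f' = "\<lambda>t. partial j Y (x + t *\<^sub>R axis j 1)"])
       (use assms in \<open>auto intro: smooth_DERIV\<close>)
  then show ?thesis by simp
qed

text \<open>The translation acts on the smooth factor, whose difference quotients are bounded by the
  supremum \<open>B\<close> of its derivative. Hence \<open>B * \<bar>G x\<bar>\<close> dominates,
  and integrability of \<open>G\<close> suffices.\<close>

lemma DERIV_integral_translate: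
  fixes G :: "real ^ 2 \<Rightarrow> real"
  assumes G: "integrable lebesgue G" and Y: "smooth Y" "compact S" "\<And>x. x \<notin> S \<Longrightarrow> Y x = 0"
  shows "((\<lambda>t. \<integral>x. G x * Y (x + t *\<^sub>R axis j 1) \<partial>lebesgue) has_real_derivative
     (\<integral>x. G x * partial j Y (x + t *\<^sub>R axis j 1) \<partial>lebesgue)) (at t)"
proof -
  let ?e = "axis j 1 :: real ^ 2"
  have c: "continuous_on UNIV (partial j Y)" "continuous_on UNIV Y"
    using Y(1) smooth_partial smooth_cont by blast+
  have tr: "(\<lambda>x. f (x + v)) \<in> borel_measurable lebesgue"
    if "continuous_on UNIV f" for f :: "real ^ 2 \<Rightarrow> real" and v
    using cont_lebesgue_measurable[OF cont_translate[OF that]] .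
  have [measurable]: "G \<in> borel_measurable lebesgue" using G by auto
  obtain B where B: "0 \<le> B" "\<And>x. norm (partial j Y x) \<le> B"
    using cc_bounded[OF c(1) Y(2) partial_outside[OF compact_imp_closed[OF Y(2)] Y(3)]] by blast
  obtain B' where B': "0 \<le> B'" "\<And>x. norm (Y x) \<le> B'"
    using cc_bounded[OF c(2) Y(2,3)] by blast
  have int: "integrable lebesgue (\<lambda>x. G x * Y (x + v))" for v
    by (rule Bochner_Integration.integrable_bound[where f = "\<lambda>x. B' * G x"])
       (use G B' tr[OF c(2)] in \<open>auto simp: abs_mult mult.commute[of "\<bar>G _\<bar>"] intro!: mult_right_mono\<close>)
  show ?thesis
    unfolding DERIV_def tendsto_at_iff_sequentially
  proof (intro allI impI)
    fix X :: "nat \<Rightarrow> real"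
    assume X: "\<forall>i. X i \<in> UNIV - {0}" "X \<longlonglongrightarrow> 0"
    let ?q = "\<lambda>n x. G x * ((Y (x + (t + X n) *\<^sub>R ?e) - Y (x + t *\<^sub>R ?e)) / X n)"
    have "(\<lambda>n. \<integral>x. ?q n x \<partial>lebesgue) \<longlonglongrightarrow> (\<integral>x. G x * partial j Y (x + t *\<^sub>R ?e) \<partial>lebesgue)"
    proof (rule integral_dominated_convergence[where w = "\<lambda>x. B * \<bar>G x\<bar>"])
      show "integrable lebesgue (\<lambda>x. B * \<bar>G x\<bar>)" using G by auto
      show "(\<lambda>x. G x * partial j Y (x + t *\<^sub>R ?e)) \<in> borel_measurable lebesgue"
        using tr[OF c(1)] by measurable
      show "?q n \<in> borel_measurable lebesgue" for n
        using tr[OF c(2)] by measurable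
      show "AE x in lebesgue. (\<lambda>n. ?q n x) \<longlonglongrightarrow> G x * partial j Y (x + t *\<^sub>R ?e)"
      proof (rule AE_I2)
        fix x
        have "((\<lambda>h. (Y (x + (t + h) *\<^sub>R ?e) - Y (x + t *\<^sub>R ?e)) / h) \<longlongrightarrow> partial j Y (x + t *\<^sub>R ?e)) (at 0)"
          using smooth_DERIV[OF Y(1), of x j t] by (simp add: DERIV_def)
        then have "(\<lambda>n. (Y (x + (t + X n) *\<^sub>R ?e) - Y (x + t *\<^sub>R ?e)) / X n)
            \<longlonglongrightarrow> partial j Y (x + t *\<^sub>R ?e)"
          using X by (auto simp: tendsto_at_iff_sequentially o_def)
        then show "(\<lambda>n. ?q n x) \<longlonglongrightarrow> G x * partial j Y (x + t *\<^sub>R ?e)"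
          by (rule tendsto_mult[OF tendsto_const])
      qed
      show "AE x in lebesgue. norm (?q n x) \<le> B * \<bar>G x\<bar>" for n
      proof (rule AE_I2)
        fix x
        have "\<bar>Y (x + (t + X n) *\<^sub>R ?e) - Y (x + t *\<^sub>R ?e)\<bar> \<le> B * \<bar>X n\<bar>"
          using smooth_diff_bound[OF Y(1), of j B x "t + X n" t] B by simp
        moreover have "X n \<noteq> 0" using X(1) by auto
        ultimately have "\<bar>Y (x + (t + X n) *\<^sub>R ?e) - Y (x + t *\<^sub>R ?e)\<bar> / \<bar>X n\<bar> \<le> B"
          by (simp add: pos_divide_le_eq)
        then have "\<bar>G x\<bar> * (\<bar>Y (x + (t + X n) *\<^sub>R ?e) - Y (x + t *\<^sub>R ?e)\<bar> / \<bar>X n\<bar>) \<le> \<bar>G x\<bar> * B"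
          by (rule mult_left_mono) simp
        then show "norm (?q n x) \<le> B * \<bar>G x\<bar>"
          by (simp add: abs_mult mult.commute)
      qed
    qed
    moreover have "(\<integral>x. ?q n x \<partial>lebesgue)
      = ((\<integral>x. G x * Y (x + (t + X n) *\<^sub>R ?e) \<partial>lebesgue) - (\<integral>x. G x * Y (x + t *\<^sub>R ?e) \<partial>lebesgue)) / X n" for n
    proof -
      have "(\<integral>x. ?q n x \<partial>lebesgue)
          = (\<integral>x. (G x * Y (x + (t + X n) *\<^sub>R ?e) - G x * Y (x + t *\<^sub>R ?e)) / X n \<partial>lebesgue)"
        by (simp add: algebra_simps)
      then show ?thesis
        by (simp add: Bochner_Integration.integral_diff[OF int int])
    qed
    ultimately show "((\<lambda>h. ((\<integral>x. G x * Y (x + (t + h) *\<^sub>R ?e) \<partial>lebesgue)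
        - (\<integral>x. G x * Y (x + t *\<^sub>R ?e) \<partial>lebesgue)) / h) \<circ> X)
      \<longlonglongrightarrow> (\<integral>x. G x * partial j Y (x + t *\<^sub>R ?e) \<partial>lebesgue)"
      by (simp only: o_def)
  qed
qed

text \<open>The mean value theorem is applied to the integral as a function of the shift. A single
  \<open>s\<close> then serves all \<open>x\<close>, and a difference quotient under the integral
  turns into one translate of the derivative.\<close>

lemma MVT_integral_translate:
  fixes G :: "real ^ 2 \<Rightarrow> real"
  assumes "integrable lebesgue G" "smooth Y" "compact S" "\<And>x. x \<notin> S \<Longrightarrow> Y x = 0" "(a::real) < b"
  obtains s where "a < s" "s < b"
    "(\<integral>x. G x * Y (x + b *\<^sub>R axis j 1) \<partial>lebesgue) - (\<integral>x. G x * Y (x + a *\<^sub>R axis j 1) \<partial>lebesgue)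
      = (b - a) * (\<integral>x. G x * partial j Y (x + s *\<^sub>R axis j 1) \<partial>lebesgue)"
  using MVT2[OF assms(5), of "\<lambda>t. \<integral>x. G x * Y (x + t *\<^sub>R axis j 1) \<partial>lebesgue"
      "\<lambda>t. \<integral>x. G x * partial j Y (x + t *\<^sub>R axis j 1) \<partial>lebesgue"]
    DERIV_integral_translate[OF assms(1-4)] by blast

definition square :: "real ^ 2 \<Rightarrow> real \<Rightarrow> (real ^ 2) set" where
  "square p \<rho> = {x. \<bar>x $ 1 - p $ 1\<bar> \<le> \<rho> \<and> \<bar>x $ 2 - p $ 2\<bar> \<le> \<rho>}"

lemma square_cbox: "square p \<rho> = cbox (\<chi> i. p $ i - \<rho>) (\<chi> i. p $ i + \<rho>)"
  by (auto simp: square_def mem_box_cart forall_2 abs_le_iff)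

lemma compact_square [simp]: "compact (square p \<rho>)"
  by (simp add: square_cbox)
lemma closed_square [simp]: "closed (square p \<rho>)"
  by (simp add: square_cbox closed_cbox)
lemma square_borel [measurable]: "square p \<rho> \<in> sets borel"
  by (simp add: borel_closed)

lemma square_mono: "\<rho> \<le> \<rho>' \<Longrightarrow> square p \<rho> \<subseteq> square p \<rho>'"
  by (auto simp: square_def)

lemma square_translate: "x \<in> square p \<rho> \<Longrightarrow> \<bar>s\<bar> \<le> h \<Longrightarrow> x + s *\<^sub>R axis 2 1 \<in> square p (\<rho> + h)"
  by (auto simp: square_def axis_def)

lemma cutoff_exists:
  assumes "0 < \<rho>" "\<rho> < \<rho>'"
  obtains \<eta> L where "smooth \<eta>" "0 \<le> L" "\<And>x. 0 \<le> \<eta> x \<and> \<eta> x \<le> 1" "\<And>x. x \<in> square 0 \<rho> \<Longrightarrow> \<eta> x = 1"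
    "\<And>x. x \<notin> square 0 \<rho>' \<Longrightarrow> \<eta> x = 0" "\<And>j x. \<bar>partial j \<eta> x\<bar> \<le> L"
proof -
  \<comment> \<open>The affine map \<open>s * t + m\<close> sends \<open>- \<rho>\<close> to 1 and
    \<open>- \<rho>'\<close> to -1, the ends of the transition of \<open>step\<close>; the reflected
    factor of \<open>c\<close> treats the other side.\<close>
  define m where "m = (\<rho> + \<rho>') / (\<rho>' - \<rho>)"
  define s where "s = 2 / (\<rho>' - \<rho>)"
  define c where "c t = step (s * t + m) * step (- s * t + m)" for t
  have s: "s > 0" using assms by (simp add: s_def)
  have "m - s * \<rho> = (\<rho> + \<rho>' - 2 * \<rho>) / (\<rho>' - \<rho>)"
    unfolding m_def s_def by (simp only: diff_divide_distrib times_divide_eq_left)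
  also have "\<rho> + \<rho>' - 2 * \<rho> = \<rho>' - \<rho>" by simp
  finally have m1: "m - s * \<rho> = 1" using assms by (simp del: diff_divide_distrib)
  have "m - s * \<rho>' = (\<rho> + \<rho>' - 2 * \<rho>') / (\<rho>' - \<rho>)"
    unfolding m_def s_def by (simp only: diff_divide_distrib times_divide_eq_left)
  also have "\<rho> + \<rho>' - 2 * \<rho>' = - (\<rho>' - \<rho>)" by simp
  finally have m2: "m - s * \<rho>' = - 1" using assms by (simp only: minus_divide_left[symmetric]) simp
  have sm: "smooth1 c"
    unfolding c_def[abs_def] by (intro smooth1_mult smooth1_affine smooth1_step)
  have c1: "c t = 1" if "\<bar>t\<bar> \<le> \<rho>" for t
  proof -
    have "s * t \<le> s * \<rho>" "s * (- t) \<le> s * \<rho>"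
      by (rule mult_left_mono; use s that in linarith)+
    then show ?thesis using m1 by (simp add: c_def step_1)
  qed
  have c0: "c t = 0" if "\<not> \<bar>t\<bar> \<le> \<rho>'" for t
  proof -
    have "s * \<rho>' \<le> s * t \<or> s * \<rho>' \<le> s * (- t)"
    proof (cases "t \<ge> 0")
      case True
      have "s * \<rho>' \<le> s * t" by (rule mult_left_mono; use s that True in linarith)
      then show ?thesis ..
    next
      case False
      have "s * \<rho>' \<le> s * (- t)" by (rule mult_left_mono; use s that False in linarith)
      then show ?thesis ..
    qed
    then show ?thesis using m2 by (auto simp: c_def step_0)
  qed
  have c01: "0 \<le> c t" "c t \<le> 1" for t
    using step_ge0 step_le1 by (auto simp: c_def intro: mult_le_one)
  define \<eta> where "\<eta> = tensor c c"
  have sme: "smooth \<eta>" unfolding \<eta>_def by (rule smooth_tensor[OF sm sm])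
  have z: "\<eta> x = 0" if "x \<notin> square 0 \<rho>'" for x
    using that c0[of "x $ 1"] c0[of "x $ 2"] by (auto simp: \<eta>_def tensor_def square_def)
  have zp: "partial j \<eta> x = 0" if "x \<notin> square 0 \<rho>'" for x j
    using partial_outside[of "square 0 \<rho>'" \<eta> x j] z that by simp
  have "\<exists>B. 0 \<le> B \<and> (\<forall>x. norm (partial j \<eta> x) \<le> B)" for j
    using cc_bounded[OF smooth_cont[OF smooth_partial[OF sme]] compact_square zp] by metis
  then obtain B where B: "\<And>j. 0 \<le> B j" "\<And>j x. norm (partial j \<eta> x) \<le> B j" by metis
  show ?thesis
  proof (rule that[of \<eta> "B 1 + B 2", OF sme])
    show "0 \<le> B 1 + B 2" using B(1) by (simp add: add_nonneg_nonneg)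
    show "0 \<le> \<eta> x \<and> \<eta> x \<le> 1" for x
      using c01 by (auto simp: \<eta>_def tensor_def intro: mult_le_one)
    show "\<eta> x = 1" if "x \<in> square 0 \<rho>" for x
      using that by (auto simp: \<eta>_def tensor_def square_def c1)
    show "\<bar>partial j \<eta> x\<bar> \<le> B 1 + B 2" for j x
      using B(2)[of j x] B(1)[of 1] B(1)[of 2] exhaust_2[of j] by auto
  qed (rule z)
qed

lemma l2norm_translate:
  fixes f :: "real ^ 2 \<Rightarrow> 'b::euclidean_space"
  assumes [measurable]: "f \<in> borel_measurable borel"
  shows "L2n (\<lambda>x. f (x + c)) = L2n f"
  unfolding l2norm_def using lebesgue_integral_translate[of "\<lambda>x. (norm (f x))\<^sup>2" c] by simp

lemma sq_int_indicator:
  assumes "sq_int M f" "S \<in> sets M"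
  shows "sq_int M (\<lambda>x. indicator S x *\<^sub>R f x)"
  by (rule sq_int_mult(1)[OF assms(1), of _ 1]) (use assms(2) in \<open>auto simp: indicator_def\<close>)

lemma sets_lebesgue_borel: "S \<in> sets borel \<Longrightarrow> S \<in> sets lebesgue"
  by (simp add: sets_completionI_sets)

text \<open>The squared norm of the truncated quotient is its integral against the quotient itself.
  \<open>MVT_integral_translate\<close> replaces the latter by one translate of the derivative;
  Cauchy-Schwarz and translation invariance then allow one factor of the norm to be
  cancelled.\<close>

lemma l2norm_diffq_le:
  assumes w: "smooth w" "compact Sw" "\<And>x. x \<notin> Sw \<Longrightarrow> w x = 0" and h: "0 < h"
    and S [measurable]: "S \<in> sets borel" "S' \<in> sets borel"
    and SS: "\<And>x s. x \<in> S \<Longrightarrow> 0 \<le> s \<Longrightarrow> s \<le> h \<Longrightarrow> x + s *\<^sub>R axis 2 1 \<in> S'"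
  shows "L2n (\<lambda>x. indicator S x *\<^sub>R diffq h w x) \<le> L2n (\<lambda>x. indicator S' x *\<^sub>R partial 2 w x)"
proof -
  let ?e = "axis 2 1 :: real ^ 2"
  let ?\<Phi> = "\<lambda>x. indicator S x *\<^sub>R diffq h w x"
  have cw: "continuous_on UNIV w" "continuous_on UNIV (partial 2 w)"
    using w(1) smooth_cont smooth_partial by blast+
  then have [measurable]: "w \<in> borel_measurable borel" "partial 2 w \<in> borel_measurable borel"
    by (auto intro: borel_measurable_continuous_onI)
  have z: "partial 2 w x = 0" if "x \<notin> Sw" for x
    using partial_outside[OF compact_imp_closed[OF w(2)] w(3) that] by simp
  have iw: "integrable lebesgue (\<lambda>x. w (x + v))" for v
  proof (rule cc_integrable(2))
    show "continuous_on UNIV (\<lambda>x. w (x + v))"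
      using smooth_cont[OF smooth_translate[OF w(1)]] .
    show "compact ((\<lambda>x. x - v) ` Sw)"
      using w(2) by (intro compact_continuous_image continuous_intros)
    show "w (x + v) = 0" if "x \<notin> (\<lambda>x. x - v) ` Sw" for x
      using that by (intro w(3)) (metis add_diff_cancel image_eqI)
  qed
  have dsq: "sq_int lebesgue (diffq h w)"
  proof -
    have "sq_int lebesgue (\<lambda>x. w (x + h *\<^sub>R ?e))"
    proof (rule cc_sq_int)
      show "continuous_on UNIV (\<lambda>x. w (x + h *\<^sub>R ?e))"
        using smooth_cont[OF smooth_translate[OF w(1)]] .
      show "compact ((\<lambda>x. x - h *\<^sub>R ?e) ` Sw)"
        using w(2) by (intro compact_continuous_image continuous_intros)
      show "w (x + h *\<^sub>R ?e) = 0" if "x \<notin> (\<lambda>x. x - h *\<^sub>R ?e) ` Sw" for x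
        using that by (intro w(3)) (metis add_diff_cancel image_eqI)
    qed
    then have "sq_int lebesgue (\<lambda>x. (1/h) *\<^sub>R (w (x + h *\<^sub>R ?e) - w x))"
      using cc_sq_int[OF cw(1) w(2,3)] by (intro sq_int_scaleR sq_int_diff)
    then show ?thesis by (simp add: diffq_def[abs_def])
  qed
  have \<Phi>s: "sq_int lebesgue ?\<Phi>"
    by (rule sq_int_indicator[OF dsq]) (simp add: sets_lebesgue_borel)
  have dint: "integrable lebesgue (diffq h w)"
    unfolding diffq_def[abs_def] using iw[of "h *\<^sub>R ?e"] iw[of 0] by auto
  have \<Phi>i: "integrable lebesgue ?\<Phi>"
    using integrable_mult_indicator[OF sets_lebesgue_borel[OF S(1)] dint] .
  obtain s where s: "0 < s" "s < h" and eq: "(\<integral>x. ?\<Phi> x * w (x + h *\<^sub>R ?e) \<partial>lebesgue) - (\<integral>x. ?\<Phi> x * w (x + 0 *\<^sub>R ?e) \<partial>lebesgue)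
      = (h - 0) * (\<integral>x. ?\<Phi> x * partial 2 w (x + s *\<^sub>R ?e) \<partial>lebesgue)"
    using MVT_integral_translate[OF \<Phi>i w h] by blast
  let ?g = "\<lambda>x. indicator S' x *\<^sub>R partial 2 w x"
  have gs: "sq_int lebesgue (\<lambda>x. indicator S' (x + s *\<^sub>R ?e) *\<^sub>R partial 2 w (x + s *\<^sub>R ?e))"
  proof (rule sq_int_mult(1)[where B = 1])
    show "sq_int lebesgue (\<lambda>x. partial 2 w (x + s *\<^sub>R ?e))"
    proof (rule cc_sq_int)
      show "continuous_on UNIV (\<lambda>x. partial 2 w (x + s *\<^sub>R ?e))"
        using smooth_cont[OF smooth_translate[OF smooth_partial[OF w(1)]]] .
      show "compact ((\<lambda>x. x - s *\<^sub>R ?e) ` Sw)"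
        using w(2) by (intro compact_continuous_image continuous_intros)
      show "partial 2 w (x + s *\<^sub>R ?e) = 0" if "x \<notin> (\<lambda>x. x - s *\<^sub>R ?e) ` Sw" for x
        using that by (intro z) (metis add_diff_cancel image_eqI)
    qed
    show "(\<lambda>x. indicator S' (x + s *\<^sub>R ?e)) \<in> borel_measurable lebesgue"
      by (rule measurable_completion) measurable
  qed (auto simp: indicator_def)
  have bdint: "integrable lebesgue (\<lambda>x. ?\<Phi> x * w (x + v))" for v
  proof -
    have "sq_int lebesgue (\<lambda>x. w (x + v))"
    proof (rule cc_sq_int)
      show "continuous_on UNIV (\<lambda>x. w (x + v))"
        using smooth_cont[OF smooth_translate[OF w(1)]] .
      show "compact ((\<lambda>x. x - v) ` Sw)"
        using w(2) by (intro compact_continuous_image continuous_intros)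
      show "w (x + v) = 0" if "x \<notin> (\<lambda>x. x - v) ` Sw" for x
        using that by (intro w(3)) (metis add_diff_cancel image_eqI)
    qed
    then show ?thesis using sq_int_inner[OF \<Phi>s] by simp
  qed
  have "(L2n ?\<Phi>)\<^sup>2 = (\<integral>x. (?\<Phi> x * w (x + h *\<^sub>R ?e) - ?\<Phi> x * w (x + 0 *\<^sub>R ?e)) / h \<partial>lebesgue)"
    unfolding l2norm_sq
  proof (rule Bochner_Integration.integral_cong[OF refl])
    fix x
    have "w (x + h *\<^sub>R ?e) - w x = h * diffq h w x" using h by (simp add: diffq_def)
    then have "?\<Phi> x * w (x + h *\<^sub>R ?e) - ?\<Phi> x * w (x + 0 *\<^sub>R ?e) = h * (?\<Phi> x * ?\<Phi> x)"
      by (cases "x \<in> S") (simp_all flip: right_diff_distrib)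
    then show "(norm (?\<Phi> x))\<^sup>2 = (?\<Phi> x * w (x + h *\<^sub>R ?e) - ?\<Phi> x * w (x + 0 *\<^sub>R ?e)) / h"
      using h by (simp add: power2_eq_square)
  qed
  also have "\<dots> = (\<integral>x. ?\<Phi> x * partial 2 w (x + s *\<^sub>R ?e) \<partial>lebesgue)"
    using h by (simp only: integral_divide_zero eq Bochner_Integration.integral_diff[OF bdint bdint]) simp
  also have "\<dots> = (\<integral>x. ?\<Phi> x \<bullet> ?g (x + s *\<^sub>R ?e) \<partial>lebesgue)"
    by (rule Bochner_Integration.integral_cong) (use SS s in \<open>auto simp: indicator_def\<close>)
  also have "\<dots> \<le> L2n ?\<Phi> * L2n (\<lambda>x. ?g (x + s *\<^sub>R ?e))"
    using Cauchy_Schwarz_l2norm[OF \<Phi>s gs] by linarith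
  also have "L2n (\<lambda>x. ?g (x + s *\<^sub>R ?e)) = L2n ?g"
    by (rule l2norm_translate) measurable
  finally have "L2n ?\<Phi> * L2n ?\<Phi> \<le> L2n ?\<Phi> * L2n ?g"
    by (simp add: power2_eq_square)
  then show ?thesis
    using mult_left_le_imp_le[of "L2n ?\<Phi>"] l2norm_nonneg[of lebesgue ?\<Phi>] l2norm_nonneg[of lebesgue ?g]
    by (cases "L2n ?\<Phi> = 0") (auto simp: less_le)
qed

lemma diffq_outside:
  assumes "\<And>x. x \<notin> square p \<rho> \<Longrightarrow> Y x = 0" "\<bar>h\<bar> \<le> k" "x \<notin> square p (\<rho> + k)"
  shows "diffq h Y x = 0"
proof -
  have k: "0 \<le> k" using assms(2) by linarith
  have "x \<notin> square p \<rho>" using assms(3) k square_mono[of \<rho> "\<rho> + k" p] by auto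
  moreover have "x + h *\<^sub>R axis 2 1 \<notin> square p \<rho>"
    using square_translate[of "x + h *\<^sub>R axis 2 1" p \<rho> "-h" k] assms(2,3) by auto
  ultimately show ?thesis using assms(1) by (simp add: diffq_def)
qed

lemma l2norm_diffq_minus_le:
  assumes "smooth Y" "compact S" "\<And>x. x \<notin> S \<Longrightarrow> Y x = 0" "0 < h"
  shows "L2n (diffq (- h) Y) \<le> L2n (partial 2 Y)"
proof -
  have "diffq (- h) Y x = diffq h Y (x + (- h) *\<^sub>R axis 2 1)" for x
    using assms(4) by (simp add: diffq_def divide_simps)
  then have "diffq (- h) Y = (\<lambda>x. diffq h Y (x + (- h) *\<^sub>R axis 2 1))" by blast
  moreover have "diffq h Y \<in> borel_measurable borel"
    using smooth_cont[OF smooth_diffq[OF assms(1)]] by (rule borel_measurable_continuous_onI)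
  ultimately have "L2n (diffq (- h) Y) = L2n (diffq h Y)"
    using l2norm_translate[of "diffq h Y" "(- h) *\<^sub>R axis 2 1"] by simp
  then show ?thesis
    using l2norm_diffq_le[OF assms, of UNIV UNIV] by simp
qed

section \<open>Smooth functions of compact support\<close>

text \<open>Unlike \<open>test_fun\<close>, no domain is prescribed: translates and difference
  quotients of test functions need not vanish outside the domain.\<close>

definition smooth_cs :: "(real ^ 2 \<Rightarrow> real) \<Rightarrow> bool" where
  "smooth_cs f \<longleftrightarrow> smooth f \<and> (\<exists>S. compact S \<and> (\<forall>x. x \<notin> S \<longrightarrow> f x = 0))"

lemma csmI: "smooth f \<Longrightarrow> compact S \<Longrightarrow> (\<And>x. x \<notin> S \<Longrightarrow> f x = 0) \<Longrightarrow> smooth_cs f"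
  by (auto simp: smooth_cs_def)

lemma smooth_cs_smooth: "smooth_cs f \<Longrightarrow> smooth f"
  by (simp add: smooth_cs_def)

lemma csmE:
  assumes "smooth_cs f" obtains S where "compact S" "\<And>x. x \<notin> S \<Longrightarrow> f x = 0"
  using assms unfolding smooth_cs_def by blast

lemma smooth_cs_translate: "smooth_cs f \<Longrightarrow> smooth_cs (\<lambda>x. f (x + c))"
proof -
  assume f: "smooth_cs f"
  obtain S where S: "compact S" "\<And>x. x \<notin> S \<Longrightarrow> f x = 0" using csmE[OF f] by blast
  show ?thesis
  proof (rule csmI)
    show "smooth (\<lambda>x. f (x + c))" using f by (intro smooth_translate smooth_cs_smooth)
    show "compact ((\<lambda>x. x - c) ` S)" using S(1) by (intro compact_continuous_image continuous_intros)
    show "f (x + c) = 0" if "x \<notin> (\<lambda>x. x - c) ` S" for x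
      using that by (intro S(2)) (metis add_diff_cancel image_eqI)
  qed
qed

lemma smooth_cs_add: "smooth_cs f \<Longrightarrow> smooth_cs g \<Longrightarrow> smooth_cs (\<lambda>x. f x + g x)"
proof -
  assume f: "smooth_cs f" "smooth_cs g"
  obtain S where S: "compact S" "\<And>x. x \<notin> S \<Longrightarrow> f x = 0" using csmE[OF f(1)] by blast
  obtain T where T: "compact T" "\<And>x. x \<notin> T \<Longrightarrow> g x = 0" using csmE[OF f(2)] by blast
  show ?thesis
    by (rule csmI[of _ "S \<union> T"]) (use f S T in \<open>auto intro: smooth_add smooth_cs_smooth\<close>)
qed

lemma smooth_cs_mult: "smooth f \<Longrightarrow> smooth_cs g \<Longrightarrow> smooth_cs (\<lambda>x. f x * g x)"
proof -
  assume f: "smooth f" "smooth_cs g"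
  obtain T where T: "compact T" "\<And>x. x \<notin> T \<Longrightarrow> g x = 0" using csmE[OF f(2)] by blast
  show ?thesis
    by (rule csmI[of _ T]) (use f T in \<open>auto intro: smooth_mult smooth_cs_smooth\<close>)
qed

lemma smooth_cs_cmult: "smooth_cs g \<Longrightarrow> smooth_cs (\<lambda>x. c * g x)"
  by (rule smooth_cs_mult[OF smooth_const])

lemma smooth_cs_diffq: "smooth_cs f \<Longrightarrow> smooth_cs (diffq h f)"
  unfolding diffq_alt by (intro smooth_cs_add smooth_cs_cmult smooth_cs_translate)

lemma smooth_cs_partial: "smooth_cs f \<Longrightarrow> smooth_cs (partial j f)"
proof -
  assume f: "smooth_cs f"
  obtain S where S: "compact S" "\<And>x. x \<notin> S \<Longrightarrow> f x = 0" using csmE[OF f] by blast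
  show ?thesis
    using partial_outside[of S f _ j] S f
    by (intro csmI[of _ S]) (auto intro: smooth_partial smooth_cs_smooth compact_imp_closed)
qed

lemma smooth_cs_sq_int: "smooth_cs f \<Longrightarrow> sq_int lebesgue f"
  by (metis csmE smooth_cs_smooth cc_sq_int smooth_cont)

lemma smooth_cs_integrable: "smooth_cs f \<Longrightarrow> integrable lebesgue f"
  by (metis csmE smooth_cs_smooth cc_integrable(2) smooth_cont)

lemma smooth_cs_grad_sq_int: "smooth_cs f \<Longrightarrow> sq_int lebesgue (grad f)"
proof -
  assume f: "smooth_cs f"
  obtain S where S: "compact S" "\<And>x. x \<notin> S \<Longrightarrow> f x = 0" using csmE[OF f] by blast
  show ?thesis
    using grad_outside[of S f] S f
    by (intro cc_sq_int[of _ S]) (auto intro: grad_cont smooth_cs_smooth compact_imp_closed)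
qed

lemma smooth_cs_grad_borel: "smooth_cs f \<Longrightarrow> grad f \<in> borel_measurable borel"
  by (intro borel_measurable_continuous_onI grad_cont smooth_cs_smooth)
lemma smooth_cs_borel: "smooth_cs f \<Longrightarrow> f \<in> borel_measurable borel"
  by (intro borel_measurable_continuous_onI smooth_cont smooth_cs_smooth)

lemma grad_translate: "grad (\<lambda>x. f (x + c)) = (\<lambda>x. grad f (x + c))"
  by (rule ext) (simp add: grad_def partial_translate)

lemma borel_lebesgue: "f \<in> borel_measurable borel \<Longrightarrow> f \<in> borel_measurable (lebesgue :: (real ^ 2) measure)"
  by (simp add: measurable_completion)

text \<open>The factor \<open>2 / h\<close> is crude, but it multiplies only the approximation
  error, which is sent to 0 while \<open>h\<close> is fixed.\<close>

lemma l2norm_grad_diffq_le: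
  assumes "smooth_cs f" "0 < h"
  shows "L2n (grad (diffq (- h) f)) \<le> 2 / h * L2n (grad f)"
proof -
  let ?T = "\<lambda>x. grad f (x + (- h) *\<^sub>R axis 2 1)"
  have 1: "sq_int lebesgue (grad f)" "sq_int lebesgue ?T"
    using smooth_cs_grad_sq_int[OF assms(1)] smooth_cs_grad_sq_int[OF smooth_cs_translate[OF assms(1)], of "(- h) *\<^sub>R axis 2 1"]
    unfolding grad_translate by blast+
  have "grad (diffq (- h) f) = (\<lambda>x. (1 / (- h)) *\<^sub>R (?T x - grad f x))"
    using grad_diffq[OF smooth_cs_smooth[OF assms(1)]] by blast
  then have "L2n (grad (diffq (- h) f)) = 1 / h * L2n (\<lambda>x. ?T x - grad f x)"
    using assms(2) by (simp only: l2norm_scaleR) simp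
  also have "\<dots> \<le> 1 / h * (L2n ?T + L2n (grad f))"
    using assms(2) l2norm_triangle_diff[OF 1(2,1)] by (intro mult_left_mono) auto
  also have "L2n ?T = L2n (grad f)"
    by (rule l2norm_translate[OF smooth_cs_grad_borel[OF assms(1)]])
  finally show ?thesis by simp
qed

section \<open>The Caccioppoli inequality for difference quotients\<close>

text \<open>The geometry of the layers enters the regularity estimates only through
  \<open>a_inv\<close>. No continuity in the first variable is assumed, so the constants cannot
  depend on the frequency of the oscillation.\<close>

locale coefficient =
  fixes \<alpha> \<beta> :: real and a :: "real ^ 2 \<Rightarrow> real"
  assumes alpha: "0 < \<alpha>" and a_ge: "\<And>x. \<alpha> \<le> a x" and a_le: "\<And>x. a x \<le> \<beta>"
    and a_meas [measurable]: "a \<in> borel_measurable borel"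
    and a_inv: "\<And>x s. a (x + s *\<^sub>R axis 2 1) = a x"
begin

lemma beta: "0 < \<beta>" "\<alpha> \<le> \<beta>"
  using alpha a_ge[of 0] a_le[of 0] by auto

lemma a_abs: "\<bar>a x\<bar> \<le> \<beta>"
  using a_ge[of x] a_le[of x] alpha by auto

lemma int_a:
  assumes "sq_int lebesgue v" "sq_int lebesgue w"
  shows "integrable lebesgue (\<lambda>x. a x * (v x \<bullet> w x))"
  using sq_int_inner[OF sq_int_mult(1)[OF assms(1) borel_lebesgue[OF a_meas] a_abs] assms(2)] by simp

lemma CS_a:
  assumes "sq_int lebesgue v" "sq_int lebesgue w"
  shows "\<bar>\<integral>x. a x * (v x \<bullet> w x) \<partial>lebesgue\<bar> \<le> \<beta> * L2n v * L2n w"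
proof -
  note m = sq_int_mult[OF assms(1) borel_lebesgue[OF a_meas] a_abs]
  have "\<bar>\<integral>x. a x * (v x \<bullet> w x) \<partial>lebesgue\<bar> \<le> L2n (\<lambda>x. a x *\<^sub>R v x) * L2n w"
    using Cauchy_Schwarz_l2norm[OF m(1) assms(2)] by simp
  also have "\<dots> \<le> \<beta> * L2n v * L2n w"
    by (rule mult_right_mono[OF m(2)]) simp
  finally show ?thesis .
qed

text \<open>Translating the integral by \<open>h\<close> moves the shift from the gradient of
  \<open>Y\<close> to that of \<open>w\<close>; the coefficient is passed without change because of
  \<open>a_inv\<close>.\<close>

lemma summation_by_parts:
  assumes w: "smooth_cs w" and Y: "smooth_cs Y" and h: "0 < h"
  shows "(\<integral>x. a x * (grad w x \<bullet> grad (diffq (- h) Y) x) \<partial>lebesgue)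
    = - (\<integral>x. a x * (grad (diffq h w) x \<bullet> grad Y x) \<partial>lebesgue)"
proof -
  let ?e = "axis 2 1 :: real ^ 2"
  have [measurable]: "grad w \<in> borel_measurable borel" "grad Y \<in> borel_measurable borel"
    using w Y smooth_cs_grad_borel by auto
  have sq: "sq_int lebesgue (grad w)" "sq_int lebesgue (grad Y)" "sq_int lebesgue (\<lambda>x. grad Y (x + c))"
    "sq_int lebesgue (\<lambda>x. grad w (x + c))" for c
    using smooth_cs_grad_sq_int w Y smooth_cs_grad_sq_int[OF smooth_cs_translate[OF w]] smooth_cs_grad_sq_int[OF smooth_cs_translate[OF Y]]
    by (auto simp: grad_translate)
  have "(\<integral>x. a x * (grad w x \<bullet> grad Y (x + (- h) *\<^sub>R ?e)) \<partial>lebesgue)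
    = (\<integral>x. a (x + h *\<^sub>R ?e) * (grad w (x + h *\<^sub>R ?e) \<bullet> grad Y (x + h *\<^sub>R ?e + (- h) *\<^sub>R ?e)) \<partial>lebesgue)"
    by (rule lebesgue_integral_translate[symmetric]) measurable
  also have "\<dots> = (\<integral>x. a x * (grad w (x + h *\<^sub>R ?e) \<bullet> grad Y x) \<partial>lebesgue)"
    by (simp add: a_inv)
  finally have tr: "(\<integral>x. a x * (grad w x \<bullet> grad Y (x + (- h) *\<^sub>R ?e)) \<partial>lebesgue)
    = (\<integral>x. a x * (grad w (x + h *\<^sub>R ?e) \<bullet> grad Y x) \<partial>lebesgue)" .
  have "(\<integral>x. a x * (grad w x \<bullet> grad (diffq (- h) Y) x) \<partial>lebesgue)
    = (\<integral>x. (a x * (grad w x \<bullet> grad Y (x + (- h) *\<^sub>R ?e)) - a x * (grad w x \<bullet> grad Y x)) / (- h) \<partial>lebesgue)"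
    by (rule Bochner_Integration.integral_cong)
       (auto simp: grad_diffq[OF smooth_cs_smooth[OF Y]] algebra_simps inner_diff_right diff_divide_distrib add_divide_distrib)
  also have "\<dots> = ((\<integral>x. a x * (grad w x \<bullet> grad Y (x + (- h) *\<^sub>R ?e)) \<partial>lebesgue)
      - (\<integral>x. a x * (grad w x \<bullet> grad Y x) \<partial>lebesgue)) / (- h)"
    by (simp only: integral_divide_zero Bochner_Integration.integral_diff[OF int_a[OF sq(1) sq(3)] int_a[OF sq(1) sq(2)]])
  also have "\<dots> = - (((\<integral>x. a x * (grad w (x + h *\<^sub>R ?e) \<bullet> grad Y x) \<partial>lebesgue)
      - (\<integral>x. a x * (grad w x \<bullet> grad Y x) \<partial>lebesgue)) / h)"
    unfolding tr by simp
  also have "\<dots> = - (\<integral>x. (a x * (grad w (x + h *\<^sub>R ?e) \<bullet> grad Y x) - a x * (grad w x \<bullet> grad Y x)) / h \<partial>lebesgue)"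
    by (simp only: integral_divide_zero Bochner_Integration.integral_diff[OF int_a[OF sq(4) sq(2)] int_a[OF sq(1) sq(2)]])
  also have "(\<integral>x. (a x * (grad w (x + h *\<^sub>R ?e) \<bullet> grad Y x) - a x * (grad w x \<bullet> grad Y x)) / h \<partial>lebesgue)
    = (\<integral>x. a x * (grad (diffq h w) x \<bullet> grad Y x) \<partial>lebesgue)"
    by (rule Bochner_Integration.integral_cong)
       (auto simp: grad_diffq[OF smooth_cs_smooth[OF w]] algebra_simps inner_diff_left diff_divide_distrib)
  finally show ?thesis .
qed

end

text \<open>Unless \<open>X\<close> is already at most \<open>N + Z\<close>, it dominates both
  \<open>N\<close> and \<open>Z\<close>. Then every term on the right of the quadratic inequality is
  at most a constant times \<open>X * (N + Z)\<close>, and one factor \<open>X\<close>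
  cancels.\<close>

lemma quadratic_bound:
  fixes X Z N \<alpha> \<beta> L :: real
  assumes "0 < \<alpha>" "0 \<le> \<beta>" "0 \<le> L" "0 \<le> X" "0 \<le> Z" "0 \<le> N"
    and q: "\<alpha> * X\<^sup>2 \<le> 4 * \<beta> * L * X * Z + N * (X + (1 + 4 * L) * Z)"
  shows "X \<le> (1 + (4 * \<beta> * L + 2 + 4 * L) / \<alpha>) * (N + Z)"
proof (cases "X \<le> N + Z")
  case True
  have "0 \<le> (4 * \<beta> * L + 2 + 4 * L) / \<alpha> * (N + Z)" using assms by auto
  then show ?thesis using True by (simp add: algebra_simps)
next
  case False
  let ?W = "N + Z"
  have X: "0 < X" "Z \<le> X" using False assms by auto
  have "4 * \<beta> * L * X * Z \<le> 4 * \<beta> * L * X * ?W"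
    using assms by (intro mult_left_mono) auto
  moreover have "N * X \<le> X * ?W"
    using assms by (simp add: algebra_simps)
  moreover have "N * ((1 + 4 * L) * Z) \<le> ?W * ((1 + 4 * L) * X)"
    using assms X by (intro mult_mono) auto
  \<comment> \<open>The three contributions are \<open>4 * \<beta> * L\<close>, \<open>1\<close> and
    \<open>1 + 4 * L\<close>, which add up to the numerator of the constant.\<close>
  ultimately have "\<alpha> * X\<^sup>2 \<le> X * ((4 * \<beta> * L + 2 + 4 * L) * ?W)"
    using q by (simp add: algebra_simps)
  then have "X * (\<alpha> * X) \<le> X * ((4 * \<beta> * L + 2 + 4 * L) * ?W)"
    by (simp add: power2_eq_square algebra_simps)
  then have "\<alpha> * X \<le> (4 * \<beta> * L + 2 + 4 * L) * ?W"
    using X(1) by (rule mult_left_le_imp_le)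
  then have "X \<le> (4 * \<beta> * L + 2 + 4 * L) * ?W / \<alpha>"
    using assms(1) by (simp add: pos_le_divide_eq mult.commute)
  also have "\<dots> \<le> (1 + (4 * \<beta> * L + 2 + 4 * L) / \<alpha>) * ?W"
    using assms by (simp add: algebra_simps)
  finally show ?thesis .
qed

text \<open>Depends on the ellipticity constants and the slope of the cut-off only; this is what
  makes the estimates uniform in the frequency and in the centre of the square.\<close>

definition cacc_const :: "real \<Rightarrow> real \<Rightarrow> real \<Rightarrow> real" where
  "cacc_const \<alpha> \<beta> L = 1 + (4 * \<beta> * L + 2 + 4 * L) / \<alpha>"

context coefficient
begin

text \<open>The test function is \<open>D\<^sub>-\<^sub>h (\<eta>\<^sup>2 D\<^sub>h w)\<close>. The smooth function \<open>w\<close> solves the equation only up to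
  the error \<open>e\<close>, because the elements of \<open>H\<^sup>1\<^sub>0\<close> are replaced by the test functions approximating them.\<close>

lemma caccioppoli:
  assumes w: "smooth_cs w" and h: "0 < h" and L: "0 \<le> L" and M: "0 \<le> M" and e: "0 \<le> e" and \<rho>: "0 \<le> \<rho>"
    and \<eta>: "smooth \<eta>" "\<And>x. 0 \<le> \<eta> x \<and> \<eta> x \<le> 1" "\<And>x. x \<notin> square p \<rho> \<Longrightarrow> \<eta> x = 0"
      "\<And>j x. \<bar>partial j \<eta> x\<bar> \<le> L"
    and eq: "\<And>\<phi>. smooth \<phi> \<Longrightarrow> (\<And>x. x \<notin> square p (\<rho> + h) \<Longrightarrow> \<phi> x = 0) \<Longrightarrow>
      \<bar>(\<integral>x. a x * (grad w x \<bullet> grad \<phi> x) \<partial>lebesgue) - F \<phi>\<bar> \<le> e * L2n (grad \<phi>)"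
    and F: "\<And>Y. smooth Y \<Longrightarrow> (\<And>x. x \<notin> square p \<rho> \<Longrightarrow> Y x = 0) \<Longrightarrow>
      \<bar>F (diffq (- h) Y)\<bar> \<le> M * (L2n Y + L2n (partial 2 Y))"
  shows "L2n (\<lambda>x. \<eta> x *\<^sub>R grad (diffq h w) x)
    \<le> cacc_const \<alpha> \<beta> L * (M + 2 * e / h + L2n (\<lambda>x. indicator (square p (\<rho> + h)) x *\<^sub>R partial 2 w x))"
proof -
  define D where "D = diffq h w"
  define Y where "Y x = (\<eta> x * \<eta> x) * D x" for x
  define V where "V x = \<eta> x *\<^sub>R grad D x" for x
  define W where "W x = D x *\<^sub>R grad \<eta> x" for x
  define I where "I x = indicator (square p \<rho>) x *\<^sub>R D x" for x
  define X where "X = L2n V"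
  define Z where "Z = L2n I"
  note ms = borel_lebesgue[OF borel_measurable_continuous_onI]
  have csD: "smooth_cs D" unfolding D_def by (rule smooth_cs_diffq[OF w])
  have csY: "smooth_cs Y" unfolding Y_def[abs_def] by (rule smooth_cs_mult[OF smooth_mult[OF \<eta>(1,1)] csD])
  have Y0: "Y x = 0" if "x \<notin> square p \<rho>" for x using \<eta>(3)[OF that] by (simp add: Y_def)
  have sD: "sq_int lebesgue D" "sq_int lebesgue (grad D)" using csD smooth_cs_sq_int smooth_cs_grad_sq_int by auto
  have sV: "sq_int lebesgue V"
    unfolding V_def by (rule sq_int_mult(1)[OF sD(2) ms[OF smooth_cont[OF \<eta>(1)]], of 1]) (use \<eta>(2) in auto)
  have sI: "sq_int lebesgue I"
    unfolding I_def by (rule sq_int_indicator[OF sD(1) sets_lebesgue_borel]) measurable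
  have gL: "norm (grad \<eta> x) \<le> 2 * L" for x
    using norm_le_l1_cart[of "grad \<eta> x"] \<eta>(4)[of 1 x] \<eta>(4)[of 2 x] by (simp add: sum_2 grad_nth)
  have WI: "norm (W x) \<le> (2 * L) * norm (I x)" for x
  proof (cases "x \<in> square p \<rho>")
    case True
    then show ?thesis using mult_right_mono[OF gL[of x], of "\<bar>D x\<bar>"] by (simp add: W_def I_def mult.commute)
  next
    case False
    then have "grad \<eta> x = 0" using grad_outside[OF closed_square \<eta>(3) False] by simp
    then show ?thesis using L by (simp add: W_def)
  qed
  have sW: "sq_int lebesgue W"
  proof (rule sq_int_bound[OF sI _ WI])
    have "continuous_on UNIV W"
      unfolding W_def[abs_def]
      by (intro continuous_on_scaleR grad_cont smooth_cont \<eta>(1) smooth_cs_smooth csD)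
    then show "W \<in> borel_measurable lebesgue" by (rule ms)
  qed
  have lW: "L2n W \<le> 2 * L * Z"
    unfolding Z_def by (rule l2norm_mono[OF sI sW _ WI]) (use L in auto)
  have X0: "0 \<le> X" "0 \<le> Z" by (auto simp: X_def Z_def)
  have gY: "grad Y x = \<eta> x *\<^sub>R (V x + 2 *\<^sub>R W x)" for x
  proof -
    have "grad Y x = D x *\<^sub>R (\<eta> x *\<^sub>R grad \<eta> x + \<eta> x *\<^sub>R grad \<eta> x) + (\<eta> x * \<eta> x) *\<^sub>R grad D x"
      unfolding Y_def[abs_def] grad_mult[OF smooth_mult[OF \<eta>(1,1)] smooth_cs_smooth[OF csD]] grad_mult[OF \<eta>(1,1)] ..
    then show ?thesis
      unfolding V_def W_def by (simp add: vec_eq_iff algebra_simps)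
  qed
  have lgY: "L2n (grad Y) \<le> X + 4 * L * Z"
  proof -
    have s2: "sq_int lebesgue (\<lambda>x. V x + 2 *\<^sub>R W x)" by (intro sq_int_add sq_int_scaleR sV sW)
    have "L2n (grad Y) = L2n (\<lambda>x. \<eta> x *\<^sub>R (V x + 2 *\<^sub>R W x))"
      by (simp add: gY[abs_def])
    also have "\<dots> \<le> 1 * L2n (\<lambda>x. V x + 2 *\<^sub>R W x)"
      by (rule sq_int_mult(2)[OF s2 ms[OF smooth_cont[OF \<eta>(1)]]]) (use \<eta>(2) in auto)
    also have "\<dots> \<le> X + 2 * L2n W"
      using l2norm_triangle[OF sV sq_int_scaleR[OF sW, of 2]] by (simp add: l2norm_scaleR X_def)
    finally show ?thesis using lW by simp
  qed
  have lpY: "L2n (partial 2 Y) \<le> X + 4 * L * Z"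
    using sq_int_nth(2)[OF smooth_cs_grad_sq_int[OF csY], of 2] lgY by (simp add: grad_nth)
  have lY: "L2n Y \<le> Z"
  proof -
    have "norm (Y x) \<le> 1 * norm (I x)" for x
    proof (cases "x \<in> square p \<rho>")
      case True
      have "\<bar>\<eta> x * \<eta> x\<bar> \<le> 1" using \<eta>(2)[of x] by (simp add: abs_mult mult_le_one)
      then show ?thesis using True mult_right_mono[of _ 1 "\<bar>D x\<bar>"] by (simp add: Y_def I_def abs_mult)
    qed (simp add: Y0)
    from l2norm_mono[OF sI smooth_cs_sq_int[OF csY] _ this] show ?thesis by (simp add: Z_def)
  qed
  have csC: "smooth_cs (diffq (- h) Y)" by (rule smooth_cs_diffq[OF csY])
  have E: "\<bar>(\<integral>x. a x * (grad w x \<bullet> grad (diffq (- h) Y) x) \<partial>lebesgue) - F (diffq (- h) Y)\<bar>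
      \<le> e * L2n (grad (diffq (- h) Y))"
  proof (rule eq)
    show "diffq (- h) Y x = 0" if "x \<notin> square p (\<rho> + h)" for x
      by (rule diffq_outside[OF Y0 _ that]) (use h in auto)
  qed (rule smooth_cs_smooth[OF csC])
  have FY: "\<bar>F (diffq (- h) Y)\<bar> \<le> M * (L2n Y + L2n (partial 2 Y))"
    by (rule F[OF smooth_cs_smooth[OF csY] Y0])
  have "\<alpha> * X\<^sup>2 = (\<integral>x. \<alpha> * (norm (V x))\<^sup>2 \<partial>lebesgue)"
    by (simp add: X_def l2norm_sq)
  also have "\<dots> \<le> (\<integral>x. a x * (V x \<bullet> V x) \<partial>lebesgue)"
  proof (rule integral_mono)
    show "integrable lebesgue (\<lambda>x. \<alpha> * (norm (V x))\<^sup>2)" using sV by (auto simp: sq_int_def)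
    show "integrable lebesgue (\<lambda>x. a x * (V x \<bullet> V x))" by (rule int_a[OF sV sV])
    show "\<alpha> * (norm (V x))\<^sup>2 \<le> a x * (V x \<bullet> V x)" for x
      using a_ge[of x] by (simp add: power2_norm_eq_inner mult_right_mono)
  qed
  \<comment> \<open>The factor \<open>\<eta>\<close> in \<open>gY\<close> turns
    \<open>grad D\<close> into \<open>V\<close>, so \<open>grad D\<close> inner
    \<open>grad Y\<close> is \<open>V\<close> inner \<open>V + 2 W\<close>.\<close>
  also have "\<dots> = (\<integral>x. a x * (grad D x \<bullet> grad Y x) - 2 * (a x * (V x \<bullet> W x)) \<partial>lebesgue)"
    by (rule Bochner_Integration.integral_cong)
       (auto simp: gY V_def inner_add_right algebra_simps)
  also have "\<dots> = (\<integral>x. a x * (grad D x \<bullet> grad Y x) \<partial>lebesgue) - 2 * (\<integral>x. a x * (V x \<bullet> W x) \<partial>lebesgue)"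
    using int_a[OF sD(2) smooth_cs_grad_sq_int[OF csY]] int_a[OF sV sW] by simp
  finally have main: "\<alpha> * X\<^sup>2 \<le> (\<integral>x. a x * (grad D x \<bullet> grad Y x) \<partial>lebesgue) - 2 * (\<integral>x. a x * (V x \<bullet> W x) \<partial>lebesgue)" .
  have s1: "(\<integral>x. a x * (grad D x \<bullet> grad Y x) \<partial>lebesgue) = - (\<integral>x. a x * (grad w x \<bullet> grad (diffq (- h) Y) x) \<partial>lebesgue)"
    unfolding summation_by_parts[OF w csY h] D_def by simp
  have s2: "- (\<integral>x. a x * (grad w x \<bullet> grad (diffq (- h) Y) x) \<partial>lebesgue)
      \<le> \<bar>F (diffq (- h) Y)\<bar> + e * L2n (grad (diffq (- h) Y))"
    using E by linarith
  \<comment> \<open>The functional may be controlled by \<open>Y\<close> or by its tangential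
    derivative: the first application of the inequality produces the former, the second the
    latter.\<close>
  have s3: "\<bar>F (diffq (- h) Y)\<bar> \<le> M * (Z + (X + 4 * L * Z))"
    using FY mult_left_mono[OF add_mono[OF lY lpY] M] by linarith
  have s4: "e * L2n (grad (diffq (- h) Y)) \<le> e * (2 / h * (X + 4 * L * Z))"
  proof (rule mult_left_mono[OF _ e])
    show "L2n (grad (diffq (- h) Y)) \<le> 2 / h * (X + 4 * L * Z)"
      using l2norm_grad_diffq_le[OF csY h] mult_left_mono[OF lgY, of "2 / h"] h by simp
  qed
  have s5: "- 2 * (\<integral>x. a x * (V x \<bullet> W x) \<partial>lebesgue) \<le> 2 * (\<beta> * X * (2 * L * Z))"
  proof -
    have "\<beta> * X * L2n W \<le> \<beta> * X * (2 * L * Z)"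
      using lW X0 beta(1) by (intro mult_left_mono) auto
    then show ?thesis using CS_a[OF sV sW] unfolding X_def[symmetric] by linarith
  qed
  have q0: "\<alpha> * X\<^sup>2 \<le> M * (Z + (X + 4 * L * Z)) + e * (2 / h * (X + 4 * L * Z)) + 2 * (\<beta> * X * (2 * L * Z))"
    using main s1 s2 s3 s4 s5 by linarith
  \<comment> \<open>The approximation error, amplified by the gradient of a difference quotient,
    acts like an additional datum of size \<open>2 * e / h\<close>.\<close>
  let ?N = "M + 2 * e / h"
  have N: "0 \<le> ?N" "0 \<le> 2 * e / h" using M e h by auto
  have "e * (2 / h * (X + 4 * L * Z)) = 2 * e / h * (X + 4 * L * Z)" by simp
  also have "\<dots> \<le> 2 * e / h * (X + (1 + 4 * L) * Z)"
    using N X0 by (intro mult_left_mono) (auto simp: algebra_simps)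
  finally have "\<alpha> * X\<^sup>2 \<le> 4 * \<beta> * L * X * Z + ?N * (X + (1 + 4 * L) * Z)"
    using q0 by (simp add: algebra_simps)
  from quadratic_bound[OF alpha _ L X0 N(1) this] beta(1)
  have "X \<le> cacc_const \<alpha> \<beta> L * (?N + Z)" by (simp add: cacc_const_def)
  also have "\<dots> \<le> cacc_const \<alpha> \<beta> L * (?N + L2n (\<lambda>x. indicator (square p (\<rho> + h)) x *\<^sub>R partial 2 w x))"
  proof (rule mult_left_mono)
    obtain S where S: "compact S" "\<And>x. x \<notin> S \<Longrightarrow> w x = 0" using csmE[OF w] by blast
    have "Z \<le> L2n (\<lambda>x. indicator (square p (\<rho> + h)) x *\<^sub>R partial 2 w x)"
      unfolding Z_def I_def D_def
      by (rule l2norm_diffq_le[OF smooth_cs_smooth[OF w] S h]) (auto intro: square_translate)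
    then show "?N + Z \<le> ?N + L2n (\<lambda>x. indicator (square p (\<rho> + h)) x *\<^sub>R partial 2 w x)" by simp
    show "0 \<le> cacc_const \<alpha> \<beta> L"
      using alpha beta(1) L by (simp add: cacc_const_def)
  qed
  finally show ?thesis unfolding X_def V_def[abs_def] D_def .
qed

end

text \<open>These integrals are the difference quotients at 0, taken from the left, of the integral
  of \<open>G\<close> against translates of \<open>Y\<close>. Differentiability of that function
  lets a bound uniform in the step pass to the derivative.\<close>

lemma diffq_limit_bound:
  assumes G: "integrable lebesgue G" and Y: "smooth_cs Y" and r: "0 < r"
    and K: "\<And>h. 0 < h \<Longrightarrow> h \<le> r \<Longrightarrow> \<bar>\<integral>x. G x * diffq (- h) Y x \<partial>lebesgue\<bar> \<le> K"
  shows "\<bar>\<integral>x. G x * partial 2 Y x \<partial>lebesgue\<bar> \<le> K"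
proof -
  obtain S where S: "compact S" "\<And>x. x \<notin> S \<Longrightarrow> Y x = 0" using csmE[OF Y] by blast
  define F where "F t = (\<integral>x. G x * Y (x + t *\<^sub>R axis 2 1) \<partial>lebesgue)" for t
  have int: "integrable lebesgue (\<lambda>x. G x * Y (x + v))" for v
  proof -
    obtain B where B: "0 \<le> B" "\<And>x. norm (Y x) \<le> B"
      using cc_bounded[OF smooth_cont[OF smooth_cs_smooth[OF Y]] S] by blast
    have [measurable]: "G \<in> borel_measurable lebesgue" "(\<lambda>x. Y (x + v)) \<in> borel_measurable lebesgue"
      using G borel_lebesgue[OF smooth_cs_borel[OF smooth_cs_translate[OF Y]]] by auto
    show ?thesis
      by (rule Bochner_Integration.integrable_bound[where f = "\<lambda>x. B * G x"])
         (use G B in \<open>auto simp: abs_mult mult.commute[of "\<bar>G _\<bar>"] intro!: mult_right_mono\<close>)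
  qed
  have "(F has_real_derivative (\<integral>x. G x * partial 2 Y (x + 0 *\<^sub>R axis 2 1) \<partial>lebesgue)) (at 0)"
    unfolding F_def by (rule DERIV_integral_translate[OF G smooth_cs_smooth[OF Y] S])
  then have lim: "((\<lambda>h. (F (0 + h) - F 0) / h) \<longlongrightarrow> (\<integral>x. G x * partial 2 Y x \<partial>lebesgue)) (at_left 0)"
    by (simp add: DERIV_def filterlim_at_split)
  have q: "(F (0 + - h) - F 0) / (- h) = (\<integral>x. G x * diffq (- h) Y x \<partial>lebesgue)" for h
  proof -
    have "(\<integral>x. G x * diffq (- h) Y x \<partial>lebesgue) = (\<integral>x. (G x * Y (x + (- h) *\<^sub>R axis 2 1) - G x * Y (x + 0 *\<^sub>R axis 2 1)) / (- h) \<partial>lebesgue)"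
      by (rule Bochner_Integration.integral_cong) (simp_all add: diffq_def right_diff_distrib)
    then show ?thesis
      unfolding F_def by (simp only: integral_divide_zero Bochner_Integration.integral_diff[OF int int] add_0)
  qed
  have "\<forall>\<^sub>F h in at_left 0. - r < h \<and> h < (0::real)"
    using r by (intro eventually_at_leftI[of "-r"]) auto
  then have "\<forall>\<^sub>F h in at_left 0. \<bar>(F (0 + h) - F 0) / h\<bar> \<le> K"
  proof eventually_elim
    case (elim h)
    then show ?case using q[of "- h"] K[of "- h"] by simp
  qed
  then show ?thesis
    by (intro tendsto_upperbound[OF tendsto_rabs[OF lim]]) auto
qed

text \<open>Cut-offs are built at the origin and translated afterwards, so that one slope
  \<open>L\<close> serves all centres.\<close>

definition cutoff :: "real \<Rightarrow> real \<Rightarrow> (real ^ 2 \<Rightarrow> real) \<Rightarrow> real \<Rightarrow> bool" where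
  "cutoff \<rho> \<rho>' \<eta> L \<longleftrightarrow> smooth \<eta> \<and> 0 \<le> L \<and> (\<forall>x. 0 \<le> \<eta> x \<and> \<eta> x \<le> 1) \<and> (\<forall>x\<in>square 0 \<rho>. \<eta> x = 1)
    \<and> (\<forall>x. x \<notin> square 0 \<rho>' \<longrightarrow> \<eta> x = 0) \<and> (\<forall>j x. \<bar>partial j \<eta> x\<bar> \<le> L)"

lemma cutoff_ex: "0 < \<rho> \<Longrightarrow> \<rho> < \<rho>' \<Longrightarrow> \<exists>\<eta> L. cutoff \<rho> \<rho>' \<eta> L"
  unfolding cutoff_def by (rule cutoff_exists[of \<rho> \<rho>']) blast+

lemma cutoff_translate:
  fixes p :: "real ^ 2"
  assumes "cutoff \<rho> \<rho>' \<eta> L"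
  shows "smooth (\<lambda>x. \<eta> (x + - p))" "0 \<le> \<eta> (x + - p) \<and> \<eta> (x + - p) \<le> 1"
    "x \<in> square p \<rho> \<Longrightarrow> \<eta> (x + - p) = 1" "x \<notin> square p \<rho>' \<Longrightarrow> \<eta> (x + - p) = 0"
    "\<bar>partial j (\<lambda>x. \<eta> (x + - p)) x\<bar> \<le> L"
proof -
  have s: "x + - p \<in> square 0 s \<longleftrightarrow> x \<in> square p s" for x s by (auto simp: square_def)
  show "smooth (\<lambda>x. \<eta> (x + - p))" using assms by (intro smooth_translate) (simp add: cutoff_def)
  show "\<bar>partial j (\<lambda>x. \<eta> (x + - p)) x\<bar> \<le> L"
    unfolding partial_translate using assms by (simp add: cutoff_def)
  show "0 \<le> \<eta> (x + - p) \<and> \<eta> (x + - p) \<le> 1"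
    using assms by (auto simp: cutoff_def)
  show "x \<in> square p \<rho> \<Longrightarrow> \<eta> (x + - p) = 1" "x \<notin> square p \<rho>' \<Longrightarrow> \<eta> (x + - p) = 0"
    using assms s[of x] unfolding cutoff_def by blast+
qed

lemma summation_by_parts_scalar:
  assumes u: "smooth_cs u" and Y: "smooth_cs Y" and h: "0 < h"
    and b: "b \<in> borel_measurable borel" "\<And>x. \<bar>b x\<bar> \<le> B" "\<And>x s. b (x + s *\<^sub>R axis 2 1) = b x"
  shows "(\<integral>x. b x * u x * diffq (- h) Y x \<partial>lebesgue) = - (\<integral>x. b x * diffq h u x * Y x \<partial>lebesgue)"
proof -
  let ?e = "axis 2 1 :: real ^ 2"
  note [measurable] = b(1) smooth_cs_borel[OF u] smooth_cs_borel[OF Y]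
  have int: "integrable lebesgue (\<lambda>x. b x * v x * w x)" if "smooth_cs v" "smooth_cs w" for v w
    using sq_int_inner[OF sq_int_mult(1)[OF smooth_cs_sq_int[OF that(1)] borel_lebesgue[OF b(1)] b(2)] smooth_cs_sq_int[OF that(2)]]
    by simp
  have tr: "(\<integral>x. b x * u x * Y (x + (- h) *\<^sub>R ?e) \<partial>lebesgue) = (\<integral>x. b x * u (x + h *\<^sub>R ?e) * Y x \<partial>lebesgue)"
  proof -
    have "(\<integral>x. b x * u x * Y (x + (- h) *\<^sub>R ?e) \<partial>lebesgue)
      = (\<integral>x. b (x + h *\<^sub>R ?e) * u (x + h *\<^sub>R ?e) * Y (x + h *\<^sub>R ?e + (- h) *\<^sub>R ?e) \<partial>lebesgue)"
      by (rule lebesgue_integral_translate[symmetric]) measurable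
    then show ?thesis by (simp add: b(3))
  qed
  have "(\<integral>x. b x * u x * diffq (- h) Y x \<partial>lebesgue)
    = (\<integral>x. (b x * u x * Y (x + (- h) *\<^sub>R ?e) - b x * u x * Y x) / (- h) \<partial>lebesgue)"
    by (rule Bochner_Integration.integral_cong) (simp_all add: diffq_def right_diff_distrib)
  also have "\<dots> = ((\<integral>x. b x * u (x + h *\<^sub>R ?e) * Y x \<partial>lebesgue) - (\<integral>x. b x * u x * Y x \<partial>lebesgue)) / (- h)"
    by (simp only: integral_divide_zero Bochner_Integration.integral_diff[OF int[OF u smooth_cs_translate[OF Y]] int[OF u Y]] tr)
  also have "\<dots> = - (\<integral>x. (b x * u (x + h *\<^sub>R ?e) * Y x - b x * u x * Y x) / h \<partial>lebesgue)"
    by (simp only: integral_divide_zero Bochner_Integration.integral_diff[OF int[OF smooth_cs_translate[OF u] Y] int[OF u Y]] minus_divide_right)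
  also have "(\<integral>x. (b x * u (x + h *\<^sub>R ?e) * Y x - b x * u x * Y x) / h \<partial>lebesgue) = (\<integral>x. b x * diffq h u x * Y x \<partial>lebesgue)"
    by (rule Bochner_Integration.integral_cong) (simp_all add: diffq_def algebra_simps diff_divide_distrib)
  finally show ?thesis .
qed

text \<open>The mean value theorem turns the quotient into the derivative of a translate of
  \<open>Y\<close> by less than \<open>h\<close>. The margin \<open>h\<close> around the support
  keeps this translate a test function, and the weak derivative of \<open>f\<close> can be
  used.\<close>

lemma weak_difference_bound:
  assumes f: "sq_int lebesgue f" "integrable lebesgue f" and f2: "sq_int lebesgue f2"
    and weak: "\<And>\<phi>. test_fun \<Omega> \<phi> \<Longrightarrow> (\<integral>x. f x * partial 2 \<phi> x \<partial>lebesgue) = - (\<integral>x. f2 x * \<phi> x \<partial>lebesgue)"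
    and Y: "smooth Y" "\<And>x. x \<notin> square p \<rho> \<Longrightarrow> Y x = 0" and h: "0 < h" and sub: "square p (\<rho> + h) \<subseteq> \<Omega>"
  shows "\<bar>\<integral>x. f x * diffq (- h) Y x \<partial>lebesgue\<bar> \<le> L2n f2 * L2n Y"
proof -
  let ?e = "axis 2 1 :: real ^ 2"
  have csY: "smooth_cs Y" by (rule csmI[OF Y(1) compact_square Y(2)])
  have int: "integrable lebesgue (\<lambda>x. f x * Y (x + v))" for v
    using sq_int_inner[OF f(1) smooth_cs_sq_int[OF smooth_cs_translate[OF csY]]] by simp
  obtain s where s: "- h < s" "s < 0"
    and eq: "(\<integral>x. f x * Y (x + 0 *\<^sub>R ?e) \<partial>lebesgue) - (\<integral>x. f x * Y (x + (- h) *\<^sub>R ?e) \<partial>lebesgue)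
      = (0 - - h) * (\<integral>x. f x * partial 2 Y (x + s *\<^sub>R ?e) \<partial>lebesgue)"
    using MVT_integral_translate[where a = "- h" and b = 0 and j = 2, OF f(2) Y(1) compact_square Y(2)] h by auto
  have "(\<integral>x. f x * diffq (- h) Y x \<partial>lebesgue)
    = (\<integral>x. (f x * Y (x + 0 *\<^sub>R ?e) - f x * Y (x + (- h) *\<^sub>R ?e)) / h \<partial>lebesgue)"
    by (rule Bochner_Integration.integral_cong) (simp_all add: diffq_def algebra_simps diff_divide_distrib)
  also have "\<dots> = (\<integral>x. f x * partial 2 Y (x + s *\<^sub>R ?e) \<partial>lebesgue)"
    using h by (simp only: integral_divide_zero Bochner_Integration.integral_diff[OF int int] eq) simp
  also have "\<dots> = (\<integral>x. f x * partial 2 (\<lambda>x. Y (x + s *\<^sub>R ?e)) x \<partial>lebesgue)"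
    by (simp only: partial_translate)
  also have "\<dots> = - (\<integral>x. f2 x * Y (x + s *\<^sub>R ?e) \<partial>lebesgue)"
  proof (rule weak, rule test_funI[OF smooth_translate[OF Y(1)] compact_square sub])
    show "Y (x + s *\<^sub>R ?e) = 0" if "x \<notin> square p (\<rho> + h)" for x
      using square_translate[of "x + s *\<^sub>R ?e" p \<rho> "- s" h] that s by (intro Y(2)) auto
  qed
  also have "\<bar>\<dots>\<bar> \<le> L2n f2 * L2n (\<lambda>x. Y (x + s *\<^sub>R ?e))"
    using Cauchy_Schwarz_l2norm[OF f2 smooth_cs_sq_int[OF smooth_cs_translate[OF csY]]] by simp
  also have "L2n (\<lambda>x. Y (x + s *\<^sub>R ?e)) = L2n Y"
    by (rule l2norm_translate[OF smooth_cs_borel[OF csY]])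
  finally show ?thesis .
qed

section \<open>Interior estimates along the layers\<close>

text \<open>The radii leave room for steps of length at most \<open>r\<close>. Test functions of the
  first estimate live in \<open>square p (5 * r)\<close> and those of the second in
  \<open>square p (4 * r)\<close>. The second estimate uses the first one on
  \<open>square p (3 * r)\<close>, where the translate of \<open>\<eta>1\<close> is 1, and its
  result holds on \<open>square p r\<close>, where that of \<open>\<eta>2\<close> is 1.\<close>

locale interior = coefficient +
  fixes \<Omega> :: "(real ^ 2) set" and f f2 :: "real ^ 2 \<Rightarrow> real" and g :: "real ^ 2 \<Rightarrow> real ^ 2"
    and \<Phi> :: "nat \<Rightarrow> real ^ 2 \<Rightarrow> real" and p :: "real ^ 2" and r :: real and \<eta>1 \<eta>2 :: "real ^ 2 \<Rightarrow> real" and L1 L2 :: real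
  assumes f: "sq_int lebesgue f" "integrable lebesgue f" and f2: "sq_int lebesgue f2"
    and f_weak: "\<And>\<phi>. test_fun \<Omega> \<phi> \<Longrightarrow> (\<integral>x. f x * partial 2 \<phi> x \<partial>lebesgue) = - (\<integral>x. f2 x * \<phi> x \<partial>lebesgue)"
    and g: "sq_int lebesgue g" "\<And>j. integrable lebesgue (\<lambda>x. g x $ j)"
    and g_weak: "\<And>\<phi>. test_fun \<Omega> \<phi> \<Longrightarrow> (\<integral>x. a x * (g x \<bullet> grad \<phi> x) \<partial>lebesgue) = (\<integral>x. f x * \<phi> x \<partial>lebesgue)"
    and \<Phi>: "\<And>k. smooth_cs (\<Phi> k)" "(\<lambda>k. L2n (\<lambda>x. grad (\<Phi> k) x - g x)) \<longlonglongrightarrow> 0"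
    and r: "0 < r" and sub: "square p (6 * r) \<subseteq> \<Omega>"
    and \<eta>1: "cutoff (3 * r) (4 * r) \<eta>1 L1" and \<eta>2: "cutoff r (2 * r) \<eta>2 L2"
begin

text \<open>\<open>caccioppoli\<close> needs a bound for the tangential derivative of the function
  it is applied to: in the first round the norm of the gradient \<open>g\<close>, in the second the
  outcome \<open>K1\<close> of the first.\<close>

definition K1 where "K1 = cacc_const \<alpha> \<beta> L1 * (L2n f2 + L2n g)"
definition K2 where "K2 = cacc_const \<alpha> \<beta> L2 * (L2n f2 + K1)"

abbreviation d :: "nat \<Rightarrow> real" where "d k \<equiv> L2n (\<lambda>x. grad (\<Phi> k) x - g x)"
abbreviation E1 where "E1 \<equiv> \<lambda>x. \<eta>1 (x + - p)"
abbreviation E2 where "E2 \<equiv> \<lambda>x. \<eta>2 (x + - p)"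

lemma L_nonneg: "0 \<le> L1" "0 \<le> L2"
  using \<eta>1 \<eta>2 by (auto simp: cutoff_def)

lemma cacc_const_nonneg: "0 \<le> L \<Longrightarrow> 0 \<le> cacc_const \<alpha> \<beta> L"
  using alpha beta(1) by (simp add: cacc_const_def)

lemma d_sq_int: "sq_int lebesgue (\<lambda>x. grad (\<Phi> k) x - g x)"
  by (intro sq_int_diff smooth_cs_grad_sq_int \<Phi>(1) g(1))

lemma sub': "\<rho> \<le> 6 * r \<Longrightarrow> square p \<rho> \<subseteq> \<Omega>"
  using sub square_mono by blast

lemma eq_error:
  assumes "smooth \<phi>" "\<And>x. x \<notin> square p \<rho> \<Longrightarrow> \<phi> x = 0" "\<rho> \<le> 6 * r"
  shows "\<bar>(\<integral>x. a x * (grad (\<Phi> k) x \<bullet> grad \<phi> x) \<partial>lebesgue) - (\<integral>x. f x * \<phi> x \<partial>lebesgue)\<bar>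
    \<le> \<beta> * d k * L2n (grad \<phi>)"
proof -
  have cs: "smooth_cs \<phi>" by (rule csmI[OF assms(1) compact_square assms(2)])
  have "test_fun \<Omega> \<phi>" by (rule test_funI[OF assms(1) compact_square sub'[OF assms(3)] assms(2)])
  then have "(\<integral>x. f x * \<phi> x \<partial>lebesgue) = (\<integral>x. a x * (g x \<bullet> grad \<phi> x) \<partial>lebesgue)"
    by (simp add: g_weak)
  then have "(\<integral>x. a x * (grad (\<Phi> k) x \<bullet> grad \<phi> x) \<partial>lebesgue) - (\<integral>x. f x * \<phi> x \<partial>lebesgue)
    = (\<integral>x. a x * ((grad (\<Phi> k) x - g x) \<bullet> grad \<phi> x) \<partial>lebesgue)"
    by (simp add: inner_diff_left right_diff_distrib int_a[OF smooth_cs_grad_sq_int[OF \<Phi>(1)] smooth_cs_grad_sq_int[OF cs]]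
        int_a[OF g(1) smooth_cs_grad_sq_int[OF cs]])
  then show ?thesis using CS_a[OF d_sq_int smooth_cs_grad_sq_int[OF cs]] by simp
qed

text \<open>Comparing the approximant with the solution costs \<open>d k\<close>, which appears
  divided by \<open>h\<close> and disappears as \<open>k\<close> tends to infinity for fixed
  \<open>h\<close>.\<close>

lemma first_difference:
  assumes h: "0 < h" "h \<le> r"
  shows "L2n (\<lambda>x. E1 x *\<^sub>R grad (diffq h (\<Phi> k)) x) \<le> K1 + cacc_const \<alpha> \<beta> L1 * (2 * \<beta> / h + 1) * d k"
proof -
  note c = cutoff_translate[where p = p, OF \<eta>1]
  have "L2n (\<lambda>x. E1 x *\<^sub>R grad (diffq h (\<Phi> k)) x)
    \<le> cacc_const \<alpha> \<beta> L1 * (L2n f2 + 2 * (\<beta> * d k) / h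
        + L2n (\<lambda>x. indicator (square p (4 * r + h)) x *\<^sub>R partial 2 (\<Phi> k) x))"
  proof (rule caccioppoli[OF \<Phi>(1) h(1) L_nonneg(1), where F = "\<lambda>\<phi>. \<integral>x. f x * \<phi> x \<partial>lebesgue"])
    show "0 \<le> \<beta> * d k" using beta(1) by simp
    show "0 \<le> 4 * r" using r by simp
    show "\<bar>(\<integral>x. a x * (grad (\<Phi> k) x \<bullet> grad \<phi> x) \<partial>lebesgue) - (\<integral>x. f x * \<phi> x \<partial>lebesgue)\<bar>
      \<le> \<beta> * d k * L2n (grad \<phi>)" if "smooth \<phi>" "\<And>x. x \<notin> square p (4 * r + h) \<Longrightarrow> \<phi> x = 0" for \<phi>
      by (rule eq_error[OF that]) (use h in auto)
    show "\<bar>\<integral>x. f x * diffq (- h) Y x \<partial>lebesgue\<bar> \<le> L2n f2 * (L2n Y + L2n (partial 2 Y))"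
      if "smooth Y" "\<And>x. x \<notin> square p (4 * r) \<Longrightarrow> Y x = 0" for Y
    proof -
      have "\<bar>\<integral>x. f x * diffq (- h) Y x \<partial>lebesgue\<bar> \<le> L2n f2 * L2n Y"
        by (rule weak_difference_bound[OF f f2 f_weak that h(1) sub']) (use h in auto)
      also have "\<dots> \<le> L2n f2 * (L2n Y + L2n (partial 2 Y))"
        by (intro mult_left_mono) auto
      finally show ?thesis .
    qed
  qed (use c in auto)
  also have "\<dots> \<le> cacc_const \<alpha> \<beta> L1 * (L2n f2 + 2 * (\<beta> * d k) / h + (L2n g + d k))"
  proof (intro mult_left_mono add_left_mono cacc_const_nonneg L_nonneg)
    have "L2n (\<lambda>x. indicator (square p (4 * r + h)) x *\<^sub>R partial 2 (\<Phi> k) x) \<le> 1 * L2n (partial 2 (\<Phi> k))"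
      by (rule sq_int_mult(2)[OF smooth_cs_sq_int[OF smooth_cs_partial[OF \<Phi>(1)]]])
         (auto simp: indicator_def intro!: borel_lebesgue borel_measurable_indicator)
    also have "\<dots> \<le> L2n (grad (\<Phi> k))"
      using sq_int_nth(2)[OF smooth_cs_grad_sq_int[OF \<Phi>(1)[of k]], of 2] by (simp add: grad_nth)
    also have "\<dots> \<le> L2n g + d k"
      using l2norm_triangle[OF g(1) d_sq_int[of k]] by simp
    finally show "L2n (\<lambda>x. indicator (square p (4 * r + h)) x *\<^sub>R partial 2 (\<Phi> k) x) \<le> L2n g + d k" .
  qed
  also have "\<dots> = K1 + cacc_const \<alpha> \<beta> L1 * (2 * \<beta> / h + 1) * d k"
    by (simp add: K1_def algebra_simps)
  finally show ?thesis .
qed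

text \<open>By \<open>summation_by_parts\<close> the quotient \<open>diffq h (\<Phi> k)\<close>
  again satisfies the equation up to an error, with the quotient of \<open>f\<close> as right-hand
  side; this quotient is left on the test function. So \<open>caccioppoli\<close> applies once more.
  Two independent steps allow the limits to be taken one after the other.\<close>

lemma second_difference:
  assumes h: "0 < h" "h \<le> r" and h': "0 < h'" "h' \<le> r"
  shows "L2n (\<lambda>x. E2 x *\<^sub>R grad (diffq h' (diffq h (\<Phi> k))) x)
    \<le> K2 + cacc_const \<alpha> \<beta> L2 * (4 * \<beta> / (h * h') + cacc_const \<alpha> \<beta> L1 * (2 * \<beta> / h + 1)) * d k"
proof -
  note c = cutoff_translate[where p = p, OF \<eta>2] and c1 = cutoff_translate[where p = p, OF \<eta>1]
  have csD: "smooth_cs (diffq h (\<Phi> k))" by (rule smooth_cs_diffq[OF \<Phi>(1)])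
  have "L2n (\<lambda>x. E2 x *\<^sub>R grad (diffq h' (diffq h (\<Phi> k))) x)
    \<le> cacc_const \<alpha> \<beta> L2 * (L2n f2 + 2 * (2 * \<beta> * d k / h) / h'
        + L2n (\<lambda>x. indicator (square p (2 * r + h')) x *\<^sub>R partial 2 (diffq h (\<Phi> k)) x))"
  proof (rule caccioppoli[OF csD h'(1) L_nonneg(2), where F = "\<lambda>\<phi>. - (\<integral>x. f x * diffq (- h) \<phi> x \<partial>lebesgue)"])
    show "0 \<le> 2 * \<beta> * d k / h" using beta(1) h by simp
    show "0 \<le> 2 * r" using r by simp
    show "\<bar>(\<integral>x. a x * (grad (diffq h (\<Phi> k)) x \<bullet> grad \<phi> x) \<partial>lebesgue) - - (\<integral>x. f x * diffq (- h) \<phi> x \<partial>lebesgue)\<bar>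
      \<le> 2 * \<beta> * d k / h * L2n (grad \<phi>)"
      if \<phi>: "smooth \<phi>" "\<And>x. x \<notin> square p (2 * r + h') \<Longrightarrow> \<phi> x = 0" for \<phi>
    proof -
      have cs: "smooth_cs \<phi>" by (rule csmI[OF \<phi>(1) compact_square \<phi>(2)])
      have "\<bar>(\<integral>x. a x * (grad (\<Phi> k) x \<bullet> grad (diffq (- h) \<phi>) x) \<partial>lebesgue) - (\<integral>x. f x * diffq (- h) \<phi> x \<partial>lebesgue)\<bar>
        \<le> \<beta> * d k * L2n (grad (diffq (- h) \<phi>))"
      proof (rule eq_error)
        show "diffq (- h) \<phi> x = 0" if "x \<notin> square p (2 * r + h' + h)" for x
          by (rule diffq_outside[OF \<phi>(2) _ that]) (use h in auto)
      qed (use h h' \<phi> in \<open>auto intro: smooth_diffq\<close>)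
      also have "\<dots> \<le> \<beta> * d k * (2 / h * L2n (grad \<phi>))"
        using l2norm_grad_diffq_le[OF cs h(1)] beta(1) by (intro mult_left_mono) auto
      also have "\<dots> = 2 * \<beta> * d k / h * L2n (grad \<phi>)" by simp
      finally show ?thesis
        unfolding summation_by_parts[OF \<Phi>(1) cs h(1)] by linarith
    qed
    show "\<bar>- (\<integral>x. f x * diffq (- h) (diffq (- h') Y) x \<partial>lebesgue)\<bar> \<le> L2n f2 * (L2n Y + L2n (partial 2 Y))"
      if Y: "smooth Y" "\<And>x. x \<notin> square p (2 * r) \<Longrightarrow> Y x = 0" for Y
    proof -
      \<comment> \<open>The weak derivative \<open>f2\<close> absorbs one of the two quotients; the
        other stays on \<open>Y\<close> and is bounded by \<open>partial 2 Y\<close>.\<close>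
      have "\<bar>\<integral>x. f x * diffq (- h) (diffq (- h') Y) x \<partial>lebesgue\<bar> \<le> L2n f2 * L2n (diffq (- h') Y)"
      proof (rule weak_difference_bound[OF f f2 f_weak smooth_diffq[OF Y(1)] _ h(1)])
        show "diffq (- h') Y x = 0" if "x \<notin> square p (2 * r + h')" for x
          by (rule diffq_outside[OF Y(2) _ that]) (use h' in auto)
      qed (assumption, rule sub', use h h' in linarith)
      also have "\<dots> \<le> L2n f2 * (L2n Y + L2n (partial 2 Y))"
      proof (rule mult_left_mono)
        have "L2n (diffq (- h') Y) \<le> L2n (partial 2 Y)"
          by (rule l2norm_diffq_minus_le[OF Y(1) compact_square[of p "2 * r"] Y(2) h'(1)])
        then show "L2n (diffq (- h') Y) \<le> L2n Y + L2n (partial 2 Y)"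
          using l2norm_nonneg[of lebesgue Y] by linarith
      qed simp
      finally show ?thesis by simp
    qed
  qed (use c in auto)
  also have "\<dots> \<le> cacc_const \<alpha> \<beta> L2 * (L2n f2 + 2 * (2 * \<beta> * d k / h) / h'
      + (K1 + cacc_const \<alpha> \<beta> L1 * (2 * \<beta> / h + 1) * d k))"
  proof (intro mult_left_mono add_left_mono cacc_const_nonneg L_nonneg)
    let ?V = "\<lambda>x. E1 x *\<^sub>R grad (diffq h (\<Phi> k)) x"
    have sV: "sq_int lebesgue ?V"
      by (rule sq_int_mult(1)[OF smooth_cs_grad_sq_int[OF csD] borel_lebesgue[OF borel_measurable_continuous_onI[OF smooth_cont[OF c1(1)]]], of 1])
         (use c1(2) in auto)
    have "L2n (\<lambda>x. indicator (square p (2 * r + h')) x *\<^sub>R partial 2 (diffq h (\<Phi> k)) x) \<le> 1 * L2n ?V"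
    proof (rule l2norm_mono[OF sV])
      show "sq_int lebesgue (\<lambda>x. indicator (square p (2 * r + h')) x *\<^sub>R partial 2 (diffq h (\<Phi> k)) x)"
        by (rule sq_int_indicator[OF smooth_cs_sq_int[OF smooth_cs_partial[OF csD]] sets_lebesgue_borel]) measurable
      show "norm (indicator (square p (2 * r + h')) x *\<^sub>R partial 2 (diffq h (\<Phi> k)) x) \<le> 1 * norm (?V x)" for x
      proof (cases "x \<in> square p (2 * r + h')")
        case True
        then have "E1 x = 1" using h' square_mono[of "2 * r + h'" "3 * r" p] by (intro c1(3)) auto
        then show ?thesis using True component_le_norm_cart[of "grad (diffq h (\<Phi> k)) x" 2] by (simp add: grad_nth)
      qed simp
    qed simp
    then show "L2n (\<lambda>x. indicator (square p (2 * r + h')) x *\<^sub>R partial 2 (diffq h (\<Phi> k)) x)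
      \<le> K1 + cacc_const \<alpha> \<beta> L1 * (2 * \<beta> / h + 1) * d k"
      using first_difference[OF h, of k] by linarith
  qed
  also have "\<dots> = K2 + cacc_const \<alpha> \<beta> L2 * (4 * \<beta> / (h * h') + cacc_const \<alpha> \<beta> L1 * (2 * \<beta> / h + 1)) * d k"
    by (simp add: K2_def algebra_simps)
  finally show ?thesis .
qed

end

context interior
begin

text \<open>The quotients are moved from the test function to the approximants, where the two
  difference estimates apply. Summation by parts forces the weight \<open>b\<close> to be invariant
  in direction 2; it will be 1 for the tangential derivative and the coefficient for the
  flux.\<close>

lemma tangential_dual_bounds:
  assumes b: "b \<in> borel_measurable borel" "\<And>x. \<bar>b x\<bar> \<le> B" "\<And>x s. b (x + s *\<^sub>R axis 2 1) = b x"
    and Y: "smooth Y" "\<And>x. x \<notin> square p r \<Longrightarrow> Y x = 0"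
  shows "\<bar>\<integral>x. b x * g x $ j * partial 2 Y x \<partial>lebesgue\<bar> \<le> B * K1 * L2n Y"
    and "\<bar>\<integral>x. b x * g x $ j * partial 2 (partial 2 Y) x \<partial>lebesgue\<bar> \<le> B * K2 * L2n Y"
proof -
  note c1 = cutoff_translate[OF \<eta>1, where p = p] and c2 = cutoff_translate[OF \<eta>2, where p = p]
  have csY: "smooth_cs Y" by (rule csmI[OF Y(1) compact_square Y(2)])
  have B: "0 \<le> B" using b(2)[of 0] by linarith
  note bl = borel_lebesgue[OF b(1)]
  have gj: "sq_int lebesgue (\<lambda>x. g x $ j)" by (rule sq_int_nth[OF g(1)])
  have bg: "integrable lebesgue (\<lambda>x. b x * g x $ j)"
    by (rule Bochner_Integration.integrable_bound[where f = "\<lambda>x. B * g x $ j"])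
       (use g(2)[of j] bl b(2) B in \<open>auto simp: abs_mult intro!: mult_right_mono\<close>)
  have approx: "(\<lambda>k. \<integral>x. b x * partial j (\<Phi> k) x * Z x \<partial>lebesgue) \<longlonglongrightarrow> (\<integral>x. b x * g x $ j * Z x \<partial>lebesgue)"
    if "smooth_cs Z" for Z
  proof (rule LIM_zero_cancel, rule tendsto_rabs_zero_cancel,
      rule tendsto_sandwich[where f = "\<lambda>k. 0" and h = "\<lambda>k. B * d k * L2n Z"])
    have i1: "integrable lebesgue (\<lambda>x. b x * partial j (\<Phi> k) x * Z x)" for k
      using sq_int_inner[OF sq_int_mult(1)[OF smooth_cs_sq_int[OF smooth_cs_partial[OF \<Phi>(1)]] bl b(2)] smooth_cs_sq_int[OF that]] by simp
    have i2: "integrable lebesgue (\<lambda>x. b x * g x $ j * Z x)"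
      using sq_int_inner[OF sq_int_mult(1)[OF gj bl b(2)] smooth_cs_sq_int[OF that]] by simp
    have dj: "sq_int lebesgue (\<lambda>x. (grad (\<Phi> k) x - g x) $ j)" "L2n (\<lambda>x. (grad (\<Phi> k) x - g x) $ j) \<le> d k" for k
      using sq_int_nth[OF d_sq_int] by blast+
    have "\<bar>(\<integral>x. b x * partial j (\<Phi> k) x * Z x \<partial>lebesgue) - (\<integral>x. b x * g x $ j * Z x \<partial>lebesgue)\<bar> \<le> B * d k * L2n Z" for k
    proof -
      have "(\<integral>x. b x * partial j (\<Phi> k) x * Z x \<partial>lebesgue) - (\<integral>x. b x * g x $ j * Z x \<partial>lebesgue)
        = (\<integral>x. b x * partial j (\<Phi> k) x * Z x - b x * g x $ j * Z x \<partial>lebesgue)"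
        by (rule Bochner_Integration.integral_diff[OF i1 i2, symmetric])
      also have "\<dots> = (\<integral>x. (b x *\<^sub>R ((grad (\<Phi> k) x - g x) $ j)) \<bullet> Z x \<partial>lebesgue)"
        by (rule Bochner_Integration.integral_cong) (simp_all add: grad_nth algebra_simps)
      also have "\<bar>\<dots>\<bar> \<le> L2n (\<lambda>x. b x *\<^sub>R ((grad (\<Phi> k) x - g x) $ j)) * L2n Z"
        by (rule Cauchy_Schwarz_l2norm[OF sq_int_mult(1)[OF dj(1) bl b(2)] smooth_cs_sq_int[OF that]])
      also have "\<dots> \<le> B * d k * L2n Z"
        using order_trans[OF sq_int_mult(2)[OF dj(1) bl b(2)] mult_left_mono[OF dj(2) B]]
        by (rule mult_right_mono) simp
      finally show ?thesis .
    qed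
    then show "\<forall>\<^sub>F k in sequentially. \<bar>(\<integral>x. b x * partial j (\<Phi> k) x * Z x \<partial>lebesgue) - (\<integral>x. b x * g x $ j * Z x \<partial>lebesgue)\<bar> \<le> B * d k * L2n Z"
      by simp
    show "(\<lambda>k. B * d k * L2n Z) \<longlonglongrightarrow> 0"
      by (rule tendsto_mult_left_zero, rule tendsto_mult_right_zero, rule \<Phi>(2))
  qed auto
  \<comment> \<open>\<open>U\<close> stands for a first or second difference quotient of an approximant\<close>
  have test: "\<bar>\<integral>x. b x * partial j U x * Y x \<partial>lebesgue\<bar> \<le> B * L2n (\<lambda>x. E x *\<^sub>R grad U x) * L2n Y"
    if U: "smooth_cs U" and E: "smooth E" "\<And>x. \<bar>E x\<bar> \<le> 1" "\<And>x. x \<in> square p r \<Longrightarrow> E x = 1" for U E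
  proof -
    have sE: "sq_int lebesgue (\<lambda>x. E x *\<^sub>R grad U x)"
      by (rule sq_int_mult(1)[OF smooth_cs_grad_sq_int[OF U] borel_lebesgue[OF borel_measurable_continuous_onI[OF smooth_cont[OF E(1)]]] E(2)])
    note sj = sq_int_nth[OF sE, of j]
    have "(\<integral>x. b x * partial j U x * Y x \<partial>lebesgue) = (\<integral>x. (b x *\<^sub>R ((E x *\<^sub>R grad U x) $ j)) \<bullet> Y x \<partial>lebesgue)"
    proof (rule Bochner_Integration.integral_cong[OF refl])
      show "b x * partial j U x * Y x = (b x *\<^sub>R ((E x *\<^sub>R grad U x) $ j)) \<bullet> Y x" for x
        using E(3)[of x] Y(2)[of x] by (cases "x \<in> square p r") (simp_all add: grad_nth)
    qed
    also have "\<bar>\<dots>\<bar> \<le> L2n (\<lambda>x. b x *\<^sub>R ((E x *\<^sub>R grad U x) $ j)) * L2n Y"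
      by (rule Cauchy_Schwarz_l2norm[OF sq_int_mult(1)[OF sj(1) bl b(2)] smooth_cs_sq_int[OF csY]])
    also have "\<dots> \<le> B * L2n (\<lambda>x. E x *\<^sub>R grad U x) * L2n Y"
      using order_trans[OF sq_int_mult(2)[OF sj(1) bl b(2)] mult_left_mono[OF sj(2) B]]
      by (rule mult_right_mono) simp
    finally show ?thesis .
  qed
  have q1: "\<bar>\<integral>x. b x * g x $ j * diffq (- h) Y x \<partial>lebesgue\<bar> \<le> B * K1 * L2n Y"
    if h: "0 < h" "h \<le> r" for h
  proof (rule LIMSEQ_le[OF tendsto_rabs[OF approx[OF smooth_cs_diffq[OF csY]]]])
    have "\<bar>\<integral>x. b x * partial j (\<Phi> k) x * diffq (- h) Y x \<partial>lebesgue\<bar>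
      \<le> B * (K1 + cacc_const \<alpha> \<beta> L1 * (2 * \<beta> / h + 1) * d k) * L2n Y" for k
    proof -
      have "(\<integral>x. b x * partial j (\<Phi> k) x * diffq (- h) Y x \<partial>lebesgue) = - (\<integral>x. b x * partial j (diffq h (\<Phi> k)) x * Y x \<partial>lebesgue)"
        unfolding partial_diffq[OF smooth_cs_smooth[OF \<Phi>(1)]]
        by (rule summation_by_parts_scalar[OF smooth_cs_partial[OF \<Phi>(1)] csY h(1) b])
      also have "\<bar>\<dots>\<bar> \<le> B * L2n (\<lambda>x. E1 x *\<^sub>R grad (diffq h (\<Phi> k)) x) * L2n Y"
        unfolding abs_minus_cancel
      proof (rule test[OF smooth_cs_diffq[OF \<Phi>(1)] c1(1)])
        show "\<bar>E1 x\<bar> \<le> 1" for x using c1(2)[of x] by simp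
        show "E1 x = 1" if "x \<in> square p r" for x
          using that r square_mono[of r "3 * r" p] by (intro c1(3)) auto
      qed
      also have "\<dots> \<le> B * (K1 + cacc_const \<alpha> \<beta> L1 * (2 * \<beta> / h + 1) * d k) * L2n Y"
        using first_difference[OF h, of k] B by (intro mult_right_mono mult_left_mono) auto
      finally show ?thesis .
    qed
    then show "\<exists>N. \<forall>k\<ge>N. \<bar>\<integral>x. b x * partial j (\<Phi> k) x * diffq (- h) Y x \<partial>lebesgue\<bar>
      \<le> B * (K1 + cacc_const \<alpha> \<beta> L1 * (2 * \<beta> / h + 1) * d k) * L2n Y" by blast
    have "(\<lambda>k. B * (K1 + cacc_const \<alpha> \<beta> L1 * (2 * \<beta> / h + 1) * d k) * L2n Y)
      \<longlonglongrightarrow> B * (K1 + cacc_const \<alpha> \<beta> L1 * (2 * \<beta> / h + 1) * 0) * L2n Y"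
      by (intro tendsto_intros \<Phi>(2))
    then show "(\<lambda>k. B * (K1 + cacc_const \<alpha> \<beta> L1 * (2 * \<beta> / h + 1) * d k) * L2n Y) \<longlonglongrightarrow> B * K1 * L2n Y"
      by simp
  qed
  show "\<bar>\<integral>x. b x * g x $ j * partial 2 Y x \<partial>lebesgue\<bar> \<le> B * K1 * L2n Y"
    by (rule diffq_limit_bound[OF bg csY r q1])
  have q2: "\<bar>\<integral>x. b x * g x $ j * diffq (- h) (diffq (- h') Y) x \<partial>lebesgue\<bar> \<le> B * K2 * L2n Y"
    if h: "0 < h" "h \<le> r" and h': "0 < h'" "h' \<le> r" for h h'
  proof (rule LIMSEQ_le[OF tendsto_rabs[OF approx[OF smooth_cs_diffq[OF smooth_cs_diffq[OF csY]]]]])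
    let ?c = "cacc_const \<alpha> \<beta> L2 * (4 * \<beta> / (h * h') + cacc_const \<alpha> \<beta> L1 * (2 * \<beta> / h + 1))"
    have "\<bar>\<integral>x. b x * partial j (\<Phi> k) x * diffq (- h) (diffq (- h') Y) x \<partial>lebesgue\<bar>
      \<le> B * (K2 + ?c * d k) * L2n Y" for k
    proof -
      have "(\<integral>x. b x * partial j (\<Phi> k) x * diffq (- h) (diffq (- h') Y) x \<partial>lebesgue)
        = - (\<integral>x. b x * partial j (diffq h (\<Phi> k)) x * diffq (- h') Y x \<partial>lebesgue)"
        unfolding partial_diffq[OF smooth_cs_smooth[OF \<Phi>(1)]]
        by (rule summation_by_parts_scalar[OF smooth_cs_partial[OF \<Phi>(1)] smooth_cs_diffq[OF csY] h(1) b])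
      also have "\<dots> = - (- (\<integral>x. b x * partial j (diffq h' (diffq h (\<Phi> k))) x * Y x \<partial>lebesgue))"
        unfolding partial_diffq[OF smooth_cs_smooth[OF smooth_cs_diffq[OF \<Phi>(1)]]]
        by (subst summation_by_parts_scalar[OF smooth_cs_partial[OF smooth_cs_diffq[OF \<Phi>(1)]] csY h'(1) b]) simp
      also have "\<bar>\<dots>\<bar> \<le> B * L2n (\<lambda>x. E2 x *\<^sub>R grad (diffq h' (diffq h (\<Phi> k))) x) * L2n Y"
        unfolding abs_minus_cancel
      proof (rule test[OF smooth_cs_diffq[OF smooth_cs_diffq[OF \<Phi>(1)]] c2(1)])
        show "\<bar>E2 x\<bar> \<le> 1" for x using c2(2)[of x] by simp
        show "E2 x = 1" if "x \<in> square p r" for x by (rule c2(3)[OF that])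
      qed
      also have "\<dots> \<le> B * (K2 + ?c * d k) * L2n Y"
        using second_difference[OF h h', of k] B by (intro mult_right_mono mult_left_mono) auto
      finally show ?thesis .
    qed
    then show "\<exists>N. \<forall>k\<ge>N. \<bar>\<integral>x. b x * partial j (\<Phi> k) x * diffq (- h) (diffq (- h') Y) x \<partial>lebesgue\<bar>
      \<le> B * (K2 + ?c * d k) * L2n Y" by blast
    have "(\<lambda>k. B * (K2 + ?c * d k) * L2n Y) \<longlonglongrightarrow> B * (K2 + ?c * 0) * L2n Y"
      by (intro tendsto_intros \<Phi>(2))
    then show "(\<lambda>k. B * (K2 + ?c * d k) * L2n Y) \<longlonglongrightarrow> B * K2 * L2n Y"
      by simp
  qed
  \<comment> \<open>Here \<open>h\<close> tends to 0 with \<open>h'\<close> fixed. Quotient and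
    derivative commute, so the remaining quotient falls on \<open>partial 2 Y\<close>, and the last
    line lets \<open>h'\<close> tend to 0.\<close>
  have q3: "\<bar>\<integral>x. b x * g x $ j * diffq (- h') (partial 2 Y) x \<partial>lebesgue\<bar> \<le> B * K2 * L2n Y"
    if h': "0 < h'" "h' \<le> r" for h'
    using diffq_limit_bound[OF bg smooth_cs_diffq[OF csY] r q2[OF _ _ h']] by (simp add: partial_diffq[OF Y(1)])
  show "\<bar>\<integral>x. b x * g x $ j * partial 2 (partial 2 Y) x \<partial>lebesgue\<bar> \<le> B * K2 * L2n Y"
    by (rule diffq_limit_bound[OF bg smooth_cs_partial[OF csY] r q3])
qed

end

subsection \<open>Functions with square integrable mixed derivative\<close>

definition supp_in :: "(real \<Rightarrow> real) \<Rightarrow> real \<Rightarrow> real \<Rightarrow> bool" where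
  "supp_in P c r \<longleftrightarrow> (\<forall>t. \<not> \<bar>t - c\<bar> \<le> r \<longrightarrow> P t = 0)"

text \<open>Duality form of the statement that \<open>\<partial>\<^sub>1h\<close>, \<open>\<partial>\<^sub>2h\<close> and \<open>\<partial>\<^sub>1\<partial>\<^sub>2h\<close> are square integrable on the
  square, with norm at most \<open>C\<close>; in this form it passes to limits without weak compactness.\<close>

definition mixed_bound :: "(real ^ 2 \<Rightarrow> real) \<Rightarrow> real ^ 2 \<Rightarrow> real \<Rightarrow> real \<Rightarrow> bool" where
  "mixed_bound h p r C \<longleftrightarrow> (\<forall>P Q. smooth1 P \<and> smooth1 Q \<and> supp_in P (p $ 1) r \<and> supp_in Q (p $ 2) r \<longrightarrow>
     \<bar>\<integral>x. h x * tensor (deriv P) Q x \<partial>lebesgue\<bar> \<le> C * L2n (tensor P Q) \<and>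
     \<bar>\<integral>x. h x * tensor P (deriv Q) x \<partial>lebesgue\<bar> \<le> C * L2n (tensor P Q) \<and>
     \<bar>\<integral>x. h x * tensor (deriv P) (deriv Q) x \<partial>lebesgue\<bar> \<le> C * L2n (tensor P Q))"

lemma mixed_bound_mono:
  assumes "mixed_bound h p r C" "C \<le> C'" shows "mixed_bound h p r C'"
proof -
  have "C * L2n (tensor P Q) \<le> C' * L2n (tensor P Q)" for P Q
    using assms(2) by (intro mult_right_mono) auto
  then show ?thesis using assms(1) unfolding mixed_bound_def by (meson order_trans)
qed

lemma supp_in_deriv:
  assumes "smooth1 P" "supp_in P c r" shows "supp_in (deriv P) c r"
  unfolding supp_in_def
proof (intro allI impI)
  fix t assume t: "\<not> \<bar>t - c\<bar> \<le> r"
  have o: "open {t. \<not> \<bar>t - c\<bar> \<le> r}"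
    unfolding not_le by (intro open_Collect_less continuous_intros)
  have "(P has_real_derivative 0) (at t)"
    by (rule has_field_derivative_transform_within_open[OF DERIV_const[of 0] o])
       (use t assms(2) in \<open>auto simp: supp_in_def\<close>)
  then show "deriv P t = 0" by (rule DERIV_imp_deriv)
qed

lemma tensor_outside:
  assumes "supp_in P (p $ 1) r" "supp_in Q (p $ 2) r" "x \<notin> square p r"
  shows "tensor P Q x = 0"
  using assms by (auto simp: supp_in_def square_def tensor_def)

lemma smooth_cs_tensor:
  assumes "smooth1 P" "smooth1 Q" "supp_in P c r" "supp_in Q c' r'"
  shows "smooth_cs (tensor P Q)"
proof (rule csmI[OF smooth_tensor[OF assms(1,2)] compact_cbox])
  show "tensor P Q x = 0" if "x \<notin> cbox (\<chi> i. if i = 1 then c - r else c' - r') (\<chi> i. if i = 1 then c + r else c' + r')" for x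
    using that assms(3,4) by (auto simp: supp_in_def tensor_def mem_box_cart forall_2 abs_le_iff)
qed

text \<open>The support has area \<open>4 * l * r\<close>. The square root of the small half-width
  \<open>l\<close> is the origin of the Hoelder exponent 1/2.\<close>

lemma l2norm_tensor_le:
  assumes P: "smooth1 P" "supp_in P c l" "\<And>t. \<bar>P t\<bar> \<le> 1" and Q: "smooth1 Q" "supp_in Q c' r" "\<And>t. \<bar>Q t\<bar> \<le> B"
    and "0 \<le> l" "0 \<le> r" "0 \<le> B"
  shows "L2n (tensor P Q) \<le> B * sqrt (4 * l * r)"
proof -
  let ?b = "cbox (\<chi> i. if i = 1 then c - l else c' - r) (\<chi> i. if i = 1 then c + l else c' + r) :: (real ^ 2) set"
  have bb: "norm (tensor P Q x) \<le> B * norm (indicator ?b x :: real)" for x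
  proof (cases "x \<in> ?b")
    case True
    have "\<bar>P (x $ 1)\<bar> * \<bar>Q (x $ 2)\<bar> \<le> 1 * B" by (intro mult_mono P Q) auto
    then show ?thesis using True by (simp add: tensor_def abs_mult)
  next
    case False
    then have "tensor P Q x = 0"
      using P(2) Q(2) by (auto simp: supp_in_def tensor_def mem_box_cart forall_2 abs_le_iff)
    then show ?thesis using assms(9) by simp
  qed
  have ii: "integrable lebesgue (indicator ?b :: _ \<Rightarrow> real)"
    using fmeasurableD[OF lmeasurable_cbox] fmeasurableD2[OF lmeasurable_cbox]
    by (intro integrable_real_indicator) (auto simp: less_top)
  have sq: "(norm (indicator ?b x :: real))\<^sup>2 = indicator ?b x" for x by (simp add: indicator_def)
  have sb: "sq_int lebesgue (indicator ?b :: _ \<Rightarrow> real)"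
    unfolding sq_int_def sq using ii by auto
  have "L2n (tensor P Q) \<le> B * L2n (indicator ?b :: _ \<Rightarrow> real)"
    by (rule l2norm_mono[OF sb smooth_cs_sq_int[OF smooth_cs_tensor[OF P(1) Q(1) P(2) Q(2)]] assms(9) bb])
  also have "L2n (indicator ?b :: _ \<Rightarrow> real) = sqrt (4 * l * r)"
  proof -
    have m: "measure lebesgue ?b = 4 * l * r" using assms(7,8) by (subst measure_cbox2) auto
    show ?thesis
      unfolding l2norm_def sq
      by (simp only: Bochner_Integration.integral_indicator space_completion space_lborel space_borel Int_UNIV_right m)
  qed
  finally show ?thesis .
qed

section \<open>Averaging kernels and the precise representative\<close>

definition step_at :: "real \<Rightarrow> real \<Rightarrow> real \<Rightarrow> real" where
  "step_at c \<delta> t = step (inverse \<delta> * t + (- c * inverse \<delta>))"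

text \<open>The kernel is given through its primitive: a difference of two kernels is then the
  derivative of an explicit function of compact support with values between -1 and 1, as duality
  against derivatives requires.\<close>

definition rho :: "real \<Rightarrow> real \<Rightarrow> real \<Rightarrow> real" where
  "rho c \<delta> = deriv (step_at c \<delta>)"

lemma smooth1_step_at: "smooth1 (step_at c \<delta>)"
  unfolding step_at_def[abs_def] by (rule smooth1_affine[OF smooth1_step])

lemma smooth1_rho: "smooth1 (rho c \<delta>)"
  unfolding rho_def by (rule smooth1_D(2)[OF smooth1_step_at])

lemma step_at_01: "0 \<le> step_at c \<delta> t" "step_at c \<delta> t \<le> 1"
  by (auto simp: step_at_def step_ge0 step_le1)

lemma step_at_0: "0 < \<delta> \<Longrightarrow> t \<le> c - \<delta> \<Longrightarrow> step_at c \<delta> t = 0"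
  unfolding step_at_def by (rule step_0) (simp add: field_simps)

lemma step_at_1: "0 < \<delta> \<Longrightarrow> c + \<delta> \<le> t \<Longrightarrow> step_at c \<delta> t = 1"
  unfolding step_at_def by (rule step_1) (simp add: field_simps)

lemma rho_eq: "rho c \<delta> t = deriv step (inverse \<delta> * t + (- c * inverse \<delta>)) * inverse \<delta>"
proof -
  have "(step_at c \<delta> has_real_derivative deriv step (inverse \<delta> * t + (- c * inverse \<delta>)) * inverse \<delta>) (at t)"
    unfolding step_at_def[abs_def]
    by (rule DERIV_chain2[OF smooth1_D(1)[OF smooth1_step]]) (auto intro!: derivative_eq_intros)
  then show ?thesis unfolding rho_def by (rule DERIV_imp_deriv)
qed

lemma deriv_step_bounded: "\<exists>B. \<forall>t. \<bar>deriv step t\<bar> \<le> B"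
proof -
  have s: "supp_in (deriv step) 0 1"
    unfolding supp_in_def
  proof (intro allI impI)
    fix t :: real assume t: "\<not> \<bar>t - 0\<bar> \<le> 1"
    have "(step has_real_derivative 0) (at t)"
    proof (cases "t > 1")
      case True
      show ?thesis
        by (rule has_field_derivative_transform_within_open[OF DERIV_const[of 1] open_greaterThan[of 1]])
           (use True in \<open>auto simp: step_1\<close>)
    next
      case False
      show ?thesis
        by (rule has_field_derivative_transform_within_open[OF DERIV_const[of 0] open_lessThan[of "-1"]])
           (use t False in \<open>auto simp: step_0\<close>)
    qed
    then show "deriv step t = 0" by (rule DERIV_imp_deriv)
  qed
  have "bounded (deriv step ` {-1..1})"
    using smooth1_D(3)[OF smooth1_D(2)[OF smooth1_step]]
    by (meson compact_Icc compact_continuous_image compact_imp_bounded continuous_on_subset subset_UNIV)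
  then obtain B where B: "\<And>t. t \<in> {-1..1} \<Longrightarrow> \<bar>deriv step t\<bar> \<le> B"
    unfolding bounded_iff real_norm_def by blast
  have "\<bar>deriv step t\<bar> \<le> \<bar>B\<bar>" for t
  proof (cases "\<bar>t\<bar> \<le> 1")
    case True
    then have "t \<in> {-1..1}" by (auto simp: abs_le_iff)
    from B[OF this] show ?thesis by linarith
  next
    case False then show ?thesis using s by (auto simp: supp_in_def)
  qed
  then show ?thesis by blast
qed

definition step_bd :: real where
  "step_bd = (SOME B. \<forall>t. \<bar>deriv step t\<bar> \<le> B)"

lemma step_bd: "\<bar>deriv step t\<bar> \<le> step_bd" "0 \<le> step_bd"
proof -
  show *: "\<bar>deriv step t\<bar> \<le> step_bd" for t
    using someI_ex[OF deriv_step_bounded, folded step_bd_def] by blast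
  show "0 \<le> step_bd" using *[of 0] by linarith
qed

lemma rho_bound: "0 < \<delta> \<Longrightarrow> \<bar>rho c \<delta> t\<bar> \<le> step_bd / \<delta>"
  using step_bd(1) by (simp add: rho_eq abs_mult divide_inverse mult_right_mono)

text \<open>Outside both transition zones the two steps agree: both are 1 on the right and both are
  0 on the left.\<close>

lemma supp_in_step_at_diff:
  assumes "0 < \<delta>" "0 < \<delta>'" "\<bar>x - c\<bar> + \<delta> \<le> r" "\<bar>y - c\<bar> + \<delta>' \<le> r"
  shows "supp_in (\<lambda>t. step_at x \<delta> t - step_at y \<delta>' t) c r"
  unfolding supp_in_def
proof (intro allI impI)
  fix t assume "\<not> \<bar>t - c\<bar> \<le> r"
  then consider "t > c + r" | "t < c - r" by linarith
  then show "step_at x \<delta> t - step_at y \<delta>' t = 0"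
  proof cases
    case 1
    then have "x + \<delta> \<le> t" "y + \<delta>' \<le> t" using assms by linarith+
    then show ?thesis using assms by (simp add: step_at_1)
  next
    case 2
    then have "t \<le> x - \<delta>" "t \<le> y - \<delta>'" using assms by linarith+
    then show ?thesis using assms by (simp add: step_at_0)
  qed
qed

lemma supp_in_rho:
  assumes "0 < \<delta>" "\<bar>x - c\<bar> + \<delta> \<le> r"
  shows "supp_in (rho x \<delta>) c r"
proof -
  show ?thesis
    unfolding supp_in_def
  proof (intro allI impI)
    fix t assume t: "\<not> \<bar>t - c\<bar> \<le> r"
    have "(step_at x \<delta> has_real_derivative 0) (at t)"
    proof (cases "t > x + \<delta>")
      case True
      show ?thesis
        by (rule has_field_derivative_transform_within_open[OF DERIV_const[of 1] open_greaterThan[of "x + \<delta>"]])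
           (use True assms in \<open>auto simp: step_at_1\<close>)
    next
      case False
      then have "t < x - \<delta>" using t assms by linarith
      then show ?thesis
        by (intro has_field_derivative_transform_within_open[OF DERIV_const[of 0] open_lessThan[of "x - \<delta>"]])
           (use assms in \<open>auto simp: step_at_0\<close>)
    qed
    then show "rho x \<delta> t = 0" unfolding rho_def by (rule DERIV_imp_deriv)
  qed
qed

definition bump :: "real ^ 2 \<Rightarrow> real \<Rightarrow> real ^ 2 \<Rightarrow> real" where
  "bump x \<delta> = tensor (rho (x $ 1) \<delta>) (rho (x $ 2) \<delta>)"

definition avg :: "(real ^ 2 \<Rightarrow> real) \<Rightarrow> real ^ 2 \<Rightarrow> real \<Rightarrow> real" where
  "avg h x \<delta> = (\<integral>y. h y * bump x \<delta> y \<partial>lebesgue)"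

lemma deriv_step_at_diff: "deriv (\<lambda>t. step_at x \<delta> t - step_at y \<delta>' t) = (\<lambda>t. rho x \<delta> t - rho y \<delta>' t)"
proof
  show "deriv (\<lambda>t. step_at x \<delta> t - step_at y \<delta>' t) t = rho x \<delta> t - rho y \<delta>' t" for t
    unfolding rho_def
    by (intro DERIV_imp_deriv DERIV_diff smooth1_D(1) smooth1_step_at)
qed

lemma smooth_cs_bump: "0 < \<delta> \<Longrightarrow> smooth_cs (bump x \<delta>)"
  unfolding bump_def
  by (rule smooth_cs_tensor[OF smooth1_rho smooth1_rho supp_in_rho[of \<delta> "x $ 1" "x $ 1" \<delta>] supp_in_rho[of \<delta> "x $ 2" "x $ 2" \<delta>]]) auto

text \<open>With \<open>R' = \<rho>\<^sub>1 - \<rho>\<^sub>2\<close> and \<open>\<rho> = \<kappa> + Q'\<close>, where \<open>\<kappa>\<close> is a fixed bump, one has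
  \<open>R' \<rho> = R' \<kappa> + R' Q'\<close>; the primitives \<open>R\<close> and \<open>Q\<close> are bounded by 1 and \<open>R\<close> has small support.\<close>

lemma mixed_half:
  assumes mb: "mixed_bound h p r C" and C: "0 \<le> C" and h: "sq_int lebesgue h" and r: "0 < r"
    and d: "0 < \<delta>" "0 < \<delta>'" "0 < \<delta>''"
    and x: "\<bar>x - c\<bar> + \<delta> \<le> r" "\<bar>y - c\<bar> + \<delta>' \<le> r" "\<bar>z - c'\<bar> + \<delta>'' \<le> r"
  shows "c = p $ 1 \<Longrightarrow> c' = p $ 2 \<Longrightarrow> \<bar>\<integral>w. h w * tensor (\<lambda>t. rho x \<delta> t - rho y \<delta>' t) (rho z \<delta>'') w \<partial>lebesgue\<bar>
      \<le> C * (1 + step_bd / r) * sqrt (4 * (\<bar>x - y\<bar> + \<delta> + \<delta>') * r)"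
    and "c = p $ 2 \<Longrightarrow> c' = p $ 1 \<Longrightarrow> \<bar>\<integral>w. h w * tensor (rho z \<delta>'') (\<lambda>t. rho x \<delta> t - rho y \<delta>' t) w \<partial>lebesgue\<bar>
      \<le> C * (1 + step_bd / r) * sqrt (4 * (\<bar>x - y\<bar> + \<delta> + \<delta>') * r)"
proof -
  define R where "R t = step_at x \<delta> t - step_at y \<delta>' t" for t
  define Q where "Q t = step_at z \<delta>'' t - step_at c' r t" for t
  define k where "k = rho c' r"
  define l where "l = \<bar>x - y\<bar> + \<delta> + \<delta>'"
  have smR: "smooth1 R" and smQ: "smooth1 Q" and smk: "smooth1 k"
    unfolding R_def[abs_def] Q_def[abs_def] k_def by (intro smooth1_diff smooth1_step_at smooth1_rho)+
  have sR: "supp_in R c r" unfolding R_def[abs_def] by (rule supp_in_step_at_diff) (use d x in auto)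
  \<comment> \<open>The same support described twice: the interval around \<open>c\<close> makes
    \<open>R\<close> admissible in \<open>mixed_bound\<close>, the one around \<open>x\<close> has
    the small half-width that enters its norm.\<close>
  have sRl: "supp_in R x l" unfolding R_def[abs_def] l_def by (rule supp_in_step_at_diff) (use d in auto)
  have sQ: "supp_in Q c' r" unfolding Q_def[abs_def] by (rule supp_in_step_at_diff) (use d x r in auto)
  have sk: "supp_in k c' r" unfolding k_def by (rule supp_in_rho) (use r in auto)
  have R1: "\<bar>R t\<bar> \<le> 1" and Q1: "\<bar>Q t\<bar> \<le> 1" for t
    using step_at_01[of x \<delta> t] step_at_01[of y \<delta>' t] step_at_01[of z \<delta>'' t] step_at_01[of c' r t]
    by (auto simp: R_def Q_def abs_le_iff)
  have kb: "\<bar>k t\<bar> \<le> step_bd / r" for t unfolding k_def by (rule rho_bound[OF r])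
  have dR: "deriv R = (\<lambda>t. rho x \<delta> t - rho y \<delta>' t)"
    unfolding R_def[abs_def] by (rule deriv_step_at_diff)
  have dQ: "rho z \<delta>'' t = k t + deriv Q t" for t
    unfolding Q_def[abs_def] deriv_step_at_diff k_def by simp
  have l0: "0 \<le> l" using d by (simp add: l_def)
  \<comment> \<open>The norm of a tensor splits into one-variable norms, so exchanging the factors
    leaves it unchanged and the second coordinate can reuse \<open>b1\<close> and
    \<open>b2\<close>.\<close>
  have sw: "L2n (tensor P S) = L2n (tensor S P)"
    if "smooth1 P" "smooth1 S" "supp_in P c1 r1" "supp_in S c2 r2" for P S c1 r1 c2 r2
  proof -
    have 1: "\<integral>x. (norm (tensor P S x))\<^sup>2 \<partial>lebesgue = (\<integral>t. (P t)\<^sup>2 \<partial>lborel) * (\<integral>t. (S t)\<^sup>2 \<partial>lborel)"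
      if "smooth1 P" "smooth1 S" "supp_in P c1 r1" "supp_in S c2 r2" for P S c1 r1 c2 r2
    proof -
      have sq: "smooth1 (\<lambda>t. P t * P t)" "smooth1 (\<lambda>t. S t * S t)" using that smooth1_mult by blast+
      have su: "supp_in (\<lambda>t. P t * P t) c1 r1" "supp_in (\<lambda>t. S t * S t) c2 r2" using that by (auto simp: supp_in_def)
      have cs: "smooth_cs (tensor (\<lambda>t. P t * P t) (\<lambda>t. S t * S t))" by (rule smooth_cs_tensor[OF sq su])
      obtain T where T: "compact T" "\<And>x. x \<notin> T \<Longrightarrow> tensor (\<lambda>t. P t * P t) (\<lambda>t. S t * S t) x = 0"
        using csmE[OF cs] by blast
      have il: "integrable lborel (tensor (\<lambda>t. P t * P t) (\<lambda>t. S t * S t))"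
        by (rule cc_integrable(1)[OF smooth_cont[OF smooth_cs_smooth[OF cs]] T])
      have "(\<integral>x. (norm (tensor P S x))\<^sup>2 \<partial>lebesgue) = (\<integral>x. tensor (\<lambda>t. P t * P t) (\<lambda>t. S t * S t) x \<partial>lebesgue)"
        by (rule Bochner_Integration.integral_cong) (auto simp: tensor_def power2_eq_square mult_ac)
      also have "\<dots> = (\<integral>t. P t * P t \<partial>lborel) * (\<integral>t. S t * S t \<partial>lborel)"
        by (rule integral_tensor[OF il]) (use sq smooth1_D(3) in \<open>auto intro: borel_measurable_continuous_onI\<close>)
      finally show ?thesis by (simp add: power2_eq_square)
    qed
    show ?thesis
      unfolding l2norm_def 1[OF that] 1[OF that(2,1,4,3)] by (simp add: mult.commute)
  qed
  have b1: "L2n (tensor R k) \<le> step_bd / r * sqrt (4 * l * r)"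
    by (rule l2norm_tensor_le[OF smR sRl R1 smk sk kb l0]) (use r step_bd in auto)
  have b2: "L2n (tensor R Q) \<le> 1 * sqrt (4 * l * r)"
    by (rule l2norm_tensor_le[OF smR sRl R1 smQ sQ Q1 l0]) (use r in auto)
  have S: "C * L2n (tensor R k) + C * L2n (tensor R Q) \<le> C * (1 + step_bd / r) * sqrt (4 * l * r)"
    using mult_left_mono[OF add_mono[OF b1 b2] C] by (simp add: algebra_simps)
  have sdR: "supp_in (deriv R) c r" "supp_in (deriv Q) c' r" using supp_in_deriv smR smQ sR sQ by auto
  have smd: "smooth1 (deriv R)" "smooth1 (deriv Q)" using smooth1_D(2) smR smQ by auto
  have int: "integrable lebesgue (\<lambda>w. h w * tensor P S w)"
    if "smooth1 P" "smooth1 S" "supp_in P c1 r1" "supp_in S c2 r2" for P S c1 r1 c2 r2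
    using sq_int_inner[OF h smooth_cs_sq_int[OF smooth_cs_tensor[OF that]]] by simp
  {
    assume c: "c = p $ 1" "c' = p $ 2"
    have "(\<integral>w. h w * tensor (\<lambda>t. rho x \<delta> t - rho y \<delta>' t) (rho z \<delta>'') w \<partial>lebesgue)
      = (\<integral>w. h w * tensor (deriv R) k w + h w * tensor (deriv R) (deriv Q) w \<partial>lebesgue)"
      by (rule Bochner_Integration.integral_cong) (simp_all add: tensor_def dR dQ algebra_simps)
    also have "\<dots> = (\<integral>w. h w * tensor (deriv R) k w \<partial>lebesgue) + (\<integral>w. h w * tensor (deriv R) (deriv Q) w \<partial>lebesgue)"
      by (rule Bochner_Integration.integral_add) (rule int; (rule smd smk sdR sk))+
    also have "\<bar>\<dots>\<bar> \<le> C * L2n (tensor R k) + C * L2n (tensor R Q)"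
    proof -
      have "\<bar>\<integral>w. h w * tensor (deriv R) k w \<partial>lebesgue\<bar> \<le> C * L2n (tensor R k)"
        using mb smR smk sR sk c unfolding mixed_bound_def by blast
      moreover have "\<bar>\<integral>w. h w * tensor (deriv R) (deriv Q) w \<partial>lebesgue\<bar> \<le> C * L2n (tensor R Q)"
        using mb smR smQ sR sQ c unfolding mixed_bound_def by blast
      ultimately show ?thesis by linarith
    qed
    finally show "\<bar>\<integral>w. h w * tensor (\<lambda>t. rho x \<delta> t - rho y \<delta>' t) (rho z \<delta>'') w \<partial>lebesgue\<bar>
      \<le> C * (1 + step_bd / r) * sqrt (4 * (\<bar>x - y\<bar> + \<delta> + \<delta>') * r)"
      using S unfolding l_def by linarith
  next
    assume c: "c = p $ 2" "c' = p $ 1"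
    have "(\<integral>w. h w * tensor (rho z \<delta>'') (\<lambda>t. rho x \<delta> t - rho y \<delta>' t) w \<partial>lebesgue)
      = (\<integral>w. h w * tensor k (deriv R) w + h w * tensor (deriv Q) (deriv R) w \<partial>lebesgue)"
      by (rule Bochner_Integration.integral_cong) (simp_all add: tensor_def dR dQ algebra_simps)
    also have "\<dots> = (\<integral>w. h w * tensor k (deriv R) w \<partial>lebesgue) + (\<integral>w. h w * tensor (deriv Q) (deriv R) w \<partial>lebesgue)"
      by (rule Bochner_Integration.integral_add) (rule int; (rule smd smk sdR sk))+
    also have "\<bar>\<dots>\<bar> \<le> C * L2n (tensor k R) + C * L2n (tensor Q R)"
    proof -
      have "\<bar>\<integral>w. h w * tensor k (deriv R) w \<partial>lebesgue\<bar> \<le> C * L2n (tensor k R)"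
        using mb smR smk sR sk c unfolding mixed_bound_def by blast
      moreover have "\<bar>\<integral>w. h w * tensor (deriv Q) (deriv R) w \<partial>lebesgue\<bar> \<le> C * L2n (tensor Q R)"
        using mb smR smQ sR sQ c unfolding mixed_bound_def by blast
      ultimately show ?thesis by linarith
    qed
    finally have "\<bar>\<integral>w. h w * tensor (rho z \<delta>'') (\<lambda>t. rho x \<delta> t - rho y \<delta>' t) w \<partial>lebesgue\<bar>
      \<le> C * L2n (tensor R k) + C * L2n (tensor R Q)"
      unfolding sw[OF smk smR sk sR] sw[OF smQ smR sQ sR] .
    then show "\<bar>\<integral>w. h w * tensor (rho z \<delta>'') (\<lambda>t. rho x \<delta> t - rho y \<delta>' t) w \<partial>lebesgue\<bar>
      \<le> C * (1 + step_bd / r) * sqrt (4 * (\<bar>x - y\<bar> + \<delta> + \<delta>') * r)"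
      using S unfolding l_def by linarith
  }
qed

text \<open>The factor 2 counts the two coordinates exchanged in \<open>avg_diff\<close>; each
  contributes the constant of \<open>mixed_half\<close>.\<close>

definition mod_const :: "real \<Rightarrow> real" where
  "mod_const r = 2 * (1 + step_bd / r) * sqrt (4 * r)"

lemma mod_const_nonneg: "0 < r \<Longrightarrow> 0 \<le> mod_const r"
  using step_bd(2) by (simp add: mod_const_def)

text \<open>One bump is changed into the other a coordinate at a time, through the product of the
  kernel of \<open>y\<close> in the first variable and that of \<open>x\<close> in the second.
  Centres and widths vary together, so the same estimate yields convergence of the averages and a
  modulus of continuity.\<close>

lemma avg_diff:
  assumes mb: "mixed_bound h p r C" and C: "0 \<le> C" and h: "sq_int lebesgue h" and r: "0 < r"
    and d: "0 < \<delta>" "\<delta> \<le> r / 2" "0 < \<delta>'" "\<delta>' \<le> r / 2" and xy: "x \<in> square p (r / 2)" "y \<in> square p (r / 2)"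
  shows "\<bar>avg h x \<delta> - avg h y \<delta>'\<bar> \<le> C * mod_const r * sqrt (\<bar>x $ 1 - y $ 1\<bar> + \<bar>x $ 2 - y $ 2\<bar> + \<delta> + \<delta>')"
proof -
  let ?l = "\<bar>x $ 1 - y $ 1\<bar> + \<bar>x $ 2 - y $ 2\<bar> + \<delta> + \<delta>'"
  have X: "\<bar>x $ 1 - p $ 1\<bar> + \<delta> \<le> r" "\<bar>x $ 2 - p $ 2\<bar> + \<delta> \<le> r"
    "\<bar>y $ 1 - p $ 1\<bar> + \<delta>' \<le> r" "\<bar>y $ 2 - p $ 2\<bar> + \<delta>' \<le> r"
    using xy d by (auto simp: square_def)
  let ?T1 = "tensor (\<lambda>t. rho (x $ 1) \<delta> t - rho (y $ 1) \<delta>' t) (rho (x $ 2) \<delta>)"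
  let ?T2 = "tensor (rho (y $ 1) \<delta>') (\<lambda>t. rho (x $ 2) \<delta> t - rho (y $ 2) \<delta>' t)"
  have m1: "\<bar>\<integral>w. h w * ?T1 w \<partial>lebesgue\<bar> \<le> C * (1 + step_bd / r) * sqrt (4 * (\<bar>x $ 1 - y $ 1\<bar> + \<delta> + \<delta>') * r)"
    by (rule mixed_half(1)[OF mb C h r d(1,3,1) X(1,3,2)]) auto
  have m2: "\<bar>\<integral>w. h w * ?T2 w \<partial>lebesgue\<bar> \<le> C * (1 + step_bd / r) * sqrt (4 * (\<bar>x $ 2 - y $ 2\<bar> + \<delta> + \<delta>') * r)"
    by (rule mixed_half(2)[OF mb C h r d(1,3,3) X(2,4,3)]) auto
  have ib: "integrable lebesgue (\<lambda>w. h w * bump z \<epsilon> w)" if "0 < \<epsilon>" for z \<epsilon>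
    using sq_int_inner[OF h smooth_cs_sq_int[OF smooth_cs_bump[OF that]]] by simp
  have iT: "integrable lebesgue (\<lambda>w. h w * ?T1 w)" "integrable lebesgue (\<lambda>w. h w * ?T2 w)"
  proof -
    have "smooth_cs ?T1"
      using X d by (intro smooth_cs_tensor[of _ _ "p $ 1" r "p $ 2" r] smooth1_diff smooth1_rho)
        (use supp_in_rho[OF d(1) X(1)] supp_in_rho[OF d(3) X(3)] supp_in_rho[OF d(1) X(2)] in \<open>auto simp: supp_in_def\<close>)
    moreover have "smooth_cs ?T2"
      using X d by (intro smooth_cs_tensor[of _ _ "p $ 1" r "p $ 2" r] smooth1_diff smooth1_rho)
        (use supp_in_rho[OF d(1) X(2)] supp_in_rho[OF d(3) X(3)] supp_in_rho[OF d(3) X(4)] in \<open>auto simp: supp_in_def\<close>)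
    ultimately show "integrable lebesgue (\<lambda>w. h w * ?T1 w)" "integrable lebesgue (\<lambda>w. h w * ?T2 w)"
      using sq_int_inner[OF h smooth_cs_sq_int] by auto
  qed
  have "avg h x \<delta> - avg h y \<delta>' = (\<integral>w. h w * bump x \<delta> w - h w * bump y \<delta>' w \<partial>lebesgue)"
    unfolding avg_def by (rule Bochner_Integration.integral_diff[OF ib[OF d(1)] ib[OF d(3)], symmetric])
  also have "\<dots> = (\<integral>w. h w * ?T1 w + h w * ?T2 w \<partial>lebesgue)"
    by (rule Bochner_Integration.integral_cong) (simp_all add: bump_def tensor_def algebra_simps)
  also have "\<dots> = (\<integral>w. h w * ?T1 w \<partial>lebesgue) + (\<integral>w. h w * ?T2 w \<partial>lebesgue)"
    by (rule Bochner_Integration.integral_add[OF iT])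
  also have "\<bar>\<dots>\<bar> \<le> C * (1 + step_bd / r) * sqrt (4 * ?l * r) + C * (1 + step_bd / r) * sqrt (4 * ?l * r)"
  proof -
    have c0: "0 \<le> C * (1 + step_bd / r)" using C step_bd(2) r by simp
    have "sqrt (4 * (\<bar>x $ 1 - y $ 1\<bar> + \<delta> + \<delta>') * r) \<le> sqrt (4 * ?l * r)"
      "sqrt (4 * (\<bar>x $ 2 - y $ 2\<bar> + \<delta> + \<delta>') * r) \<le> sqrt (4 * ?l * r)"
      using r by (auto intro!: mult_right_mono)
    from this[THEN mult_left_mono[OF _ c0]] show ?thesis using m1 m2 by linarith
  qed
  also have "\<dots> = C * mod_const r * sqrt ?l"
  proof -
    have "4 * ?l * r = (4 * r) * ?l" by simp
    then have "sqrt (4 * ?l * r) = sqrt (4 * r) * sqrt ?l" by (simp only: real_sqrt_mult)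
    then show ?thesis by (simp add: mod_const_def algebra_simps)
  qed
  finally show ?thesis .
qed

text \<open>A limit of averages does not see null sets, so this is a canonical choice of pointwise
  values. Where the averages diverge, \<open>lim\<close> has an unspecified value.\<close>

definition rep :: "(real ^ 2 \<Rightarrow> real) \<Rightarrow> real ^ 2 \<Rightarrow> real" where
  "rep h x = lim (\<lambda>m. avg h x (1 / real (Suc m)))"

lemma self_square: "0 \<le> r \<Longrightarrow> x \<in> square x r"
  by (simp add: square_def)

lemma avg_tendsto_rep:
  assumes mb: "mixed_bound h x r C" and C: "0 \<le> C" and h: "sq_int lebesgue h" and r: "0 < r"
  shows "(\<lambda>m. avg h x (1 / real (Suc m))) \<longlonglongrightarrow> rep h x"
proof -
  let ?X = "\<lambda>m. avg h x (1 / real (Suc m))"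
  have s0: "(\<lambda>m. C * mod_const r * sqrt (2 * (1 / real (Suc m)))) \<longlonglongrightarrow> C * mod_const r * sqrt (2 * 0)"
    by (intro tendsto_intros LIMSEQ_Suc lim_1_over_n)
  have "Cauchy ?X"
  proof (rule metric_CauchyI)
    fix e :: real assume e: "0 < e"
    have "\<forall>\<^sub>F m in sequentially. C * mod_const r * sqrt (2 * (1 / real (Suc m))) < e"
      using order_tendstoD(2)[OF s0, of e] e by simp
    moreover have "\<forall>\<^sub>F m in sequentially. 1 / real (Suc m) < r / 2"
      using order_tendstoD(2)[OF LIMSEQ_Suc[OF lim_1_over_n], of "r / 2"] r by simp
    ultimately obtain N where N: "C * mod_const r * sqrt (2 * (1 / real (Suc N))) < e" "1 / real (Suc N) < r / 2"
      by (metis (mono_tags, lifting) eventually_conj eventually_sequentially order_refl)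
    show "\<exists>M. \<forall>m\<ge>M. \<forall>n\<ge>M. dist (?X m) (?X n) < e"
    proof (intro exI[of _ N] allI impI)
      fix m n assume mn: "N \<le> m" "N \<le> n"
      have le: "1 / real (Suc m) \<le> 1 / real (Suc N)" "1 / real (Suc n) \<le> 1 / real (Suc N)"
        using mn by (auto intro!: divide_left_mono)
      have "\<bar>?X m - ?X n\<bar> \<le> C * mod_const r * sqrt (\<bar>x $ 1 - x $ 1\<bar> + \<bar>x $ 2 - x $ 2\<bar> + 1 / real (Suc m) + 1 / real (Suc n))"
        by (rule avg_diff[OF mb C h r]) (use le N(2) r in \<open>auto intro!: self_square\<close>)
      also have "\<dots> \<le> C * mod_const r * sqrt (2 * (1 / real (Suc N)))"
        using C mod_const_nonneg[OF r] le by (intro mult_left_mono) auto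
      finally show "dist (?X m) (?X n) < e" using N(1) by (simp add: dist_real_def)
    qed
  qed
  then have "convergent ?X" by (simp add: Cauchy_convergent_iff)
  then show ?thesis unfolding rep_def by (simp add: convergent_LIMSEQ_iff)
qed

lemma eventually_small: "0 < r \<Longrightarrow> \<forall>\<^sub>F m in sequentially. 1 / real (Suc m) \<le> r"
  using order_tendstoD(2)[OF LIMSEQ_Suc[OF lim_1_over_n], of r] by (auto elim: eventually_mono)

lemma rep_avg:
  assumes mb: "mixed_bound h x r C" and C: "0 \<le> C" and h: "sq_int lebesgue h" and r: "0 < r"
    and d: "0 < \<delta>" "\<delta> \<le> r / 2"
  shows "\<bar>rep h x - avg h x \<delta>\<bar> \<le> C * mod_const r * sqrt \<delta>"
proof (rule tendsto_le[OF sequentially_bot])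
  show "(\<lambda>m. \<bar>avg h x (1 / real (Suc m)) - avg h x \<delta>\<bar>) \<longlonglongrightarrow> \<bar>rep h x - avg h x \<delta>\<bar>"
    by (intro tendsto_intros avg_tendsto_rep[OF mb C h r])
  have "(\<lambda>m. C * mod_const r * sqrt (1 / real (Suc m) + \<delta>)) \<longlonglongrightarrow> C * mod_const r * sqrt (0 + \<delta>)"
    by (intro tendsto_intros LIMSEQ_Suc lim_1_over_n)
  then show "(\<lambda>m. C * mod_const r * sqrt (1 / real (Suc m) + \<delta>)) \<longlonglongrightarrow> C * mod_const r * sqrt \<delta>" by simp
  have r2: "0 < r / 2" using r by simp
  show "\<forall>\<^sub>F m in sequentially. \<bar>avg h x (1 / real (Suc m)) - avg h x \<delta>\<bar> \<le> C * mod_const r * sqrt (1 / real (Suc m) + \<delta>)"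
    using eventually_small[OF r2]
  proof eventually_elim
    case (elim m)
    have "\<bar>avg h x (1 / real (Suc m)) - avg h x \<delta>\<bar>
      \<le> C * mod_const r * sqrt (\<bar>x $ 1 - x $ 1\<bar> + \<bar>x $ 2 - x $ 2\<bar> + 1 / real (Suc m) + \<delta>)"
      by (rule avg_diff[OF mb C h r]) (use elim d r in \<open>auto intro!: self_square\<close>)
    then show ?case by simp
  qed
qed

lemma rep_modulus:
  assumes mb: "mixed_bound h x r C" "mixed_bound h y r C" and C: "0 \<le> C" and h: "sq_int lebesgue h" and r: "0 < r"
    and y: "y \<in> square x (r / 2)"
  shows "\<bar>rep h x - rep h y\<bar> \<le> C * mod_const r * sqrt (\<bar>x $ 1 - y $ 1\<bar> + \<bar>x $ 2 - y $ 2\<bar>)"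
proof (rule tendsto_le[OF sequentially_bot])
  let ?d = "\<lambda>m. 1 / real (Suc m)"
  let ?l = "\<bar>x $ 1 - y $ 1\<bar> + \<bar>x $ 2 - y $ 2\<bar>"
  show "(\<lambda>m. \<bar>avg h x (?d m) - avg h y (?d m)\<bar>) \<longlonglongrightarrow> \<bar>rep h x - rep h y\<bar>"
    by (intro tendsto_intros avg_tendsto_rep[OF mb(1) C h r] avg_tendsto_rep[OF mb(2) C h r])
  have "(\<lambda>m. C * mod_const r * sqrt (?l + ?d m + ?d m)) \<longlonglongrightarrow> C * mod_const r * sqrt (?l + 0 + 0)"
    by (intro tendsto_intros LIMSEQ_Suc lim_1_over_n)
  then show "(\<lambda>m. C * mod_const r * sqrt (?l + ?d m + ?d m)) \<longlonglongrightarrow> C * mod_const r * sqrt ?l" by simp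
  have r2: "0 < r / 2" using r by simp
  show "\<forall>\<^sub>F m in sequentially. \<bar>avg h x (?d m) - avg h y (?d m)\<bar> \<le> C * mod_const r * sqrt (?l + ?d m + ?d m)"
    using eventually_small[OF r2]
  proof eventually_elim
    case (elim m)
    show ?case
      by (rule avg_diff[OF mb(1) C h r]) (use elim r y in \<open>auto intro!: self_square\<close>)
  qed
qed

subsection \<open>Mollification\<close>

lemma lborel_avg:
  assumes "h \<in> borel_measurable borel" "0 < \<delta>"
  shows "avg h x \<delta> = (\<integral>y. h y * bump x \<delta> y \<partial>lborel)"
proof -
  have [measurable]: "bump x \<delta> \<in> borel_measurable borel" by (rule smooth_cs_borel[OF smooth_cs_bump[OF assms(2)]])
  show ?thesis unfolding avg_def using assms(1) by (subst integral_completion) auto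
qed

lemma bump_pair_measurable [measurable]: "(\<lambda>(x, y). bump x \<delta> y) \<in> borel_measurable (borel \<Otimes>\<^sub>M borel)"
proof -
  have [measurable]: "deriv step \<in> borel_measurable borel"
    using smooth1_D(3)[OF smooth1_D(2)[OF smooth1_step]] by (rule borel_measurable_continuous_onI)
  show ?thesis unfolding bump_def tensor_def rho_eq by measurable
qed

lemma bump_bound: "0 < \<delta> \<Longrightarrow> \<bar>bump x \<delta> y\<bar> \<le> (step_bd / \<delta>)\<^sup>2 * indicator (square x \<delta>) y"
proof -
  assume d: "0 < \<delta>"
  show ?thesis
  proof (cases "y \<in> square x \<delta>")
    case True
    have "\<bar>rho (x $ 1) \<delta> (y $ 1)\<bar> * \<bar>rho (x $ 2) \<delta> (y $ 2)\<bar> \<le> (step_bd / \<delta>) * (step_bd / \<delta>)"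
      using step_bd(2) d by (intro mult_mono rho_bound) auto
    then show ?thesis using True by (simp add: bump_def tensor_def abs_mult power2_eq_square)
  next
    case False
    then have "bump x \<delta> y = 0" unfolding bump_def
      by (intro tensor_outside[of _ x \<delta>] supp_in_rho) (use d in auto)
    then show ?thesis using step_bd(2) by simp
  qed
qed

lemma emeasure_square: "0 \<le> \<delta> \<Longrightarrow> emeasure lborel (square x \<delta>) = ennreal (4 * \<delta>\<^sup>2)"
  unfolding square_cbox by (subst emeasure_lborel_cbox)
    (auto simp: prod_Basis_vec2 inner_axis_2 power2_eq_square, auto simp: Basis_vec2 inner_axis_2)

lemma square_sym: "y \<in> square x \<delta> \<longleftrightarrow> x \<in> square y \<delta>"
  by (auto simp: square_def abs_minus_commute)

text \<open>Monotonicity of \<open>step\<close> is not part of its description, so the kernels may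
  change sign; the bound is supremum times area, and the width \<open>\<delta>\<close>
  cancels.\<close>

lemma nn_integral_bump:
  assumes "0 < \<delta>"
  shows "(\<integral>\<^sup>+y. ennreal \<bar>bump x \<delta> y\<bar> \<partial>lborel) \<le> ennreal (4 * step_bd\<^sup>2)"
    and "(\<integral>\<^sup>+x. ennreal \<bar>bump x \<delta> y\<bar> \<partial>lborel) \<le> ennreal (4 * step_bd\<^sup>2)"
proof -
  have e: "(step_bd / \<delta>)\<^sup>2 * (4 * \<delta>\<^sup>2) = 4 * step_bd\<^sup>2"
    using assms by (simp add: power_divide)
  have "(\<integral>\<^sup>+y. ennreal \<bar>bump x \<delta> y\<bar> \<partial>lborel) \<le> (\<integral>\<^sup>+y. ennreal ((step_bd / \<delta>)\<^sup>2) * indicator (square x \<delta>) y \<partial>lborel)"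
  proof (rule nn_integral_mono)
    show "ennreal \<bar>bump x \<delta> y\<bar> \<le> ennreal ((step_bd / \<delta>)\<^sup>2) * indicator (square x \<delta>) y" for y
      using bump_bound[OF assms, of x y] by (cases "y \<in> square x \<delta>") (auto intro!: ennreal_leI)
  qed
  also have "\<dots> = ennreal (4 * step_bd\<^sup>2)"
    using assms by (subst nn_integral_cmult_indicator) (auto simp: emeasure_square e simp flip: ennreal_mult)
  finally show "(\<integral>\<^sup>+y. ennreal \<bar>bump x \<delta> y\<bar> \<partial>lborel) \<le> ennreal (4 * step_bd\<^sup>2)" .
  have "(\<integral>\<^sup>+x. ennreal \<bar>bump x \<delta> y\<bar> \<partial>lborel) \<le> (\<integral>\<^sup>+x. ennreal ((step_bd / \<delta>)\<^sup>2) * indicator (square y \<delta>) x \<partial>lborel)"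
  proof (rule nn_integral_mono)
    show "ennreal \<bar>bump x \<delta> y\<bar> \<le> ennreal ((step_bd / \<delta>)\<^sup>2) * indicator (square y \<delta>) x" for x
      using bump_bound[OF assms, of x y] square_sym[of y x \<delta>]
      by (cases "x \<in> square y \<delta>") (auto intro!: ennreal_leI)
  qed
  also have "\<dots> = ennreal (4 * step_bd\<^sup>2)"
    using assms by (subst nn_integral_cmult_indicator) (auto simp: emeasure_square e simp flip: ennreal_mult)
  finally show "(\<integral>\<^sup>+x. ennreal \<bar>bump x \<delta> y\<bar> \<partial>lborel) \<le> ennreal (4 * step_bd\<^sup>2)" .
qed

lemma avg_measurable:
  assumes [measurable]: "h \<in> borel_measurable borel" and "0 < \<delta>"
  shows "(\<lambda>x. avg h x \<delta>) \<in> borel_measurable borel"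
proof -
  have "(\<lambda>x. \<integral>y. h y * bump x \<delta> y \<partial>lborel) \<in> borel_measurable borel"
  proof (rule lborel.borel_measurable_lebesgue_integral)
    have "(\<lambda>(x, y). h y * bump x \<delta> y) \<in> borel_measurable (borel \<Otimes>\<^sub>M borel)" by measurable
    then show "(\<lambda>(x, y). h y * bump x \<delta> y) \<in> borel_measurable (borel \<Otimes>\<^sub>M lborel)"
      by (simp cong: measurable_cong_sets sets_pair_measure_cong)
  qed
  then show ?thesis using assms by (simp add: lborel_avg)
qed

text \<open>By Fubini the kernel is integrated over its centre first. The constant does not depend
  on the width, which allows Fatou's lemma in \<open>rep_AE\<close>.\<close>

lemma avg_L1:
  assumes h [measurable]: "h \<in> borel_measurable borel" and d: "0 < \<delta>"
  shows "(\<integral>\<^sup>+x. ennreal \<bar>avg h x \<delta>\<bar> \<partial>lborel) \<le> ennreal (4 * step_bd\<^sup>2) * (\<integral>\<^sup>+y. ennreal \<bar>h y\<bar> \<partial>lborel)"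
proof -
  have [measurable]: "bump x \<delta> \<in> borel_measurable borel" for x by (rule smooth_cs_borel[OF smooth_cs_bump[OF d]])
  have [measurable]: "(\<lambda>x. bump x \<delta> y) \<in> borel_measurable borel" for y
    using measurable_compose_Pair1[of y borel "\<lambda>(y, x). bump x \<delta> y" borel borel]
    by (simp add: measurable_split_conv) (use bump_pair_measurable in measurable)
  have mp: "(\<lambda>(x, y). ennreal \<bar>h y * bump x \<delta> y\<bar>) \<in> borel_measurable (lborel \<Otimes>\<^sub>M lborel)"
  proof -
    have "(\<lambda>(x, y). ennreal \<bar>h y * bump x \<delta> y\<bar>) \<in> borel_measurable (borel \<Otimes>\<^sub>M borel)" by measurable
    then show ?thesis by (simp cong: measurable_cong_sets sets_pair_measure_cong)
  qed
  have "(\<integral>\<^sup>+x. ennreal \<bar>avg h x \<delta>\<bar> \<partial>lborel) \<le> (\<integral>\<^sup>+x. (\<integral>\<^sup>+y. ennreal \<bar>h y * bump x \<delta> y\<bar> \<partial>lborel) \<partial>lborel)"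
  proof (rule nn_integral_mono)
    fix x
    show "ennreal \<bar>avg h x \<delta>\<bar> \<le> (\<integral>\<^sup>+y. ennreal \<bar>h y * bump x \<delta> y\<bar> \<partial>lborel)"
    proof (cases "integrable lborel (\<lambda>y. h y * bump x \<delta> y)")
      case True
      then show ?thesis
        using integral_norm_bound_ennreal[OF True] by (simp add: lborel_avg[OF h d])
    next
      \<comment> \<open>The Bochner integral of a non-integrable function is 0 by default, so the
        inequality is trivial.\<close>
      case False
      then show ?thesis by (simp add: lborel_avg[OF h d] not_integrable_integral_eq)
    qed
  qed
  also have "\<dots> = (\<integral>\<^sup>+y. (\<integral>\<^sup>+x. ennreal \<bar>h y * bump x \<delta> y\<bar> \<partial>lborel) \<partial>lborel)"
    using lborel_pair.Fubini'[OF mp] by simp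
  also have "\<dots> = (\<integral>\<^sup>+y. ennreal \<bar>h y\<bar> * (\<integral>\<^sup>+x. ennreal \<bar>bump x \<delta> y\<bar> \<partial>lborel) \<partial>lborel)"
    by (simp add: abs_mult ennreal_mult nn_integral_cmult)
  also have "\<dots> \<le> (\<integral>\<^sup>+y. ennreal \<bar>h y\<bar> * ennreal (4 * step_bd\<^sup>2) \<partial>lborel)"
    by (intro nn_integral_mono mult_left_mono nn_integral_bump(2)[OF d]) auto
  also have "\<dots> = ennreal (4 * step_bd\<^sup>2) * (\<integral>\<^sup>+y. ennreal \<bar>h y\<bar> \<partial>lborel)"
    by (subst nn_integral_multc) (auto simp: mult.commute)
  finally show ?thesis .
qed

lemma integral_rho:
  assumes "0 < \<delta>" shows "(\<integral>t. rho c \<delta> t \<partial>lborel) = 1"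
proof -
  have "(\<integral>t. rho c \<delta> t * indicator {c - \<delta>..c + \<delta>} t \<partial>lborel) = step_at c \<delta> (c + \<delta>) - step_at c \<delta> (c - \<delta>)"
  proof (rule integral_FTC_Icc_real)
    show "DERIV (step_at c \<delta>) t :> rho c \<delta> t" for t
      unfolding rho_def by (rule smooth1_D(1)[OF smooth1_step_at])
    show "isCont (rho c \<delta>) t" for t
      using smooth1_D(3)[OF smooth1_rho, of c \<delta>] by (simp add: continuous_on_eq_continuous_at)
  qed (use assms in auto)
  moreover have "rho c \<delta> t * indicator {c - \<delta>..c + \<delta>} t = rho c \<delta> t" for t
  proof (cases "t \<in> {c - \<delta>..c + \<delta>}")
    case False
    then have "\<not> \<bar>t - c\<bar> \<le> \<delta>" by (auto simp: abs_le_iff)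
    then show ?thesis using supp_in_rho[OF assms, of c c \<delta>] by (simp add: supp_in_def)
  qed simp
  ultimately show ?thesis using assms by (simp add: step_at_0 step_at_1)
qed

lemma integral_bump: "0 < \<delta> \<Longrightarrow> (\<integral>y. bump x \<delta> y \<partial>lebesgue) = 1"
proof -
  assume d: "0 < \<delta>"
  obtain T where T: "compact T" "\<And>y. y \<notin> T \<Longrightarrow> bump x \<delta> y = 0"
    using csmE[OF smooth_cs_bump[OF d]] by blast
  have "integrable lborel (bump x \<delta>)"
    by (rule cc_integrable(1)[OF smooth_cont[OF smooth_cs_smooth[OF smooth_cs_bump[OF d]]] T])
  then show ?thesis
    unfolding bump_def
    by (subst integral_tensor) (use smooth1_D(3)[OF smooth1_rho] d in \<open>auto intro: borel_measurable_continuous_onI simp: integral_rho\<close>)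
qed

lemma avg_tendsto_at_cont:
  assumes c: "integrable lebesgue c" "sq_int lebesgue c" and cont: "isCont c x"
  shows "(\<lambda>m. avg c x (1 / real (Suc m))) \<longlonglongrightarrow> c x"
proof (rule LIMSEQ_I)
  fix e :: real assume e: "0 < e"
  \<comment> \<open>The kernel has L1 norm at most \<open>4 * step_bd\<^sup>2\<close>; the added 1
    makes \<open>B\<close> positive and the final inequality strict.\<close>
  define B where "B = 4 * step_bd\<^sup>2 + 1"
  have B: "0 < B" by (simp add: B_def add_nonneg_pos)
  obtain s where s: "0 < s" "\<And>y. dist y x < s \<Longrightarrow> dist (c y) (c x) < e / B"
    using cont e B unfolding continuous_at_eps_delta by (metis divide_pos_pos)
  have s4: "0 < s / 4" using s by simp
  obtain N where N: "\<And>m. N \<le> m \<Longrightarrow> 1 / real (Suc m) \<le> s / 4"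
    using eventually_small[OF s4] unfolding eventually_sequentially by blast
  show "\<exists>N. \<forall>m\<ge>N. norm (avg c x (1 / real (Suc m)) - c x) < e"
  proof (intro exI[of _ N] allI impI)
    fix m assume m: "N \<le> m"
    let ?d = "1 / real (Suc m)"
    have d: "0 < ?d" by simp
    note ci = smooth_cs_integrable[OF smooth_cs_bump[OF d, of x]]
    have ib: "integrable lebesgue (\<lambda>y. c y * bump x ?d y)"
      using sq_int_inner[OF c(2) smooth_cs_sq_int[OF smooth_cs_bump[OF d]]] by simp
    have "avg c x ?d - c x = (\<integral>y. c y * bump x ?d y \<partial>lebesgue) - (\<integral>y. c x * bump x ?d y \<partial>lebesgue)"
      by (simp add: avg_def integral_bump)
    also have "\<dots> = (\<integral>y. (c y - c x) * bump x ?d y \<partial>lebesgue)"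
      unfolding left_diff_distrib
      by (rule Bochner_Integration.integral_diff[OF ib integrable_mult_right[OF ci], symmetric])
    also have "norm \<dots> \<le> (\<integral>y. e / B * \<bar>bump x ?d y\<bar> \<partial>lebesgue)"
    proof (rule order_trans[OF Bochner_Integration.integral_norm_bound integral_mono])
      show "integrable lebesgue (\<lambda>y. norm ((c y - c x) * bump x ?d y))"
        using ib ci by (simp add: left_diff_distrib)
      show "integrable lebesgue (\<lambda>y. e / B * \<bar>bump x ?d y\<bar>)" using ci by simp
      show "norm ((c y - c x) * bump x ?d y) \<le> e / B * \<bar>bump x ?d y\<bar>" for y
      proof (cases "y \<in> square x ?d")
        case True
        have "dist y x \<le> \<bar>y $ 1 - x $ 1\<bar> + \<bar>y $ 2 - x $ 2\<bar>"
          using norm_le_l1_cart[of "y - x"] by (simp add: sum_2 dist_norm)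
        also have "\<dots> < s" using True N[OF m] s(1) unfolding square_def by simp
        finally have "dist (c y) (c x) < e / B" by (rule s(2))
        then have "\<bar>c y - c x\<bar> * \<bar>bump x ?d y\<bar> \<le> e / B * \<bar>bump x ?d y\<bar>"
          by (intro mult_right_mono) (simp_all add: dist_real_def)
        then show ?thesis by (simp add: abs_mult)
      next
        case False
        then have "bump x ?d y = 0" using bump_bound[OF d, of x y] by simp
        then show ?thesis by simp
      qed
    qed
    also have "\<dots> = e / B * (\<integral>y. \<bar>bump x ?d y\<bar> \<partial>lebesgue)" by simp
    also have "\<dots> \<le> e / B * (4 * step_bd\<^sup>2)"
    proof (rule mult_left_mono)
      have [measurable]: "bump x ?d \<in> borel_measurable borel" by (rule smooth_cs_borel[OF smooth_cs_bump[OF d]])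
      have "(\<integral>y. \<bar>bump x ?d y\<bar> \<partial>lebesgue) = (\<integral>y. \<bar>bump x ?d y\<bar> \<partial>lborel)"
        by (rule integral_completion) measurable
      also have "\<dots> = enn2real (\<integral>\<^sup>+y. ennreal \<bar>bump x ?d y\<bar> \<partial>lborel)"
        by (rule integral_eq_nn_integral) auto
      also have "\<dots> \<le> 4 * step_bd\<^sup>2"
        using nn_integral_bump(1)[OF d, of x] by (intro enn2real_leI) auto
      finally show "(\<integral>y. \<bar>bump x ?d y\<bar> \<partial>lebesgue) \<le> 4 * step_bd\<^sup>2" .
    qed (use e B in simp)
    also have "\<dots> < e / B * B" using e B by (intro mult_strict_left_mono) (auto simp: B_def)
    finally show "norm (avg c x ?d - c x) < e" using B by simp
  qed
qed

lemma avg_cong_AE: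
  assumes "AE y in lebesgue. h y = h' y" "h \<in> borel_measurable lebesgue" "h' \<in> borel_measurable lebesgue" "0 < \<delta>"
  shows "avg h x \<delta> = avg h' x \<delta>"
proof -
  have [measurable]: "bump x \<delta> \<in> borel_measurable lebesgue"
    by (rule borel_lebesgue[OF smooth_cs_borel[OF smooth_cs_bump[OF assms(4)]]])
  note [measurable] = assms(2,3)
  show ?thesis unfolding avg_def
    by (rule integral_cong_AE) (use assms(1) in \<open>auto elim: eventually_mono\<close>)
qed

text \<open>Existence of the limit on \<open>K\<close> is assumed, so only its value has to be
  identified. Since averages of \<open>c k\<close> converge to \<open>c k\<close> almost everywhere,
  the distance of \<open>rep h\<close> from \<open>h\<close> is at most the liminf of the averaged
  error plus the error itself. By Fatou and \<open>avg_L1\<close> the integral of this bound is a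
  multiple of the L1 distance of \<open>h\<close> and \<open>c k\<close>. Almost everywhere
  continuity of \<open>c k\<close> is the right generality: the approximants of the flux jump across
  the interfaces.\<close>

lemma rep_AE:
  assumes h: "integrable lebesgue h" "sq_int lebesgue h"
    and c: "\<And>k. c k \<in> borel_measurable borel" "\<And>k. integrable lebesgue (c k)" "\<And>k. sq_int lebesgue (c k)"
      "\<And>k. AE x in lborel. isCont (c k) x"
    and lim: "(\<lambda>k. \<integral>x. \<bar>h x - c k x\<bar> \<partial>lebesgue) \<longlonglongrightarrow> 0"
    and conv: "\<And>x. x \<in> K \<Longrightarrow> (\<lambda>m. avg h x (1 / real (Suc m))) \<longlonglongrightarrow> rep h x"
  shows "AE x in lebesgue. x \<in> K \<longrightarrow> rep h x = h x"
proof -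
  let ?d = "\<lambda>m. 1 / real (Suc m)"
  have hm: "h \<in> borel_measurable lebesgue" using h by auto
  \<comment> \<open>A Borel version is chosen because Fubini and the measurability of averages are
    available for Borel functions; \<open>avg\<close> does not notice the change.\<close>
  obtain h' where h' [measurable]: "h' \<in> borel_measurable borel" and hh: "AE x in lborel. h x = h' x"
    using completion_ex_borel_measurable_real[OF hm] by auto
  have hh': "AE x in lebesgue. h x = h' x" using hh by (rule AE_completion)
  have ah: "avg h x (?d m) = avg h' x (?d m)" for x m
    by (rule avg_cong_AE[OF hh' hm borel_lebesgue[OF h']]) simp
  define D where "D k x = h' x - c k x" for k x
  note [measurable] = c(1)
  have Dm [measurable]: "D k \<in> borel_measurable borel" for k unfolding D_def by measurable
  have ib: "integrable lebesgue (\<lambda>y. f y * bump x (?d m) y)" if "sq_int lebesgue f" for f x m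
    using sq_int_inner[OF that smooth_cs_sq_int[OF smooth_cs_bump[of "?d m"]]] by simp
  have sh': "sq_int lebesgue h'" "integrable lebesgue h'"
  proof -
    have [measurable]: "h \<in> borel_measurable lebesgue" "h' \<in> borel_measurable lebesgue"
      using hm borel_lebesgue[OF h'] by auto
    show "integrable lebesgue h'"
      using h(1) hh' by (subst (asm) integrable_cong_AE[of h _ h']) auto
    have "integrable lebesgue (\<lambda>x. (norm (h' x))\<^sup>2)"
      using sqiD(2)[OF h(2)] hh'
      by (subst (asm) integrable_cong_AE[of "\<lambda>x. (norm (h x))\<^sup>2" _ "\<lambda>x. (norm (h' x))\<^sup>2"]) (auto elim: eventually_mono)
    then show "sq_int lebesgue h'" by (simp add: sq_int_def)
  qed
  have aD: "avg h' x (?d m) = avg (D k) x (?d m) + avg (c k) x (?d m)" for x m k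
  proof -
    have sD: "sq_int lebesgue (D k)" unfolding D_def[abs_def] by (rule sq_int_diff[OF sh'(1) c(3)])
    have "avg h' x (?d m) = (\<integral>y. D k y * bump x (?d m) y + c k y * bump x (?d m) y \<partial>lebesgue)"
      unfolding avg_def by (rule Bochner_Integration.integral_cong) (simp_all add: D_def algebra_simps)
    also have "\<dots> = avg (D k) x (?d m) + avg (c k) x (?d m)"
      unfolding avg_def by (rule Bochner_Integration.integral_add[OF ib[OF sD] ib[OF c(3)]])
    finally show ?thesis .
  qed
  define G where "G k x = liminf (\<lambda>m. ennreal \<bar>avg (D k) x (?d m)\<bar>) + ennreal \<bar>D k x\<bar>" for k x
  have am [measurable]: "(\<lambda>x. avg (D k) x (?d m)) \<in> borel_measurable borel" for k m
    by (rule avg_measurable[OF Dm]) simp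
  have Gm [measurable]: "G k \<in> borel_measurable borel" for k
    unfolding G_def by measurable
  define \<epsilon> where "\<epsilon> k = (\<integral>x. \<bar>h x - c k x\<bar> \<partial>lebesgue)" for k
  have nD: "(\<integral>\<^sup>+x. ennreal \<bar>D k x\<bar> \<partial>lborel) = ennreal (\<epsilon> k)" for k
  proof -
    have [measurable]: "h \<in> borel_measurable lebesgue" "h' \<in> borel_measurable lebesgue"
      "c k \<in> borel_measurable lebesgue" "D k \<in> borel_measurable lebesgue"
      using hm borel_lebesgue[OF h'] borel_lebesgue[OF c(1)] borel_lebesgue[OF Dm] by auto
    have "(\<integral>\<^sup>+x. ennreal \<bar>D k x\<bar> \<partial>lborel) = (\<integral>\<^sup>+x. ennreal \<bar>D k x\<bar> \<partial>lebesgue)"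
      by (rule nn_integral_completion[symmetric])
    also have "\<dots> = ennreal (\<integral>x. \<bar>D k x\<bar> \<partial>lebesgue)"
      by (rule nn_integral_eq_integral) (use sh'(2) c(2) in \<open>auto simp: D_def[abs_def]\<close>)
    also have "(\<integral>x. \<bar>D k x\<bar> \<partial>lebesgue) = \<epsilon> k"
      unfolding \<epsilon>_def by (rule integral_cong_AE) (use hh' in \<open>auto simp: D_def elim: eventually_mono\<close>)
    finally show ?thesis .
  qed
  have nG: "(\<integral>\<^sup>+x. G k x \<partial>lborel) \<le> ennreal ((4 * step_bd\<^sup>2 + 1) * \<epsilon> k)" for k
  proof -
    have "(\<integral>\<^sup>+x. G k x \<partial>lborel) = (\<integral>\<^sup>+x. liminf (\<lambda>m. ennreal \<bar>avg (D k) x (?d m)\<bar>) \<partial>lborel) + ennreal (\<epsilon> k)"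
    proof -
      have m1: "(\<lambda>x. liminf (\<lambda>m. ennreal \<bar>avg (D k) x (?d m)\<bar>)) \<in> borel_measurable lborel"
        and m2: "(\<lambda>x. ennreal \<bar>D k x\<bar>) \<in> borel_measurable lborel" by measurable
      show ?thesis unfolding G_def nn_integral_add[OF m1 m2] nD ..
    qed
    also have "(\<integral>\<^sup>+x. liminf (\<lambda>m. ennreal \<bar>avg (D k) x (?d m)\<bar>) \<partial>lborel)
      \<le> liminf (\<lambda>m. \<integral>\<^sup>+x. ennreal \<bar>avg (D k) x (?d m)\<bar> \<partial>lborel)"
      by (rule nn_integral_liminf) measurable
    also have "\<dots> \<le> liminf (\<lambda>m. ennreal (4 * step_bd\<^sup>2) * ennreal (\<epsilon> k))"
    proof (rule Liminf_mono, rule always_eventually, rule allI)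
      show "(\<integral>\<^sup>+x. ennreal \<bar>avg (D k) x (?d m)\<bar> \<partial>lborel) \<le> ennreal (4 * step_bd\<^sup>2) * ennreal (\<epsilon> k)" for m
        using avg_L1[OF Dm, of "?d m" k] by (simp add: nD)
    qed
    also have "\<dots> = ennreal (4 * step_bd\<^sup>2) * ennreal (\<epsilon> k)" by (simp add: Liminf_const)
    also have "\<dots> + ennreal (\<epsilon> k) = ennreal ((4 * step_bd\<^sup>2 + 1) * \<epsilon> k)"
    proof -
      have "0 \<le> \<epsilon> k" by (simp add: \<epsilon>_def)
      then show ?thesis by (simp add: algebra_simps flip: ennreal_mult ennreal_plus)
    qed
    finally show ?thesis by (simp add: add_right_mono)
  qed
  have "(\<integral>\<^sup>+x. (INF k. G k x) \<partial>lborel) = 0"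
  proof -
    have le: "(\<integral>\<^sup>+x. (INF k. G k x) \<partial>lborel) \<le> ennreal ((4 * step_bd\<^sup>2 + 1) * \<epsilon> k)" for k
      by (rule order_trans[OF nn_integral_mono nG[of k]]) (auto intro: INF_lower)
    have "(\<lambda>k. ennreal ((4 * step_bd\<^sup>2 + 1) * \<epsilon> k)) \<longlonglongrightarrow> ennreal ((4 * step_bd\<^sup>2 + 1) * 0)"
      using lim unfolding \<epsilon>_def[symmetric] by (intro tendsto_intros)
    then have "(\<integral>\<^sup>+x. (INF k. G k x) \<partial>lborel) \<le> ennreal ((4 * step_bd\<^sup>2 + 1) * 0)"
      by (rule tendsto_lowerbound) (use le in auto)
    then show ?thesis by simp
  qed
  \<comment> \<open>The infimum over \<open>k\<close> avoids the choice of a subsequence converging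
    almost everywhere.\<close>
  then have I0: "AE x in lborel. (INF k. G k x) = 0"
    by (subst (asm) nn_integral_0_iff_AE) auto
  have "AE x in lborel. \<forall>k. isCont (c k) x"
    using c(4) by (simp add: AE_all_countable)
  then have "AE x in lborel. x \<in> K \<longrightarrow> rep h x = h x"
    using I0 hh
  proof eventually_elim
    case (elim x)
    show ?case
    proof
      assume x: "x \<in> K"
      have "ennreal \<bar>rep h x - h' x\<bar> \<le> G k x" for k
      proof -
        have "(\<lambda>m. avg h' x (?d m) - avg (c k) x (?d m)) \<longlonglongrightarrow> rep h x - c k x"
          using conv[OF x] avg_tendsto_at_cont[OF c(2,3)] elim(1) unfolding ah by (intro tendsto_diff) auto
        then have "(\<lambda>m. avg (D k) x (?d m)) \<longlonglongrightarrow> rep h x - c k x"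
          by (simp only: aD[of x _ k] add_diff_cancel_right')
        then have "(\<lambda>m. ennreal \<bar>avg (D k) x (?d m)\<bar>) \<longlonglongrightarrow> ennreal \<bar>rep h x - c k x\<bar>"
          by (intro tendsto_intros)
        then have l: "liminf (\<lambda>m. ennreal \<bar>avg (D k) x (?d m)\<bar>) = ennreal \<bar>rep h x - c k x\<bar>"
          by (intro lim_imp_Liminf) auto
        have "\<bar>rep h x - h' x\<bar> \<le> \<bar>rep h x - c k x\<bar> + \<bar>D k x\<bar>" by (simp add: D_def)
        then show ?thesis unfolding G_def l by (simp add: ennreal_leI flip: ennreal_plus)
      qed
      then have "ennreal \<bar>rep h x - h' x\<bar> \<le> (INF k. G k x)" by (rule INF_greatest)
      then show "rep h x = h x" using elim by simp
    qed
  qed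
  then show ?thesis by (rule AE_completion)
qed

subsection \<open>Mixed bounds for the flux and the tangential derivative\<close>

context interior
begin

text \<open>A common upper bound for the six constants that arise in
  \<open>mixed_bounds\<close>.\<close>

definition KC where "KC = (1 + \<beta>) * (K1 + K2) + L2n f + L2n f2"

lemma K_nonneg: "0 \<le> K1" "0 \<le> K2"
proof -
  show "0 \<le> K1" unfolding K1_def using cacc_const_nonneg[OF L_nonneg(1)] by (intro mult_nonneg_nonneg add_nonneg_nonneg) auto
  then show "0 \<le> K2" unfolding K2_def using cacc_const_nonneg[OF L_nonneg(2)] by (intro mult_nonneg_nonneg add_nonneg_nonneg) auto
qed

text \<open>A derivative in the first variable is always traded for tangential ones. For the second
  component of \<open>g\<close> this is the symmetry \<open>cross\<close> of second derivatives; for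
  the flux it is the equation \<open>W\<close>, which leaves \<open>f\<close> and the tangential
  derivative of the other flux component.\<close>

lemma mixed_bounds:
  assumes cross: "\<And>P Q. smooth1 P \<Longrightarrow> smooth1 Q \<Longrightarrow> supp_in P (p $ 1) r \<Longrightarrow> supp_in Q (p $ 2) r \<Longrightarrow>
      (\<integral>x. g x $ 2 * tensor (deriv P) Q x \<partial>lebesgue) = (\<integral>x. g x $ 1 * tensor P (deriv Q) x \<partial>lebesgue)"
  shows "mixed_bound (\<lambda>x. g x $ 2) p r KC" "mixed_bound (\<lambda>x. a x * g x $ 1) p r KC"
proof -
  have c1: "(\<lambda>x::real ^ 2. 1::real) \<in> borel_measurable borel" by simp
  {
    fix P Q assume PQ: "smooth1 P" "smooth1 Q" "supp_in P (p $ 1) r" "supp_in Q (p $ 2) r"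
    have dPQ: "smooth1 (deriv P)" "smooth1 (deriv Q)" "supp_in (deriv P) (p $ 1) r" "supp_in (deriv Q) (p $ 2) r"
      using smooth1_D(2) supp_in_deriv PQ by auto
    note sm = smooth_tensor[OF PQ(1,2)] and z = tensor_outside[OF PQ(3,4)]
    note cs = smooth_cs_tensor[OF PQ]
    let ?n = "L2n (tensor P Q)"
    have n0: "0 \<le> ?n" by simp
    note pt = partial_tensor[OF PQ(1,2)] partial_tensor[OF PQ(1) dPQ(2)]
    have A1: "\<bar>\<integral>x. g x $ j * tensor P (deriv Q) x \<partial>lebesgue\<bar> \<le> K1 * ?n" for j
      using tangential_dual_bounds(1)[of "\<lambda>x. 1" 1, OF c1 _ _ sm z, of j] by (simp add: pt)
    have A2: "\<bar>\<integral>x. g x $ j * tensor P (deriv (deriv Q)) x \<partial>lebesgue\<bar> \<le> K2 * ?n" for j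
      using tangential_dual_bounds(2)[of "\<lambda>x. 1" 1, OF c1 _ _ sm z, of j] by (simp add: pt)
    have B1: "\<bar>\<integral>x. a x * g x $ j * tensor P (deriv Q) x \<partial>lebesgue\<bar> \<le> \<beta> * K1 * ?n" for j
      using tangential_dual_bounds(1)[of a \<beta>, OF a_meas a_abs a_inv sm z, of j] by (simp add: pt)
    have B2: "\<bar>\<integral>x. a x * g x $ j * tensor P (deriv (deriv Q)) x \<partial>lebesgue\<bar> \<le> \<beta> * K2 * ?n" for j
      using tangential_dual_bounds(2)[of a \<beta>, OF a_meas a_abs a_inv sm z, of j] by (simp add: pt)
    have Fb: "\<bar>\<integral>x. f x * tensor P Q x \<partial>lebesgue\<bar> \<le> L2n f * ?n"
      using Cauchy_Schwarz_l2norm[OF f(1) smooth_cs_sq_int[OF cs]] by simp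
    have F2: "\<bar>\<integral>x. f x * tensor P (deriv Q) x \<partial>lebesgue\<bar> \<le> L2n f2 * ?n"
    proof -
      have "(\<integral>x. f x * partial 2 (tensor P Q) x \<partial>lebesgue) = - (\<integral>x. f2 x * tensor P Q x \<partial>lebesgue)"
        by (rule f_weak, rule test_funI[OF sm compact_square sub' z]) (use r in auto)
      then show ?thesis using Cauchy_Schwarz_l2norm[OF f2 smooth_cs_sq_int[OF cs]] by (simp add: pt)
    qed
    \<comment> \<open>This is the weak equation for the test function \<open>tensor P S\<close>;
      \<open>S\<close> will be \<open>Q\<close> and \<open>deriv Q\<close>, the latter bringing in
      the weak derivative of \<open>f\<close>.\<close>
    have W: "(\<integral>x. a x * g x $ 1 * tensor (deriv P) S x \<partial>lebesgue)
        = (\<integral>x. f x * tensor P S x \<partial>lebesgue) - (\<integral>x. a x * g x $ 2 * tensor P (deriv S) x \<partial>lebesgue)"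
      if S: "smooth1 S" "supp_in S (p $ 2) r" for S
    proof -
      have dS: "smooth1 (deriv S)" "supp_in (deriv S) (p $ 2) r" using smooth1_D(2) supp_in_deriv S by auto
      have ig: "integrable lebesgue (\<lambda>x. a x * g x $ j * w x)" if "smooth_cs w" for j w
        using sq_int_inner[OF sq_int_mult(1)[OF sq_int_nth(1)[OF g(1)] borel_lebesgue[OF a_meas] a_abs] smooth_cs_sq_int[OF that]] by simp
      have "test_fun \<Omega> (tensor P S)"
        by (rule test_funI[OF smooth_tensor[OF PQ(1) S(1)] compact_square sub' tensor_outside[OF PQ(3) S(2)]]) (use r in auto)
      from g_weak[OF this]
      have "(\<integral>x. f x * tensor P S x \<partial>lebesgue)
        = (\<integral>x. a x * g x $ 1 * tensor (deriv P) S x + a x * g x $ 2 * tensor P (deriv S) x \<partial>lebesgue)"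
        by (simp add: inner_vec_def sum_2 grad_nth partial_tensor[OF PQ(1) S(1)] algebra_simps)
      also have "\<dots> = (\<integral>x. a x * g x $ 1 * tensor (deriv P) S x \<partial>lebesgue) + (\<integral>x. a x * g x $ 2 * tensor P (deriv S) x \<partial>lebesgue)"
        by (rule Bochner_Integration.integral_add)
           (rule ig, rule smooth_cs_tensor[OF dPQ(1) S(1) dPQ(3) S(2)] smooth_cs_tensor[OF PQ(1) dS(1) PQ(3) dS(2)])+
      finally show ?thesis by simp
    qed
    have le: "K1 * ?n \<le> KC * ?n" "K2 * ?n \<le> KC * ?n" "\<beta> * K1 * ?n \<le> KC * ?n"
      "L2n f * ?n + \<beta> * K1 * ?n \<le> KC * ?n" "L2n f2 * ?n + \<beta> * K2 * ?n \<le> KC * ?n"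
    proof -
      have k: "0 \<le> \<beta> * K1" "0 \<le> \<beta> * K2" using beta(1) K_nonneg by auto
      have "K1 \<le> KC" "K2 \<le> KC" "\<beta> * K1 \<le> KC" "L2n f + \<beta> * K1 \<le> KC" "L2n f2 + \<beta> * K2 \<le> KC"
        using k K_nonneg l2norm_nonneg[of lebesgue f] l2norm_nonneg[of lebesgue f2] unfolding KC_def distrib_right distrib_left mult_1
        by linarith+
      from this[THEN mult_right_mono[OF _ n0]]
      show "K1 * ?n \<le> KC * ?n" "K2 * ?n \<le> KC * ?n" "\<beta> * K1 * ?n \<le> KC * ?n"
        "L2n f * ?n + \<beta> * K1 * ?n \<le> KC * ?n" "L2n f2 * ?n + \<beta> * K2 * ?n \<le> KC * ?n"
        by (simp_all add: distrib_right)
    qed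
    have v1: "\<bar>\<integral>x. g x $ 2 * tensor (deriv P) Q x \<partial>lebesgue\<bar> \<le> KC * ?n"
      unfolding cross[OF PQ] using A1[of 1] le(1) by linarith
    have v2: "\<bar>\<integral>x. g x $ 2 * tensor P (deriv Q) x \<partial>lebesgue\<bar> \<le> KC * ?n"
      using A1[of 2] le(1) by linarith
    have v12: "\<bar>\<integral>x. g x $ 2 * tensor (deriv P) (deriv Q) x \<partial>lebesgue\<bar> \<le> KC * ?n"
      unfolding cross[OF PQ(1) dPQ(2) PQ(3) dPQ(4)] using A2[of 1] le(2) by linarith
    have s1: "\<bar>\<integral>x. a x * g x $ 1 * tensor (deriv P) Q x \<partial>lebesgue\<bar> \<le> KC * ?n"
      unfolding W[OF PQ(2,4)] using Fb B1[of 2] le(4) by linarith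
    have s2: "\<bar>\<integral>x. a x * g x $ 1 * tensor P (deriv Q) x \<partial>lebesgue\<bar> \<le> KC * ?n"
      using B1[of 1] le(3) by linarith
    have s12: "\<bar>\<integral>x. a x * g x $ 1 * tensor (deriv P) (deriv Q) x \<partial>lebesgue\<bar> \<le> KC * ?n"
      unfolding W[OF dPQ(2,4)] using F2 B2[of 2] le(5) by linarith
    note v1 v2 v12 s1 s2 s12
  } note * = this
  show "mixed_bound (\<lambda>x. g x $ 2) p r KC" "mixed_bound (\<lambda>x. a x * g x $ 1) p r KC"
    unfolding mixed_bound_def using * by blast+
qed

end

subsection \<open>Oscillating layers\<close>

lemma chi_1: "chi \<theta> 1 y = (if frac (y $ 1 + 1/2) \<le> \<theta> then 1 else 0)"
  by (simp add: chi_def layer_coord_def frac_def)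

lemma chi_2: "chi \<theta> 2 y = 1 - chi \<theta> 1 y"
  by (simp add: chi_def)

lemma chi_measurable [measurable]: "chi \<theta> i \<in> borel_measurable borel"
  unfolding chi_def layer_coord_def by measurable

lemma chi_bound: "0 \<le> chi \<theta> i y" "chi \<theta> i y \<le> 1"
  by (auto simp: chi_def)

lemma integrable_indicator_Icc: "integrable lborel (indicator {a..b::real} :: real \<Rightarrow> real)"
  by (cases "a \<le> b") (auto intro!: integrable_real_indicator)

text \<open>According to the phase \<open>d\<close>, the part of the layer in the unit interval is
  either split into two pieces of lengths \<open>\<theta> - d\<close> and \<open>d\<close>, or is
  one piece of length \<open>\<theta>\<close>.\<close>

lemma layer_mean:
  assumes "0 < \<theta>" "\<theta> < 1"
  shows "(\<integral>s. indicator {0..1} s * (if frac (c + s) \<le> \<theta> then 1 else (0::real)) \<partial>lborel) = \<theta>"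
proof -
  define d where "d = frac c"
  have d: "0 \<le> d" "d < 1" by (auto simp: d_def frac_lt_1)
  have fr: "frac (c + s) = (if d + s < 1 then d + s else d + s - 1)" if "0 \<le> s" "s < 1" for s
  proof -
    have "frac s = s" using that by (simp add: frac_eq)
    then show ?thesis using frac_add[of c s] unfolding d_def by auto
  qed
  have fr1: "frac (c + 1) = d" by (simp add: d_def frac_1_eq)
  show ?thesis
  proof (cases "d \<le> \<theta>")
    case True
    have "indicator {0..1} s * (if frac (c + s) \<le> \<theta> then 1 else (0::real))
      = indicator {0..\<theta> - d} s + indicator {1 - d..1} s" for s
    proof (cases "0 \<le> s \<and> s < 1")
      case s: True
      then show ?thesis using fr[of s] True d assms by (auto simp: indicator_def)
    next
      case F: False
      then consider "s = 1" | "s < 0" | "1 < s" by linarith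
      then show ?thesis
        by cases (use fr1 True d assms in \<open>simp_all add: indicator_def\<close>)
    qed
    then have "(\<integral>s. indicator {0..1} s * (if frac (c + s) \<le> \<theta> then 1 else (0::real)) \<partial>lborel)
      = (\<integral>s. indicator {0..\<theta> - d} s + indicator {1 - d..1} s \<partial>lborel)" by presburger
    also have "\<dots> = (\<integral>s. indicator {0..\<theta> - d} s \<partial>lborel) + (\<integral>s. indicator {1 - d..1} s \<partial>lborel)"
      by (rule Bochner_Integration.integral_add) (rule integrable_indicator_Icc)+
    also have "\<dots> = (\<theta> - d) + d" using True d by simp
    finally show ?thesis by simp
  next
    case False
    have "indicator {0..1} s * (if frac (c + s) \<le> \<theta> then 1 else (0::real))
      = indicator {1 - d..1 + \<theta> - d} s" for s
    proof (cases "0 \<le> s \<and> s < 1")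
      case s: True
      then show ?thesis using fr[of s] False d assms by (auto simp: indicator_def)
    next
      case F: False
      then consider "s = 1" | "s < 0" | "1 < s" by linarith
      then show ?thesis
        by cases (use fr1 False d assms in \<open>simp_all add: indicator_def\<close>)
    qed
    then have "(\<integral>s. indicator {0..1} s * (if frac (c + s) \<le> \<theta> then 1 else (0::real)) \<partial>lborel)
      = (\<integral>s. indicator {1 - d..1 + \<theta> - d} s \<partial>lborel)" by presburger
    also have "\<dots> = \<theta>" using assms by simp
    finally show ?thesis .
  qed
qed

text \<open>Translating the integral by \<open>s / n\<close> shifts the phase of the layer function
  by \<open>s\<close>, at a cost of at most \<open>w\<close> from the change in \<open>H\<close>.
  Averaging over one period of \<open>s\<close> replaces the layer function by its mean at every
  point.\<close>

lemma oscillation_bound: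
  assumes th: "0 < \<theta>" "\<theta> < 1" and n: "1 \<le> (n::nat)"
    and H: "integrable lborel H" "H \<in> borel_measurable borel"
    and w: "\<And>t. 0 \<le> t \<Longrightarrow> t \<le> 1 / n \<Longrightarrow> (\<integral>x. \<bar>H (x + t *\<^sub>R axis 1 1) - H x\<bar> \<partial>lborel) \<le> w"
  shows "\<bar>(\<integral>x. chi \<theta> 1 (real n *\<^sub>R x) * H x \<partial>lborel) - \<theta> * (\<integral>x. H x \<partial>lborel)\<bar> \<le> w"
proof -
  let ?e = "axis 1 1 :: real ^ 2"
  note [measurable] = H(2)
  define X where "X s x = chi \<theta> 1 (real n *\<^sub>R x + s *\<^sub>R ?e)" for s x
  have Xm [measurable]: "(\<lambda>(s, x). X s x) \<in> borel_measurable (borel \<Otimes>\<^sub>M borel)"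
    unfolding X_def by measurable
  have X01: "0 \<le> X s x" "X s x \<le> 1" for s x by (auto simp: X_def chi_bound)
  have Xs [measurable]: "X s \<in> borel_measurable borel" for s unfolding X_def by measurable
  define I where "I = (\<integral>x. chi \<theta> 1 (real n *\<^sub>R x) * H x \<partial>lborel)"
  have tr: "integrable lborel (\<lambda>x. H (x + v))" "(\<integral>x. F (x + v) \<partial>lborel) = (\<integral>x. F x \<partial>lborel)"
    if "F \<in> borel_measurable borel" for v and F :: "real ^ 2 \<Rightarrow> real"
  proof -
    have "integrable (distr lborel borel ((+) v)) H" using H(1) by (simp add: lborel_distr_plus)
    then show "integrable lborel (\<lambda>x. H (x + v))"
      by (subst (asm) integrable_distr_eq) (auto simp: add.commute)
    have "(\<integral>x. F x \<partial>lborel) = (\<integral>x. F x \<partial>(distr lborel borel ((+) v)))" by (simp add: lborel_distr_plus)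
    also have "\<dots> = (\<integral>x. F (v + x) \<partial>lborel)" by (rule integral_distr) (use that in auto)
    finally show "(\<integral>x. F (x + v) \<partial>lborel) = (\<integral>x. F x \<partial>lborel)" by (simp add: add.commute)
  qed
  have bd: "integrable lborel (\<lambda>x. X s x * F x)" if "integrable lborel F" for s F
    by (rule Bochner_Integration.integrable_bound[OF that])
       (use that X01 in \<open>auto simp: abs_mult intro!: mult_left_le_one_le\<close>)
  define J where "J s = (\<integral>x. X s x * H x \<partial>lborel)" for s
  have IJ: "\<bar>I - J s\<bar> \<le> w" if s: "0 \<le> s" "s \<le> 1" for s
  proof -
    let ?t = "s / real n"
    have t: "0 \<le> ?t" "?t \<le> 1 / n" using s n by (auto intro!: divide_right_mono)
    have "I = (\<integral>x. chi \<theta> 1 (real n *\<^sub>R (x + ?t *\<^sub>R ?e)) * H (x + ?t *\<^sub>R ?e) \<partial>lborel)"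
      unfolding I_def by (rule tr(2)[symmetric]) measurable
    also have "\<dots> = (\<integral>x. X s x * H (x + ?t *\<^sub>R ?e) \<partial>lborel)"
      using n by (simp add: X_def scaleR_add_right)
    finally have "I - J s = (\<integral>x. X s x * H (x + ?t *\<^sub>R ?e) - X s x * H x \<partial>lborel)"
      unfolding J_def by (simp only: Bochner_Integration.integral_diff[OF bd[OF tr(1)[OF H(2)]] bd[OF H(1)]])
    also have "\<bar>\<dots>\<bar> \<le> (\<integral>x. \<bar>X s x * H (x + ?t *\<^sub>R ?e) - X s x * H x\<bar> \<partial>lborel)"
      by (rule integral_abs_bound)
    also have "\<dots> \<le> (\<integral>x. \<bar>H (x + ?t *\<^sub>R ?e) - H x\<bar> \<partial>lborel)"
    proof (rule integral_mono)
      show "integrable lborel (\<lambda>x. \<bar>X s x * H (x + ?t *\<^sub>R ?e) - X s x * H x\<bar>)"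
        by (intro integrable_abs Bochner_Integration.integrable_diff bd tr(1)[OF H(2)] H(1))
      show "integrable lborel (\<lambda>x. \<bar>H (x + ?t *\<^sub>R ?e) - H x\<bar>)"
        by (intro integrable_abs Bochner_Integration.integrable_diff tr(1)[OF H(2)] H(1))
      show "\<bar>X s x * H (x + ?t *\<^sub>R ?e) - X s x * H x\<bar> \<le> \<bar>H (x + ?t *\<^sub>R ?e) - H x\<bar>" for x
        using X01[of s x] by (simp add: abs_mult mult_left_le_one_le flip: right_diff_distrib)
    qed
    also have "\<dots> \<le> w" by (rule w[OF t])
    finally show ?thesis .
  qed
  let ?F = "\<lambda>(s, x). indicator {0..1} s * (X s x * H x)"
  have Fm: "?F \<in> borel_measurable (lborel \<Otimes>\<^sub>M lborel)"
  proof -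
    have "?F \<in> borel_measurable (borel \<Otimes>\<^sub>M borel)" by measurable
    then show ?thesis by (simp cong: measurable_cong_sets sets_pair_measure_cong)
  qed
  have Fi: "integrable (lborel \<Otimes>\<^sub>M lborel) ?F"
  proof (rule Bochner_Integration.integrable_bound[OF _ Fm])
    show "integrable (lborel \<Otimes>\<^sub>M lborel) (\<lambda>(s::real, x). indicator {0..1} s * \<bar>H x\<bar>)"
    proof (rule lborel_pair.Fubini_integrable)
      have "(\<lambda>(s::real, x). indicator {0..1} s * \<bar>H x\<bar>) \<in> borel_measurable (borel \<Otimes>\<^sub>M borel)" by measurable
      then show "(\<lambda>(s::real, x). indicator {0..1} s * \<bar>H x\<bar>) \<in> borel_measurable (lborel \<Otimes>\<^sub>M lborel)"
        by (simp cong: measurable_cong_sets sets_pair_measure_cong)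
      have "integrable lborel (\<lambda>s::real. indicator {0..1} s * (\<integral>x. \<bar>H x\<bar> \<partial>lborel))"
        by (rule integrable_mult_left[OF integrable_indicator_Icc])
      then show "integrable lborel (\<lambda>s::real. \<integral>x. norm (case (s, x) of (s, x) \<Rightarrow> indicator {0..1} s * \<bar>H x\<bar>) \<partial>lborel)"
        by (simp add: abs_mult)
      show "AE s::real in lborel. integrable lborel (\<lambda>x. case (s, x) of (s, x) \<Rightarrow> indicator {0..1} s * \<bar>H x\<bar>)"
        using H(1) by auto
    qed
    show "AE z in lborel \<Otimes>\<^sub>M lborel. norm (?F z) \<le> norm (case z of (s, x) \<Rightarrow> indicator {0..1} s * \<bar>H x\<bar>)"
    proof (rule AE_I2)
      fix z :: "real \<times> (real ^ 2)"
      obtain s x where z: "z = (s, x)" by (cases z)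
      have "X s x * \<bar>H x\<bar> \<le> \<bar>H x\<bar>" using X01[of s x] by (simp add: mult_left_le_one_le)
      then show "norm (?F z) \<le> norm (case z of (s, x) \<Rightarrow> indicator {0..1} s * \<bar>H x\<bar>)"
        using X01(1)[of s x] by (simp add: z abs_mult indicator_def)
    qed
  qed
  have "(\<integral>s. indicator {0..1} s * J s \<partial>lborel) = (\<integral>s. (\<integral>x. ?F (s, x) \<partial>lborel) \<partial>lborel)"
    by (simp add: J_def)
  also have "\<dots> = (\<integral>x. (\<integral>s. ?F (s, x) \<partial>lborel) \<partial>lborel)"
    using lborel_pair.Fubini_integral[of "\<lambda>s x. ?F (s, x)"] Fi by simp
  also have "\<dots> = (\<integral>x. \<theta> * H x \<partial>lborel)"
  proof (rule Bochner_Integration.integral_cong[OF refl])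
    fix x
    have "(\<integral>s. ?F (s, x) \<partial>lborel) = (\<integral>s. (indicator {0..1} s * (if frac ((real n * x $ 1 + 1/2) + s) \<le> \<theta> then 1 else 0)) * H x \<partial>lborel)"
    proof (rule Bochner_Integration.integral_cong[OF refl])
      fix s
      have "X s x = (if frac ((real n * x $ 1 + 1/2) + s) \<le> \<theta> then 1 else 0)"
        unfolding X_def chi_1 by (simp add: axis_def add_ac)
      then show "?F (s, x) = (indicator {0..1} s * (if frac ((real n * x $ 1 + 1/2) + s) \<le> \<theta> then 1 else 0)) * H x"
        by (simp only: prod.case mult.assoc)
    qed
    also have "\<dots> = \<theta> * H x" using layer_mean[OF th, of "real n * x $ 1 + 1/2"] by simp
    finally show "(\<integral>s. ?F (s, x) \<partial>lborel) = \<theta> * H x" .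
  qed
  also have "\<dots> = \<theta> * (\<integral>x. H x \<partial>lborel)" by simp
  finally have JJ: "(\<integral>s. indicator {0..1} s * J s \<partial>lborel) = \<theta> * (\<integral>x. H x \<partial>lborel)" .
  have iJ: "integrable lborel (\<lambda>s. indicator {0..1} s * J s)"
    using lborel_pair.integrable_fst'[OF Fi] by (simp add: J_def)
  have i1: "integrable lborel (\<lambda>s::real. indicator {0..1} s * c)" for c :: real
    by (rule integrable_mult_left[OF integrable_indicator_Icc])
  have "I - \<theta> * (\<integral>x. H x \<partial>lborel) = (\<integral>s. indicator {0..1} s * I - indicator {0..1} s * J s \<partial>lborel)"
    by (subst Bochner_Integration.integral_diff[OF i1 iJ]) (simp add: JJ)
  also have "\<bar>\<dots>\<bar> \<le> (\<integral>s. \<bar>indicator {0..1} s * I - indicator {0..1} s * J s\<bar> \<partial>lborel)"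
    by (rule integral_abs_bound)
  also have "\<dots> \<le> (\<integral>s. indicator {0..1::real} s * w \<partial>lborel)"
  proof (rule integral_mono[OF _ i1])
    show "integrable lborel (\<lambda>s. \<bar>indicator {0..1} s * I - indicator {0..1} s * J s\<bar>)"
      by (intro integrable_abs Bochner_Integration.integrable_diff i1 iJ)
    show "\<bar>indicator {0..1} s * I - indicator {0..1} s * J s\<bar> \<le> indicator {0..1} s * w" for s
      using IJ[of s] by (auto simp: indicator_def)
  qed
  also have "\<dots> = w" by simp
  finally show ?thesis by (simp add: I_def)
qed

text \<open>\<open>H\<close> is allowed to vary with \<open>n\<close>; compactness is replaced by a
  common modulus of continuity in direction 1 and a common support. This is how products with
  \<open>S n\<close> and \<open>V n\<close> are handled before their convergence is known.\<close>

lemma oscillation_limit: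
  fixes H :: "nat \<Rightarrow> real ^ 2 \<Rightarrow> real"
  assumes th: "0 < \<theta>" "\<theta> < 1"
    and H: "\<And>n. H n \<in> borel_measurable borel" "\<And>n. integrable lborel (H n)" "\<And>n x. x \<notin> square 0 R \<Longrightarrow> H n x = 0"
    and w: "\<And>n t x. 1 \<le> n \<Longrightarrow> 0 \<le> t \<Longrightarrow> t \<le> 1 / real n \<Longrightarrow> \<bar>H n (x + t *\<^sub>R axis 1 1) - H n x\<bar> \<le> w n"
      "w \<longlonglongrightarrow> 0"
  shows "(\<lambda>n. \<integral>x. (chi \<theta> 1 (real n *\<^sub>R x) - \<theta>) * H n x \<partial>lebesgue) \<longlonglongrightarrow> 0"
proof (rule tendsto_rabs_zero_cancel, rule tendsto_sandwich[where f = "\<lambda>n. 0"])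
  \<comment> \<open>The added 1 makes room for shifts \<open>t \<le> 1 / n \<le> 1\<close>, so both
    \<open>H n\<close> and its translate vanish outside this square.\<close>
  let ?m = "measure lborel (square 0 (\<bar>R\<bar> + 1))"
  show "(\<lambda>n. ?m * w n) \<longlonglongrightarrow> 0" by (rule tendsto_mult_right_zero[OF w(2)])
  have fin: "emeasure lborel (square 0 (\<bar>R\<bar> + 1)) < \<infinity>" unfolding square_cbox by (rule emeasure_lborel_cbox_finite)
  have "\<bar>\<integral>x. (chi \<theta> 1 (real n *\<^sub>R x) - \<theta>) * H n x \<partial>lebesgue\<bar> \<le> ?m * w n" if n: "1 \<le> n" for n
  proof -
    note [measurable] = H(1)
    have ic: "integrable lborel (\<lambda>x. chi \<theta> 1 (real n *\<^sub>R x) * H n x)"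
      by (rule Bochner_Integration.integrable_bound[OF H(2)[of n]])
         (use chi_bound in \<open>auto simp: abs_mult intro!: mult_left_le_one_le\<close>)
    have "(\<integral>x. (chi \<theta> 1 (real n *\<^sub>R x) - \<theta>) * H n x \<partial>lebesgue) = (\<integral>x. chi \<theta> 1 (real n *\<^sub>R x) * H n x - \<theta> * H n x \<partial>lborel)"
      by (subst integral_completion) (auto simp: left_diff_distrib)
    also have "\<dots> = (\<integral>x. chi \<theta> 1 (real n *\<^sub>R x) * H n x \<partial>lborel) - \<theta> * (\<integral>x. H n x \<partial>lborel)"
      by (rule trans[OF Bochner_Integration.integral_diff[OF ic integrable_mult_right[OF H(2)]]])
         (simp only: integral_mult_right_zero)
    also have "\<bar>\<dots>\<bar> \<le> ?m * w n"
    proof (rule oscillation_bound[OF th n H(2) H(1)])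
      fix t assume t: "0 \<le> t" "t \<le> 1 / real n"
      have "1 / real n \<le> 1" using n by simp
      then have t1: "t \<le> 1" using t(2) by linarith
      have z: "\<bar>H n (x + t *\<^sub>R axis 1 1) - H n x\<bar> \<le> indicator (square 0 (\<bar>R\<bar> + 1)) x * w n" for x
      proof (cases "x \<in> square 0 (\<bar>R\<bar> + 1)")
        case True then show ?thesis using w(1)[OF n t] by simp
      next
        case False
        then have "x \<notin> square 0 R" "x + t *\<^sub>R axis 1 1 \<notin> square 0 R"
          using t t1 by (auto simp: square_def axis_def)
        then show ?thesis using False H(3) by simp
      qed
      have iw: "integrable lborel (\<lambda>x. indicator (square 0 (\<bar>R\<bar> + 1)) x * w n :: real)"
        using fin by (intro integrable_mult_left integrable_real_indicator) auto
      have "(\<integral>x. \<bar>H n (x + t *\<^sub>R axis 1 1) - H n x\<bar> \<partial>lborel) \<le> (\<integral>x. indicator (square 0 (\<bar>R\<bar> + 1)) x * w n \<partial>lborel)"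
      proof (rule integral_mono[OF _ iw z])
        show "integrable lborel (\<lambda>x. \<bar>H n (x + t *\<^sub>R axis 1 1) - H n x\<bar>)"
          by (rule Bochner_Integration.integrable_bound[OF iw])
             (use z in \<open>auto intro!: AE_I2 intro: order_trans[OF _ abs_ge_self]\<close>)
      qed
      then show "(\<integral>x. \<bar>H n (x + t *\<^sub>R axis 1 1) - H n x\<bar> \<partial>lborel) \<le> ?m * w n"
        by simp
    qed
    finally show ?thesis .
  qed
  then show "\<forall>\<^sub>F n in sequentially. \<bar>\<integral>x. (chi \<theta> 1 (real n *\<^sub>R x) - \<theta>) * H n x \<partial>lebesgue\<bar> \<le> ?m * w n"
    by (intro eventually_sequentiallyI[of 1])
qed auto

subsection \<open>Zero extension\<close>

text \<open>After extension by zero all integrals are over the whole plane, where translations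
  act.\<close>

definition zero_ext :: "(real ^ 2) set \<Rightarrow> (real ^ 2 \<Rightarrow> 'b::real_vector) \<Rightarrow> real ^ 2 \<Rightarrow> 'b" where
  "zero_ext S F x = indicator S x *\<^sub>R F x"

lemma zero_ext_in: "x \<in> S \<Longrightarrow> zero_ext S F x = F x" and zero_ext_out: "x \<notin> S \<Longrightarrow> zero_ext S F x = 0"
  by (auto simp: zero_ext_def)

lemma zero_ext_nth: "zero_ext S F x $ j = zero_ext S (\<lambda>x. F x $ j) x"
  by (simp add: zero_ext_def)

lemma integral_on_zero_ext:
  fixes F :: "real ^ 2 \<Rightarrow> 'b::euclidean_space"
  assumes "open \<Omega>"
  shows "integral\<^sup>L (lebesgue_on \<Omega>) F = integral\<^sup>L lebesgue (zero_ext \<Omega> F)"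
  using assms by (subst integral_restrict_space) (auto simp: zero_ext_def[abs_def] borel_open)

text \<open>Boundedness of the domain gives the second claim: there the norm is at most 1 plus its
  square, and the constant 1 is integrable.\<close>

lemma L2_zero_ext:
  fixes F :: "real ^ 2 \<Rightarrow> 'b::euclidean_space"
  assumes \<Omega>: "open \<Omega>" "bounded \<Omega>" and F: "L2 \<Omega> F"
  shows "sq_int lebesgue (zero_ext \<Omega> F)" "integrable lebesgue (zero_ext \<Omega> F)"
proof -
  have S: "\<Omega> \<in> sets lebesgue" using \<Omega> by (simp add: borel_open)
  have m: "zero_ext \<Omega> F \<in> borel_measurable lebesgue"
    using F S unfolding L2_def zero_ext_def[abs_def]
    by (subst (asm) borel_measurable_restrict_space_iff) auto
  have i: "integrable lebesgue (\<lambda>x. indicator \<Omega> x *\<^sub>R (norm (F x))\<^sup>2)"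
    using F S unfolding L2_def by (simp add: integrable_restrict_space)
  have e: "indicator \<Omega> x *\<^sub>R (norm (F x))\<^sup>2 = (norm (zero_ext \<Omega> F x))\<^sup>2" for x
    by (simp add: zero_ext_def indicator_def)
  show s: "sq_int lebesgue (zero_ext \<Omega> F)" using m i unfolding e by (simp add: sq_int_def)
  have fin: "\<Omega> \<in> lmeasurable" using \<Omega> by (simp add: lmeasurable_open)
  have ind: "integrable lebesgue (indicator \<Omega> :: _ \<Rightarrow> real)"
    using fmeasurableD[OF fin] fmeasurableD2[OF fin] by (intro integrable_real_indicator) (auto simp: less_top)
  show "integrable lebesgue (zero_ext \<Omega> F)"
  proof (rule Bochner_Integration.integrable_bound[OF _ m])
    show "integrable lebesgue (\<lambda>x. indicator \<Omega> x + (norm (zero_ext \<Omega> F x))\<^sup>2)"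
      using ind sqiD(2)[OF s] by simp
    show "AE x in lebesgue. norm (zero_ext \<Omega> F x) \<le> norm (indicator \<Omega> x + (norm (zero_ext \<Omega> F x))\<^sup>2)"
    proof (rule AE_I2)
      fix x
      show "norm (zero_ext \<Omega> F x) \<le> norm (indicator \<Omega> x + (norm (zero_ext \<Omega> F x))\<^sup>2)"
      proof (cases "x \<in> \<Omega>")
        case True
        have "2 * norm (F x) \<le> (norm (F x))\<^sup>2 + 1" using sum_squares_bound[of "norm (F x)" 1] by simp
        moreover have "0 \<le> norm (F x)" "0 \<le> (norm (F x))\<^sup>2" by simp_all
        ultimately have "norm (F x) \<le> 1 + (norm (F x))\<^sup>2" by linarith
        then show ?thesis using True by (simp add: zero_ext_def)
      qed (simp add: zero_ext_def)
    qed
  qed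
qed

lemma test_fun_smooth_cs: "test_fun \<Omega> \<phi> \<Longrightarrow> smooth_cs \<phi>"
  using test_funE[of \<Omega> \<phi>] csmI by metis

lemma test_fun_out:
  assumes "test_fun \<Omega> \<phi>" "x \<notin> \<Omega>"
  shows "\<phi> x = 0" "grad \<phi> x = 0" "partial j \<phi> x = 0"
proof -
  obtain S where S: "compact S" "S \<subseteq> \<Omega>" "\<And>x. x \<notin> S \<Longrightarrow> \<phi> x = 0" using test_funE[OF assms(1)] by metis
  then show "\<phi> x = 0" "grad \<phi> x = 0" "partial j \<phi> x = 0"
    using assms(2) grad_outside[of S \<phi> x] partial_outside[of S \<phi> x j] compact_imp_closed[OF S(1)] by blast+
qed

lemma H10_approx:
  assumes \<Omega>: "open \<Omega>" "bounded \<Omega>" and H: "H10 \<Omega> u g"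
  obtains \<phi> where "\<And>k. test_fun \<Omega> (\<phi> k)"
    "(\<lambda>k. L2n (\<lambda>x. \<phi> k x - zero_ext \<Omega> u x)) \<longlonglongrightarrow> 0"
    "(\<lambda>k. L2n (\<lambda>x. grad (\<phi> k) x - zero_ext \<Omega> g x)) \<longlonglongrightarrow> 0"
proof -
  obtain \<phi> where t: "\<And>k. test_fun \<Omega> (\<phi> k)"
    and l: "(\<lambda>k. integral\<^sup>L (lebesgue_on \<Omega>) (\<lambda>x. (\<phi> k x - u x)\<^sup>2)
            + integral\<^sup>L (lebesgue_on \<Omega>) (\<lambda>x. (norm (grad (\<phi> k) x - g x))\<^sup>2)) \<longlonglongrightarrow> 0"
    using H unfolding H10_def by blast
  have e1: "integral\<^sup>L (lebesgue_on \<Omega>) (\<lambda>x. (\<phi> k x - u x)\<^sup>2) = (L2n (\<lambda>x. \<phi> k x - zero_ext \<Omega> u x))\<^sup>2" for k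
    unfolding integral_on_zero_ext[OF \<Omega>(1)] l2norm_sq
  proof (rule Bochner_Integration.integral_cong[OF refl])
    show "zero_ext \<Omega> (\<lambda>x. (\<phi> k x - u x)\<^sup>2) x = (norm (\<phi> k x - zero_ext \<Omega> u x))\<^sup>2" for x
      using test_fun_out(1)[OF t, of x k] by (cases "x \<in> \<Omega>") (auto simp: zero_ext_def)
  qed
  have e2: "integral\<^sup>L (lebesgue_on \<Omega>) (\<lambda>x. (norm (grad (\<phi> k) x - g x))\<^sup>2) = (L2n (\<lambda>x. grad (\<phi> k) x - zero_ext \<Omega> g x))\<^sup>2" for k
    unfolding integral_on_zero_ext[OF \<Omega>(1)] l2norm_sq
  proof (rule Bochner_Integration.integral_cong[OF refl])
    show "zero_ext \<Omega> (\<lambda>x. (norm (grad (\<phi> k) x - g x))\<^sup>2) x = (norm (grad (\<phi> k) x - zero_ext \<Omega> g x))\<^sup>2" for x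
      using test_fun_out(2)[OF t, of x k] by (cases "x \<in> \<Omega>") (auto simp: zero_ext_def)
  qed
  have z: "(\<lambda>k. b k) \<longlonglongrightarrow> 0" if "(\<lambda>k. (a k)\<^sup>2 + (b k)\<^sup>2) \<longlonglongrightarrow> 0" "\<And>k. 0 \<le> b k" for a b :: "nat \<Rightarrow> real"
  proof -
    have "(\<lambda>k. (b k)\<^sup>2) \<longlonglongrightarrow> 0"
      by (rule tendsto_sandwich[OF _ _ tendsto_const that(1)]) auto
    from tendsto_real_sqrt[OF this] show ?thesis using that(2) by simp
  qed
  show ?thesis
  proof (rule that[OF t])
    show "(\<lambda>k. L2n (\<lambda>x. grad (\<phi> k) x - zero_ext \<Omega> g x)) \<longlonglongrightarrow> 0"
      by (rule z[OF l[unfolded e1 e2]]) simp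
    show "(\<lambda>k. L2n (\<lambda>x. \<phi> k x - zero_ext \<Omega> u x)) \<longlonglongrightarrow> 0"
      by (rule z[where a = "\<lambda>k. L2n (\<lambda>x. grad (\<phi> k) x - zero_ext \<Omega> g x)"])
         (use l[unfolded e1 e2] in \<open>simp_all add: add.commute\<close>)
  qed
qed

lemma inner_tendsto:
  assumes F: "sq_int M F" and G: "\<And>k. sq_int M (G k)" "sq_int M G'" and l: "(\<lambda>k. l2norm M (\<lambda>x. G k x - G' x)) \<longlonglongrightarrow> 0"
  shows "(\<lambda>k. \<integral>x. F x \<bullet> G k x \<partial>M) \<longlonglongrightarrow> (\<integral>x. F x \<bullet> G' x \<partial>M)"
proof (rule LIM_zero_cancel, rule tendsto_rabs_zero_cancel, rule tendsto_sandwich[where f = "\<lambda>k. 0"])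
  show "(\<lambda>k. l2norm M F * l2norm M (\<lambda>x. G k x - G' x)) \<longlonglongrightarrow> 0" by (rule tendsto_mult_right_zero[OF l])
  have "\<bar>(\<integral>x. F x \<bullet> G k x \<partial>M) - (\<integral>x. F x \<bullet> G' x \<partial>M)\<bar> \<le> l2norm M F * l2norm M (\<lambda>x. G k x - G' x)" for k
  proof -
    have "(\<integral>x. F x \<bullet> G k x \<partial>M) - (\<integral>x. F x \<bullet> G' x \<partial>M) = (\<integral>x. F x \<bullet> (G k x - G' x) \<partial>M)"
      unfolding inner_diff_right
      by (rule Bochner_Integration.integral_diff[OF sq_int_inner[OF F G(1)] sq_int_inner[OF F G(2)], symmetric])
    then show ?thesis using Cauchy_Schwarz_l2norm[OF F sq_int_diff[OF G(1) G(2)]] by simp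
  qed
  then show "\<forall>\<^sub>F k in sequentially. \<bar>(\<integral>x. F x \<bullet> G k x \<partial>M) - (\<integral>x. F x \<bullet> G' x \<partial>M)\<bar> \<le> l2norm M F * l2norm M (\<lambda>x. G k x - G' x)"
    by simp
qed auto

lemma sq_int_prod_integrable:
  fixes F G b :: "'a \<Rightarrow> real"
  assumes "sq_int M F" "sq_int M G" "b \<in> borel_measurable M" "\<And>x. \<bar>b x\<bar> \<le> B"
  shows "integrable M (\<lambda>x. b x * (F x * G x))"
  using sq_int_inner[OF sq_int_mult(1)[OF assms(1,3,4)] assms(2)] by (simp add: mult.assoc)

lemma rep_measurable:
  assumes "h \<in> borel_measurable lebesgue" shows "rep h \<in> borel_measurable borel"
proof -
  obtain h' where h' [measurable]: "h' \<in> borel_measurable borel" and hh: "AE x in lborel. h x = h' x"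
    using completion_ex_borel_measurable_real[OF assms] by auto
  have "avg h x (1 / real (Suc m)) = avg h' x (1 / real (Suc m))" for x m
    by (rule avg_cong_AE[OF AE_completion[OF hh] assms borel_lebesgue[OF h']]) simp
  then have "rep h = (\<lambda>x. lim (\<lambda>m. avg h' x (1 / real (Suc m))))" by (simp add: rep_def fun_eq_iff)
  moreover have "(\<lambda>x. lim (\<lambda>m. avg h' x (1 / real (Suc m)))) \<in> borel_measurable borel"
    by (rule borel_measurable_lim_metric, rule avg_measurable[OF h']) simp
  ultimately show ?thesis by simp
qed

lemma l2norm_bump: "0 < \<delta> \<Longrightarrow> L2n (bump x \<delta>) \<le> (step_bd / \<delta>)\<^sup>2 * (2 * \<delta>)"
proof -
  assume d: "0 < \<delta>"
  have fm: "square x \<delta> \<in> lmeasurable" unfolding square_cbox by (rule lmeasurable_cbox)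
  have ii: "integrable lebesgue (indicator (square x \<delta>) :: _ \<Rightarrow> real)"
    using fmeasurableD[OF fm] fmeasurableD2[OF fm] by (intro integrable_real_indicator) (auto simp: less_top)
  have sq: "(norm (indicator (square x \<delta>) y :: real))\<^sup>2 = indicator (square x \<delta>) y" for y by (simp add: indicator_def)
  have sb: "sq_int lebesgue (indicator (square x \<delta>) :: _ \<Rightarrow> real)" unfolding sq_int_def sq using ii by auto
  have "L2n (bump x \<delta>) \<le> (step_bd / \<delta>)\<^sup>2 * L2n (indicator (square x \<delta>) :: _ \<Rightarrow> real)"
    by (rule l2norm_mono[OF sb smooth_cs_sq_int[OF smooth_cs_bump[OF d]]]) (use bump_bound[OF d, of x] in auto)
  also have "L2n (indicator (square x \<delta>) :: _ \<Rightarrow> real) = 2 * \<delta>"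
  proof -
    have "measure lebesgue (square x \<delta>) = (2 * \<delta>)\<^sup>2"
      using d unfolding square_cbox by (subst measure_cbox2) (auto simp: power2_eq_square)
    then show ?thesis unfolding l2norm_def sq using d
      by (simp only: Bochner_Integration.integral_indicator space_completion space_lborel space_borel Int_UNIV_right real_sqrt_abs abs_of_pos mult_pos_pos zero_less_numeral)
  qed
  finally show ?thesis .
qed

section \<open>Locally equicontinuous families and their oscillation\<close>

lemma mixed_bound_limit:
  assumes mb: "\<And>n. 1 \<le> n \<Longrightarrow> mixed_bound (h n) p r C" and h: "\<And>n. 1 \<le> n \<Longrightarrow> sq_int lebesgue (h n)" "sq_int lebesgue h'"
    and l: "(\<lambda>n. L2n (\<lambda>x. h n x - h' x)) \<longlonglongrightarrow> 0"
  shows "mixed_bound h' p r C"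
proof -
  have lim: "\<bar>\<integral>x. h' x * T x \<partial>lebesgue\<bar> \<le> K" if T: "smooth_cs T" and b: "\<And>n. 1 \<le> n \<Longrightarrow> \<bar>\<integral>x. h n x * T x \<partial>lebesgue\<bar> \<le> K" for T K
  proof -
    \<comment> \<open>Nothing is known about \<open>h 0\<close>, hence the shift by
      \<open>Suc\<close>.\<close>
    have "(\<lambda>k. \<integral>x. T x \<bullet> h (Suc k) x \<partial>lebesgue) \<longlonglongrightarrow> (\<integral>x. T x \<bullet> h' x \<partial>lebesgue)"
      by (rule inner_tendsto[OF smooth_cs_sq_int[OF T]]) (use h LIMSEQ_Suc[OF l] in auto)
    then have "(\<lambda>k. \<bar>\<integral>x. T x \<bullet> h (Suc k) x \<partial>lebesgue\<bar>) \<longlonglongrightarrow> \<bar>\<integral>x. T x \<bullet> h' x \<partial>lebesgue\<bar>"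
      by (rule tendsto_rabs)
    then have "\<bar>\<integral>x. T x \<bullet> h' x \<partial>lebesgue\<bar> \<le> K"
      by (rule tendsto_upperbound) (use b in \<open>auto simp: mult.commute\<close>)
    then show ?thesis by (simp add: mult.commute)
  qed
  show ?thesis
    unfolding mixed_bound_def
  proof (intro allI impI)
    fix P Q assume PQ: "smooth1 P \<and> smooth1 Q \<and> supp_in P (p $ 1) r \<and> supp_in Q (p $ 2) r"
    then have d: "smooth1 (deriv P)" "smooth1 (deriv Q)" "supp_in (deriv P) (p $ 1) r" "supp_in (deriv Q) (p $ 2) r"
      using smooth1_D(2) supp_in_deriv by auto
    have c: "smooth_cs (tensor (deriv P) Q)" "smooth_cs (tensor P (deriv Q))" "smooth_cs (tensor (deriv P) (deriv Q))"
      using PQ d smooth_cs_tensor by blast+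
    show "\<bar>\<integral>x. h' x * tensor (deriv P) Q x \<partial>lebesgue\<bar> \<le> C * L2n (tensor P Q) \<and>
     \<bar>\<integral>x. h' x * tensor P (deriv Q) x \<partial>lebesgue\<bar> \<le> C * L2n (tensor P Q) \<and>
     \<bar>\<integral>x. h' x * tensor (deriv P) (deriv Q) x \<partial>lebesgue\<bar> \<le> C * L2n (tensor P Q)"
      by (intro conjI lim c) (use mb PQ in \<open>auto simp: mixed_bound_def\<close>)
  qed
qed

lemma compact_square_sub:
  assumes "compact K" "open \<Omega>" "K \<subseteq> \<Omega>"
  obtains e where "0 < e" "\<And>x. x \<in> K \<Longrightarrow> square x e \<subseteq> \<Omega>"
proof -
  obtain d where d: "0 < d" "(\<Union>x\<in>K. ball x d) \<subseteq> \<Omega>"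
    using compact_subset_open_imp_ball_epsilon_subset[OF assms] by blast
  \<comment> \<open>The Euclidean distance is at most the sum of the coordinate distances, here
    \<open>2 * d / 3\<close>.\<close>
  have sb: "square x (d / 3) \<subseteq> ball x d" for x
  proof
    fix y assume y: "y \<in> square x (d / 3)"
    have "norm (y - x) \<le> \<bar>y $ 1 - x $ 1\<bar> + \<bar>y $ 2 - x $ 2\<bar>"
      using norm_le_l1_cart[of "y - x"] by (simp add: sum_2)
    also have "\<dots> < d" using y d(1) by (auto simp: square_def)
    finally show "y \<in> ball x d" by (simp add: dist_norm norm_minus_commute)
  qed
  show ?thesis
  proof (rule that[of "d / 3"])
    show "square x (d / 3) \<subseteq> \<Omega>" if "x \<in> K" for x using sb[of x] d(2) that by blast
  qed (use d(1) in simp)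
qed

text \<open>\<open>equi \<Omega> h\<close>: the functions \<open>h n\<close>, \<open>n \<ge> 1\<close>, have representatives that are locally Hoelder
  continuous and locally bounded, uniformly in \<open>n\<close>.\<close>

definition equi :: "(real ^ 2) set \<Rightarrow> (nat \<Rightarrow> real ^ 2 \<Rightarrow> real) \<Rightarrow> bool" where
  "equi \<Omega> h \<longleftrightarrow> (\<forall>n\<ge>1. sq_int lebesgue (h n)) \<and> (\<exists>B. \<forall>n\<ge>1. L2n (h n) \<le> B) \<and>
     (\<forall>K. compact K \<and> K \<subseteq> \<Omega> \<longrightarrow>
       (\<exists>r>0. \<exists>C\<ge>0. \<forall>x\<in>K. \<forall>n\<ge>1. mixed_bound (h n) x r C) \<and>
       (\<forall>n\<ge>1. AE x in lebesgue. x \<in> K \<longrightarrow> rep (h n) x = h n x))"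

text \<open>At the fixed width \<open>r / 2\<close> the average is controlled by Cauchy-Schwarz, and
  \<open>rep\<close> is close to it by \<open>rep_avg\<close>.\<close>

lemma rep_bound:
  assumes mb: "mixed_bound h x r C" and C: "0 \<le> C" and h: "sq_int lebesgue h" and r: "0 < r"
  shows "\<bar>rep h x\<bar> \<le> L2n h * ((step_bd / (r / 2))\<^sup>2 * r) + C * mod_const r * sqrt (r / 2)"
proof -
  have d: "0 < r / 2" using r by simp
  have "\<bar>avg h x (r / 2)\<bar> \<le> L2n h * L2n (bump x (r / 2))"
    unfolding avg_def using Cauchy_Schwarz_l2norm[OF h smooth_cs_sq_int[OF smooth_cs_bump[OF d]]] by simp
  also have "\<dots> \<le> L2n h * ((step_bd / (r / 2))\<^sup>2 * r)"
    using l2norm_bump[OF d, of x] by (intro mult_left_mono) auto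
  finally show ?thesis using rep_avg[OF mb C h r d] by linarith
qed

text \<open>The functions \<open>h n\<close> are replaced by \<open>rep (h n)\<close>, which changes
  no integral. The product with \<open>\<psi>\<close> then has the modulus required by
  \<open>oscillation_limit\<close>, from the bound and the modulus of \<open>rep\<close> and the
  Lipschitz bound of \<open>\<psi>\<close>.\<close>

lemma oscillation_equi:
  assumes th: "0 < \<theta>" "\<theta> < 1" and \<Omega>: "open \<Omega>" and eq: "equi \<Omega> h"
    and \<psi>: "smooth \<psi>" "compact K0" "K0 \<subseteq> \<Omega>" "\<And>x. x \<notin> K0 \<Longrightarrow> \<psi> x = 0"
  shows "(\<lambda>n. \<integral>x. (chi \<theta> 1 (real n *\<^sub>R x) - \<theta>) * (h n x * \<psi> x) \<partial>lebesgue) \<longlonglongrightarrow> 0"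
proof -
  let ?e = "axis 1 1 :: real ^ 2"
  obtain e where e: "0 < e" "\<And>x. x \<in> K0 \<Longrightarrow> square x e \<subseteq> \<Omega>"
    using compact_square_sub[OF \<psi>(2) \<Omega> \<psi>(3)] by blast
  \<comment> \<open>\<open>K0\<close> is widened along direction 1 so that both ends of a short
    shift lie where the bounds hold, even if only one of them is in \<open>K0\<close>.\<close>
  define K1 where "K1 = (\<lambda>z. fst z + snd z *\<^sub>R ?e) ` (K0 \<times> {- e..e})"
  have cK1: "compact K1" unfolding K1_def
    by (intro compact_continuous_image compact_Times \<psi>(2) continuous_intros) auto
  have K1in: "y + t *\<^sub>R ?e \<in> K1" if "y \<in> K0" "\<bar>t\<bar> \<le> e" for y t
    unfolding K1_def using that by (intro image_eqI[of _ _ "(y, t)"]) auto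
  have K1\<Omega>: "K1 \<subseteq> \<Omega>"
  proof
    fix x assume "x \<in> K1"
    then obtain z where z: "z \<in> K0 \<times> {- e..e}" "x = fst z + snd z *\<^sub>R ?e" unfolding K1_def by blast
    then have "fst z \<in> K0" "x \<in> square (fst z) e" by (auto simp: square_def axis_def abs_le_iff)
    then show "x \<in> \<Omega>" using e(2) by blast
  qed
  have K01: "K0 \<subseteq> K1" using K1in[of _ 0] e(1) by auto
  obtain B where B: "\<And>n. 1 \<le> n \<Longrightarrow> L2n (h n) \<le> B" using eq by (auto simp: equi_def)
  have hs: "sq_int lebesgue (h n)" if "1 \<le> n" for n using eq that by (auto simp: equi_def)
  obtain r C where r: "0 < r" and C: "0 \<le> C" and mb: "\<And>x n. x \<in> K1 \<Longrightarrow> 1 \<le> n \<Longrightarrow> mixed_bound (h n) x r C"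
    using eq cK1 K1\<Omega> unfolding equi_def by metis
  have ae: "AE x in lebesgue. x \<in> K0 \<longrightarrow> rep (h n) x = h n x" if "1 \<le> n" for n
    using eq \<psi>(2,3) that unfolding equi_def by blast
  have c\<psi>: "smooth_cs \<psi>" by (rule csmI[OF \<psi>(1,2,4)])
  obtain B0 where B0: "0 \<le> B0" "\<And>x. norm (\<psi> x) \<le> B0" using cc_bounded[OF smooth_cont[OF \<psi>(1)] \<psi>(2,4)] by blast
  obtain S1 where S1: "compact S1" "\<And>x. x \<notin> S1 \<Longrightarrow> partial 1 \<psi> x = 0" using csmE[OF smooth_cs_partial[OF c\<psi>]] by blast
  obtain B1 where B1: "0 \<le> B1" "\<And>x. norm (partial 1 \<psi> x) \<le> B1"
    using cc_bounded[OF smooth_cont[OF smooth_partial[OF \<psi>(1)]] S1] by blast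
  define R0 where "R0 = B * ((step_bd / (r / 2))\<^sup>2 * r) + C * mod_const r * sqrt (r / 2)"
  have R0: "\<bar>rep (h n) x\<bar> \<le> R0" if "x \<in> K1" "1 \<le> n" for n x
  proof -
    have "L2n (h n) * ((step_bd / (r / 2))\<^sup>2 * r) \<le> B * ((step_bd / (r / 2))\<^sup>2 * r)"
      by (rule mult_right_mono[OF B[OF that(2)]]) (use r in simp)
    then show ?thesis using rep_bound[OF mb[OF that] C hs[OF that(2)] r] unfolding R0_def by linarith
  qed
  obtain N where N: "1 \<le> N" "\<And>n. N \<le> n \<Longrightarrow> 1 / real n \<le> min e (r / 2)"
  proof -
    have "\<forall>\<^sub>F n in sequentially. 1 / real n < min e (r / 2)"
      using order_tendstoD(2)[OF lim_1_over_n, of "min e (r / 2)"] e(1) r by auto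
    then obtain M where "\<And>n. M \<le> n \<Longrightarrow> 1 / real n < min e (r / 2)" by (auto simp: eventually_sequentially)
    then show ?thesis using that[of "max 1 M"] by (meson less_imp_le max.bounded_iff max.cobounded1)
  qed
  \<comment> \<open>Before \<open>N\<close> the shifts may be too long for
    \<open>rep_modulus\<close>; setting these members to 0 does not affect the limit.\<close>
  define H where "H n x = (if n < N then 0 else rep (h n) x * \<psi> x)" for n x
  have n1: "1 \<le> n" if "\<not> n < N" for n using that N(1) by simp
  obtain R where R: "K0 \<subseteq> square 0 R"
  proof -
    obtain b where b: "\<And>x. x \<in> K0 \<Longrightarrow> norm x \<le> b" using compact_imp_bounded[OF \<psi>(2)] by (auto simp: bounded_iff)
    have "K0 \<subseteq> square 0 b"
      using b component_le_norm_cart[of _ 1] component_le_norm_cart[of _ 2] by (fastforce simp: square_def intro: order_trans)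
    then show ?thesis by (rule that)
  qed
  have m\<psi> [measurable]: "\<psi> \<in> borel_measurable borel" by (rule smooth_cs_borel[OF c\<psi>])
  have Hm: "H n \<in> borel_measurable borel" for n
  proof (cases "n < N")
    case True then show ?thesis by (simp add: H_def[abs_def])
  next
    case False
    have [measurable]: "rep (h n) \<in> borel_measurable borel"
      by (rule rep_measurable[OF sqiD(1)[OF hs[OF n1[OF False]]]])
    show ?thesis using False unfolding H_def[abs_def] by simp
  qed
  have z: "H n x = 0" if "x \<notin> K0" for n x using \<psi>(4)[OF that] by (simp add: H_def)
  have lim: "(\<lambda>n. \<integral>x. (chi \<theta> 1 (real n *\<^sub>R x) - \<theta>) * H n x \<partial>lebesgue) \<longlonglongrightarrow> 0"
  proof (rule oscillation_limit[OF th Hm])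
    show "H n x = 0" if "x \<notin> square 0 R" for n x using z[of x n] R that by blast
    have fin: "emeasure lborel (square 0 R) < \<infinity>" unfolding square_cbox by (rule emeasure_lborel_cbox_finite)
    show "integrable lborel (H n)" for n
    proof (rule Bochner_Integration.integrable_bound)
      show "integrable lborel (\<lambda>x. indicator (square 0 R) x * (\<bar>R0\<bar> * B0))"
        using fin by (intro integrable_mult_left integrable_real_indicator) auto
      show "H n \<in> borel_measurable lborel" using Hm by simp
      show "AE x in lborel. norm (H n x) \<le> norm (indicator (square 0 R) x * (\<bar>R0\<bar> * B0))"
      proof (rule AE_I2)
        fix x
        show "norm (H n x) \<le> norm (indicator (square 0 R) x * (\<bar>R0\<bar> * B0))"
        proof (cases "x \<in> K0 \<and> \<not> n < N")
          case True
          then have "\<bar>rep (h n) x\<bar> * \<bar>\<psi> x\<bar> \<le> \<bar>R0\<bar> * B0"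
            using R0[of x n] n1[of n] K01 B0 by (intro mult_mono) (auto intro: order_trans[OF _ abs_ge_self])
          moreover have "x \<in> square 0 R" using True R by blast
          ultimately show ?thesis using True B0(1) by (simp add: H_def abs_mult)
        next
          case False
          then have "H n x = 0" using \<psi>(4)[of x] by (auto simp: H_def)
          then show ?thesis by simp
        qed
      qed
    qed
    define w where "w n = \<bar>R0\<bar> * (B1 * (1 / real n)) + B0 * (C * mod_const r * sqrt (1 / real n))" for n
    have w0: "0 \<le> w n" for n
      unfolding w_def using B0 B1 C mod_const_nonneg[OF r] by (intro add_nonneg_nonneg mult_nonneg_nonneg) auto
    show "\<bar>H n (x + t *\<^sub>R ?e) - H n x\<bar> \<le> w n" if n: "1 \<le> n" and t: "0 \<le> t" "t \<le> 1 / real n" for n t x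
    proof (cases "n < N \<or> x \<notin> K0 \<and> x + t *\<^sub>R ?e \<notin> K0")
      case True
      then have "H n (x + t *\<^sub>R ?e) = 0" "H n x = 0"
        using \<psi>(4)[of x] \<psi>(4)[of "x + t *\<^sub>R ?e"] by (auto simp: H_def)
      then show ?thesis using w0 by simp
    next
      case False
      then have nN: "N \<le> n" and K: "x \<in> K0 \<or> x + t *\<^sub>R ?e \<in> K0" by auto
      have te: "\<bar>t\<bar> \<le> e" "t \<le> r / 2" using N(2)[OF nN] t by auto
      have x1: "x \<in> K1" "x + t *\<^sub>R ?e \<in> K1"
        using K K1in[of x 0] K1in[of x t] K1in[of "x + t *\<^sub>R ?e" 0] K1in[of "x + t *\<^sub>R ?e" "- t"] te(1) e(1) by auto
      have "\<bar>rep (h n) x - rep (h n) (x + t *\<^sub>R ?e)\<bar> \<le> C * mod_const r * sqrt (\<bar>x $ 1 - (x + t *\<^sub>R ?e) $ 1\<bar> + \<bar>x $ 2 - (x + t *\<^sub>R ?e) $ 2\<bar>)"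
        by (rule rep_modulus[OF mb[OF x1(1) n] mb[OF x1(2) n] C hs[OF n] r]) (use t te in \<open>auto simp: square_def axis_def\<close>)
      also have "\<dots> \<le> C * mod_const r * sqrt (1 / real n)"
        using C mod_const_nonneg[OF r] t by (intro mult_left_mono real_sqrt_le_mono) (auto simp: axis_def)
      finally have m: "\<bar>rep (h n) (x + t *\<^sub>R ?e) - rep (h n) x\<bar> \<le> C * mod_const r * sqrt (1 / real n)" by linarith
      have "\<bar>\<psi> (x + t *\<^sub>R ?e) - \<psi> x\<bar> \<le> B1 * \<bar>t\<bar>"
        using smooth_diff_bound[OF \<psi>(1), of 1 B1 x t 0] B1(2) by simp
      also have "\<dots> \<le> B1 * (1 / real n)" using B1(1) t by (intro mult_left_mono) auto
      finally have p: "\<bar>\<psi> (x + t *\<^sub>R ?e) - \<psi> x\<bar> \<le> B1 * (1 / real n)" .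
      have "H n (x + t *\<^sub>R ?e) - H n x = rep (h n) (x + t *\<^sub>R ?e) * (\<psi> (x + t *\<^sub>R ?e) - \<psi> x) + \<psi> x * (rep (h n) (x + t *\<^sub>R ?e) - rep (h n) x)"
        using nN by (simp add: H_def algebra_simps)
      also have "\<bar>\<dots>\<bar> \<le> \<bar>rep (h n) (x + t *\<^sub>R ?e)\<bar> * \<bar>\<psi> (x + t *\<^sub>R ?e) - \<psi> x\<bar> + \<bar>\<psi> x\<bar> * \<bar>rep (h n) (x + t *\<^sub>R ?e) - rep (h n) x\<bar>"
        by (rule order_trans[OF abs_triangle_ineq]) (simp add: abs_mult)
      also have "\<dots> \<le> w n"
        unfolding w_def
      proof (rule add_mono)
        show "\<bar>rep (h n) (x + t *\<^sub>R ?e)\<bar> * \<bar>\<psi> (x + t *\<^sub>R ?e) - \<psi> x\<bar> \<le> \<bar>R0\<bar> * (B1 * (1 / real n))"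
          using R0[OF x1(2) n] p by (intro mult_mono) auto
        show "\<bar>\<psi> x\<bar> * \<bar>rep (h n) (x + t *\<^sub>R ?e) - rep (h n) x\<bar> \<le> B0 * (C * mod_const r * sqrt (1 / real n))"
          using B0 m by (intro mult_mono) auto
      qed
      finally show ?thesis .
    qed
    have "w \<longlonglongrightarrow> \<bar>R0\<bar> * (B1 * 0) + B0 * (C * mod_const r * sqrt 0)"
      unfolding w_def[abs_def] by (intro tendsto_intros lim_1_over_n)
    then show "w \<longlonglongrightarrow> 0" by simp
  qed
  show ?thesis
  proof (rule Lim_transform_eventually[OF lim], rule eventually_sequentiallyI[of N])
    fix n assume n: "N \<le> n"
    then have nn: "1 \<le> n" using N(1) by simp
    have [measurable]: "h n \<in> borel_measurable lebesgue" "\<psi> \<in> borel_measurable lebesgue" "H n \<in> borel_measurable lebesgue"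
      "(\<lambda>x. chi \<theta> 1 (real n *\<^sub>R x)) \<in> borel_measurable lebesgue"
      using sqiD(1)[OF hs[OF nn]] borel_lebesgue[OF m\<psi>] borel_lebesgue[OF Hm] by (auto intro!: borel_lebesgue)
    show "(\<integral>x. (chi \<theta> 1 (real n *\<^sub>R x) - \<theta>) * H n x \<partial>lebesgue) = (\<integral>x. (chi \<theta> 1 (real n *\<^sub>R x) - \<theta>) * (h n x * \<psi> x) \<partial>lebesgue)"
    proof (rule integral_cong_AE)
      show "AE x in lebesgue. (chi \<theta> 1 (real n *\<^sub>R x) - \<theta>) * H n x = (chi \<theta> 1 (real n *\<^sub>R x) - \<theta>) * (h n x * \<psi> x)"
        using ae[OF nn]
      proof eventually_elim
        case (elim x)
        then show ?case using n \<psi>(4)[of x] by (cases "x \<in> K0") (auto simp: H_def)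
      qed
    qed measurable
  qed
qed

subsection \<open>The laminate\<close>

text \<open>The exceptional set is a countable union of vertical lines. It is applied to the jumps
  of the layer function, so that approximants of the flux are continuous almost everywhere.\<close>

lemma AE_not_frac:
  fixes n :: nat and c :: real
  assumes "1 \<le> n"
  shows "AE x :: real ^ 2 in lborel. frac ((real n *\<^sub>R x) $ 1 + 1/2) \<noteq> c"
proof -
  have "AE x :: real ^ 2 in lborel. x $ 1 \<noteq> (of_int k + c - 1/2) / real n" for k :: int
  proof -
    let ?N = "{x :: real ^ 2. x $ 1 = (of_int k + c - 1/2) / real n}"
    have cl: "closed ?N" by (intro closed_Collect_eq continuous_intros)
    have "negligible {x :: real ^ 2. x \<bullet> axis 1 1 = (of_int k + c - 1/2) / real n}"
      by (rule negligible_standard_hyperplane) (simp add: Basis_vec2)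
    then have "?N \<in> null_sets lebesgue" by (simp add: inner_axis_2 negligible_iff_null_sets)
    then have "?N \<in> null_sets lborel" using borel_closed[OF cl] by (simp add: null_sets_completion_iff)
    from AE_not_in[OF this] show ?thesis by simp
  qed
  then have "AE x :: real ^ 2 in lborel. \<forall>k::int. x $ 1 \<noteq> (of_int k + c - 1/2) / real n"
    by (simp add: AE_all_countable)
  then show ?thesis
  proof eventually_elim
    case (elim x)
    show ?case
    proof
      assume "frac ((real n *\<^sub>R x) $ 1 + 1/2) = c"
      then have "real n * x $ 1 = of_int \<lfloor>real n * x $ 1 + 1/2\<rfloor> + c - 1/2" by (simp add: frac_def)
      then have "x $ 1 = (of_int \<lfloor>real n * x $ 1 + 1/2\<rfloor> + c - 1/2) / real n" using assms by (simp add: field_simps)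
      then show False using elim by blast
    qed
  qed
qed

text \<open>A jump can occur at either end of a layer: at \<open>\<theta>\<close>, and where
  \<open>frac\<close> itself falls back to 0.\<close>

lemma isCont_chi:
  assumes "frac ((real n *\<^sub>R x) $ 1 + 1/2) \<noteq> 0" "frac ((real n *\<^sub>R x) $ 1 + 1/2) \<noteq> \<theta>"
  shows "isCont (\<lambda>x. chi \<theta> 1 (real n *\<^sub>R x)) x"
proof -
  let ?t = "\<lambda>x :: real ^ 2. (real n *\<^sub>R x) $ 1 + 1/2"
  have c: "isCont (\<lambda>x. frac (?t x)) x"
  proof (rule isCont_o2[of _ ?t])
    show "isCont ?t x" by (intro continuous_intros)
    show "isCont frac (?t x)" using assms(1) by (intro continuous_frac) (simp add: frac_eq_0_iff)
  qed
  have cn: "((\<lambda>x. frac (?t x)) \<longlongrightarrow> frac (?t x)) (nhds x)"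
    using c unfolding isCont_def by (rule tendsto_at_iff_tendsto_nhds[THEN iffD1])
  have ev: "\<forall>\<^sub>F y in nhds x. chi \<theta> 1 (real n *\<^sub>R y) = chi \<theta> 1 (real n *\<^sub>R x)"
  proof (cases "frac (?t x) < \<theta>")
    case True
    have "\<forall>\<^sub>F y in nhds x. frac (?t y) < \<theta>"
      by (rule order_tendstoD(2)[OF cn True])
    then show ?thesis by eventually_elim (use True in \<open>simp only: chi_1, simp\<close>)
  next
    case False
    then have "\<theta> < frac (?t x)" using assms(2) by simp
    then have "\<forall>\<^sub>F y in nhds x. \<theta> < frac (?t y)"
      by (rule order_tendstoD(1)[OF cn])
    then show ?thesis by eventually_elim (use False assms(2) in \<open>simp only: chi_1, simp\<close>)
  qed
  show ?thesis
    by (subst isCont_cong[OF ev]) simp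
qed

locale laminate =
  fixes \<theta> \<alpha> \<beta> :: real and \<Omega> :: "(real ^ 2) set"
    and f :: "real ^ 2 \<Rightarrow> real" and Df :: "real ^ 2 \<Rightarrow> real ^ 2"
    and u :: "nat \<Rightarrow> real ^ 2 \<Rightarrow> real" and Du :: "nat \<Rightarrow> real ^ 2 \<Rightarrow> real ^ 2"
    and uH :: "real ^ 2 \<Rightarrow> real" and DuH :: "real ^ 2 \<Rightarrow> real ^ 2"
  assumes theta: "0 < \<theta>" "\<theta> < 1" and ab: "0 < \<alpha>" "\<alpha> < \<beta>"
    and Omega: "open \<Omega>" "bounded \<Omega>" and f_H1: "H1 \<Omega> f Df"
    and u_sol: "\<And>n. n \<ge> 1 \<Longrightarrow> weak_solution \<Omega> (\<lambda>x v. coef \<theta> \<alpha> \<beta> (real n *\<^sub>R x) *\<^sub>R v) f (u n) (Du n)"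
    and uH_sol: "weak_solution \<Omega> (\<lambda>x v. AH \<theta> \<alpha> \<beta> v) f uH DuH"
begin

definition A where "A n x = coef \<theta> \<alpha> \<beta> (real n *\<^sub>R x)"
definition g where "g n = zero_ext \<Omega> (Du n)"
definition gH where "gH = zero_ext \<Omega> DuH"
definition f0 where "f0 = zero_ext \<Omega> f"
definition f2 where "f2 = zero_ext \<Omega> (\<lambda>x. Df x $ 2)"
text \<open>\<open>S\<close> and \<open>V\<close> are the normal flux and the tangential derivative, the two quantities that do not
  oscillate; \<open>SH\<close> and \<open>VH\<close> are their limits.\<close>

definition S where "S n x = A n x * g n x $ 1"
definition V where "V n x = g n x $ 2"
abbreviation "ah \<equiv> a_h \<theta> \<alpha> \<beta>"
abbreviation "am \<equiv> a_m \<theta> \<alpha> \<beta>"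
definition SH where "SH x = ah * gH x $ 1"
definition VH where "VH x = gH x $ 2"

lemma den_pos: "0 < \<theta> * \<beta> + (1 - \<theta>) * \<alpha>"
  using theta ab by (intro add_pos_pos mult_pos_pos) auto

lemma ah_pos: "0 < ah"
  using ab den_pos by (simp add: a_h_def)

lemma A_eq: "A n x = \<beta> + (\<alpha> - \<beta>) * chi \<theta> 1 (real n *\<^sub>R x)"
  unfolding A_def coef_def chi_2 by (simp add: algebra_simps)

lemma A_cases: "A n x = (if chi \<theta> 1 (real n *\<^sub>R x) = 1 then \<alpha> else \<beta>)"
  unfolding A_eq chi_1 by simp

text \<open>\<open>ah\<close> is the harmonic mean, so \<open>1 / A n\<close> has mean
  \<open>1 / ah\<close> and the deviation is a multiple of the layer function minus its mean.
  \<open>A_am\<close> is the analogue for the arithmetic mean \<open>am\<close>.\<close>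

lemma inv_A: "ah / A n x - 1 = ah * (1 / \<alpha> - 1 / \<beta>) * (chi \<theta> 1 (real n *\<^sub>R x) - \<theta>)"
proof -
  have m: "ah * (\<theta> / \<alpha> + (1 - \<theta>) / \<beta>) = 1"
  proof -
    have "\<theta> / \<alpha> + (1 - \<theta>) / \<beta> = (\<theta> * \<beta> + (1 - \<theta>) * \<alpha>) / (\<alpha> * \<beta>)" using ab by (simp add: field_simps)
    then show ?thesis using ab den_pos by (simp add: a_h_def)
  qed
  have "1 / A n x = 1 / \<beta> + (1 / \<alpha> - 1 / \<beta>) * chi \<theta> 1 (real n *\<^sub>R x)"
    unfolding A_eq chi_1 using ab by simp
  then have "ah / A n x - ah * (\<theta> / \<alpha> + (1 - \<theta>) / \<beta>) = ah * (1 / \<beta> + (1 / \<alpha> - 1 / \<beta>) * chi \<theta> 1 (real n *\<^sub>R x)) - ah * (\<theta> / \<alpha> + (1 - \<theta>) / \<beta>)"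
    by (metis mult.right_neutral times_divide_eq_right)
  also have "\<dots> = ah * (1 / \<alpha> - 1 / \<beta>) * (chi \<theta> 1 (real n *\<^sub>R x) - \<theta>)"
    by (simp add: algebra_simps diff_divide_distrib)
  finally show ?thesis unfolding m .
qed

lemma A_am: "A n x - am = (\<alpha> - \<beta>) * (chi \<theta> 1 (real n *\<^sub>R x) - \<theta>)"
  unfolding A_eq by (simp add: a_m_def algebra_simps)

lemma A_measurable [measurable]: "A n \<in> borel_measurable borel"
  unfolding A_eq[abs_def] by measurable

lemma coefficient: "coefficient \<alpha> \<beta> (A n)"
proof
  show "\<alpha> \<le> A n x" "A n x \<le> \<beta>" for x using ab by (auto simp: A_cases)
  show "A n (x + s *\<^sub>R axis 2 1) = A n x" for x s
    unfolding A_eq chi_1 by (simp add: axis_def)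
qed (use ab in auto)

lemma A_bounds: "\<alpha> \<le> A n x" "A n x \<le> \<beta>" "0 < A n x" "\<bar>A n x\<bar> \<le> \<beta>"
  using ab by (auto simp: A_cases)

lemma L2s: "L2 \<Omega> f" "L2 \<Omega> Df" "n \<ge> 1 \<Longrightarrow> L2 \<Omega> (u n)" "n \<ge> 1 \<Longrightarrow> L2 \<Omega> (Du n)" "L2 \<Omega> uH" "L2 \<Omega> DuH"
  using f_H1 u_sol[of n] uH_sol by (auto simp: weak_solution_def H10_def H1_def)

lemma sq_f0: "sq_int lebesgue f0" "integrable lebesgue f0" and sq_f2: "sq_int lebesgue f2"
proof -
  show "sq_int lebesgue f0" "integrable lebesgue f0" unfolding f0_def by (rule L2_zero_ext[OF Omega L2s(1)])+
  show "sq_int lebesgue f2"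
    using sq_int_nth(1)[OF L2_zero_ext(1)[OF Omega L2s(2)], of 2] unfolding f2_def zero_ext_nth .
qed

lemma sq_g: "n \<ge> 1 \<Longrightarrow> sq_int lebesgue (g n)" "n \<ge> 1 \<Longrightarrow> integrable lebesgue (g n)"
  and sq_gH: "sq_int lebesgue gH" "integrable lebesgue gH"
  unfolding g_def gH_def using L2_zero_ext[OF Omega] L2s by auto

lemma sq_S: "n \<ge> 1 \<Longrightarrow> sq_int lebesgue (S n)" and sq_V: "n \<ge> 1 \<Longrightarrow> sq_int lebesgue (V n)"
  and sq_SH: "sq_int lebesgue SH" and sq_VH: "sq_int lebesgue VH"
proof -
  show "sq_int lebesgue (V n)" if "n \<ge> 1" unfolding V_def[abs_def] by (rule sq_int_nth[OF sq_g(1)[OF that]])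
  show "sq_int lebesgue (S n)" if "n \<ge> 1"
  proof -
    have "sq_int lebesgue (\<lambda>x. A n x *\<^sub>R g n x $ 1)"
      by (rule sq_int_mult(1)[OF sq_int_nth(1)[OF sq_g(1)[OF that]] borel_lebesgue[OF A_measurable] A_bounds(4)])
    then show ?thesis by (simp add: S_def[abs_def])
  qed
  show "sq_int lebesgue VH" unfolding VH_def[abs_def] by (rule sq_int_nth[OF sq_gH(1)])
  show "sq_int lebesgue SH" using sq_int_scaleR[OF sq_int_nth(1)[OF sq_gH(1)], of ah 1] unfolding SH_def[abs_def] by simp
qed

lemma g_weak:
  assumes "n \<ge> 1" "test_fun \<Omega> \<phi>"
  shows "(\<integral>x. A n x * (g n x \<bullet> grad \<phi> x) \<partial>lebesgue) = (\<integral>x. f0 x * \<phi> x \<partial>lebesgue)"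
proof -
  have "(\<integral>x. A n x * (g n x \<bullet> grad \<phi> x) \<partial>lebesgue) = integral\<^sup>L (lebesgue_on \<Omega>) (\<lambda>x. (coef \<theta> \<alpha> \<beta> (real n *\<^sub>R x) *\<^sub>R Du n x) \<bullet> grad \<phi> x)"
    unfolding integral_on_zero_ext[OF Omega(1)]
    by (rule Bochner_Integration.integral_cong) (auto simp: zero_ext_def g_def A_def indicator_def)
  also have "\<dots> = integral\<^sup>L (lebesgue_on \<Omega>) (\<lambda>x. f x * \<phi> x)"
    using u_sol[OF assms(1)] assms(2) unfolding weak_solution_def by blast
  also have "\<dots> = (\<integral>x. f0 x * \<phi> x \<partial>lebesgue)"
    unfolding integral_on_zero_ext[OF Omega(1)]
    by (rule Bochner_Integration.integral_cong) (auto simp: zero_ext_def f0_def indicator_def)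
  finally show ?thesis .
qed

lemma AH_inner: "AH \<theta> \<alpha> \<beta> v \<bullet> w = ah * v $ 1 * w $ 1 + am * v $ 2 * w $ 2"
  by (simp add: AH_def inner_vec_def sum_2)

lemma gH_weak:
  assumes "test_fun \<Omega> \<phi>"
  shows "(\<integral>x. AH \<theta> \<alpha> \<beta> (gH x) \<bullet> grad \<phi> x \<partial>lebesgue) = (\<integral>x. f0 x * \<phi> x \<partial>lebesgue)"
proof -
  have "(\<integral>x. AH \<theta> \<alpha> \<beta> (gH x) \<bullet> grad \<phi> x \<partial>lebesgue) = integral\<^sup>L (lebesgue_on \<Omega>) (\<lambda>x. AH \<theta> \<alpha> \<beta> (DuH x) \<bullet> grad \<phi> x)"
    unfolding integral_on_zero_ext[OF Omega(1)] AH_inner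
    by (rule Bochner_Integration.integral_cong) (auto simp: zero_ext_def gH_def indicator_def)
  also have "\<dots> = integral\<^sup>L (lebesgue_on \<Omega>) (\<lambda>x. f x * \<phi> x)"
    using uH_sol assms unfolding weak_solution_def by blast
  also have "\<dots> = (\<integral>x. f0 x * \<phi> x \<partial>lebesgue)"
    unfolding integral_on_zero_ext[OF Omega(1)]
    by (rule Bochner_Integration.integral_cong) (auto simp: zero_ext_def f0_def indicator_def)
  finally show ?thesis .
qed

lemma weak_grad_zero_ext:
  assumes "weak_grad \<Omega> w h" "test_fun \<Omega> \<phi>"
  shows "(\<integral>x. zero_ext \<Omega> w x * partial j \<phi> x \<partial>lebesgue) = - (\<integral>x. zero_ext \<Omega> h x $ j * \<phi> x \<partial>lebesgue)"
proof -
  have "(\<integral>x. zero_ext \<Omega> w x * partial j \<phi> x \<partial>lebesgue) = integral\<^sup>L (lebesgue_on \<Omega>) (\<lambda>x. w x * partial j \<phi> x)"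
    unfolding integral_on_zero_ext[OF Omega(1)]
    by (rule Bochner_Integration.integral_cong) (auto simp: zero_ext_def indicator_def)
  also have "\<dots> = - integral\<^sup>L (lebesgue_on \<Omega>) (\<lambda>x. h x $ j * \<phi> x)"
    using assms unfolding weak_grad_def by blast
  also have "integral\<^sup>L (lebesgue_on \<Omega>) (\<lambda>x. h x $ j * \<phi> x) = (\<integral>x. zero_ext \<Omega> h x $ j * \<phi> x \<partial>lebesgue)"
    unfolding integral_on_zero_ext[OF Omega(1)]
    by (rule Bochner_Integration.integral_cong) (auto simp: zero_ext_def indicator_def)
  finally show ?thesis .
qed

lemma f_weak:
  assumes "test_fun \<Omega> \<phi>"
  shows "(\<integral>x. f0 x * partial 2 \<phi> x \<partial>lebesgue) = - (\<integral>x. f2 x * \<phi> x \<partial>lebesgue)"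
  using weak_grad_zero_ext[OF _ assms, of f Df 2] f_H1 unfolding H1_def f0_def f2_def zero_ext_nth by blast

text \<open>Both sides are minus the integral of u_n against
  \<open>tensor (deriv P) (deriv Q)\<close>, by the weak gradient in the two directions.\<close>

lemma cross_derivative:
  assumes n: "n \<ge> 1" and PQ: "smooth1 P" "smooth1 Q" "supp_in P (p $ 1) r" "supp_in Q (p $ 2) r" and sub: "square p r \<subseteq> \<Omega>"
  shows "(\<integral>x. g n x $ 2 * tensor (deriv P) Q x \<partial>lebesgue) = (\<integral>x. g n x $ 1 * tensor P (deriv Q) x \<partial>lebesgue)"
proof -
  have w: "weak_grad \<Omega> (u n) (Du n)" using u_sol[OF n] by (auto simp: weak_solution_def H10_def H1_def)
  have d: "smooth1 (deriv P)" "smooth1 (deriv Q)" "supp_in (deriv P) (p $ 1) r" "supp_in (deriv Q) (p $ 2) r"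
    using smooth1_D(2) supp_in_deriv PQ by auto
  have t: "test_fun \<Omega> (tensor P (deriv Q))" "test_fun \<Omega> (tensor (deriv P) Q)"
    by (rule test_funI[OF smooth_tensor compact_square sub tensor_outside]; (rule PQ d | assumption))+
  show ?thesis
    using weak_grad_zero_ext[OF w t(1), of 1] weak_grad_zero_ext[OF w t(2), of 2]
    unfolding partial_tensor[OF PQ(1) d(2)] partial_tensor[OF d(1) PQ(2)] g_def by simp
qed

lemma l2norm_AH: "sq_int lebesgue v \<Longrightarrow> sq_int lebesgue (\<lambda>x. AH \<theta> \<alpha> \<beta> (v x))"
  "sq_int lebesgue v \<Longrightarrow> L2n (\<lambda>x. AH \<theta> \<alpha> \<beta> (v x)) \<le> (\<bar>ah\<bar> + \<bar>am\<bar>) * L2n v"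
proof -
  have B: "norm (AH \<theta> \<alpha> \<beta> w) \<le> (\<bar>ah\<bar> + \<bar>am\<bar>) * norm w" for w
  proof -
    have "norm (AH \<theta> \<alpha> \<beta> w) \<le> \<bar>ah * w $ 1\<bar> + \<bar>am * w $ 2\<bar>"
      using norm_le_l1_cart[of "AH \<theta> \<alpha> \<beta> w"] by (simp add: sum_2 AH_def)
    also have "\<dots> \<le> \<bar>ah\<bar> * norm w + \<bar>am\<bar> * norm w"
      unfolding abs_mult by (intro add_mono mult_left_mono component_le_norm_cart) auto
    finally show ?thesis by (simp add: algebra_simps)
  qed
  assume v: "sq_int lebesgue v"
  have m: "AH \<theta> \<alpha> \<beta> \<in> borel_measurable borel"
  proof (intro borel_measurable_continuous_onI continuous_on_vec2)
    show "continuous_on UNIV (\<lambda>v. AH \<theta> \<alpha> \<beta> v $ j)" for j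
      using exhaust_2[of j] by (elim disjE) (auto simp: AH_def intro!: continuous_intros)
  qed
  show s: "sq_int lebesgue (\<lambda>x. AH \<theta> \<alpha> \<beta> (v x))"
    by (rule sq_int_bound[OF v measurable_compose[OF sqiD(1)[OF v] m] B])
  show "L2n (\<lambda>x. AH \<theta> \<alpha> \<beta> (v x)) \<le> (\<bar>ah\<bar> + \<bar>am\<bar>) * L2n v"
    by (rule l2norm_mono[OF v s _ B]) simp
qed

definition Mc where "Mc = \<bar>ah\<bar> + \<bar>am\<bar>"
text \<open>Comes from comparing \<open>\<alpha>\<close> times the squared norm of
  \<open>g n\<close> with \<open>Mc\<close> times the product of the norms of \<open>gH\<close> and
  \<open>g n\<close>.\<close>

definition Gb where "Gb = Mc / \<alpha> * L2n gH"

lemma Mc_nonneg: "0 \<le> Mc" and Gb_nonneg: "0 \<le> Gb"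
  using ab by (auto simp: Mc_def Gb_def)

lemma approx:
  assumes "n \<ge> 1"
  shows "\<exists>\<phi>. (\<forall>k. test_fun \<Omega> (\<phi> k)) \<and> (\<lambda>k. L2n (\<lambda>x. grad (\<phi> k) x - g n x)) \<longlonglongrightarrow> 0"
proof -
  have H: "H10 \<Omega> (u n) (Du n)" using u_sol[OF assms] by (simp add: weak_solution_def)
  show ?thesis
    by (rule H10_approx[OF Omega H], unfold g_def) blast
qed

lemma approx_H: "\<exists>\<phi>. (\<forall>k. test_fun \<Omega> (\<phi> k)) \<and> (\<lambda>k. L2n (\<lambda>x. grad (\<phi> k) x - gH x)) \<longlonglongrightarrow> 0"
proof -
  have H: "H10 \<Omega> uH DuH" using uH_sol by (simp add: weak_solution_def)
  show ?thesis
    by (rule H10_approx[OF Omega H], unfold gH_def) blast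
qed

section \<open>Energy identity and uniform bounds\<close>

text \<open>Both equations have the same right-hand side, so they may be subtracted on the test
  functions approximating u_n. In the limit \<open>f\<close> has disappeared, and the energy is
  expressed through the gradient of u^H.\<close>

lemma energy_identity:
  assumes n: "n \<ge> 1"
  shows "(\<integral>x. A n x * (g n x \<bullet> g n x) \<partial>lebesgue) = (\<integral>x. AH \<theta> \<alpha> \<beta> (gH x) \<bullet> g n x \<partial>lebesgue)"
proof -
  obtain \<phi> where \<phi>: "\<And>k. test_fun \<Omega> (\<phi> k)"
    "(\<lambda>k. L2n (\<lambda>x. grad (\<phi> k) x - g n x)) \<longlonglongrightarrow> 0"
    using approx[OF n] by blast
  have sg: "sq_int lebesgue (grad (\<phi> k))" for k using smooth_cs_grad_sq_int[OF test_fun_smooth_cs[OF \<phi>(1)]] .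
  have sA: "sq_int lebesgue (\<lambda>x. A n x *\<^sub>R g n x)"
    by (rule sq_int_mult(1)[OF sq_g(1)[OF n] borel_lebesgue[OF A_measurable] A_bounds(4)])
  have 1: "(\<lambda>k. \<integral>x. (A n x *\<^sub>R g n x) \<bullet> grad (\<phi> k) x \<partial>lebesgue) \<longlonglongrightarrow> (\<integral>x. (A n x *\<^sub>R g n x) \<bullet> g n x \<partial>lebesgue)"
    by (rule inner_tendsto[OF sA sg sq_g(1)[OF n] \<phi>(2)])
  have 2: "(\<lambda>k. \<integral>x. AH \<theta> \<alpha> \<beta> (gH x) \<bullet> grad (\<phi> k) x \<partial>lebesgue) \<longlonglongrightarrow> (\<integral>x. AH \<theta> \<alpha> \<beta> (gH x) \<bullet> g n x \<partial>lebesgue)"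
    by (rule inner_tendsto[OF l2norm_AH(1)[OF sq_gH(1)] sg sq_g(1)[OF n] \<phi>(2)])
  have "(\<integral>x. (A n x *\<^sub>R g n x) \<bullet> grad (\<phi> k) x \<partial>lebesgue) = (\<integral>x. AH \<theta> \<alpha> \<beta> (gH x) \<bullet> grad (\<phi> k) x \<partial>lebesgue)" for k
    using g_weak[OF n \<phi>(1)] gH_weak[OF \<phi>(1)] by simp
  then show ?thesis using LIMSEQ_unique[OF 1] 2 by simp
qed

text \<open>Comparing the two equations gives a bound that is uniform in \<open>n\<close> without the Poincare inequality.\<close>

lemma g_bound:
  assumes n: "n \<ge> 1" shows "L2n (g n) \<le> Gb"
proof -
  interpret coefficient \<alpha> \<beta> "A n" by (rule coefficient)
  let ?X = "L2n (g n)"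
  have "\<alpha> * ?X\<^sup>2 = (\<integral>x. \<alpha> * (norm (g n x))\<^sup>2 \<partial>lebesgue)" by (simp add: l2norm_sq)
  also have "\<dots> \<le> (\<integral>x. A n x * (g n x \<bullet> g n x) \<partial>lebesgue)"
  proof (rule integral_mono)
    show "integrable lebesgue (\<lambda>x. \<alpha> * (norm (g n x))\<^sup>2)" using sq_g(1)[OF n] by (auto simp: sq_int_def)
    show "\<alpha> * (norm (g n x))\<^sup>2 \<le> A n x * (g n x \<bullet> g n x)" for x
      using A_bounds(1)[of n x] by (simp add: power2_norm_eq_inner mult_right_mono)
  qed (rule int_a[OF sq_g(1)[OF n] sq_g(1)[OF n]])
  also have "\<dots> \<le> L2n (\<lambda>x. AH \<theta> \<alpha> \<beta> (gH x)) * ?X"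
    using Cauchy_Schwarz_l2norm[OF l2norm_AH(1)[OF sq_gH(1)] sq_g(1)[OF n]] unfolding energy_identity[OF n] by linarith
  also have "\<dots> \<le> (Mc * L2n gH) * ?X"
    using l2norm_AH(2)[OF sq_gH(1)] by (intro mult_right_mono) (auto simp: Mc_def)
  finally have "?X * (\<alpha> * ?X) \<le> ?X * (Mc * L2n gH)" by (simp add: power2_eq_square mult_ac)
  then have "?X = 0 \<or> \<alpha> * ?X \<le> Mc * L2n gH"
    using mult_left_le_imp_le[of ?X "\<alpha> * ?X" "Mc * L2n gH"] l2norm_nonneg[of lebesgue "g n"] by linarith
  then show ?thesis
  proof
    assume "?X = 0" then show ?thesis using Gb_nonneg by simp
  next
    assume "\<alpha> * ?X \<le> Mc * L2n gH"
    then show ?thesis using ab by (simp add: Gb_def pos_le_divide_eq mult.commute)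
  qed
qed

text \<open>Uniformity has three sources: the radius depends only on the room around
  \<open>K\<close> in the domain, the cut-offs are translates of fixed ones, and the gradient enters
  the constants through its norm, bounded by \<open>Gb\<close>.\<close>

lemma uniform_mixed_bounds:
  assumes K: "compact K" "K \<subseteq> \<Omega>"
  obtains r C where "0 < r" "0 \<le> C"
    "\<And>x n. x \<in> K \<Longrightarrow> 1 \<le> n \<Longrightarrow> mixed_bound (S n) x r C" "\<And>x n. x \<in> K \<Longrightarrow> 1 \<le> n \<Longrightarrow> mixed_bound (V n) x r C"
proof -
  obtain e where e: "0 < e" "\<And>x. x \<in> K \<Longrightarrow> square x e \<subseteq> \<Omega>" using compact_square_sub[OF K(1) Omega(1) K(2)] by blast
  \<comment> \<open>The locale \<open>interior\<close> needs a square of half-width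
    \<open>6 * r\<close> inside the domain.\<close>
  define r where "r = e / 6"
  have r: "0 < r" and r6: "6 * r = e" using e(1) by (auto simp: r_def)
  obtain \<eta>1 L1 where c1: "cutoff (3 * r) (4 * r) \<eta>1 L1" using cutoff_ex[of "3 * r" "4 * r"] r by auto
  obtain \<eta>2 L2 where c2: "cutoff r (2 * r) \<eta>2 L2" using cutoff_ex[of r "2 * r"] r by auto
  define k1 where "k1 = cacc_const \<alpha> \<beta> L1 * (L2n f2 + Gb)"
  define k2 where "k2 = cacc_const \<alpha> \<beta> L2 * (L2n f2 + k1)"
  define C where "C = (1 + \<beta>) * (k1 + k2) + L2n f0 + L2n f2"
  have both: "mixed_bound (S n) x r C \<and> mixed_bound (V n) x r C" if x: "x \<in> K" and n: "1 \<le> n" for x n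
  proof -
    obtain \<phi> where \<phi>: "\<And>k. test_fun \<Omega> (\<phi> k)"
      "(\<lambda>k. L2n (\<lambda>x. grad (\<phi> k) x - g n x)) \<longlonglongrightarrow> 0"
      using approx[OF n] by blast
    interpret coefficient \<alpha> \<beta> "A n" by (rule coefficient)
    have gi: "integrable lebesgue (\<lambda>x. g n x $ j)" for j
      using integrable_inner_left[OF sq_g(2)[OF n], of "axis j 1"] by (simp add: inner_axis_2)
    interpret I: interior \<alpha> \<beta> "A n" \<Omega> f0 f2 "g n" \<phi> x r \<eta>1 \<eta>2 L1 L2
      by unfold_locales
        (use sq_f0 sq_f2 f_weak sq_g(1)[OF n] gi g_weak[OF n] test_fun_smooth_cs[OF \<phi>(1)] \<phi>(2) r e(2)[OF x] r6 c1 c2 in auto)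
    have "I.K1 \<le> k1"
      unfolding I.K1_def k1_def using g_bound[OF n] I.cacc_const_nonneg[OF I.L_nonneg(1)] by (intro mult_left_mono) auto
    moreover from this have "I.K2 \<le> k2"
      unfolding I.K2_def k2_def using I.cacc_const_nonneg[OF I.L_nonneg(2)] by (intro mult_left_mono) auto
    ultimately have "(1 + \<beta>) * (I.K1 + I.K2) \<le> (1 + \<beta>) * (k1 + k2)"
      using beta(1) by (intro mult_left_mono) auto
    then have KC: "I.KC \<le> C" unfolding I.KC_def C_def by simp
    have "square x r \<subseteq> \<Omega>" using I.sub'[of r] r by simp
    note m = I.mixed_bounds[OF cross_derivative[OF n _ _ _ _ this]]
    show ?thesis
      using mixed_bound_mono[OF m(1) KC] mixed_bound_mono[OF m(2) KC]
      unfolding S_def[abs_def] V_def[abs_def] by blast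
  qed
  show ?thesis
  proof (cases "K = {}")
    case True
    then show ?thesis using that[of r 0] r by blast
  next
    case False
    have C0: "0 \<le> C"
    proof -
      have L: "0 \<le> L1" "0 \<le> L2" using c1 c2 by (auto simp: cutoff_def)
      have cc: "0 \<le> cacc_const \<alpha> \<beta> L" if "0 \<le> L" for L using that ab by (simp add: cacc_const_def)
      have k: "0 \<le> k1" unfolding k1_def using cc[OF L(1)] Gb_nonneg by (intro mult_nonneg_nonneg add_nonneg_nonneg) auto
      then have "0 \<le> k2" unfolding k2_def using cc[OF L(2)] by (intro mult_nonneg_nonneg add_nonneg_nonneg) auto
      then show ?thesis unfolding C_def using k ab by (intro add_nonneg_nonneg mult_nonneg_nonneg) auto
    qed
    show ?thesis by (rule that[OF r C0]) (use both in blast)+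
  qed
qed

end

section \<open>Strong convergence of the flux and the tangential derivative\<close>

lemma oscillation_smooth_cs:
  assumes th: "0 < \<theta>" "\<theta> < 1" and \<psi>: "smooth_cs \<psi>"
  shows "(\<lambda>n. \<integral>x. (chi \<theta> 1 (real n *\<^sub>R x) - \<theta>) * \<psi> x \<partial>lebesgue) \<longlonglongrightarrow> 0"
proof -
  obtain T where T: "compact T" "\<And>x. x \<notin> T \<Longrightarrow> \<psi> x = 0" using csmE[OF \<psi>] by blast
  obtain T1 where T1: "compact T1" "\<And>x. x \<notin> T1 \<Longrightarrow> partial 1 \<psi> x = 0" using csmE[OF smooth_cs_partial[OF \<psi>]] by blast
  obtain B where B: "0 \<le> B" "\<And>x. norm (partial 1 \<psi> x) \<le> B"
    using cc_bounded[OF smooth_cont[OF smooth_cs_smooth[OF smooth_cs_partial[OF \<psi>]]] T1] by blast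
  obtain b where b: "\<And>x. x \<in> T \<Longrightarrow> norm x \<le> b" using compact_imp_bounded[OF T(1)] by (auto simp: bounded_iff)
  have z: "\<psi> x = 0" if "x \<notin> square 0 b" for x
  proof (rule T(2))
    show "x \<notin> T"
      using that b[of x] component_le_norm_cart[of x 1] component_le_norm_cart[of x 2] by (auto simp: square_def)
  qed
  show ?thesis
  proof (rule oscillation_limit[OF th, where H = "\<lambda>n. \<psi>" and R = b and w = "\<lambda>n. B * (1 / real n)"])
    show "integrable lborel \<psi>" by (rule cc_integrable(1)[OF smooth_cont[OF smooth_cs_smooth[OF \<psi>]] T])
    show "\<bar>\<psi> (x + t *\<^sub>R axis 1 1) - \<psi> x\<bar> \<le> B * (1 / real n)" if "0 \<le> t" "t \<le> 1 / real n" for n t x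
    proof -
      have "\<bar>\<psi> (x + t *\<^sub>R axis 1 1) - \<psi> x\<bar> \<le> B * \<bar>t\<bar>"
        using smooth_diff_bound[OF smooth_cs_smooth[OF \<psi>], of 1 B x t 0] B(2) by simp
      also have "\<dots> \<le> B * (1 / real n)" using B(1) that by (intro mult_left_mono) auto
      finally show ?thesis .
    qed
    show "(\<lambda>n. B * (1 / real n)) \<longlonglongrightarrow> 0" by (rule tendsto_mult_right_zero[OF lim_1_over_n])
  qed (use smooth_cs_borel[OF \<psi>] z in auto)
qed

text \<open>To be read with \<open>g\<close> for the gradient of u_n, \<open>h\<close> for that of
  u^H, \<open>d\<close> for that of a test function, \<open>b\<close> and \<open>m\<close> for the
  homogenized coefficients. The first line on the right is small when \<open>d\<close> is close to
  \<open>h\<close>, the second carries a mean-zero oscillating factor in every term, and the last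
  two integrate to 0 by the equations.\<close>

lemma energy_algebra:
  fixes A k :: real
  assumes "A * k = b"
  shows "A * ((g1 - k * d1) * (g1 - k * d1)) + A * ((g2 - d2) * (g2 - d2))
    = b * (h1 - d1) * g1 + m * (h2 - d2) * g2 + (b * (d1 - h1) * d1 + m * (d2 - h2) * d2)
      + (- ((A - m) * (g2 * d2)) - (k - 1) * (A * g1 * d1) + b * ((k - 1) * (d1 * d1)) + (A - m) * (d2 * d2))
      + (A * (g1 * g1 + g2 * g2) - (b * h1 * g1 + m * h2 * g2))
      + (b * h1 * d1 + m * h2 * d2 - A * (g1 * d1 + g2 * d2))"
  unfolding assms[symmetric] by (simp add: algebra_simps)

context laminate
begin

text \<open>Supplies \<open>rep_AE\<close> with the approximants \<open>b\<close> times
  \<open>partial j (\<phi> k)\<close>, continuous wherever \<open>b\<close> is. Convergence of the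
  gradients in L2 gives convergence in L1, because everything vanishes outside a set of finite
  measure.\<close>

lemma rep_AE_flux:
  assumes b: "b \<in> borel_measurable borel" "\<And>x. \<bar>b x\<bar> \<le> B" "AE x in lborel. isCont b x"
    and G: "sq_int lebesgue G" "integrable lebesgue G" "\<And>x. x \<notin> \<Omega> \<Longrightarrow> G x = 0"
    and \<phi>: "\<And>k. test_fun \<Omega> (\<phi> k)" "(\<lambda>k. L2n (\<lambda>x. grad (\<phi> k) x - G x)) \<longlonglongrightarrow> 0"
    and mb: "\<And>x. x \<in> K \<Longrightarrow> mixed_bound (\<lambda>x. b x * G x $ j) x r C" and r: "0 < r" "0 \<le> C"
  shows "AE x in lebesgue. x \<in> K \<longrightarrow> rep (\<lambda>x. b x * G x $ j) x = b x * G x $ j"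
proof -
  let ?h = "\<lambda>x. b x * G x $ j"
  let ?c = "\<lambda>k x. b x * partial j (\<phi> k) x"
  note bl = borel_lebesgue[OF b(1)]
  note cs = test_fun_smooth_cs[OF \<phi>(1)]
  have B0: "0 \<le> B" using b(2)[of 0] by linarith
  have sh: "sq_int lebesgue ?h" using sq_int_mult(1)[OF sq_int_nth(1)[OF G(1)] bl b(2)] by simp
  have sc: "sq_int lebesgue (?c k)" for k using sq_int_mult(1)[OF smooth_cs_sq_int[OF smooth_cs_partial[OF cs]] bl b(2)] by simp
  have fin: "\<Omega> \<in> lmeasurable" using Omega by (simp add: lmeasurable_open)
  have ind: "integrable lebesgue (indicator \<Omega> :: _ \<Rightarrow> real)"
    using fmeasurableD[OF fin] fmeasurableD2[OF fin] by (intro integrable_real_indicator) (auto simp: less_top)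
  have si: "sq_int lebesgue (indicator \<Omega> :: _ \<Rightarrow> real)"
  proof -
    have "(norm (indicator \<Omega> x :: real))\<^sup>2 = indicator \<Omega> x" for x by (simp add: indicator_def)
    then show ?thesis unfolding sq_int_def using ind by auto
  qed
  have i1: "integrable lebesgue F" if "sq_int lebesgue F" "\<And>x. x \<notin> \<Omega> \<Longrightarrow> F x = 0" for F :: "real ^ 2 \<Rightarrow> real"
  proof -
    have "(\<lambda>x. indicator \<Omega> x \<bullet> F x) = F" using that(2) by (auto simp: indicator_def fun_eq_iff)
    then show ?thesis using sq_int_inner[OF si that(1)] by simp
  qed
  have hz: "?h x = 0" and cz: "?c k x = 0" if "x \<notin> \<Omega>" for x k
    using G(3)[OF that] test_fun_out(3)[OF \<phi>(1) that] by auto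
  have d: "L2n (\<lambda>x. ?h x - ?c k x) \<le> B * L2n (\<lambda>x. grad (\<phi> k) x - G x)" for k
  proof -
    have sd: "sq_int lebesgue (\<lambda>x. grad (\<phi> k) x - G x)" by (intro sq_int_diff smooth_cs_grad_sq_int cs G(1))
    show ?thesis
    proof (rule l2norm_mono[OF sd sq_int_diff[OF sh sc] B0])
      fix x
      have "norm (?h x - ?c k x) = \<bar>b x\<bar> * \<bar>(grad (\<phi> k) x - G x) $ j\<bar>"
        by (simp add: grad_nth abs_minus_commute flip: right_diff_distrib abs_mult)
      also have "\<dots> \<le> B * norm (grad (\<phi> k) x - G x)"
        by (intro mult_mono b(2) component_le_norm_cart B0) auto
      finally show "norm (?h x - ?c k x) \<le> B * norm (grad (\<phi> k) x - G x)" .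
    qed
  qed
  show ?thesis
  proof (rule rep_AE[where c = ?c])
    show "integrable lebesgue ?h" by (rule i1[OF sh hz])
    show "integrable lebesgue (?c k)" for k by (rule i1[OF sc cz])
    show "?c k \<in> borel_measurable borel" for k using b(1) smooth_cs_borel[OF smooth_cs_partial[OF cs]] by simp
    show "AE x in lborel. isCont (?c k) x" for k
      using b(3)
    proof eventually_elim
      case (elim x)
      have "isCont (partial j (\<phi> k)) x"
        using smooth_cont[OF smooth_cs_smooth[OF smooth_cs_partial[OF cs]]] by (simp add: continuous_on_eq_continuous_at)
      then show ?case using elim by (intro isCont_mult)
    qed
    show "(\<lambda>k. \<integral>x. \<bar>?h x - ?c k x\<bar> \<partial>lebesgue) \<longlonglongrightarrow> 0"
    proof (rule tendsto_sandwich[where f = "\<lambda>k. 0"])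
      let ?M = "L2n (indicator \<Omega> :: _ \<Rightarrow> real)"
      show "(\<lambda>k. ?M * (B * L2n (\<lambda>x. grad (\<phi> k) x - G x))) \<longlonglongrightarrow> 0"
        by (intro tendsto_mult_right_zero \<phi>(2))
      have "(\<integral>x. \<bar>?h x - ?c k x\<bar> \<partial>lebesgue) \<le> ?M * (B * L2n (\<lambda>x. grad (\<phi> k) x - G x))" for k
      proof -
        have sa: "sq_int lebesgue (\<lambda>x. \<bar>?h x - ?c k x\<bar>)"
          using sq_int_diff[OF sh sc[of k]] by (auto simp: sq_int_def)
        have "(\<integral>x. \<bar>?h x - ?c k x\<bar> \<partial>lebesgue) = (\<integral>x. indicator \<Omega> x \<bullet> \<bar>?h x - ?c k x\<bar> \<partial>lebesgue)"
        proof (rule Bochner_Integration.integral_cong[OF refl])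
          show "\<bar>?h x - ?c k x\<bar> = indicator \<Omega> x \<bullet> \<bar>?h x - ?c k x\<bar>" for x
            using G(3)[of x] test_fun_out(3)[OF \<phi>(1), of x j k] by (cases "x \<in> \<Omega>") simp_all
        qed
        also have "\<dots> \<le> ?M * L2n (\<lambda>x. \<bar>?h x - ?c k x\<bar>)"
          using Cauchy_Schwarz_l2norm[OF si sa] by linarith
        also have "L2n (\<lambda>x. \<bar>?h x - ?c k x\<bar>) = L2n (\<lambda>x. ?h x - ?c k x)" by (simp add: l2norm_def)
        also have "?M * \<dots> \<le> ?M * (B * L2n (\<lambda>x. grad (\<phi> k) x - G x))"
          by (rule mult_left_mono[OF d]) simp
        finally show ?thesis .
      qed
      then show "\<forall>\<^sub>F k in sequentially. (\<integral>x. \<bar>?h x - ?c k x\<bar> \<partial>lebesgue) \<le> ?M * (B * L2n (\<lambda>x. grad (\<phi> k) x - G x))"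
        by simp
    qed auto
    show "(\<lambda>m. avg ?h x (1 / real (Suc m))) \<longlonglongrightarrow> rep ?h x" if "x \<in> K" for x
      by (rule avg_tendsto_rep[OF mb[OF that] r(2) sh r(1)])
  qed (use sh sc in auto)
qed

lemma isCont_A:
  assumes "1 \<le> n" shows "AE x in lborel. isCont (A n) x"
  using AE_not_frac[OF assms, of 0] AE_not_frac[OF assms, of \<theta>]
proof eventually_elim
  case (elim x)
  show ?case unfolding A_eq[abs_def] by (intro continuous_intros isCont_chi elim)
qed

lemma g_out: "x \<notin> \<Omega> \<Longrightarrow> g n x = 0" and gH_out: "x \<notin> \<Omega> \<Longrightarrow> gH x = 0"
  by (simp_all add: g_def gH_def zero_ext_out)

lemma rep_S:
  assumes n: "1 \<le> n" and K: "compact K" "K \<subseteq> \<Omega>"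
  shows "AE x in lebesgue. x \<in> K \<longrightarrow> rep (S n) x = S n x"
proof -
  obtain r C where m: "0 < r" "0 \<le> C" "\<And>x. x \<in> K \<Longrightarrow> mixed_bound (S n) x r C"
    using uniform_mixed_bounds[OF K] n by metis
  obtain \<phi> where \<phi>: "\<And>k. test_fun \<Omega> (\<phi> k)" "(\<lambda>k. L2n (\<lambda>x. grad (\<phi> k) x - g n x)) \<longlonglongrightarrow> 0"
    using approx[OF n] by blast
  show ?thesis
    using rep_AE_flux[OF A_measurable A_bounds(4) isCont_A[OF n] sq_g[OF n] g_out \<phi> _ m(1,2), of K 1] m(3)
    unfolding S_def[abs_def] by blast
qed

lemma rep_V:
  assumes n: "1 \<le> n" and K: "compact K" "K \<subseteq> \<Omega>"
  shows "AE x in lebesgue. x \<in> K \<longrightarrow> rep (V n) x = V n x"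
proof -
  obtain r C where m: "0 < r" "0 \<le> C" "\<And>x. x \<in> K \<Longrightarrow> mixed_bound (V n) x r C"
    using uniform_mixed_bounds[OF K] n by metis
  obtain \<phi> where \<phi>: "\<And>k. test_fun \<Omega> (\<phi> k)" "(\<lambda>k. L2n (\<lambda>x. grad (\<phi> k) x - g n x)) \<longlonglongrightarrow> 0"
    using approx[OF n] by blast
  have e: "V n = (\<lambda>x. 1 * g n x $ 2)" by (simp add: V_def fun_eq_iff)
  show ?thesis
    using rep_AE_flux[of "\<lambda>x. 1" 1, OF _ _ _ sq_g[OF n] g_out \<phi> _ m(1,2), of K 2] m(3)
    unfolding e by simp
qed

lemma equi_S: "equi \<Omega> S" and equi_V: "equi \<Omega> V"
proof -
  have bS: "L2n (S n) \<le> \<beta> * Gb" if n: "1 \<le> n" for n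
  proof -
    have "L2n (\<lambda>x. A n x *\<^sub>R g n x $ 1) \<le> \<beta> * L2n (\<lambda>x. g n x $ 1)"
      by (rule sq_int_mult(2)[OF sq_int_nth(1)[OF sq_g(1)[OF n]] borel_lebesgue[OF A_measurable] A_bounds(4)])
    also have "\<dots> \<le> \<beta> * Gb"
      using sq_int_nth(2)[OF sq_g(1)[OF n], of 1] g_bound[OF n] ab by (intro mult_left_mono) auto
    finally show ?thesis by (simp add: S_def[abs_def])
  qed
  have bV: "L2n (V n) \<le> Gb" if n: "1 \<le> n" for n
    using sq_int_nth(2)[OF sq_g(1)[OF n], of 2] g_bound[OF n] by (simp add: V_def[abs_def])
  show "equi \<Omega> S"
    unfolding equi_def
  proof (intro conjI allI impI)
    fix K assume K: "compact K \<and> K \<subseteq> \<Omega>"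
    show "\<exists>r>0. \<exists>C\<ge>0. \<forall>x\<in>K. \<forall>n\<ge>1. mixed_bound (S n) x r C"
      by (rule uniform_mixed_bounds[of K]) (use K in blast)+
  qed (use sq_S bS rep_S in blast)+
  show "equi \<Omega> V"
    unfolding equi_def
  proof (intro conjI allI impI)
    fix K assume K: "compact K \<and> K \<subseteq> \<Omega>"
    show "\<exists>r>0. \<exists>C\<ge>0. \<forall>x\<in>K. \<forall>n\<ge>1. mixed_bound (V n) x r C"
      by (rule uniform_mixed_bounds[of K]) (use K in blast)+
  qed (use sq_V bV rep_V in blast)+
qed

definition osc where "osc \<psi> n = (\<integral>x. (chi \<theta> 1 (real n *\<^sub>R x) - \<theta>) * \<psi> n x \<partial>lebesgue)"

text \<open>The amplitude of \<open>ah / A n - 1\<close> found in \<open>inv_A\<close>.\<close>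

definition cc where "cc = ah * (1 / \<alpha> - 1 / \<beta>)"

definition R where
  "R \<phi> n = - (\<alpha> - \<beta>) * osc (\<lambda>n x. V n x * partial 2 \<phi> x) n - cc * osc (\<lambda>n x. S n x * partial 1 \<phi> x) n
    + ah * cc * osc (\<lambda>n x. partial 1 \<phi> x * partial 1 \<phi> x) n + (\<alpha> - \<beta>) * osc (\<lambda>n x. partial 2 \<phi> x * partial 2 \<phi> x) n"

text \<open>The terms with \<open>V n\<close> and \<open>S n\<close> are products of two factors,
  one varying with \<open>n\<close>, and rest on equicontinuity; in the other two the smooth factor
  is fixed.\<close>

lemma R_tendsto:
  assumes \<phi>: "test_fun \<Omega> \<phi>" shows "R \<phi> \<longlonglongrightarrow> 0"
proof -
  obtain K where K: "smooth \<phi>" "compact K" "K \<subseteq> \<Omega>" "\<And>x. x \<notin> K \<Longrightarrow> \<phi> x = 0" using test_funE[OF \<phi>] by metis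
  have z: "partial j \<phi> x = 0" if "x \<notin> K" for j x
    using partial_outside[of K \<phi> x j] compact_imp_closed[OF K(2)] K(4) that by blast
  note cs = test_fun_smooth_cs[OF \<phi>]
  have "osc (\<lambda>n x. V n x * partial 2 \<phi> x) \<longlonglongrightarrow> 0" "osc (\<lambda>n x. S n x * partial 1 \<phi> x) \<longlonglongrightarrow> 0"
    unfolding osc_def
    using oscillation_equi[OF theta Omega(1) equi_V smooth_partial[OF K(1)] K(2,3) z]
      oscillation_equi[OF theta Omega(1) equi_S smooth_partial[OF K(1)] K(2,3) z] by blast+
  moreover have "osc (\<lambda>n x. partial j \<phi> x * partial j \<phi> x) \<longlonglongrightarrow> 0" for j
    unfolding osc_def
    by (rule oscillation_smooth_cs[OF theta smooth_cs_mult[OF smooth_partial[OF K(1)] smooth_cs_partial[OF cs]]])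
  ultimately have "R \<phi> \<longlonglongrightarrow> - (\<alpha> - \<beta>) * 0 - cc * 0 + ah * cc * 0 + (\<alpha> - \<beta>) * 0"
    unfolding R_def[abs_def] by (intro tendsto_intros)
  then show ?thesis by simp
qed

definition W1 where "W1 \<phi> n x = g n x $ 1 - ah / A n x * partial 1 \<phi> x"
definition W2 where "W2 \<phi> n x = g n x $ 2 - partial 2 \<phi> x"

lemma W_sq_int:
  assumes n: "1 \<le> n" and \<phi>: "test_fun \<Omega> \<phi>"
  shows "sq_int lebesgue (W1 \<phi> n)" "sq_int lebesgue (W2 \<phi> n)"
proof -
  note cs = test_fun_smooth_cs[OF \<phi>]
  show "sq_int lebesgue (W2 \<phi> n)"
    unfolding W2_def[abs_def] by (intro sq_int_diff sq_int_nth(1) sq_g(1) n smooth_cs_sq_int smooth_cs_partial cs)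
  have "sq_int lebesgue (\<lambda>x. (ah / A n x) *\<^sub>R partial 1 \<phi> x)"
  proof (rule sq_int_mult(1)[OF smooth_cs_sq_int[OF smooth_cs_partial[OF cs]]])
    show "(\<lambda>x. ah / A n x) \<in> borel_measurable lebesgue" by (rule borel_lebesgue) measurable
    show "\<bar>ah / A n x\<bar> \<le> ah / \<alpha>" for x
      using ah_pos A_bounds(1,3)[of n x] ab by (simp add: divide_left_mono)
  qed
  then show "sq_int lebesgue (W1 \<phi> n)"
    unfolding W1_def[abs_def] using sq_int_diff[OF sq_int_nth(1)[OF sq_g(1)[OF n], of 1]] by simp
qed

text \<open>\<open>W1\<close>, \<open>W2\<close> are the components of the difference between the gradient of \<open>u\<^sub>n\<close> and the corrected
  gradient of \<open>\<phi>\<close>; all oscillating terms of the energy are collected in \<open>R\<close>.\<close>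

lemma energy_bound:
  assumes n: "1 \<le> n" and \<phi>: "test_fun \<Omega> \<phi>"
  defines "d \<equiv> L2n (\<lambda>x. grad \<phi> x - gH x)"
  shows "\<alpha> * (L2n (W1 \<phi> n))\<^sup>2 + \<alpha> * (L2n (W2 \<phi> n))\<^sup>2 \<le> Mc * d * (Gb + L2n gH + d) + \<bar>R \<phi> n\<bar>"
proof -
  note cs = test_fun_smooth_cs[OF \<phi>]
  interpret coefficient \<alpha> \<beta> "A n" by (rule coefficient)
  let ?AH = "AH \<theta> \<alpha> \<beta>"
  let ?x = "\<lambda>x. chi \<theta> 1 (real n *\<^sub>R x) - \<theta>"
  have sg: "sq_int lebesgue (grad \<phi>)" by (rule smooth_cs_grad_sq_int[OF cs])
  have sp: "sq_int lebesgue (partial j \<phi>)" for j by (rule smooth_cs_sq_int[OF smooth_cs_partial[OF cs]])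
  have sgn: "sq_int lebesgue (g n)" by (rule sq_g(1)[OF n])
  have sd: "sq_int lebesgue (\<lambda>x. grad \<phi> x - gH x)" "sq_int lebesgue (\<lambda>x. gH x - grad \<phi> x)" by (intro sq_int_diff sg sq_gH(1))+
  have xm: "?x \<in> borel_measurable lebesgue" by (rule borel_lebesgue) measurable
  have xb: "\<bar>?x x\<bar> \<le> 1" for x using chi_bound[of \<theta> 1 "real n *\<^sub>R x"] theta by (simp add: abs_le_iff)
  have ix: "integrable lebesgue (\<lambda>x. ?x x * (F x * G x))" if "sq_int lebesgue F" "sq_int lebesgue G" for F G :: "real ^ 2 \<Rightarrow> real"
    by (rule sq_int_prod_integrable[OF that xm xb])
  have iW: "integrable lebesgue (\<lambda>x. A n x * (W x * W x))" if "sq_int lebesgue W" for W :: "real ^ 2 \<Rightarrow> real"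
    by (rule sq_int_prod_integrable[OF that that borel_lebesgue[OF A_measurable] A_bounds(4)])
  have lower: "\<alpha> * (L2n W)\<^sup>2 \<le> (\<integral>x. A n x * (W x * W x) \<partial>lebesgue)" if W: "sq_int lebesgue W" for W :: "real ^ 2 \<Rightarrow> real"
  proof -
    have "\<alpha> * (L2n W)\<^sup>2 = (\<integral>x. \<alpha> * (norm (W x))\<^sup>2 \<partial>lebesgue)" by (simp add: l2norm_sq)
    also have "\<dots> \<le> (\<integral>x. A n x * (W x * W x) \<partial>lebesgue)"
    proof (rule integral_mono[OF _ iW[OF W]])
      show "integrable lebesgue (\<lambda>x. \<alpha> * (norm (W x))\<^sup>2)" using W by (auto simp: sq_int_def)
      show "\<alpha> * (norm (W x))\<^sup>2 \<le> A n x * (W x * W x)" for x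
        using A_bounds(1)[of n x] by (simp add: power2_eq_square mult_right_mono)
    qed
    finally show ?thesis .
  qed
  define T1 where "T1 x = ?AH (gH x - grad \<phi> x) \<bullet> g n x" for x
  define T2 where "T2 x = ?AH (grad \<phi> x - gH x) \<bullet> grad \<phi> x" for x
  define Z1 where "Z1 x = ?x x * (V n x * partial 2 \<phi> x)" for x
  define Z2 where "Z2 x = ?x x * (S n x * partial 1 \<phi> x)" for x
  define Z3 where "Z3 x = ?x x * (partial 1 \<phi> x * partial 1 \<phi> x)" for x
  define Z4 where "Z4 x = ?x x * (partial 2 \<phi> x * partial 2 \<phi> x)" for x
  define Y1 where "Y1 x = A n x * (g n x \<bullet> g n x)" for x
  define Y2 where "Y2 x = ?AH (gH x) \<bullet> g n x" for x
  define Y3 where "Y3 x = ?AH (gH x) \<bullet> grad \<phi> x" for x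
  define Y4 where "Y4 x = A n x * (g n x \<bullet> grad \<phi> x)" for x
  have ints: "integrable lebesgue T1" "integrable lebesgue T2" "integrable lebesgue Z1" "integrable lebesgue Z2"
    "integrable lebesgue Z3" "integrable lebesgue Z4" "integrable lebesgue Y1" "integrable lebesgue Y2"
    "integrable lebesgue Y3" "integrable lebesgue Y4"
    unfolding T1_def[abs_def] T2_def[abs_def] Z1_def[abs_def] Z2_def[abs_def] Z3_def[abs_def] Z4_def[abs_def]
      Y1_def[abs_def] Y2_def[abs_def] Y3_def[abs_def] Y4_def[abs_def]
    by (intro sq_int_inner ix int_a l2norm_AH(1) sd sgn sg sp sq_V[OF n] sq_S[OF n] sq_gH(1))+
  have pw: "A n x * (W1 \<phi> n x * W1 \<phi> n x) + A n x * (W2 \<phi> n x * W2 \<phi> n x)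
    = T1 x + T2 x + (- (\<alpha> - \<beta>) * Z1 x - cc * Z2 x + ah * cc * Z3 x + (\<alpha> - \<beta>) * Z4 x) + (Y1 x - Y2 x) + (Y3 x - Y4 x)" for x
  proof -
    define k where "k = ah / A n x"
    have k: "A n x * k = ah" using A_bounds(3)[of n x] by (simp add: k_def)
    have c1: "cc * ?x x = k - 1" using inv_A[of n x] by (simp add: k_def cc_def)
    have c2: "(\<alpha> - \<beta>) * ?x x = A n x - am" using A_am[of n x] by simp
    have z: "(\<alpha> - \<beta>) * Z1 x = (A n x - am) * (V n x * partial 2 \<phi> x)" "cc * Z2 x = (k - 1) * (S n x * partial 1 \<phi> x)"
      "ah * cc * Z3 x = ah * ((k - 1) * (partial 1 \<phi> x * partial 1 \<phi> x))" "(\<alpha> - \<beta>) * Z4 x = (A n x - am) * (partial 2 \<phi> x * partial 2 \<phi> x)"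
      unfolding Z1_def Z2_def Z3_def Z4_def c1[symmetric] c2[symmetric] by (simp_all only: mult.assoc)
    have i: "g n x \<bullet> w = g n x $ 1 * w $ 1 + g n x $ 2 * w $ 2" for w by (simp add: inner_vec_def sum_2)
    show ?thesis
      unfolding minus_mult_left[symmetric] z T1_def T2_def Y1_def Y2_def Y3_def Y4_def AH_inner i W1_def W2_def V_def S_def
        k_def[symmetric] grad_nth vector_minus_component
      by (rule energy_algebra[OF k])
  qed
  \<comment> \<open>The first difference vanishes by the energy identity, the second because both
    terms equal the integral of \<open>f0\<close> against the test function.\<close>
  have e0: "(\<integral>x. Y1 x - Y2 x \<partial>lebesgue) = 0" "(\<integral>x. Y3 x - Y4 x \<partial>lebesgue) = 0"
  proof -
    show "(\<integral>x. Y1 x - Y2 x \<partial>lebesgue) = 0"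
      unfolding Bochner_Integration.integral_diff[OF ints(7,8)] unfolding Y1_def Y2_def energy_identity[OF n] by simp
    show "(\<integral>x. Y3 x - Y4 x \<partial>lebesgue) = 0"
      unfolding Bochner_Integration.integral_diff[OF ints(9,10)] unfolding Y3_def Y4_def g_weak[OF n \<phi>] gH_weak[OF \<phi>] by simp
  qed
  have R: "(\<integral>x. - (\<alpha> - \<beta>) * Z1 x - cc * Z2 x + ah * cc * Z3 x + (\<alpha> - \<beta>) * Z4 x \<partial>lebesgue) = R \<phi> n"
  proof -
    have "(\<integral>x. - (\<alpha> - \<beta>) * Z1 x - cc * Z2 x + ah * cc * Z3 x + (\<alpha> - \<beta>) * Z4 x \<partial>lebesgue)
      = - (\<alpha> - \<beta>) * (\<integral>x. Z1 x \<partial>lebesgue) - cc * (\<integral>x. Z2 x \<partial>lebesgue) + ah * cc * (\<integral>x. Z3 x \<partial>lebesgue) + (\<alpha> - \<beta>) * (\<integral>x. Z4 x \<partial>lebesgue)"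
      using ints(3,4,5,6) by (simp del: mult_minus_left minus_mult_left)
    then show ?thesis by (simp only: R_def osc_def Z1_def Z2_def Z3_def Z4_def)
  qed
  have "\<alpha> * (L2n (W1 \<phi> n))\<^sup>2 + \<alpha> * (L2n (W2 \<phi> n))\<^sup>2
    \<le> (\<integral>x. A n x * (W1 \<phi> n x * W1 \<phi> n x) \<partial>lebesgue) + (\<integral>x. A n x * (W2 \<phi> n x * W2 \<phi> n x) \<partial>lebesgue)"
    by (intro add_mono lower W_sq_int n \<phi>)
  also have "\<dots> = (\<integral>x. A n x * (W1 \<phi> n x * W1 \<phi> n x) + A n x * (W2 \<phi> n x * W2 \<phi> n x) \<partial>lebesgue)"
    by (rule Bochner_Integration.integral_add[OF iW[OF W_sq_int(1)[OF n \<phi>]] iW[OF W_sq_int(2)[OF n \<phi>]], symmetric])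
  also have "\<dots> = (\<integral>x. T1 x + T2 x + (- (\<alpha> - \<beta>) * Z1 x - cc * Z2 x + ah * cc * Z3 x + (\<alpha> - \<beta>) * Z4 x) + (Y1 x - Y2 x) + (Y3 x - Y4 x) \<partial>lebesgue)"
    by (simp only: pw)
  also have "\<dots> = (\<integral>x. T1 x \<partial>lebesgue) + (\<integral>x. T2 x \<partial>lebesgue) + R \<phi> n"
  proof -
    have iz: "integrable lebesgue (\<lambda>x. - (\<alpha> - \<beta>) * Z1 x - cc * Z2 x + ah * cc * Z3 x + (\<alpha> - \<beta>) * Z4 x)"
      using ints(3,4,5,6) by simp
    have iy: "integrable lebesgue (\<lambda>x. Y1 x - Y2 x)" "integrable lebesgue (\<lambda>x. Y3 x - Y4 x)"
      using ints(7,8,9,10) by simp_all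
    note i12 = Bochner_Integration.integrable_add[OF ints(1,2)]
    note i3 = Bochner_Integration.integrable_add[OF i12 iz]
    note i4 = Bochner_Integration.integrable_add[OF i3 iy(1)]
    show ?thesis
      unfolding Bochner_Integration.integral_add[OF i4 iy(2)] Bochner_Integration.integral_add[OF i3 iy(1)]
        Bochner_Integration.integral_add[OF i12 iz] Bochner_Integration.integral_add[OF ints(1,2)] R e0
      by simp
  qed
  also have "\<dots> \<le> Mc * d * Gb + Mc * d * (L2n gH + d) + \<bar>R \<phi> n\<bar>"
  proof -
    have dd: "L2n (\<lambda>x. gH x - grad \<phi> x) = d" unfolding d_def l2norm_def by (simp add: norm_minus_commute)
    have "(\<integral>x. T1 x \<partial>lebesgue) \<le> L2n (\<lambda>x. ?AH (gH x - grad \<phi> x)) * L2n (g n)"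
      unfolding T1_def using Cauchy_Schwarz_l2norm[OF l2norm_AH(1)[OF sd(2)] sgn] by linarith
    also have "\<dots> \<le> (Mc * d) * Gb"
      using l2norm_AH(2)[OF sd(2)] g_bound[OF n] Mc_nonneg unfolding dd by (intro mult_mono) (auto simp: Mc_def d_def)
    finally have 1: "(\<integral>x. T1 x \<partial>lebesgue) \<le> Mc * d * Gb" .
    have "(\<integral>x. T2 x \<partial>lebesgue) \<le> L2n (\<lambda>x. ?AH (grad \<phi> x - gH x)) * L2n (grad \<phi>)"
      unfolding T2_def using Cauchy_Schwarz_l2norm[OF l2norm_AH(1)[OF sd(1)] sg] by linarith
    also have "\<dots> \<le> (Mc * d) * (L2n gH + d)"
    proof (rule mult_mono)
      show "L2n (grad \<phi>) \<le> L2n gH + d"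
        using l2norm_triangle[OF sq_gH(1) sd(1)] by (simp add: d_def)
    qed (use l2norm_AH(2)[OF sd(1)] Mc_nonneg in \<open>auto simp: Mc_def d_def\<close>)
    finally show ?thesis using 1 by linarith
  qed
  finally show ?thesis by (simp add: algebra_simps)
qed

text \<open>The order of the choices matters: first \<open>k\<close>, which makes the approximation
  terms small for all \<open>n\<close> at once, and then \<open>n\<close>, since
  \<open>R (\<phi> k)\<close> tends to 0 only for fixed \<open>k\<close>.\<close>

lemma strong_convergence:
  shows "(\<lambda>n. L2n (\<lambda>x. S n x - SH x)) \<longlonglongrightarrow> 0" "(\<lambda>n. L2n (\<lambda>x. V n x - VH x)) \<longlonglongrightarrow> 0"
proof -
  obtain \<phi> where \<phi>: "\<And>k. test_fun \<Omega> (\<phi> k)" "(\<lambda>k. L2n (\<lambda>x. grad (\<phi> k) x - gH x)) \<longlonglongrightarrow> 0"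
    using approx_H by blast
  let ?d = "\<lambda>k. L2n (\<lambda>x. grad (\<phi> k) x - gH x)"
  have key: "\<exists>N. \<forall>n\<ge>N. L2n (\<lambda>x. S n x - SH x) \<le> (\<beta> + ah) * e \<and> L2n (\<lambda>x. V n x - VH x) \<le> 2 * e"
    if e: "0 < e" for e
  proof -
    have "(\<lambda>k. Mc * ?d k * (Gb + L2n gH + ?d k)) \<longlonglongrightarrow> Mc * 0 * (Gb + L2n gH + 0)"
      by (intro tendsto_intros \<phi>(2))
    then have "\<forall>\<^sub>F k in sequentially. Mc * ?d k * (Gb + L2n gH + ?d k) < \<alpha> * e\<^sup>2 / 2"
      by (rule order_tendstoD(2)) (use e ab in simp)
    moreover have "\<forall>\<^sub>F k in sequentially. ?d k < e" by (rule order_tendstoD(2)[OF \<phi>(2) e])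
    ultimately obtain k where k: "Mc * ?d k * (Gb + L2n gH + ?d k) < \<alpha> * e\<^sup>2 / 2" "?d k < e"
      using eventually_happens'[OF sequentially_bot eventually_conj] by blast
    have "\<forall>\<^sub>F n in sequentially. \<bar>R (\<phi> k) n\<bar> < \<alpha> * e\<^sup>2 / 2"
      by (rule order_tendstoD(2)[OF tendsto_rabs_zero[OF R_tendsto[OF \<phi>(1)]]]) (use e ab in simp)
    then obtain N where N: "\<And>n. N \<le> n \<Longrightarrow> \<bar>R (\<phi> k) n\<bar> < \<alpha> * e\<^sup>2 / 2" by (auto simp: eventually_sequentially)
    show ?thesis
    proof (intro exI[of _ "max 1 N"] allI impI)
      fix n assume "max 1 N \<le> n"
      then have n: "1 \<le> n" "N \<le> n" by auto
      note sW = W_sq_int[OF n(1) \<phi>(1), of k]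
      have "\<alpha> * (L2n (W1 (\<phi> k) n))\<^sup>2 + \<alpha> * (L2n (W2 (\<phi> k) n))\<^sup>2 \<le> \<alpha> * e\<^sup>2"
        using energy_bound[OF n(1) \<phi>(1), of k] k(1) N[OF n(2)] by linarith
      moreover have "0 \<le> \<alpha> * (L2n (W1 (\<phi> k) n))\<^sup>2" "0 \<le> \<alpha> * (L2n (W2 (\<phi> k) n))\<^sup>2" using ab by auto
      ultimately have "\<alpha> * (L2n (W1 (\<phi> k) n))\<^sup>2 \<le> \<alpha> * e\<^sup>2" "\<alpha> * (L2n (W2 (\<phi> k) n))\<^sup>2 \<le> \<alpha> * e\<^sup>2" by linarith+
      then have "(L2n (W1 (\<phi> k) n))\<^sup>2 \<le> e\<^sup>2" "(L2n (W2 (\<phi> k) n))\<^sup>2 \<le> e\<^sup>2" using ab by auto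
      then have W: "L2n (W1 (\<phi> k) n) \<le> e" "L2n (W2 (\<phi> k) n) \<le> e"
        using e by (auto intro: power2_le_imp_le)
      have sd: "sq_int lebesgue (\<lambda>x. grad (\<phi> k) x - gH x)" by (intro sq_int_diff smooth_cs_grad_sq_int test_fun_smooth_cs[OF \<phi>(1)] sq_gH(1))
      note sj = sq_int_nth[OF sd]
      have S: "L2n (\<lambda>x. S n x - SH x) \<le> (\<beta> + ah) * e"
      proof -
        note sA = sq_int_mult[OF sW(1) borel_lebesgue[OF A_measurable] A_bounds(4), of n]
        \<comment> \<open>Multiplication by \<open>A n\<close> turns the corrector
          \<open>ah / A n\<close> into the constant \<open>ah\<close>, so the flux of the corrected
          gradient can be compared with \<open>SH\<close>.\<close>
        have "S n x - SH x = A n x *\<^sub>R W1 (\<phi> k) n x + ah *\<^sub>R ((grad (\<phi> k) x - gH x) $ 1)" for x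
          using A_bounds(3)[of n x] by (simp add: S_def SH_def W1_def grad_nth right_diff_distrib)
        then have "L2n (\<lambda>x. S n x - SH x) = L2n (\<lambda>x. A n x *\<^sub>R W1 (\<phi> k) n x + ah *\<^sub>R ((grad (\<phi> k) x - gH x) $ 1))"
          by simp
        also have "\<dots> \<le> L2n (\<lambda>x. A n x *\<^sub>R W1 (\<phi> k) n x) + \<bar>ah\<bar> * L2n (\<lambda>x. (grad (\<phi> k) x - gH x) $ 1)"
          unfolding l2norm_scaleR[symmetric] by (rule l2norm_triangle[OF sA(1) sq_int_scaleR[OF sj(1)]])
        also have "\<dots> \<le> \<beta> * e + ah * e"
        proof (rule add_mono)
          show "L2n (\<lambda>x. A n x *\<^sub>R W1 (\<phi> k) n x) \<le> \<beta> * e"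
            using sA(2) mult_left_mono[OF W(1), of \<beta>] ab by linarith
          show "\<bar>ah\<bar> * L2n (\<lambda>x. (grad (\<phi> k) x - gH x) $ 1) \<le> ah * e"
            using ah_pos sj(2)[of 1] k(2) by (simp add: mult_left_mono)
        qed
        finally show ?thesis by (simp add: distrib_right)
      qed
      have "V n x - VH x = W2 (\<phi> k) n x + (grad (\<phi> k) x - gH x) $ 2" for x
        by (simp add: V_def VH_def W2_def grad_nth)
      then have "L2n (\<lambda>x. V n x - VH x) = L2n (\<lambda>x. W2 (\<phi> k) n x + (grad (\<phi> k) x - gH x) $ 2)" by simp
      also have "\<dots> \<le> 2 * e"
        using l2norm_triangle[OF sW(2) sj(1), of 2] W(2) sj(2)[of 2] k(2) by linarith
      finally show "L2n (\<lambda>x. S n x - SH x) \<le> (\<beta> + ah) * e \<and> L2n (\<lambda>x. V n x - VH x) \<le> 2 * e"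
        using S by blast
    qed
  qed
  have lim: "a \<longlonglongrightarrow> 0" if c: "0 < c" and a: "\<And>n. 0 \<le> a n" and b: "\<And>e. 0 < e \<Longrightarrow> \<exists>N. \<forall>n\<ge>N. a n \<le> c * e" for a :: "nat \<Rightarrow> real" and c
  proof (rule LIMSEQ_I)
    fix e :: real assume e: "0 < e"
    obtain N where N: "\<forall>n\<ge>N. a n \<le> c * (e / (2 * c))" using b[of "e / (2 * c)"] e c by auto
    then show "\<exists>N. \<forall>n\<ge>N. norm (a n - 0) < e" using a e c by (intro exI[of _ N]) auto
  qed
  have p: "0 < \<beta> + ah" using ab ah_pos by simp
  show "(\<lambda>n. L2n (\<lambda>x. S n x - SH x)) \<longlonglongrightarrow> 0" by (rule lim[OF p]) (simp, use key in blast)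
  show "(\<lambda>n. L2n (\<lambda>x. V n x - VH x)) \<longlonglongrightarrow> 0" by (rule lim[of 2]) (simp, simp, use key in blast)
qed

end

section \<open>Uniform convergence of the representatives\<close>

text \<open>Averages of one fixed width converge uniformly, since the norm of the kernel does not
  depend on its centre. The distance from averages to representatives is small uniformly in
  \<open>x\<close> and \<open>n\<close> by \<open>rep_avg\<close>.\<close>

lemma rep_uniform:
  assumes mb: "\<And>x n. x \<in> K \<Longrightarrow> 1 \<le> n \<Longrightarrow> mixed_bound (h n) x r C" "\<And>x. x \<in> K \<Longrightarrow> mixed_bound h' x r C"
    and C: "0 \<le> C" and r: "0 < r" and h: "\<And>n. 1 \<le> n \<Longrightarrow> sq_int lebesgue (h n)" "sq_int lebesgue h'"
    and l: "(\<lambda>n. L2n (\<lambda>x. h n x - h' x)) \<longlonglongrightarrow> 0" and e: "0 < e"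
  shows "\<forall>\<^sub>F n in sequentially. \<forall>x\<in>K. \<bar>rep (h n) x - rep h' x\<bar> < e"
proof -
  have "((\<lambda>\<delta>. C * mod_const r * sqrt \<delta>) \<longlongrightarrow> C * mod_const r * sqrt 0) (at_right 0)" by (intro tendsto_intros)
  then have "\<forall>\<^sub>F \<delta> in at_right 0. C * mod_const r * sqrt \<delta> < e / 3"
    by (rule order_tendstoD(2)) (use e in simp)
  moreover have "\<forall>\<^sub>F \<delta> in at_right 0. 0 < \<delta> \<and> \<delta> < r / 2"
    by (rule eventually_at_rightI[of 0 "r / 2"]) (use r in auto)
  ultimately obtain \<delta> where d: "C * mod_const r * sqrt \<delta> < e / 3" "0 < \<delta>" "\<delta> < r / 2"
    using eventually_happens'[OF trivial_limit_at_right_real eventually_conj] by blast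
  let ?b = "(step_bd / \<delta>)\<^sup>2 * (2 * \<delta>)"
  have "(\<lambda>n. L2n (\<lambda>x. h n x - h' x) * ?b) \<longlonglongrightarrow> 0" by (rule tendsto_mult_left_zero[OF l])
  then have "\<forall>\<^sub>F n in sequentially. L2n (\<lambda>x. h n x - h' x) * ?b < e / 3"
    by (rule order_tendstoD(2)) (use e in simp)
  then show ?thesis
    using eventually_ge_at_top[of 1]
  proof eventually_elim
    case (elim n)
    note hn = h(1)[OF elim(2)]
    have sd: "sq_int lebesgue (\<lambda>x. h n x - h' x)" by (rule sq_int_diff[OF hn h(2)])
    show ?case
    proof
      fix x assume x: "x \<in> K"
      note sb = smooth_cs_sq_int[OF smooth_cs_bump[OF d(2), of x]]
      have "avg (h n) x \<delta> - avg h' x \<delta> = (\<integral>y. (h n y - h' y) * bump x \<delta> y \<partial>lebesgue)"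
        using sq_int_inner[OF hn sb] sq_int_inner[OF h(2) sb] by (simp add: avg_def left_diff_distrib)
      also have "\<bar>\<dots>\<bar> \<le> L2n (\<lambda>x. h n x - h' x) * L2n (bump x \<delta>)"
        using Cauchy_Schwarz_l2norm[OF sd sb] by simp
      also have "\<dots> \<le> L2n (\<lambda>x. h n x - h' x) * ?b"
        by (intro mult_left_mono l2norm_bump d) simp
      finally have a: "\<bar>avg (h n) x \<delta> - avg h' x \<delta>\<bar> < e / 3" using elim(1) by linarith
      have "\<bar>rep (h n) x - avg (h n) x \<delta>\<bar> \<le> C * mod_const r * sqrt \<delta>"
        by (rule rep_avg[OF mb(1)[OF x elim(2)] C hn r d(2)]) (use d in simp)
      moreover have "\<bar>rep h' x - avg h' x \<delta>\<bar> \<le> C * mod_const r * sqrt \<delta>"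
        by (rule rep_avg[OF mb(2)[OF x] C h(2) r d(2)]) (use d in simp)
      ultimately show "\<bar>rep (h n) x - rep h' x\<bar> < e" using a d(1) by linarith
    qed
  qed
qed

lemma rep_continuous:
  assumes mb: "\<And>x. x \<in> K \<Longrightarrow> mixed_bound h x r C" and C: "0 \<le> C" and r: "0 < r" and h: "sq_int lebesgue h"
  shows "continuous_on K (rep h)"
  unfolding continuous_on_def
proof
  fix x assume x: "x \<in> K"
  show "(rep h \<longlongrightarrow> rep h x) (at x within K)"
  proof (rule LIM_zero_cancel, rule tendsto_rabs_zero_cancel,
      rule tendsto_sandwich[where f = "\<lambda>y. 0" and h = "\<lambda>y. C * mod_const r * sqrt (\<bar>x $ 1 - y $ 1\<bar> + \<bar>x $ 2 - y $ 2\<bar>)"])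
    have "((\<lambda>y. C * mod_const r * sqrt (\<bar>x $ 1 - y $ 1\<bar> + \<bar>x $ 2 - y $ 2\<bar>))
      \<longlongrightarrow> C * mod_const r * sqrt (\<bar>x $ 1 - x $ 1\<bar> + \<bar>x $ 2 - x $ 2\<bar>)) (at x within K)"
      by (intro tendsto_intros)
    then show "((\<lambda>y. C * mod_const r * sqrt (\<bar>x $ 1 - y $ 1\<bar> + \<bar>x $ 2 - y $ 2\<bar>)) \<longlongrightarrow> 0) (at x within K)" by simp
    have "\<forall>\<^sub>F y in at x within K. dist y x < r / 2 \<and> y \<in> K"
      using r by (auto simp: eventually_at intro!: exI[of _ "r / 2"])
    then show "\<forall>\<^sub>F y in at x within K. \<bar>rep h y - rep h x\<bar> \<le> C * mod_const r * sqrt (\<bar>x $ 1 - y $ 1\<bar> + \<bar>x $ 2 - y $ 2\<bar>)"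
    proof eventually_elim
      case (elim y)
      have "y \<in> square x (r / 2)"
        using elim component_le_norm_cart[of "y - x" 1] component_le_norm_cart[of "y - x" 2]
        by (simp add: square_def dist_norm)
      from rep_modulus[OF mb[OF x] mb C h r this] elim show ?case by (simp add: abs_minus_commute)
    qed
  qed auto
qed

lemma sqrt_sum_squares_diff:
  fixes a b c d :: real
  shows "\<bar>sqrt (a\<^sup>2 + b\<^sup>2) - sqrt (c\<^sup>2 + d\<^sup>2)\<bar> \<le> \<bar>a - c\<bar> + \<bar>b - d\<bar>"
proof -
  have "\<bar>norm (a, b) - norm (c, d)\<bar> \<le> norm ((a, b) - (c, d))" by (rule norm_triangle_ineq3)
  also have "\<dots> \<le> \<bar>a - c\<bar> + \<bar>b - d\<bar>" by (simp add: norm_Pair sqrt_sum_squares_le_sum_abs)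
  finally show ?thesis by (simp add: norm_Pair)
qed

section \<open>Essential suprema over the layers\<close>

text \<open>A period has length \<open>1 / n\<close>, less than the radius, so the period containing
  \<open>x0\<close> has points of either layer in the ball.\<close>

lemma layer_open:
  assumes th: "0 < \<theta>" "\<theta> < 1" and n: "1 \<le> n" "1 / real n < \<rho>" and i: "i \<in> {1, 2}"
  obtains U where "open U" "U \<noteq> {}" "U \<subseteq> ball x0 \<rho>" "\<And>x. x \<in> U \<Longrightarrow> chi \<theta> i (real n *\<^sub>R x) = 1"
proof -
  \<comment> \<open>\<open>k\<close> numbers the period of \<open>x0\<close>. The midpoint of the
    layer lies in the same period, so \<open>t\<close> is smaller than \<open>1 / n\<close> in
    modulus.\<close>
  define k where "k = \<lfloor>real n * x0 $ 1 + 1/2\<rfloor>"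
  define lo where "lo = (if i = 1 then of_int k else of_int k + \<theta>)"
  define hi where "hi = (if i = 1 then of_int k + \<theta> else of_int k + 1)"
  define mid where "mid = (lo + hi) / 2"
  define t where "t = (mid - (real n * x0 $ 1 + 1/2)) / real n"
  let ?U = "ball x0 \<rho> \<inter> {x. lo < real n * x $ 1 + 1/2} \<inter> {x. real n * x $ 1 + 1/2 < hi}"
  have lh: "of_int k \<le> lo" "lo < hi" "hi \<le> of_int k + 1" using th by (auto simp: lo_def hi_def)
  have m: "lo < mid" "mid < hi" using lh by (auto simp: mid_def)
  have "open ?U" by (intro open_Int open_ball open_Collect_less continuous_intros)
  moreover have "?U \<noteq> {}"
  proof -
    have kk: "of_int k \<le> real n * x0 $ 1 + 1/2" "real n * x0 $ 1 + 1/2 < of_int k + 1"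
      unfolding k_def by linarith+
    then have "\<bar>mid - (real n * x0 $ 1 + 1/2)\<bar> < 1" using m lh by linarith
    then have "\<bar>t\<bar> < 1 / real n" using n(1) by (simp add: t_def abs_divide divide_strict_right_mono)
    then have "dist x0 (x0 + t *\<^sub>R axis 1 1) < \<rho>" using n(2) by (simp add: dist_norm)
    moreover have "real n * (x0 + t *\<^sub>R axis 1 1) $ 1 + 1/2 = mid"
      using n(1) by (simp add: t_def axis_def distrib_left)
    ultimately have "x0 + t *\<^sub>R axis 1 1 \<in> ?U" using m by (simp del: vector_add_component)
    then show ?thesis by blast
  qed
  moreover have "chi \<theta> i (real n *\<^sub>R x) = 1" if "x \<in> ?U" for x
  proof -
    let ?s = "real n * x $ 1 + 1/2"
    have s: "lo < ?s" "?s < hi" using that by auto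
    then have "\<lfloor>?s\<rfloor> = k" using lh by (intro floor_unique) linarith+
    then have fr: "layer_coord (real n *\<^sub>R x) = ?s - of_int k" by (simp add: layer_coord_def)
    show ?thesis
    proof (cases "i = 1")
      case True
      then show ?thesis using s fr by (simp add: chi_def hi_def)
    next
      case False
      then have "i = 2" using i by simp
      then show ?thesis using s fr by (simp add: chi_def lo_def)
    qed
  qed
  ultimately show ?thesis by (intro that[of ?U]) auto
qed

text \<open>A smaller essential supremum would make the nonempty open set \<open>U\<close>
  negligible.\<close>

lemma esssup_lower:
  assumes \<Omega>': "open \<Omega>'" and U: "open U" "U \<noteq> {}" "U \<subseteq> \<Omega>'" and G: "\<And>x. x \<in> U \<Longrightarrow> c \<le> G x"
  shows "ereal c \<le> esssup (lebesgue_on \<Omega>') (\<lambda>x. ereal (G x))"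
proof (rule ccontr)
  assume n: "\<not> ereal c \<le> esssup (lebesgue_on \<Omega>') (\<lambda>x. ereal (G x))"
  have S: "\<Omega>' \<inter> space lebesgue \<in> sets lebesgue" using \<Omega>' by (simp add: borel_open)
  have "AE x in lebesgue_on \<Omega>'. ereal (G x) \<le> esssup (lebesgue_on \<Omega>') (\<lambda>x. ereal (G x))" by (rule esssup_AE)
  then have "AE x in lebesgue_on \<Omega>'. x \<notin> U"
  proof eventually_elim
    case (elim x)
    show ?case
    proof
      assume "x \<in> U"
      then have "ereal c \<le> ereal (G x)" using G by simp
      then show False using elim n by (meson order_trans)
    qed
  qed
  then have "AE x in lebesgue. x \<in> \<Omega>' \<longrightarrow> x \<notin> U" by (simp add: AE_restrict_space_iff[OF S])
  then have "AE x in lebesgue. x \<notin> U" by eventually_elim (use U(3) in blast)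
  then obtain N where N: "\<And>x. x \<in> space lebesgue - N \<Longrightarrow> x \<notin> U" "N \<in> null_sets lebesgue"
    using AE_E3 by blast
  then have "U \<subseteq> N" by auto
  moreover have "negligible N" using N(2) by (simp add: negligible_iff_null_sets)
  ultimately have "negligible U" by (rule negligible_subset[rotated])
  then show False using open_not_negligible[OF U(1,2)] by blast
qed

lemma ereal_tendsto_squeeze:
  assumes "\<And>e. 0 < e \<Longrightarrow> \<forall>\<^sub>F n in F. ereal (s - e) \<le> X n \<and> X n \<le> ereal (s + e)"
  shows "(X \<longlongrightarrow> ereal s) F"
proof (rule order_tendstoI)
  fix a assume "a < ereal s"
  then obtain z where z: "a < ereal z" "ereal z < ereal s" using ereal_dense2 by blast
  then have "\<forall>\<^sub>F n in F. ereal (s - (s - z)) \<le> X n \<and> X n \<le> ereal (s + (s - z))" by (intro assms) simp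
  then show "\<forall>\<^sub>F n in F. a < X n" by eventually_elim (use z(1) in \<open>auto intro: less_le_trans\<close>)
next
  fix a assume "ereal s < a"
  then obtain z where z: "ereal s < ereal z" "ereal z < a" using ereal_dense2 by blast
  then have "\<forall>\<^sub>F n in F. ereal (s - (z - s)) \<le> X n \<and> X n \<le> ereal (s + (z - s))" by (intro assms) simp
  then show "\<forall>\<^sub>F n in F. X n < a" by eventually_elim (use z(2) in \<open>auto intro: le_less_trans\<close>)
qed

context laminate
begin

lemma esssup_limit:
  assumes \<Omega>': "open \<Omega>'" "\<Omega>' \<noteq> {}" "compact (closure \<Omega>')" "closure \<Omega>' \<subseteq> \<Omega>" and i: "i \<in> {1, 2}"
  shows "(\<lambda>n. esssup (lebesgue_on \<Omega>') (\<lambda>x. ereal (norm (chi \<theta> i (real n *\<^sub>R x) *\<^sub>R Du n x))))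
         \<longlonglongrightarrow> esssup (lebesgue_on \<Omega>') (\<lambda>x. ereal (Mlim \<theta> \<alpha> \<beta> i (DuH x)))"
proof -
  define K where "K = closure \<Omega>'"
  have K: "compact K" "K \<subseteq> \<Omega>" "\<Omega>' \<subseteq> K" using \<Omega>' closure_subset by (auto simp: K_def)
  let ?M = "lebesgue_on \<Omega>'"
  have Sm: "\<Omega>' \<inter> space lebesgue \<in> sets lebesgue" using \<Omega>' by (simp add: borel_open)
  obtain r C where rC: "0 < r" "0 \<le> C" and mS: "\<And>x n. x \<in> K \<Longrightarrow> 1 \<le> n \<Longrightarrow> mixed_bound (S n) x r C"
    and mV: "\<And>x n. x \<in> K \<Longrightarrow> 1 \<le> n \<Longrightarrow> mixed_bound (V n) x r C"
    using uniform_mixed_bounds[OF K(1,2)] by metis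
  have mSH: "mixed_bound SH x r C" and mVH: "mixed_bound VH x r C" if x: "x \<in> K" for x
    using mixed_bound_limit[OF mS[OF x] sq_S sq_SH strong_convergence(1)]
      mixed_bound_limit[OF mV[OF x] sq_V sq_VH strong_convergence(2)] by auto
  obtain \<phi> where \<phi>: "\<And>k. test_fun \<Omega> (\<phi> k)" "(\<lambda>k. L2n (\<lambda>x. grad (\<phi> k) x - gH x)) \<longlonglongrightarrow> 0"
    using approx_H by blast
  have aSH: "AE x in lebesgue. x \<in> K \<longrightarrow> rep SH x = SH x"
    using rep_AE_flux[of "\<lambda>x. ah" "\<bar>ah\<bar>", OF _ _ _ sq_gH gH_out \<phi> _ rC, of K 1] mSH
    unfolding SH_def[abs_def] by simp
  have aVH: "AE x in lebesgue. x \<in> K \<longrightarrow> rep VH x = VH x"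
  proof -
    have e: "VH = (\<lambda>x. 1 * gH x $ 2)" by (simp add: VH_def fun_eq_iff)
    show ?thesis
      using rep_AE_flux[of "\<lambda>x. 1" 1, OF _ _ _ sq_gH gH_out \<phi> _ rC, of K 2] mVH unfolding e by simp
  qed
  define ai where "ai = (if i = 1 then \<alpha> else \<beta>)"
  have ai: "0 < ai" using ab by (simp add: ai_def)
  \<comment> \<open>Defined at every point, but equal to the modulus of the gradient almost
    everywhere only in layer \<open>i\<close>, where the coefficient is \<open>ai\<close>; hence the
    factor \<open>chi\<close> in \<open>En\<close>.\<close>
  define F where "F n x = sqrt ((rep (S n) x / ai)\<^sup>2 + (rep (V n) x)\<^sup>2)" for n x
  define FH where "FH x = sqrt ((rep SH x / ai)\<^sup>2 + (rep VH x)\<^sup>2)" for x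
  have bm: "f \<in> borel_measurable ?M" if "f \<in> borel_measurable borel" for f :: "real ^ 2 \<Rightarrow> real"
    using borel_lebesgue[OF that] by (rule measurable_restrict_space1)
  have Fm: "F n \<in> borel_measurable borel" if "1 \<le> n" for n
  proof -
    have [measurable]: "rep (S n) \<in> borel_measurable borel" "rep (V n) \<in> borel_measurable borel"
      using rep_measurable sqiD(1) sq_S[OF that] sq_V[OF that] by blast+
    show ?thesis unfolding F_def[abs_def] by measurable
  qed
  have FHm: "FH \<in> borel_measurable borel"
  proof -
    have [measurable]: "rep SH \<in> borel_measurable borel" "rep VH \<in> borel_measurable borel"
      using rep_measurable sqiD(1) sq_SH sq_VH by blast+
    show ?thesis unfolding FH_def[abs_def] by measurable
  qed
  have F0: "0 \<le> F n x" "0 \<le> FH x" for n x by (auto simp: F_def FH_def)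
  have FHc: "continuous_on K FH"
  proof -
    have "continuous_on K (rep SH)" "continuous_on K (rep VH)"
      using rep_continuous[OF mSH rC(2,1) sq_SH] rep_continuous[OF mVH rC(2,1) sq_VH] by blast+
    then show ?thesis unfolding FH_def[abs_def] using ai by (intro continuous_intros) auto
  qed
  have unif: "\<forall>\<^sub>F n in sequentially. \<forall>x\<in>K. \<bar>F n x - FH x\<bar> < e" if e: "0 < e" for e
  proof -
    have e2: "0 < ai * (e / 2)" "0 < e / 2" using e ai by auto
    have "\<forall>\<^sub>F n in sequentially. \<forall>x\<in>K. \<bar>rep (S n) x - rep SH x\<bar> < ai * (e / 2)"
      by (rule rep_uniform[of K S r C SH])
        (assumption | rule mS mSH rC sq_S sq_SH strong_convergence(1) e2(1))+
    moreover have "\<forall>\<^sub>F n in sequentially. \<forall>x\<in>K. \<bar>rep (V n) x - rep VH x\<bar> < e / 2"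
      by (rule rep_uniform[of K V r C VH])
        (assumption | rule mV mVH rC sq_V sq_VH strong_convergence(2) e2(2))+
    ultimately show ?thesis
    proof eventually_elim
      case (elim n)
      show ?case
      proof
        fix x assume x: "x \<in> K"
        have "\<bar>F n x - FH x\<bar> \<le> \<bar>rep (S n) x / ai - rep SH x / ai\<bar> + \<bar>rep (V n) x - rep VH x\<bar>"
          unfolding F_def FH_def by (rule sqrt_sum_squares_diff)
        moreover have "\<bar>rep (S n) x / ai - rep SH x / ai\<bar> < e / 2"
          using elim(1) x ai by (simp add: pos_divide_less_eq mult.commute flip: diff_divide_distrib)
        moreover have "\<bar>rep (V n) x - rep VH x\<bar> < e / 2" using elim(2) x by blast
        ultimately show "\<bar>F n x - FH x\<bar> < e" by linarith
      qed
    qed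
  qed
  have EH: "esssup ?M (\<lambda>x. ereal (Mlim \<theta> \<alpha> \<beta> i (DuH x))) = esssup ?M (\<lambda>x. ereal (FH x))"
  proof -
    \<comment> \<open>The coefficients in \<open>Mlim\<close> are \<open>ah / \<alpha>\<close> and
      \<open>ah / \<beta>\<close>, that is \<open>ah / ai\<close>.\<close>
    have p: "Mlim \<theta> \<alpha> \<beta> i (gH x) = sqrt ((SH x / ai)\<^sup>2 + (VH x)\<^sup>2)" for x
      using ab den_pos i by (auto simp: Mlim_def SH_def VH_def ai_def a_h_def)
    have pm: "(\<lambda>x. sqrt ((SH x / ai)\<^sup>2 + (VH x)\<^sup>2)) \<in> borel_measurable ?M"
    proof -
      have [measurable]: "SH \<in> borel_measurable lebesgue" "VH \<in> borel_measurable lebesgue" using sqiD(1) sq_SH sq_VH by auto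
      have "(\<lambda>x. sqrt ((SH x / ai)\<^sup>2 + (VH x)\<^sup>2)) \<in> borel_measurable lebesgue" by measurable
      then show ?thesis by (rule measurable_restrict_space1)
    qed
    have q: "Mlim \<theta> \<alpha> \<beta> i (DuH x) = sqrt ((SH x / ai)\<^sup>2 + (VH x)\<^sup>2)" if "x \<in> \<Omega>'" for x
      using p[of x] K(2,3) that by (simp add: gH_def zero_ext_in subset_iff)
    have m1: "(\<lambda>x. ereal (Mlim \<theta> \<alpha> \<beta> i (DuH x))) \<in> borel_measurable ?M"
    proof -
      have "(\<lambda>x. ereal (sqrt ((SH x / ai)\<^sup>2 + (VH x)\<^sup>2))) \<in> borel_measurable ?M" using pm by measurable
      then show ?thesis by (rule measurable_cong[THEN iffD1, rotated]) (simp add: q)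
    qed
    have ae: "AE x in ?M. ereal (Mlim \<theta> \<alpha> \<beta> i (DuH x)) = ereal (FH x)"
      unfolding AE_restrict_space_iff[OF Sm] using aSH aVH
    proof eventually_elim
      case (elim x)
      then show ?case using q[of x] K(3) by (auto simp: FH_def)
    qed
    show ?thesis by (rule esssup_AE_cong[OF m1 _ ae]) (use bm[OF FHm] in measurable)
  qed
  have En: "esssup ?M (\<lambda>x. ereal (norm (chi \<theta> i (real n *\<^sub>R x) *\<^sub>R Du n x)))
    = esssup ?M (\<lambda>x. ereal (chi \<theta> i (real n *\<^sub>R x) * F n x))" if n: "1 \<le> n" for n
  proof -
    have cm: "(\<lambda>x. chi \<theta> i (real n *\<^sub>R x)) \<in> borel_measurable ?M" by (rule bm) measurable
    have q: "norm (chi \<theta> i (real n *\<^sub>R x) *\<^sub>R Du n x) = chi \<theta> i (real n *\<^sub>R x) * norm (g n x)" if "x \<in> \<Omega>'" for x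
      using K(2,3) that chi_bound(1)[of \<theta> i "real n *\<^sub>R x"] by (simp add: g_def zero_ext_in subset_iff)
    have gm: "g n \<in> borel_measurable ?M" using sqiD(1)[OF sq_g(1)[OF n]] by (rule measurable_restrict_space1)
    have m1: "(\<lambda>x. ereal (norm (chi \<theta> i (real n *\<^sub>R x) *\<^sub>R Du n x))) \<in> borel_measurable ?M"
    proof -
      have "(\<lambda>x. ereal (chi \<theta> i (real n *\<^sub>R x) * norm (g n x))) \<in> borel_measurable ?M" using cm gm by measurable
      then show ?thesis by (rule measurable_cong[THEN iffD1, rotated]) (simp add: q del: norm_scaleR)
    qed
    have m2: "(\<lambda>x. ereal (chi \<theta> i (real n *\<^sub>R x) * F n x)) \<in> borel_measurable ?M" using cm bm[OF Fm[OF n]] by measurable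
    have ae: "AE x in ?M. ereal (norm (chi \<theta> i (real n *\<^sub>R x) *\<^sub>R Du n x)) = ereal (chi \<theta> i (real n *\<^sub>R x) * F n x)"
      unfolding AE_restrict_space_iff[OF Sm] using rep_S[OF n K(1,2)] rep_V[OF n K(1,2)]
    proof eventually_elim
      case (elim x)
      show ?case
      proof
        assume x: "x \<in> \<Omega>'"
        then have xK: "x \<in> K" using K(3) by blast
        have "chi \<theta> i (real n *\<^sub>R x) * norm (g n x) = chi \<theta> i (real n *\<^sub>R x) * F n x"
        proof (cases "chi \<theta> i (real n *\<^sub>R x) = 0")
          case False
          then have "A n x = ai"
            using i unfolding A_cases ai_def by (auto simp: chi_2 chi_1 split: if_splits simp del: One_nat_def)
          then have "rep (S n) x / ai = g n x $ 1" using elim(1) xK ai by (simp add: S_def)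
          moreover have "rep (V n) x = g n x $ 2" using elim(2) xK by (simp add: V_def)
          ultimately have "F n x = norm (g n x)" by (simp add: F_def norm_eq_sqrt_inner inner_vec_def sum_2 power2_eq_square)
          then show ?thesis by simp
        qed simp
        then show "ereal (norm (chi \<theta> i (real n *\<^sub>R x) *\<^sub>R Du n x)) = ereal (chi \<theta> i (real n *\<^sub>R x) * F n x)"
          using q[OF x] by simp
      qed
    qed
    show ?thesis by (rule esssup_AE_cong[OF m1 m2 ae])
  qed
  define s where "s = (SUP x\<in>\<Omega>'. FH x)"
  have bd: "bdd_above (FH ` \<Omega>')"
  proof -
    have "bounded (FH ` K)" using compact_imp_bounded[OF compact_continuous_image[OF FHc K(1)]] .
    then show ?thesis using K(3) by (meson bdd_above_mono bounded_imp_bdd_above image_mono)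
  qed
  have sup: "FH x \<le> s" if "x \<in> \<Omega>'" for x unfolding s_def by (rule cSUP_upper[OF that bd])
  \<comment> \<open>A ball is required, not just a point: the layers move with \<open>n\<close> and
    can be met only on open sets.\<close>
  have near: "\<exists>x0 \<rho>. 0 < \<rho> \<and> ball x0 \<rho> \<subseteq> \<Omega>' \<and> (\<forall>x\<in>ball x0 \<rho>. s - e < FH x)" if e: "0 < e" for e
  proof -
    obtain x0 where x0: "x0 \<in> \<Omega>'" "s - e < FH x0"
      using less_cSUP_iff[OF \<Omega>'(2) bd, of "s - e"] e by (auto simp: s_def)
    have "continuous_on \<Omega>' FH" using FHc K(3) by (rule continuous_on_subset)
    then have "open ({x \<in> \<Omega>'. s - e < FH x})"
      using continuous_open_preimage[OF _ \<Omega>'(1) open_greaterThan[of "s - e"], of FH]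
      by (simp add: vimage_def Int_def conj_commute)
    then obtain \<rho> where "0 < \<rho>" "ball x0 \<rho> \<subseteq> {x \<in> \<Omega>'. s - e < FH x}"
      using x0 by (auto simp: open_contains_ball)
    then show ?thesis by blast
  qed
  have HS: "esssup ?M (\<lambda>x. ereal (FH x)) = ereal s"
  proof (rule antisym)
    show "esssup ?M (\<lambda>x. ereal (FH x)) \<le> ereal s"
      by (rule esssup_I) (use bm[OF FHm] sup in \<open>auto intro!: AE_I2\<close>)
    show "ereal s \<le> esssup ?M (\<lambda>x. ereal (FH x))"
    proof (rule ereal_le_epsilon2)
      fix e :: real assume e: "0 < e"
      obtain x0 \<rho> where x: "0 < \<rho>" "ball x0 \<rho> \<subseteq> \<Omega>'" "\<forall>x\<in>ball x0 \<rho>. s - e < FH x" using near[OF e] by blast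
      have "ereal (s - e) \<le> esssup ?M (\<lambda>x. ereal (FH x))"
      proof (rule esssup_lower[OF \<Omega>'(1) open_ball _ x(2)])
        show "ball x0 \<rho> \<noteq> {}" using x(1) by simp
        show "s - e \<le> FH y" if "y \<in> ball x0 \<rho>" for y using x(3) that by (simp add: less_imp_le)
      qed
      then have "ereal (s - e) + ereal e \<le> esssup ?M (\<lambda>x. ereal (FH x)) + ereal e" by (rule add_right_mono)
      then show "ereal s \<le> esssup ?M (\<lambda>x. ereal (FH x)) + ereal e" by simp
    qed
  qed
  have "(\<lambda>n. esssup ?M (\<lambda>x. ereal (norm (chi \<theta> i (real n *\<^sub>R x) *\<^sub>R Du n x)))) \<longlonglongrightarrow> ereal s"
  proof (rule ereal_tendsto_squeeze)
    fix e :: real assume e: "0 < e"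
    then have e2: "0 < e / 2" by simp
    \<comment> \<open>One half of \<open>e\<close> is spent on nearly attaining the supremum, the
      other on the uniform distance of \<open>F n\<close> from \<open>FH\<close>.\<close>
    obtain x0 \<rho> where x: "0 < \<rho>" "ball x0 \<rho> \<subseteq> \<Omega>'" "\<forall>x\<in>ball x0 \<rho>. s - e / 2 < FH x" using near[OF e2] by blast
    show "\<forall>\<^sub>F n in sequentially. ereal (s - e) \<le> esssup ?M (\<lambda>x. ereal (norm (chi \<theta> i (real n *\<^sub>R x) *\<^sub>R Du n x)))
      \<and> esssup ?M (\<lambda>x. ereal (norm (chi \<theta> i (real n *\<^sub>R x) *\<^sub>R Du n x))) \<le> ereal (s + e)"
      using unif[OF e2] order_tendstoD(2)[OF lim_1_over_n x(1)] eventually_ge_at_top[of 1]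
    proof eventually_elim
      case (elim n)
      note n = elim(3)
      have close: "FH x - e / 2 < F n x" "F n x < FH x + e / 2" if "x \<in> \<Omega>'" for x
      proof -
        have "\<bar>F n x - FH x\<bar> < e / 2" using elim(1) K(3) that by blast
        then show "FH x - e / 2 < F n x" "F n x < FH x + e / 2" by linarith+
      qed
      obtain U where U: "open U" "U \<noteq> {}" "U \<subseteq> ball x0 \<rho>" "\<And>x. x \<in> U \<Longrightarrow> chi \<theta> i (real n *\<^sub>R x) = 1"
        using layer_open[OF theta n elim(2) i] by blast
      have "ereal (s - e) \<le> esssup ?M (\<lambda>x. ereal (chi \<theta> i (real n *\<^sub>R x) * F n x))"
      proof (rule esssup_lower[OF \<Omega>'(1) U(1,2)])
        show "U \<subseteq> \<Omega>'" using U(3) x(2) by blast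
        show "s - e \<le> chi \<theta> i (real n *\<^sub>R y) * F n y" if "y \<in> U" for y
        proof -
          have "y \<in> ball x0 \<rho>" "y \<in> \<Omega>'" using that U(3) x(2) by blast+
          then have "s - e / 2 < FH y" "FH y - e / 2 < F n y" using x(3) close(1) by blast+
          then show ?thesis using U(4)[OF that] by simp
        qed
      qed
      moreover have "esssup ?M (\<lambda>x. ereal (chi \<theta> i (real n *\<^sub>R x) * F n x)) \<le> ereal (s + e)"
      proof (rule esssup_I)
        have "(\<lambda>x. chi \<theta> i (real n *\<^sub>R x) * F n x) \<in> borel_measurable borel" using Fm[OF n] by measurable
        from bm[OF this] show "(\<lambda>x. ereal (chi \<theta> i (real n *\<^sub>R x) * F n x)) \<in> borel_measurable ?M" by measurable
        show "AE x in ?M. ereal (chi \<theta> i (real n *\<^sub>R x) * F n x) \<le> ereal (s + e)"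
        proof (rule AE_I2)
          fix y assume "y \<in> space ?M"
          then have y: "y \<in> \<Omega>'" by simp
          have "chi \<theta> i (real n *\<^sub>R y) * F n y \<le> F n y" using chi_bound F0 by (intro mult_left_le_one_le) auto
          also have "\<dots> \<le> s + e" using close(2)[OF y] sup[OF y] e by linarith
          finally show "ereal (chi \<theta> i (real n *\<^sub>R y) * F n y) \<le> ereal (s + e)" by simp
        qed
      qed
      ultimately show ?case unfolding En[OF n] by blast
    qed
  qed
  then show ?thesis unfolding EH HS .
qed

end

theorem theorem4p1:
  fixes \<theta> \<alpha> \<beta> :: real
    and \<Omega> \<Omega>' :: "(real ^ 2) set"
    and f :: "real ^ 2 \<Rightarrow> real" and Df :: "real ^ 2 \<Rightarrow> real ^ 2"
    and u :: "nat \<Rightarrow> real ^ 2 \<Rightarrow> real" and Du :: "nat \<Rightarrow> real ^ 2 \<Rightarrow> real ^ 2"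
    and uH :: "real ^ 2 \<Rightarrow> real" and DuH :: "real ^ 2 \<Rightarrow> real ^ 2"
    and i :: nat
  assumes theta: "0 < \<theta>" "\<theta> < 1"
    and alpha_beta: "0 < \<alpha>" "\<alpha> < \<beta>"
    and Omega: "open \<Omega>" "connected \<Omega>" "bounded \<Omega>"
    and f_H1: "H1 \<Omega> f Df"
    and u_sol: "\<And>n. n \<ge> 1 \<Longrightarrow>
        weak_solution \<Omega> (\<lambda>x v. coef \<theta> \<alpha> \<beta> (real n *\<^sub>R x) *\<^sub>R v) f (u n) (Du n)"
    and uH_sol: "weak_solution \<Omega> (\<lambda>x v. AH \<theta> \<alpha> \<beta> v) f uH DuH"
    and Omega': "open \<Omega>'" "connected \<Omega>'" "\<Omega>' \<noteq> {}"
        "compact (closure \<Omega>')" "closure \<Omega>' \<subseteq> \<Omega>"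
    and i: "i \<in> {1, 2}"
  shows "(\<lambda>n. esssup (lebesgue_on \<Omega>')
            (\<lambda>x. ereal (norm (chi \<theta> i (real n *\<^sub>R x) *\<^sub>R Du n x))))
         \<longlonglongrightarrow> esssup (lebesgue_on \<Omega>') (\<lambda>x. ereal (Mlim \<theta> \<alpha> \<beta> i (DuH x)))"
proof -
  interpret laminate \<theta> \<alpha> \<beta> \<Omega> f Df u Du uH DuH
    by unfold_locales (use assms in auto)
  show ?thesis by (rule esssup_limit[OF Omega'(1,3,4,5) i])
qed

end
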